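(* Let $(M,g,Q,P)$ be a super-null Riemannian manifold. Then there exists a compatible affine connection on $M$, i.e. an affine connection $\nabla$ on $M$ such that $\nabla_X Q = 0$ for all $X\in\mathrm{Vect}(M)$ and $$X\langle Y|Z\rangle = \langle \nabla_X Y|Z\rangle + (-1)^{\widetilde{X}\,\widetilde{Y}}\langle Y|\nabla_X Z\rangle$$ for all (homogeneous) $X,Y,Z\in \mathrm{Vect}(M)$.
   Context: Supermanifolds are real, finite-dimensional, in the Berezin–Leites (locally ringed space) sense, $M=(|M|,\mathcal{O}_M)$; $C^\infty(M)$ is the superalgebra of global functions, $\mathrm{Vect}(M)$ the $C^\infty(M)$-module of vector fields, $\widetilde{\cdot}$ denotes $\mathbb{Z}_2$-parity, and $[X,Y]=XY-(-1)^{\widetilde X\widetilde Y}YX$ is the graded commutator. Formulas are stated for homogeneous elements and extended by linearity. A metric $g$ on $M$ is an even, graded-symmetric, rank 2 covariant tensor, possibly degenerate; it determines a pairing $\langle X|Y\rangle$ with $\widetilde{\langle X|Y\rangle}=\widetilde X+\widetilde Y$, $\langle X|Y\rangle=(-1)^{\widetilde X\widetilde Y}\langle Y|X\rangle$, $\langle fX+Y|Z\rangle=f\langle X|Z\rangle+\langle Y|Z\rangle$. Its kernel is $\ker(g)=\{X\in\mathrm{Vect}(M) : \langle X|Y\rangle=0\ \text{for all } Y\in\mathrm{Vect}(M)\}$; $g$ is degenerate if $\ker(g)\neq\{0\}$. A super-null Riemannian manifold is a quadruple $(M,g,Q,P)$ where $M$ is a supermanifold of dimension $n|1$ ($n\ge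 1$), $g$ is a degenerate (even) metric on $M$, $Q\in\mathrm{Vect}(M)$ is a non-singular odd vector field (i.e. its value in $T_mM$ is nonzero at every point $m\in|M|$) with $[Q,Q]=2P$ for an even vector field $P$, and $\ker(g)=\mathrm{Span}\{Q\}$ (the $C^\infty(M)$-span). It is part of the setting that the rank of the kernel is constant, equal to $0|1$ (at every point $m\in |M|$ the bilinear form induced by $g$ on $T_mM$ has kernel of dimension $0|1$), and that around every point of $|M|$ there are Shander coordinates $(x^a,t,\tau)$, with $x^a,t$ even and $\tau$ odd, in which $Q=\partial_\tau+\tau\partial_t$ and $P=\partial_t$. An affine connection on $M$ is a parity-preserving map $\nabla:\mathrm{Vect}(M)\times\mathrm{Vect}(M)\to\mathrm{Vect}(M)$, $(X,Y)\mapsto\nabla_XY$, that is biadditive, satisfies $\nabla_{fX}Y=f\nabla_XY$ and $\nabla_X(fY)=X(f)Y+(-1)^{\widetilde X\widetilde f}f\nabla_XY$ for $f\in C^\infty(M)$. *)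

theory Defs
  imports "HOL-Analysis.Analysis" "HOL-Algebra.Module" "HOL-Library.Z2"
begin

section \<open>Superalgebras\<close>

text \<open>Parities are elements of \<^typ>\<open>bit\<close>, the field with two elements. \<open>koszul p r\<close> is the
  sign \<open>(-1)^(p r)\<close>.\<close>

definition koszul :: "bit \<Rightarrow> bit \<Rightarrow> real" where
  "koszul p r = (if p * r = 1 then -1 else 1)"

definition real_ring :: "real ring" where
  "real_ring = \<lparr>carrier = UNIV, mult = (*), one = 1, zero = 0, add = (+)\<rparr>"

record 's superalgebra = "(real, 's) module" +
  part :: "bit \<Rightarrow> 's set"

definition superalgebra :: "'s superalgebra \<Rightarrow> bool" where
  "superalgebra A \<longleftrightarrow>
     ring A \<and> module real_ring A \<and>
     (\<forall>c. \<forall>a\<in>carrier A. \<forall>b\<in>carrier A.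
        (c \<odot>\<^bsub>A\<^esub> a) \<otimes>\<^bsub>A\<^esub> b = c \<odot>\<^bsub>A\<^esub> (a \<otimes>\<^bsub>A\<^esub> b) \<and>
        a \<otimes>\<^bsub>A\<^esub> (c \<odot>\<^bsub>A\<^esub> b) = c \<odot>\<^bsub>A\<^esub> (a \<otimes>\<^bsub>A\<^esub> b)) \<and>
     (\<forall>p. submodule (part A p) real_ring A) \<and>
     (\<forall>a\<in>carrier A. \<exists>b\<in>part A 0. \<exists>c\<in>part A 1. a = b \<oplus>\<^bsub>A\<^esub> c) \<and>
     part A 0 \<inter> part A 1 = {\<zero>\<^bsub>A\<^esub>} \<and>
     \<one>\<^bsub>A\<^esub> \<in> part A 0 \<and>
     (\<forall>p r. \<forall>a\<in>part A p. \<forall>b\<in>part A r.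
        a \<otimes>\<^bsub>A\<^esub> b \<in> part A (p + r) \<and>
        a \<otimes>\<^bsub>A\<^esub> b = koszul p r \<odot>\<^bsub>A\<^esub> (b \<otimes>\<^bsub>A\<^esub> a))"

definition superalgebra_hom :: "'s superalgebra \<Rightarrow> 't superalgebra \<Rightarrow> ('s \<Rightarrow> 't) \<Rightarrow> bool" where
  "superalgebra_hom A B h \<longleftrightarrow>
     h \<in> ring_hom A B \<and>
     (\<forall>c. \<forall>a\<in>carrier A. h (c \<odot>\<^bsub>A\<^esub> a) = c \<odot>\<^bsub>B\<^esub> h a) \<and>
     (\<forall>p. h ` part A p \<subseteq> part B p)"

definition superalgebra_iso :: "'s superalgebra \<Rightarrow> 't superalgebra \<Rightarrow> ('s \<Rightarrow> 't) \<Rightarrow> bool" where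
  "superalgebra_iso A B h \<longleftrightarrow> superalgebra_hom A B h \<and> bij_betw h (carrier A) (carrier B)"


section \<open>Spaces with a sheaf of superalgebras\<close>

record ('a, 's) superspace =
  base :: "'a topology"
  sheaf :: "'a set \<Rightarrow> 's superalgebra"
  res :: "'a set \<Rightarrow> 'a set \<Rightarrow> 's \<Rightarrow> 's"  \<comment> \<open>\<open>res M U W\<close> restricts from \<open>U\<close> to \<open>W \<subseteq> U\<close>\<close>

definition opens :: "('a, 's) superspace \<Rightarrow> 'a set \<Rightarrow> 'a set set" where
  "opens M U = {W. openin (base M) W \<and> W \<subseteq> U}"

abbreviation points :: "('a, 's) superspace \<Rightarrow> 'a set" where
  "points M \<equiv> topspace (base M)"

definition presheaf :: "('a, 's) superspace \<Rightarrow> bool" where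
  "presheaf M \<longleftrightarrow>
     (\<forall>U. openin (base M) U \<longrightarrow> superalgebra (sheaf M U)) \<and>
     (\<forall>U. openin (base M) U \<longrightarrow> (\<forall>W\<in>opens M U.
        superalgebra_hom (sheaf M U) (sheaf M W) (res M U W))) \<and>
     (\<forall>U. openin (base M) U \<longrightarrow> (\<forall>f\<in>carrier (sheaf M U). res M U U f = f)) \<and>
     (\<forall>U. openin (base M) U \<longrightarrow> (\<forall>W\<in>opens M U. \<forall>W'\<in>opens M W. \<forall>f\<in>carrier (sheaf M U).
        res M W W' (res M U W f) = res M U W' f))"

definition gluing :: "('a, 's) superspace \<Rightarrow> bool" where
  "gluing M \<longleftrightarrow>
     (\<forall>\<C> s. (\<forall>W\<in>\<C>. openin (base M) W \<and> s W \<in> carrier (sheaf M W)) \<longrightarrow>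
        (\<forall>W\<in>\<C>. \<forall>W'\<in>\<C>. res M W (W \<inter> W') (s W) = res M W' (W \<inter> W') (s W')) \<longrightarrow>
        (\<exists>!f. f \<in> carrier (sheaf M (\<Union>\<C>)) \<and> (\<forall>W\<in>\<C>. res M (\<Union>\<C>) W f = s W)))"

definition open_sub :: "('a, 's) superspace \<Rightarrow> 'a set \<Rightarrow> ('a, 's) superspace" where
  "open_sub M U = M\<lparr>base := subtopology (base M) U\<rparr>"

definition preim :: "('a, 's) superspace \<Rightarrow> ('a \<Rightarrow> 'b) \<Rightarrow> 'b set \<Rightarrow> 'a set" where
  "preim M \<phi> W = {x \<in> points M. \<phi> x \<in> W}"

text \<open>Isomorphisms consist of a homeomorphism \<open>\<phi>\<close> and of the pullbacks
  \<open>\<Phi> W\<close> from the sections of \<open>N\<close> over \<open>W\<close> to the sections of \<open>M\<close> over the preimage of \<open>W\<close>.\<close>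

definition superspace_iso ::
  "('a, 's) superspace \<Rightarrow> ('b, 't) superspace \<Rightarrow> ('a \<Rightarrow> 'b) \<Rightarrow> ('b set \<Rightarrow> 't \<Rightarrow> 's) \<Rightarrow> bool" where
  "superspace_iso M N \<phi> \<Phi> \<longleftrightarrow>
     homeomorphic_map (base M) (base N) \<phi> \<and>
     (\<forall>W. openin (base N) W \<longrightarrow>
        superalgebra_iso (sheaf N W) (sheaf M (preim M \<phi> W)) (\<Phi> W)) \<and>
     (\<forall>W. openin (base N) W \<longrightarrow> (\<forall>W'\<in>opens N W. \<forall>f\<in>carrier (sheaf N W).
        \<Phi> W' (res N W W' f) = res M (preim M \<phi> W) (preim M \<phi> W') (\<Phi> W f)))"


section \<open>Superdomains\<close>

definition partial :: "'n::finite \<Rightarrow> (real^'n \<Rightarrow> real) \<Rightarrow> real^'n \<Rightarrow> real" where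
  "partial i f x = frechet_derivative f (at x) (axis i 1)"

primrec C_k :: "nat \<Rightarrow> (real^'n::finite) set \<Rightarrow> (real^'n \<Rightarrow> real) \<Rightarrow> bool" where
  "C_k 0 W f \<longleftrightarrow> continuous_on W f"
| "C_k (Suc k) W f \<longleftrightarrow> (\<forall>x\<in>W. f differentiable (at x)) \<and> (\<forall>i. C_k k W (partial i f))"

definition smooth :: "(real^'n::finite) set \<Rightarrow> (real^'n \<Rightarrow> real) \<Rightarrow> bool" where
  "smooth W f \<longleftrightarrow> (\<forall>k. C_k k W f)"

text \<open>An element \<open>\<Sum>\<^sub>I f\<^sub>I \<xi>\<^sub>I\<close> of \<open>C\<^sup>\<infinity>(W) \<otimes> \<Lambda>(\<xi>\<^sub>0, \<dots>, \<xi>\<^sub>q\<^sub>-\<^sub>1)\<close>, where \<open>\<xi>\<^sub>I\<close> is the product of the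
  \<open>\<xi>\<^sub>i\<close>, \<open>i \<in> I\<close>, in increasing order, is represented by the family of its coefficients, extended by
  zero outside \<open>W\<close> and for \<open>I\<close> not contained in \<open>{..<q}\<close>.
  \<open>grassmann_sign J K\<close> is the sign in \<open>\<xi>\<^sub>J \<xi>\<^sub>K = \<plusminus> \<xi>\<^sub>J\<^sub>\<union>\<^sub>K\<close> for disjoint \<open>J\<close>, \<open>K\<close>.\<close>

type_synonym 'n grassmann = "nat set \<Rightarrow> real^'n \<Rightarrow> real"

definition grassmann_sign :: "nat set \<Rightarrow> nat set \<Rightarrow> real" where
  "grassmann_sign J K = (-1) ^ card {(j, k). j \<in> J \<and> k \<in> K \<and> k < j}"

definition superfunctions :: "nat \<Rightarrow> (real^'n::finite) set \<Rightarrow> 'n grassmann superalgebra" where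
  "superfunctions q W =
     (let C = {f. (\<forall>I x. I \<subseteq> {..<q} \<and> x \<in> W \<or> f I x = 0) \<and> (\<forall>I. smooth W (f I))} in
     \<lparr>carrier = C,
      mult = (\<lambda>f h I x. \<Sum>J\<in>Pow I. grassmann_sign J (I - J) * f J x * h (I - J) x),
      one = (\<lambda>I x. if I = {} \<and> x \<in> W then 1 else 0),
      zero = (\<lambda>I x. 0),
      add = (\<lambda>f h I x. f I x + h I x),
      smult = (\<lambda>c f I x. c * f I x),
      part = (\<lambda>p. {f \<in> C. \<forall>I x. of_nat (card I) = p \<or> f I x = 0})\<rparr>)"

definition superdomain :: "nat \<Rightarrow> (real^'n::finite) set \<Rightarrow> (real^'n, 'n grassmann) superspace" where
  "superdomain q V =
     \<lparr>base = top_of_set V,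
      sheaf = superfunctions q,
      res = (\<lambda>U W f I x. if x \<in> W then f I x else 0)\<rparr>"

definition odd_coord :: "nat \<Rightarrow> (real^'n::finite) set \<Rightarrow> 'n grassmann" where
  "odd_coord j W = (\<lambda>I x. if I = {j} \<and> x \<in> W then 1 else 0)"

definition d_even :: "'n::finite \<Rightarrow> (real^'n) set \<Rightarrow> 'n grassmann \<Rightarrow> 'n grassmann" where
  "d_even i W f = (\<lambda>I x. if x \<in> W then partial i (f I) x else 0)"

text \<open>The left derivative with respect to \<open>\<xi>\<^sub>j\<close>.\<close>

definition d_odd :: "nat \<Rightarrow> (real^'n::finite) set \<Rightarrow> 'n grassmann \<Rightarrow> 'n grassmann" where
  "d_odd j W f = (\<lambda>I x. if j \<in> I then 0 else (-1) ^ card {i\<in>I. i < j} * f (insert j I) x)"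


section \<open>Supermanifolds\<close>

definition superchart ::
  "nat \<Rightarrow> ('a, 's) superspace \<Rightarrow> 'a set \<Rightarrow> (real^'n::finite) set \<Rightarrow>
   ('a \<Rightarrow> real^'n) \<Rightarrow> ((real^'n) set \<Rightarrow> 'n grassmann \<Rightarrow> 's) \<Rightarrow> bool" where
  "superchart q M U V \<phi> \<Phi> \<longleftrightarrow>
     openin (base M) U \<and> open V \<and> superspace_iso (open_sub M U) (superdomain q V) \<phi> \<Phi>"

definition second_countable :: "'a topology \<Rightarrow> bool" where
  "second_countable X \<longleftrightarrow>
     (\<exists>\<B>. countable \<B> \<and> (\<forall>B\<in>\<B>. openin X B) \<and>
        (\<forall>U. openin X U \<longrightarrow> (\<exists>\<U>. \<U> \<subseteq> \<B> \<and> U = \<Union>\<U>)))"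

text \<open>Supermanifolds of dimension \<open>CARD('n)|q\<close>. The stalks are local rings because those of
  superdomains are.\<close>

definition supermanifold :: "'n::finite itself \<Rightarrow> nat \<Rightarrow> ('a, 's) superspace \<Rightarrow> bool" where
  "supermanifold N q M \<longleftrightarrow>
     Hausdorff_space (base M) \<and> second_countable (base M) \<and> presheaf M \<and> gluing M \<and>
     (\<forall>m\<in>points M. \<exists>U (V :: (real^'n) set) \<phi> \<Phi>. m \<in> U \<and> superchart q M U V \<phi> \<Phi>)"


section \<open>Vector fields\<close>

text \<open>Vector fields on an open set \<open>U\<close> are the sections over \<open>U\<close> of the tangent sheaf, that is,
  superderivations of the sheaf restricted to \<open>U\<close>: families, indexed by the open \<open>W \<subseteq> U\<close>, of
  superderivations of the algebras of sections over \<open>W\<close> that commute with restrictions. The families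
  are \<^const>\<open>undefined\<close> outside their domain, so that equality of vector fields is equality in HOL.\<close>

type_synonym ('a, 's) vf = "'a set \<Rightarrow> 's \<Rightarrow> 's"

definition on_opens :: "('a, 's) superspace \<Rightarrow> 'a set \<Rightarrow> ('a, 's) vf \<Rightarrow> ('a, 's) vf" where
  "on_opens M U F =
     (\<lambda>W f. if W \<in> opens M U \<and> f \<in> carrier (sheaf M W) then F W f else undefined)"

definition vf_part :: "('a, 's) superspace \<Rightarrow> 'a set \<Rightarrow> bit \<Rightarrow> ('a, 's) vf set" where
  "vf_part M U p = {X. on_opens M U X = X \<and>
     (\<forall>W\<in>opens M U.
        X W \<in> carrier (sheaf M W) \<rightarrow> carrier (sheaf M W) \<and>
        (\<forall>f\<in>carrier (sheaf M W). \<forall>h\<in>carrier (sheaf M W).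
           X W (f \<oplus>\<^bsub>sheaf M W\<^esub> h) = X W f \<oplus>\<^bsub>sheaf M W\<^esub> X W h) \<and>
        (\<forall>c. \<forall>f\<in>carrier (sheaf M W). X W (c \<odot>\<^bsub>sheaf M W\<^esub> f) = c \<odot>\<^bsub>sheaf M W\<^esub> X W f) \<and>
        (\<forall>r. X W ` part (sheaf M W) r \<subseteq> part (sheaf M W) (p + r)) \<and>
        (\<forall>r. \<forall>f\<in>part (sheaf M W) r. \<forall>h\<in>carrier (sheaf M W).
           X W (f \<otimes>\<^bsub>sheaf M W\<^esub> h) =
             X W f \<otimes>\<^bsub>sheaf M W\<^esub> h \<oplus>\<^bsub>sheaf M W\<^esub> koszul p r \<odot>\<^bsub>sheaf M W\<^esub> (f \<otimes>\<^bsub>sheaf M W\<^esub> X W h)) \<and>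
        (\<forall>W'\<in>opens M W. \<forall>f\<in>carrier (sheaf M W). X W' (res M W W' f) = res M W W' (X W f)))}"

definition vf_add ::
  "('a, 's) superspace \<Rightarrow> 'a set \<Rightarrow> ('a, 's) vf \<Rightarrow> ('a, 's) vf \<Rightarrow> ('a, 's) vf" where
  "vf_add M U X Y = on_opens M U (\<lambda>W f. X W f \<oplus>\<^bsub>sheaf M W\<^esub> Y W f)"

definition vf_smult ::
  "('a, 's) superspace \<Rightarrow> 'a set \<Rightarrow> 's \<Rightarrow> ('a, 's) vf \<Rightarrow> ('a, 's) vf" where
  "vf_smult M U h X = on_opens M U (\<lambda>W f. res M U W h \<otimes>\<^bsub>sheaf M W\<^esub> X W f)"

definition vf_zero :: "('a, 's) superspace \<Rightarrow> 'a set \<Rightarrow> ('a, 's) vf" where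
  "vf_zero M U = on_opens M U (\<lambda>W f. \<zero>\<^bsub>sheaf M W\<^esub>)"

definition vf :: "('a, 's) superspace \<Rightarrow> 'a set \<Rightarrow> ('a, 's) vf set" where
  "vf M U = {vf_add M U X Y | X Y. X \<in> vf_part M U 0 \<and> Y \<in> vf_part M U 1}"

definition vf_res :: "('a, 's) superspace \<Rightarrow> 'a set \<Rightarrow> ('a, 's) vf \<Rightarrow> ('a, 's) vf" where
  "vf_res M W X = on_opens M W X"

text \<open>The graded commutator of vector fields \<open>X\<close>, \<open>Y\<close> of parities \<open>p\<close>, \<open>r\<close>.\<close>

definition vf_bracket ::
  "('a, 's) superspace \<Rightarrow> 'a set \<Rightarrow> bit \<Rightarrow> bit \<Rightarrow> ('a, 's) vf \<Rightarrow> ('a, 's) vf \<Rightarrow> ('a, 's) vf" where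
  "vf_bracket M U p r X Y = on_opens M U
     (\<lambda>W f. X W (Y W f) \<ominus>\<^bsub>sheaf M W\<^esub> koszul p r \<odot>\<^bsub>sheaf M W\<^esub> Y W (X W f))"

abbreviation C_inf :: "('a, 's) superspace \<Rightarrow> 's set" where
  "C_inf M \<equiv> carrier (sheaf M (points M))"

abbreviation Vect :: "('a, 's) superspace \<Rightarrow> ('a, 's) vf set" where
  "Vect M \<equiv> vf M (points M)"

abbreviation Vect_part :: "('a, 's) superspace \<Rightarrow> bit \<Rightarrow> ('a, 's) vf set" where
  "Vect_part M p \<equiv> vf_part M (points M) p"


section \<open>Values at points and tangent spaces\<close>

text \<open>The value of a section \<open>f\<close> over \<open>U\<close> at \<open>m\<close> is its class in the residue field of the stalk:
  the unique real \<open>c\<close> such that \<open>f - c\<close> is not invertible in any neighbourhood of \<open>m\<close>.\<close>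

definition val :: "('a, 's) superspace \<Rightarrow> 'a set \<Rightarrow> 's \<Rightarrow> 'a \<Rightarrow> real" where
  "val M U f m = (THE c. \<forall>W\<in>opens M U. m \<in> W \<longrightarrow>
     res M U W f \<ominus>\<^bsub>sheaf M W\<^esub> c \<odot>\<^bsub>sheaf M W\<^esub> \<one>\<^bsub>sheaf M W\<^esub> \<notin> Units (sheaf M W))"

text \<open>Tangent vectors at \<open>m\<close> are superderivations of the stalk at \<open>m\<close> with values in the reals,
  represented as restriction-invariant functions of pairs of an open set \<open>U\<close> around \<open>m\<close> and a section
  over \<open>U\<close>, extended by zero. As the reals are purely even, a tangent vector of parity \<open>p\<close> vanishes
  on germs of the other parity.\<close>

type_synonym ('a, 's) tv = "'a set \<Rightarrow> 's \<Rightarrow> real"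

definition tangent_part :: "('a, 's) superspace \<Rightarrow> 'a \<Rightarrow> bit \<Rightarrow> ('a, 's) tv set" where
  "tangent_part M m p = {v.
     (\<forall>U f. openin (base M) U \<and> m \<in> U \<and> f \<in> carrier (sheaf M U) \<or> v U f = 0) \<and>
     (\<forall>U. openin (base M) U \<and> m \<in> U \<longrightarrow>
        (\<forall>W\<in>opens M U. \<forall>f\<in>carrier (sheaf M U). m \<in> W \<longrightarrow> v W (res M U W f) = v U f) \<and>
        (\<forall>f\<in>carrier (sheaf M U). \<forall>h\<in>carrier (sheaf M U).
           v U (f \<oplus>\<^bsub>sheaf M U\<^esub> h) = v U f + v U h) \<and>
        (\<forall>c. \<forall>f\<in>carrier (sheaf M U). v U (c \<odot>\<^bsub>sheaf M U\<^esub> f) = c * v U f) \<and>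
        (\<forall>r. \<forall>f\<in>part (sheaf M U) r. r = p \<or> v U f = 0) \<and>
        (\<forall>r. \<forall>f\<in>part (sheaf M U) r. \<forall>h\<in>carrier (sheaf M U).
           v U (f \<otimes>\<^bsub>sheaf M U\<^esub> h) =
             v U f * val M U h m + koszul p r * val M U f m * v U h))}"

definition tangent :: "('a, 's) superspace \<Rightarrow> 'a \<Rightarrow> ('a, 's) tv set" where
  "tangent M m =
     {(\<lambda>U f. v U f + w U f) | v w. v \<in> tangent_part M m 0 \<and> w \<in> tangent_part M m 1}"

definition vf_at :: "('a, 's) superspace \<Rightarrow> 'a set \<Rightarrow> ('a, 's) vf \<Rightarrow> 'a \<Rightarrow> ('a, 's) tv" where
  "vf_at M U X m = (\<lambda>W f. if openin (base M) W \<and> m \<in> W \<and> f \<in> carrier (sheaf M W)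
     then val M (U \<inter> W) (X (U \<inter> W) (res M W (U \<inter> W) f)) m else 0)"

definition nonsingular :: "('a, 's) superspace \<Rightarrow> ('a, 's) vf \<Rightarrow> bool" where
  "nonsingular M X \<longleftrightarrow> (\<forall>m\<in>points M. vf_at M (points M) X m \<noteq> (\<lambda>U f. 0))"


section \<open>Metrics\<close>

text \<open>A rank 2 covariant tensor is a morphism from the tensor square of the tangent sheaf to the
  structure sheaf, that is, a family of pairings \<open>g U\<close> of the vector fields on open sets \<open>U\<close> that
  commutes with restrictions. Graded symmetry is stated for homogeneous arguments; it is
  extended to all arguments by the additivity in both of them.\<close>

type_synonym ('a, 's) pairing = "'a set \<Rightarrow> ('a, 's) vf \<Rightarrow> ('a, 's) vf \<Rightarrow> 's"

definition metric :: "('a, 's) superspace \<Rightarrow> ('a, 's) pairing \<Rightarrow> bool" where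
  "metric M g \<longleftrightarrow> (\<forall>U. openin (base M) U \<longrightarrow>
     (\<forall>X\<in>vf M U. \<forall>Y\<in>vf M U. g U X Y \<in> carrier (sheaf M U)) \<and>
     (\<forall>X\<in>vf M U. \<forall>Y\<in>vf M U. \<forall>Z\<in>vf M U. \<forall>f\<in>carrier (sheaf M U).
        g U (vf_add M U (vf_smult M U f X) Y) Z =
          f \<otimes>\<^bsub>sheaf M U\<^esub> g U X Z \<oplus>\<^bsub>sheaf M U\<^esub> g U Y Z) \<and>
     (\<forall>X\<in>vf M U. \<forall>Y\<in>vf M U. \<forall>Z\<in>vf M U.
        g U X (vf_add M U Y Z) = g U X Y \<oplus>\<^bsub>sheaf M U\<^esub> g U X Z) \<and>
     (\<forall>p r. \<forall>X\<in>vf_part M U p. \<forall>Y\<in>vf_part M U r.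
        g U X Y \<in> part (sheaf M U) (p + r) \<and>
        g U X Y = koszul p r \<odot>\<^bsub>sheaf M U\<^esub> g U Y X) \<and>
     (\<forall>W\<in>opens M U. \<forall>X\<in>vf M U. \<forall>Y\<in>vf M U.
        g W (vf_res M W X) (vf_res M W Y) = res M U W (g U X Y)))"

definition metric_ker :: "('a, 's) superspace \<Rightarrow> ('a, 's) pairing \<Rightarrow> ('a, 's) vf set" where
  "metric_ker M g =
     {X \<in> Vect M. \<forall>Y\<in>Vect M. g (points M) X Y = \<zero>\<^bsub>sheaf M (points M)\<^esub>}"

definition degenerate :: "('a, 's) superspace \<Rightarrow> ('a, 's) pairing \<Rightarrow> bool" where
  "degenerate M g \<longleftrightarrow> metric_ker M g \<noteq> {vf_zero M (points M)}"

text \<open>The bilinear form on the tangent space at \<open>m\<close> that is induced by \<open>g\<close>.\<close>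

definition form_at ::
  "('a, 's) superspace \<Rightarrow> ('a, 's) pairing \<Rightarrow> 'a \<Rightarrow> ('a, 's) tv \<Rightarrow> ('a, 's) tv \<Rightarrow> real" where
  "form_at M g m v w = (THE c. \<exists>U X Y. openin (base M) U \<and> m \<in> U \<and> X \<in> vf M U \<and> Y \<in> vf M U \<and>
     vf_at M U X m = v \<and> vf_at M U Y m = w \<and> c = val M U (g U X Y) m)"

definition form_ker :: "('a, 's) superspace \<Rightarrow> ('a, 's) pairing \<Rightarrow> 'a \<Rightarrow> ('a, 's) tv set" where
  "form_ker M g m = {v \<in> tangent M m. \<forall>w\<in>tangent M m. form_at M g m v w = 0}"

text \<open>The dimension of the kernel at \<open>m\<close> is \<open>0|1\<close>: its even part is zero and its odd part is a line.\<close>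

definition form_ker_dim_0_1 :: "('a, 's) superspace \<Rightarrow> ('a, 's) pairing \<Rightarrow> 'a \<Rightarrow> bool" where
  "form_ker_dim_0_1 M g m \<longleftrightarrow>
     form_ker M g m \<inter> tangent_part M m 0 = {(\<lambda>U f. 0)} \<and>
     (\<exists>v. v \<noteq> (\<lambda>U f. 0) \<and>
        form_ker M g m \<inter> tangent_part M m 1 = {(\<lambda>U f. c * v U f) | c. True})"


section \<open>Super-null Riemannian manifolds\<close>

text \<open>The vector field on the domain \<open>U\<close> of a chart \<open>(\<phi>, \<Phi>)\<close> that corresponds to the derivation
  \<open>D\<close> of the superdomain.\<close>

definition chart_vf ::
  "nat \<Rightarrow> ('a, 's) superspace \<Rightarrow> 'a set \<Rightarrow> ('a \<Rightarrow> real^'n::finite) \<Rightarrow>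
   ((real^'n) set \<Rightarrow> 'n grassmann \<Rightarrow> 's) \<Rightarrow> (real^'n, 'n grassmann) vf \<Rightarrow> ('a, 's) vf" where
  "chart_vf q M U \<phi> \<Phi> D = on_opens M U (\<lambda>W f.
     \<Phi> (\<phi> ` W) (D (\<phi> ` W) (inv_into (carrier (superfunctions q (\<phi> ` W))) (\<Phi> (\<phi> ` W)) f)))"

text \<open>In the chart below, \<open>t\<close> is the even coordinate with index \<open>i\<close>, the \<open>x\<^sup>a\<close> are the other even
  coordinates, and \<open>\<tau>\<close> is the only odd coordinate.\<close>

definition shander_chart ::
  "('a, 's) superspace \<Rightarrow> ('a, 's) vf \<Rightarrow> ('a, 's) vf \<Rightarrow> 'a set \<Rightarrow> (real^'n::finite) set \<Rightarrow>
   ('a \<Rightarrow> real^'n) \<Rightarrow> ((real^'n) set \<Rightarrow> 'n grassmann \<Rightarrow> 's) \<Rightarrow> 'n \<Rightarrow> bool" where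
  "shander_chart M Q P U V \<phi> \<Phi> i \<longleftrightarrow>
     superchart 1 M U V \<phi> \<Phi> \<and>
     (let Dt = chart_vf 1 M U \<phi> \<Phi> (d_even i);
          D\<tau> = chart_vf 1 M U \<phi> \<Phi> (d_odd 0);
          \<tau> = \<Phi> V (odd_coord 0 V)
      in vf_res M U Q = vf_add M U D\<tau> (vf_smult M U \<tau> Dt) \<and> vf_res M U P = Dt)"

text \<open>The dimension is \<open>CARD('n)|1\<close>.\<close>

definition super_null_manifold ::
  "'n::finite itself \<Rightarrow> ('a, 's) superspace \<Rightarrow> ('a, 's) pairing \<Rightarrow>
   ('a, 's) vf \<Rightarrow> ('a, 's) vf \<Rightarrow> bool" where
  "super_null_manifold N M g Q P \<longleftrightarrow>
     supermanifold N 1 M \<and> metric M g \<and> degenerate M g \<and>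
     Q \<in> Vect_part M 1 \<and> nonsingular M Q \<and> P \<in> Vect_part M 0 \<and>
     vf_bracket M (points M) 1 1 Q Q = vf_add M (points M) P P \<and>
     metric_ker M g = {vf_smult M (points M) f Q | f. f \<in> C_inf M} \<and>
     (\<forall>m\<in>points M. form_ker_dim_0_1 M g m) \<and>
     (\<forall>m\<in>points M. \<exists>U (V :: (real^'n) set) \<phi> \<Phi> i. m \<in> U \<and> shander_chart M Q P U V \<phi> \<Phi> i)"


section \<open>Affine connections\<close>

type_synonym ('a, 's) connection = "('a, 's) vf \<Rightarrow> ('a, 's) vf \<Rightarrow> ('a, 's) vf"

definition affine_connection :: "('a, 's) superspace \<Rightarrow> ('a, 's) connection \<Rightarrow> bool" where
  "affine_connection M nabla \<longleftrightarrow>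
     (\<forall>X\<in>Vect M. \<forall>Y\<in>Vect M. nabla X Y \<in> Vect M) \<and>
     (\<forall>p r. \<forall>X\<in>Vect_part M p. \<forall>Y\<in>Vect_part M r. nabla X Y \<in> Vect_part M (p + r)) \<and>
     (\<forall>X\<in>Vect M. \<forall>Y\<in>Vect M. \<forall>Z\<in>Vect M.
        nabla (vf_add M (points M) X Y) Z = vf_add M (points M) (nabla X Z) (nabla Y Z) \<and>
        nabla X (vf_add M (points M) Y Z) = vf_add M (points M) (nabla X Y) (nabla X Z)) \<and>
     (\<forall>f\<in>C_inf M. \<forall>X\<in>Vect M. \<forall>Y\<in>Vect M.
        nabla (vf_smult M (points M) f X) Y = vf_smult M (points M) f (nabla X Y)) \<and>
     (\<forall>p r. \<forall>X\<in>Vect_part M p. \<forall>f\<in>part (sheaf M (points M)) r. \<forall>Y\<in>Vect M.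
        nabla X (vf_smult M (points M) f Y) =
          vf_add M (points M) (vf_smult M (points M) (X (points M) f) Y)
            (vf_smult M (points M) (koszul p r \<odot>\<^bsub>sheaf M (points M)\<^esub> f) (nabla X Y)))"

definition compatible ::
  "('a, 's) superspace \<Rightarrow> ('a, 's) pairing \<Rightarrow> ('a, 's) vf \<Rightarrow> ('a, 's) connection \<Rightarrow> bool" where
  "compatible M g Q nabla \<longleftrightarrow>
     (\<forall>X\<in>Vect M. nabla X Q = vf_zero M (points M)) \<and>
     (\<forall>p r s. \<forall>X\<in>Vect_part M p. \<forall>Y\<in>Vect_part M r. \<forall>Z\<in>Vect_part M s.
        X (points M) (g (points M) Y Z) =
          g (points M) (nabla X Y) Z \<oplus>\<^bsub>sheaf M (points M)\<^esub>
          koszul p r \<odot>\<^bsub>sheaf M (points M)\<^esub> g (points M) Y (nabla X Z))"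

end

theory Submission
  imports Defs
begin

text \<open>
  Near a point let \<open>\<tau>\<close> be the odd Shander coordinate, so that \<open>Q \<tau> = 1\<close>. As \<open>\<langle>\<cdot>|\<cdot>\<rangle>\<close> is nondegenerate on the
  even coordinate directions modulo \<open>Q\<close>, its inverse matrix, once diagonalized by polarization, gives constants
  \<open>c\<^sub>s\<close> and even vector fields \<open>v\<^sub>s\<close> with \<open>Y = \<Sum>\<^sub>s c\<^sub>s \<langle>Y|v\<^sub>s\<rangle> v\<^sub>s + (Y \<tau>) Q\<close> for every \<open>Y\<close>. Differentiating only the
  coefficients defines a local connection
  \<open>\<nabla>\<^sub>X Y = \<Sum>\<^sub>s c\<^sub>s X\<langle>Y|v\<^sub>s\<rangle> v\<^sub>s + X(Y \<tau>) Q\<close>. It kills \<open>Q\<close> because \<open>\<langle>Q|v\<^sub>s\<rangle> = 0\<close> and \<open>Q \<tau> = 1\<close>, and it is metric by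
  the Leibniz rule applied to \<open>\<langle>Y|Z\<rangle> = \<Sum>\<^sub>s c\<^sub>s \<langle>Y|v\<^sub>s\<rangle> \<langle>v\<^sub>s|Z\<rangle>\<close>; no Koszul formula is involved.

  The defining properties of a connection, with \<open>X f\<close> and \<open>X\<langle>Y|Z\<rangle>\<close> scaled by an even function \<open>\<kappa>\<close>, are additive
  in \<open>\<kappa>\<close>. Instead of a partition of unity, countably many cutoffs \<open>\<kappa>\<^sub>n\<close> with \<open>\<kappa>\<^sub>n = 1\<close> on \<open>B\<^sub>n\<close> are combined by
  \<open>\<sigma>\<^sub>n\<^sub>+\<^sub>1 = \<sigma>\<^sub>n + (1 - \<sigma>\<^sub>n) \<kappa>\<^sub>n\<close>. On \<open>B\<^sub>j\<close> this is \<open>1\<close>, and the corresponding sum of connections is stationary, for \<open>n > j\<close>.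
\<close>

section \<open>Smooth functions\<close>

text \<open>The Koszul formula would only give the pairings of \<open>\<nabla>\<^sub>X Y\<close>
  with other fields and so leave its \<open>Q\<close>-part undetermined; differentiating
  coefficients fixes that part through \<open>\<tau>\<close>. Polarization is there because a
  summand \<open>c X\<langle>Y|v\<rangle> v\<close> satisfies the metric identity by itself: the
  same \<open>v\<close> occurs in the coefficient and in the direction, so the derivative of either
  factor of \<open>\<langle>Y|v\<rangle> \<langle>v|Z\<rangle>\<close> is again a value of the
  operator. The frame lives on a chart whereas a connection acts on global fields, hence the
  repeated extensions by cutoffs. Calculations exploit the single odd dimension. A section is a pair
  of real functions, multiplied like dual numbers, so an identity of sections becomes two identities
  of real numbers at every point; products of two odd sections vanish, and with them most questions
  of sign. The second component depends on the chart, but whether it vanishes does not if the value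
  vanishes as well, and that is enough to prove equalities.\<close>

lemma partial_eq: "(f has_derivative f') (at x) \<Longrightarrow> partial i f x = f' (axis i 1)"
  unfolding partial_def using frechet_derivative_at by metis

lemma C_k_subset: "C_k k W f \<Longrightarrow> V \<subseteq> W \<Longrightarrow> C_k k V f"
  by (induction k arbitrary: f) (auto intro: continuous_on_subset)

text \<open>\<open>frechet_derivative\<close> is a choice from the predicate
  \<open>has_derivative\<close>, so functions with the same derivatives at \<open>x\<close> get the
  same value, also where no derivative exists.\<close>

lemma partial_cong:
  assumes "open W" "x \<in> W" "\<And>y. y \<in> W \<Longrightarrow> f y = h y"
  shows "partial i f x = partial i h x"
proof -
  have "(f has_derivative f') (at x) \<longleftrightarrow> (h has_derivative f') (at x)" for f'
    using assms has_derivative_transform_within_open[of f f' x UNIV W h]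
      has_derivative_transform_within_open[of h f' x UNIV W f] by auto
  then show ?thesis by (simp add: partial_def frechet_derivative_def)
qed

lemma C_k_cong:
  assumes "open W" "\<And>y. y \<in> W \<Longrightarrow> f y = h y" "C_k k W f"
  shows "C_k k W h"
  using assms(2,3)
proof (induction k arbitrary: f h)
  case 0
  then show ?case using continuous_on_cong[of W W f h] by simp
next
  case (Suc k)
  have "h differentiable (at x)" if "x \<in> W" for x
    using Suc.prems that assms(1) has_derivative_transform_within_open[of f _ x UNIV W h]
    unfolding differentiable_def C_k.simps by blast
  moreover have "C_k k W (partial i h)" for i
    by (rule Suc.IH[of "partial i f"]) (use Suc.prems partial_cong[OF assms(1), of _ f h] in auto)
  ultimately show ?case by simp
qed

text \<open>\<open>C_k (Suc k)\<close> asks that \<open>f\<close> be differentiable and otherwise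
  constrains only its partial derivatives; the regularity of \<open>f\<close> itself is recovered by
  induction, starting from the continuity of differentiable functions.\<close>

lemma C_k_Suc_D: "C_k (Suc k) W f \<Longrightarrow> C_k k W f"
proof (induction k arbitrary: f)
  case 0
  then have "continuous (at x within W) f" if "x \<in> W" for x
    using that differentiable_imp_continuous_within continuous_at_imp_continuous_at_within
    unfolding C_k.simps by blast
  then show ?case by (simp add: continuous_on_eq_continuous_within)
next
  case (Suc k)
  then have "\<forall>x\<in>W. f differentiable (at x)" "C_k (Suc k) W (partial i f)" for i
    using C_k.simps(2)[of "Suc k" W f] by blast+
  then show ?case using Suc.IH C_k.simps(2)[of k W f] by blast
qed

lemma C_k_const: "C_k k W (\<lambda>x. c)"
proof (induction k arbitrary: c)
  case (Suc k)
  have "partial i (\<lambda>x. c) = (\<lambda>x. 0)" for i :: 'a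
    using partial_eq[OF has_derivative_const] by auto
  with Suc show ?case by simp
qed simp

lemma C_k_component: "C_k k W (\<lambda>x. x $ j)"
proof (cases k)
  case (Suc m)
  have d: "((\<lambda>x. x $ j) has_derivative (\<lambda>x. x $ j)) (at x)" for x :: "real^'a"
    by (simp add: bounded_linear_imp_has_derivative bounded_linear_vec_nth)
  have "partial i (\<lambda>x. x $ j) = (\<lambda>x. axis i 1 $ j)" for i
    using partial_eq[OF d] by auto
  with d Suc show ?thesis by (auto simp: C_k_const differentiable_def)
qed (simp add: continuous_intros)

lemma C_k_add:
  assumes "open W" "C_k k W f" "C_k k W h"
  shows "C_k k W (\<lambda>x. f x + h x)"
  using assms(2,3)
proof (induction k arbitrary: f h)
  case (Suc k)
  have "partial i (\<lambda>x. f x + h x) x = partial i f x + partial i h x" if x: "x \<in> W" for i x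
  proof -
    obtain f' h' where "(f has_derivative f') (at x)" "(h has_derivative h') (at x)"
      using Suc.prems x unfolding differentiable_def C_k.simps by blast
    then show ?thesis
      using partial_eq[OF has_derivative_add[of f f' _ h h']] by (simp add: partial_eq)
  qed
  then have "C_k k W (partial i (\<lambda>x. f x + h x))" for i
    using Suc.prems by - (rule C_k_cong[OF assms(1) _ Suc.IH[of "partial i f" "partial i h"]], simp_all)
  then show ?case using Suc.prems by (simp add: differentiable_add)
qed (simp add: continuous_on_add)

lemma C_k_mult:
  assumes "open W" "C_k k W f" "C_k k W h"
  shows "C_k k W (\<lambda>x. f x * h x)"
  using assms(2,3)
proof (induction k arbitrary: f h)
  case (Suc k)
  have "partial i (\<lambda>x. f x * h x) x = f x * partial i h x + partial i f x * h x" if x: "x \<in> W" for i x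
  proof -
    obtain f' h' where "(f has_derivative f') (at x)" "(h has_derivative h') (at x)"
      using Suc.prems x unfolding differentiable_def C_k.simps by blast
    then show ?thesis
      using partial_eq[OF has_derivative_mult[of f f' x UNIV h h']] by (simp add: partial_eq)
  qed
  then have "C_k k W (partial i (\<lambda>x. f x * h x))" for i
    using Suc.prems C_k_Suc_D[OF Suc.prems(1)] C_k_Suc_D[OF Suc.prems(2)]
    by - (rule C_k_cong[OF assms(1) _ C_k_add[OF assms(1) Suc.IH[of f "partial i h"] Suc.IH[of "partial i f" h]]], simp_all)
  then show ?case using Suc.prems by simp
qed (simp add: continuous_on_mult)

text \<open>The chain rule trades \<open>F\<close> for its derivative, so the induction on
  \<open>k\<close> lets the outer function range over a family that is closed under differentiation
  at the values of \<open>u\<close>. Such a family replaces a separate notion of smoothness in one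
  variable.\<close>

lemma C_k_compose:
  assumes "open W" "C_k k W u" "F \<in> \<F>"
    and "\<And>F. F \<in> \<F> \<Longrightarrow> \<exists>F'\<in>\<F>. \<forall>x\<in>W. (F has_real_derivative F' (u x)) (at (u x))"
  shows "C_k k W (\<lambda>x. F (u x))"
  using assms(2,3)
proof (induction k arbitrary: F)
  case 0
  obtain F' where F': "\<forall>x\<in>W. (F has_real_derivative F' (u x)) (at (u x))"
    using assms(4)[OF 0(2)] by blast
  then have "\<forall>x\<in>W. isCont F (u x)" using DERIV_isCont by blast
  then have "\<forall>y\<in>u ` W. isCont F y" by blast
  then have "continuous_on (u ` W) F" by (simp add: continuous_at_imp_continuous_on)
  then show ?case using 0 continuous_on_compose2[of "u ` W" F W u] by auto
next
  case (Suc k)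
  obtain F' where F': "F' \<in> \<F>" "\<forall>x\<in>W. (F has_real_derivative F' (u x)) (at (u x))"
    using assms(4)[OF Suc.prems(2)] by blast
  have d: "((\<lambda>x. F (u x)) has_derivative (\<lambda>v. F' (u x) * u' v)) (at x)"
    if "x \<in> W" "(u has_derivative u') (at x)" for x u'
    using F'(2) that has_derivative_compose[of u u' x UNIV F "(*) (F' (u x))"]
    by (auto simp: has_field_derivative_def)
  have u: "\<exists>u'. (u has_derivative u') (at x)" if "x \<in> W" for x
    using Suc.prems(1) that by (auto simp: differentiable_def)
  have "partial i (\<lambda>x. F (u x)) x = F' (u x) * partial i u x" if "x \<in> W" for i x
    using u[OF that] d[OF that] partial_eq[of "\<lambda>x. F (u x)" _ x i] partial_eq[of u _ x i] by force
  then have "C_k k W (partial i (\<lambda>x. F (u x)))" for i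
    using Suc.prems(1) C_k_Suc_D[OF Suc.prems(1)]
    by - (rule C_k_cong[OF assms(1) _ C_k_mult[OF assms(1) Suc.IH[OF _ F'(1)]], of "partial i u"], simp_all)
  moreover have "(\<lambda>x. F (u x)) differentiable (at x)" if "x \<in> W" for x
    using u[OF that] d[OF that] by (auto intro: differentiableI)
  ultimately show ?case by simp
qed

lemma smooth_subset: "smooth W f \<Longrightarrow> V \<subseteq> W \<Longrightarrow> smooth V f"
  unfolding smooth_def using C_k_subset[of _ W f V] by blast

lemma smooth_cong: "open W \<Longrightarrow> smooth W f \<Longrightarrow> (\<And>y. y \<in> W \<Longrightarrow> f y = h y) \<Longrightarrow> smooth W h"
  unfolding smooth_def by (rule allI, rule C_k_cong[of W f h]) blast+

lemma smooth_const: "smooth W (\<lambda>x. c)"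
  by (simp add: smooth_def C_k_const)

lemma smooth_component: "smooth W (\<lambda>x. x $ i)"
  by (simp add: smooth_def C_k_component)

lemma smooth_add: "open W \<Longrightarrow> smooth W f \<Longrightarrow> smooth W h \<Longrightarrow> smooth W (\<lambda>x. f x + h x)"
  by (simp add: smooth_def C_k_add)

lemma smooth_mult: "open W \<Longrightarrow> smooth W f \<Longrightarrow> smooth W h \<Longrightarrow> smooth W (\<lambda>x. f x * h x)"
  by (simp add: smooth_def C_k_mult)

lemma smooth_cmult: "open W \<Longrightarrow> smooth W f \<Longrightarrow> smooth W (\<lambda>x. c * f x)"
  by (simp add: smooth_mult smooth_const)

lemma smooth_diff: "open W \<Longrightarrow> smooth W f \<Longrightarrow> smooth W h \<Longrightarrow> smooth W (\<lambda>x. f x - h x)"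
  using smooth_add[of W f "\<lambda>x. (-1) * h x"] smooth_cmult[of W h "-1"] by simp

lemma smooth_sum: "open W \<Longrightarrow> (\<And>i. i \<in> A \<Longrightarrow> smooth W (f i)) \<Longrightarrow> smooth W (\<lambda>x. \<Sum>i\<in>A. f i x)"
  by (induction A rule: infinite_finite_induct) (simp_all add: smooth_const smooth_add)

lemma smooth_prod: "open W \<Longrightarrow> (\<And>i. i \<in> A \<Longrightarrow> smooth W (f i)) \<Longrightarrow> smooth W (\<lambda>x. \<Prod>i\<in>A. f i x)"
  by (induction A rule: infinite_finite_induct) (simp_all add: smooth_const smooth_mult)

lemma smooth_partial: "smooth W f \<Longrightarrow> smooth W (partial i f)"
proof -
  assume "smooth W f"
  then have "C_k (Suc k) W f" for k by (simp only: smooth_def)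
  then show ?thesis by (simp add: smooth_def)
qed

lemma smooth_differentiable: "smooth W f \<Longrightarrow> x \<in> W \<Longrightarrow> f differentiable (at x)"
proof -
  assume "smooth W f" "x \<in> W"
  moreover from this have "C_k (Suc 0) W f" by (simp only: smooth_def)
  ultimately show ?thesis by simp
qed

lemma smooth_continuous_on: "smooth W f \<Longrightarrow> continuous_on W f"
proof -
  assume "smooth W f"
  then have "C_k 0 W f" by (simp only: smooth_def)
  then show ?thesis by simp
qed

lemma smooth_inverse:
  assumes "open W" "smooth W u" "\<And>x. x \<in> W \<Longrightarrow> u x \<noteq> 0"
  shows "smooth W (\<lambda>x. inverse (u x))"
proof -
  \<comment> \<open>The functions \<open>c / y ^ n\<close> are closed under differentiation away
    from \<open>0\<close>, and \<open>c = n = 1\<close> is the inverse.\<close>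
  let ?F = "range (\<lambda>(c, n) y. c * inverse y ^ n :: real)"
  have "C_k k W (\<lambda>x. (\<lambda>y. 1 * inverse y ^ 1) (u x))" for k
  proof (rule C_k_compose[of _ _ _ "\<lambda>y. 1 * inverse y ^ 1" ?F])
    show "(\<lambda>y. 1 * inverse y ^ 1) \<in> ?F" by (rule range_eqI[of _ _ "(1, 1)"]) simp
    fix F assume "F \<in> ?F"
    then obtain c n where F: "F = (\<lambda>y. c * inverse y ^ n)" by auto
    have "(F has_real_derivative (- c * n) * inverse y ^ (n + 1)) (at y)" if "y \<noteq> 0" for y
      unfolding F using DERIV_cmult[OF DERIV_power[OF DERIV_inverse[OF that], of n], of c]
      by (cases n) (simp_all add: mult.commute mult.left_commute)
    then show "\<exists>F'\<in>?F. \<forall>x\<in>W. (F has_real_derivative F' (u x)) (at (u x))"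
      using assms(3) by (intro bexI[of _ "\<lambda>y. (- c * n) * inverse y ^ (n + 1)"])
        (auto intro!: range_eqI[of _ _ "(- c * n, n + 1)"])
  qed (use assms in \<open>auto simp: smooth_def\<close>)
  then show ?thesis by (simp add: smooth_def)
qed

lemma smooth_divide:
  assumes "open W" "smooth W f" "smooth W u" "\<And>x. x \<in> W \<Longrightarrow> u x \<noteq> 0"
  shows "smooth W (\<lambda>x. f x / u x)"
  using smooth_mult[OF assms(1,2) smooth_inverse[OF assms(1,3,4)]] by (simp add: divide_inverse)

section \<open>Determinants and inverse matrices with smooth entries\<close>

lemma smooth_det:
  fixes A :: "real^'n \<Rightarrow> real^'m^'m"
  assumes "open W" "\<And>i j. smooth W (\<lambda>x. A x $ i $ j)"
  shows "smooth W (\<lambda>x. det (A x))"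
  unfolding det_def using assms by (intro smooth_sum smooth_mult smooth_prod smooth_const) auto

lemma matrix_inv_inverse:
  fixes A :: "real^'m^'m"
  assumes "det A \<noteq> 0"
  shows "A ** matrix_inv A = mat 1" "matrix_inv A ** A = mat 1"
  using assms someI_ex[of "\<lambda>A'. A ** A' = mat 1 \<and> A' ** A = mat 1"]
  unfolding matrix_inv_def invertible_det_nz[symmetric] invertible_def by blast+

text \<open>Cramer's rule for column \<open>j\<close> of the inverse, which solves
  \<open>A x = axis j 1\<close>. As a quotient of determinants the entry is visibly smooth in the
  entries of \<open>A\<close>.\<close>

lemma matrix_inv_entry:
  fixes A :: "real^'m^'m"
  assumes "det A \<noteq> 0"
  shows "matrix_inv A $ k $ j = det (\<chi> i l. if l = k then axis j 1 $ i else A $ i $ l) / det A"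
proof -
  have "A *v column j (matrix_inv A) = axis j 1"
    using matrix_inv_inverse(1)[OF assms]
    by (simp add: matrix_vector_mul_assoc flip: matrix_vector_mult_basis)
  then have "column j (matrix_inv A) = (\<chi> k. det (\<chi> i l. if l = k then axis j 1 $ i else A $ i $ l) / det A)"
    using cramer[OF assms] by blast
  then have "column j (matrix_inv A) $ k = (\<chi> k. det (\<chi> i l. if l = k then axis j 1 $ i else A $ i $ l) / det A) $ k"
    by simp
  then show ?thesis by (simp add: column_def)
qed

lemma smooth_matrix_inv:
  fixes A :: "real^'n \<Rightarrow> real^'m^'m"
  assumes "open W" "\<And>i j. smooth W (\<lambda>x. A x $ i $ j)" "\<And>x. x \<in> W \<Longrightarrow> det (A x) \<noteq> 0"
  shows "smooth W (\<lambda>x. matrix_inv (A x) $ k $ j)"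
proof -
  have smooth_entry: "smooth W (\<lambda>x. if l = k then axis j 1 $ i else A x $ i $ l)" for i l
    using assms(2) by (cases "l = k") (simp_all add: smooth_const)
  have "smooth W (\<lambda>x. det (\<chi> i l. if l = k then axis j 1 $ i else A x $ i $ l) / det (A x))"
    using assms by (intro smooth_divide smooth_det) (simp_all only: vec_lambda_beta smooth_entry simp_thms)
  then show ?thesis
    using assms by (elim smooth_cong[rotated]) (auto simp: matrix_inv_entry)
qed

subsection \<open>Bump functions\<close>

text \<open>The function \<open>p (1/y) exp (-1/y)\<close>, continued by zero. Allowing every
  polynomial \<open>p\<close> makes the family closed under differentiation, as
  \<open>C_k_compose\<close> demands; \<open>p = 1\<close> is the classical flat function.\<close>

definition flat_exp :: "real poly \<Rightarrow> real \<Rightarrow> real" where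
  "flat_exp p y = (if y > 0 then poly p (1 / y) * exp (- (1 / y)) else 0)"

lemma flat_exp_tendsto_0: "((\<lambda>y. flat_exp p y / y) \<longlongrightarrow> 0) (at 0)"
proof -
  have "((\<lambda>z. z ^ n * exp (- z)) \<longlongrightarrow> (0::real)) at_top" for n :: nat
    using tendsto_power_div_exp_0[of n] by (simp only: exp_minus divide_inverse)
  then have m: "((\<lambda>z. poly q z * exp (- z)) \<longlongrightarrow> 0) at_top" for q :: "real poly"
    unfolding poly_altdef sum_distrib_right mult.assoc
    by (intro tendsto_null_sum tendsto_mult_right_zero)
  \<comment> \<open>\<open>pCons 0 p\<close> is \<open>z p(z)\<close>: for \<open>z = 1/y\<close>
    the extra factor is the division by \<open>y\<close>.\<close>
  have "((\<lambda>y. poly (pCons 0 p) (inverse y) * exp (- inverse y)) \<longlongrightarrow> 0) (at_right (0::real))"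
    by (rule filterlim_compose[OF m filterlim_inverse_at_top_right])
  then have "((\<lambda>y. flat_exp p y / y) \<longlongrightarrow> 0) (at_right 0)"
    by (rule Lim_transform_eventually)
      (auto simp: eventually_at_right_less flat_exp_def field_simps intro!: eventually_at_right_less[THEN eventually_mono])
  moreover have "((\<lambda>y. flat_exp p y / y) \<longlongrightarrow> 0) (at_left 0)"
    by (rule Lim_transform_eventually[OF tendsto_const])
      (auto simp: flat_exp_def eventually_at_left_field intro!: exI[of _ "-1"])
  ultimately show ?thesis by (simp add: filterlim_at_split)
qed

text \<open>With \<open>z = 1/y\<close>, hence \<open>dz/dy = - z^2\<close>, the derivative of
  \<open>p(z) exp (-z)\<close> is \<open>z^2 (p - p')(z) exp (-z)\<close>; at \<open>0\<close> the
  difference quotient is the one of \<open>flat_exp_tendsto_0\<close>.\<close>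

lemma flat_exp_deriv:
  "(flat_exp p has_real_derivative flat_exp ([:0, 0, 1:] * (p - pderiv p)) y) (at y)"
proof -
  consider "y > 0" | "y = 0" | "y < 0" by linarith
  then show ?thesis
  proof cases
    case 1
    have "((\<lambda>y. poly p (1 / y) * exp (- (1 / y))) has_real_derivative flat_exp ([:0, 0, 1:] * (p - pderiv p)) y) (at y)"
      using 1 by (auto intro!: derivative_eq_intros DERIV_chain2[OF poly_DERIV]
          simp: flat_exp_def field_simps power2_eq_square)
    then show ?thesis
      by (rule has_field_derivative_transform_within_open[of _ _ _ "{0<..}"])
        (use 1 in \<open>auto simp: flat_exp_def\<close>)
  next
    case 2
    then show ?thesis using flat_exp_tendsto_0[of p]
      by (simp add: has_field_derivative_iff flat_exp_def)
  next
    case 3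
    have "((\<lambda>y. 0) has_real_derivative flat_exp ([:0, 0, 1:] * (p - pderiv p)) y) (at y)"
      using 3 by (simp add: flat_exp_def)
    then show ?thesis
      by (rule has_field_derivative_transform_within_open[of _ _ _ "{..<0}"])
        (use 3 in \<open>auto simp: flat_exp_def\<close>)
  qed
qed

lemma smooth_flat_exp:
  assumes "open W" "smooth W u"
  shows "smooth W (\<lambda>x. flat_exp p (u x))"
  unfolding smooth_def
proof
  fix k show "C_k k W (\<lambda>x. flat_exp p (u x))"
    by (rule C_k_compose[of _ _ _ _ "range flat_exp"])
      (use assms flat_exp_deriv in \<open>auto simp: smooth_def\<close>)
qed

lemma smooth_bump:
  fixes a :: "real^'n"
  assumes "0 < r"
  obtains b :: "real^'n \<Rightarrow> real" and s where "smooth UNIV b" "0 < s" "s < r" "\<And>x. x \<in> ball a s \<Longrightarrow> b x = 1"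
    "\<And>x. x \<notin> ball a r \<Longrightarrow> b x = 0"
proof -
  \<comment> \<open>This is \<open>2 - 2 (dist a x / r)^2\<close>, spelled out as a polynomial in
    the coordinates so that it is smooth. It is at least \<open>1\<close> on the ball of radius
    \<open>r / 2\<close> and at most \<open>0\<close> outside the ball of radius
    \<open>r\<close>.\<close>
  define u :: "real^'n \<Rightarrow> real" where "u x = 2 - 2 / r\<^sup>2 * (\<Sum>i\<in>UNIV. (a $ i - x $ i) * (a $ i - x $ i))" for x
  have u: "u x = 2 - 2 * (dist a x / r)\<^sup>2" for x
  proof -
    have "(dist a x)\<^sup>2 = (\<Sum>i\<in>UNIV. (a $ i - x $ i) * (a $ i - x $ i))"
      by (simp add: dist_norm norm_vec_def L2_set_def sum_nonneg flip: power2_eq_square)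
    then show ?thesis by (simp add: u_def power_divide)
  qed
  have su: "smooth UNIV u"
    unfolding u_def by (intro smooth_diff smooth_cmult smooth_sum smooth_mult smooth_const smooth_component) auto
  \<comment> \<open>A smooth step in \<open>u\<close>, from \<open>0\<close> for
    \<open>u \<le> 0\<close> to \<open>1\<close> for \<open>u \<ge> 1\<close>; the denominator is
    positive because \<open>u\<close> and \<open>1 - u\<close> are never both nonpositive.\<close>
  define b where "b x = flat_exp 1 (u x) / (flat_exp 1 (u x) + flat_exp 1 (1 - u x))" for x
  have "flat_exp 1 y + flat_exp 1 (1 - y) > 0" for y
    by (auto simp: flat_exp_def add_pos_pos)
  then have "flat_exp 1 y + flat_exp 1 (1 - y) \<noteq> 0" for y
    by (metis less_irrefl)
  then have "smooth UNIV b"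
    unfolding b_def using su by (intro smooth_divide smooth_flat_exp smooth_add smooth_diff smooth_const) auto
  moreover have "b x = 1" if "x \<in> ball a (r / 2)" for x
  proof -
    have "dist a x / r \<le> 1 / 2" using that assms by (simp add: field_simps)
    then have "(dist a x / r)\<^sup>2 \<le> (1 / 2)\<^sup>2" using assms by (intro power_mono) auto
    then have "u x \<ge> 1" unfolding u by (simp only: power_one_over) simp
    then show ?thesis by (simp add: b_def flat_exp_def)
  qed
  moreover have "b x = 0" if "x \<notin> ball a r" for x
  proof -
    have "dist a x / r \<ge> 1" using that assms by (simp add: field_simps)
    then have "(dist a x / r)\<^sup>2 \<ge> 1" by (simp add: one_le_power)
    then have "u x \<le> 0" by (simp add: u)
    then show ?thesis by (simp add: b_def flat_exp_def)
  qed
  ultimately show ?thesis using that[of b "r / 2"] assms by simp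
qed

subsection \<open>Hadamard's lemma\<close>

lemma has_derivative_partial:
  assumes "f differentiable (at x)"
  shows "(f has_derivative (\<lambda>v. \<Sum>i\<in>UNIV. partial i f x * v $ i)) (at x)"
proof -
  let ?f' = "frechet_derivative f (at x)"
  have f': "(f has_derivative ?f') (at x)"
    using assms frechet_derivative_works by blast
  then interpret linear ?f' by (rule has_derivative_linear)
  have "?f' v = (\<Sum>i\<in>UNIV. partial i f x * v $ i)" for v
  proof -
    have "?f' v = ?f' (\<Sum>i\<in>UNIV. v $ i *\<^sub>R axis i 1)"
      using basis_expansion[of v] by (simp add: scalar_mult_eq_scaleR)
    also have "\<dots> = (\<Sum>i\<in>UNIV. partial i f x * v $ i)"
      by (simp add: sum scale partial_def mult.commute)
    finally show ?thesis .
  qed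
  with f' show ?thesis by (metis (no_types, lifting) ext)
qed

text \<open>Iterated differentiation under the integral sign; segments from the centre stay inside
  the ball, where \<open>f\<close> is smooth.\<close>

lemma smooth_integral_segment:
  fixes f :: "real^'n \<Rightarrow> real"
  assumes "smooth (ball a r) f"
  shows "smooth (ball a r) (\<lambda>x. integral {0..1} (\<lambda>s. f (a + s *\<^sub>R (x - a))))"
proof -
  let ?B = "ball a r"
  let ?h = "\<lambda>s x. a + s *\<^sub>R (x - a)"
  have seg: "?h s x \<in> ?B" if "x \<in> ?B" "s \<in> {0..1}" for s x
  proof -
    have "dist a (?h s x) = s * dist a x"
      using that by (simp add: dist_norm norm_minus_commute)
    also have "\<dots> \<le> dist a x" using that by (simp add: mult_left_le_one_le)
    finally show ?thesis using that by simp
  qed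
  have cont: "continuous_on (?B \<times> cbox 0 1) (\<lambda>(x, s). s ^ m * f (?h s x))"
    if "continuous_on ?B f" for m and f :: "real^'n \<Rightarrow> real"
    unfolding split_beta
    by (intro continuous_intros continuous_on_compose2[OF that]) (use seg in auto)
  have cont1: "continuous_on {0..1} (\<lambda>s. s ^ m * f (?h s x))"
    if "continuous_on ?B f" "x \<in> ?B" for m x and f :: "real^'n \<Rightarrow> real"
    by (intro continuous_intros continuous_on_compose2[OF that(1)]) (use seg that in auto)
  \<comment> \<open>Each derivative in \<open>x\<close> produces a factor \<open>s\<close>, so the
    induction has to cover all weights \<open>s ^ m\<close>; the claim is the case
    \<open>m = 0\<close>.\<close>
  have "C_k k ?B (\<lambda>x. integral {0..1} (\<lambda>s. s ^ m * f (?h s x)))"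
    if "smooth ?B f" for k m and f :: "real^'n \<Rightarrow> real"
    using that
  proof (induction k arbitrary: m f)
    case 0
    then show ?case
      using integral_continuous_on_param[OF cont[OF smooth_continuous_on[OF 0], of m]] by simp
  next
    case (Suc k)
    let ?F = "\<lambda>x. integral {0..1} (\<lambda>s. s ^ m * f (?h s x))"
    \<comment> \<open>The derivative of the integrand in \<open>x\<close>, as a bounded linear map:
      the Leibniz rule integrates it as a vector, and evaluating the integral on basis vectors gives
      the partial derivatives.\<close>
    define D where "D x s = (\<Sum>i\<in>UNIV. (s ^ Suc m * partial i f (?h s x)) *\<^sub>R blinfun_inner_left (axis i 1 :: real^'n))" for x s
    have D: "blinfun_apply (D x s) v = (\<Sum>i\<in>UNIV. s ^ Suc m * partial i f (?h s x) * v $ i)" for x s and v :: "real^'n"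
      by (simp add: D_def blinfun.sum_left blinfun.scaleR_left inner_axis)
    have cp: "continuous_on ?B (partial i f)" for i
      using Suc.prems smooth_partial smooth_continuous_on by blast
    have d: "(?F has_derivative integral (cbox 0 1) (D x)) (at x within ?B)" if x: "x \<in> ?B" for x
      unfolding box_real(2)[symmetric]
    proof (rule leibniz_rule[OF _ _ _ x])
      fix x s :: "real^'n" and t :: real
      assume x: "x \<in> ?B" and t: "t \<in> cbox 0 1"
      have hd: "(?h t has_derivative (\<lambda>v. t *\<^sub>R v)) (at x)"
        by (auto intro!: derivative_eq_intros)
      have fd: "(f has_derivative (\<lambda>v. \<Sum>i\<in>UNIV. partial i f (?h t x) * v $ i)) (at (?h t x))"
        using seg[OF x] t by (intro has_derivative_partial smooth_differentiable[OF Suc.prems]) simp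
      have "((\<lambda>x. t ^ m * f (?h t x)) has_derivative
          (\<lambda>v. t ^ m * (\<Sum>i\<in>UNIV. partial i f (?h t x) * (t *\<^sub>R v) $ i))) (at x)"
        by (rule has_derivative_mult_right[OF has_derivative_compose[OF hd fd]])
      moreover have "(\<lambda>v. t ^ m * (\<Sum>i\<in>UNIV. partial i f (?h t x) * (t *\<^sub>R v) $ i)) = blinfun_apply (D x t)"
        by (auto simp: D sum_distrib_left mult_ac)
      ultimately show "((\<lambda>x. t ^ m * f (?h t x)) has_derivative blinfun_apply (D x t)) (at x within ?B)"
        by (simp add: has_derivative_at_withinI)
    next
      fix x assume "x \<in> ?B"
      then show "(\<lambda>s. s ^ m * f (?h s x)) integrable_on cbox 0 1"
        using cont1[of f x m] smooth_continuous_on[OF Suc.prems] by (intro integrable_continuous) simp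
    next
      have "continuous_on (?B \<times> cbox 0 1) (\<lambda>z. (snd z ^ Suc m * partial i f (?h (snd z) (fst z))) *\<^sub>R
          (blinfun_inner_left (axis i 1) :: (real^'n) \<Rightarrow>\<^sub>L real))" for i
        using cont[OF cp[of i], of "Suc m"] unfolding split_beta by (intro continuous_on_scaleR continuous_on_const)
      then show "continuous_on (?B \<times> cbox 0 1) (\<lambda>(x, t). D x t)"
        unfolding D_def split_beta by (intro continuous_on_sum) auto
    qed simp
    have d': "(?F has_derivative integral (cbox 0 1) (D x)) (at x)" if "x \<in> ?B" for x
      using d[OF that] unfolding at_within_open[OF that open_ball] .
    have int: "integral (cbox 0 1) (D x) (axis i 1) = integral {0..1} (\<lambda>s. s ^ Suc m * partial i f (?h s x))"
      if x: "x \<in> ?B" for x i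
    proof -
      have "continuous_on {0..1} (D x)"
        unfolding D_def by (intro continuous_on_sum continuous_on_scaleR continuous_on_const cont1[OF cp x])
      then have "D x integrable_on cbox 0 1" by (intro integrable_continuous) simp
      then have "integral (cbox 0 1) (D x) (axis i 1) = integral (cbox 0 1) (\<lambda>s. D x s (axis i 1))"
        by (rule blinfun_apply_integral)
      also have "(\<lambda>s. D x s (axis i 1)) = (\<lambda>s. s ^ Suc m * partial i f (?h s x))"
        by (auto simp: D axis_def if_distrib cong: if_cong)
      finally show ?thesis by simp
    qed
    have "C_k k ?B (partial i ?F)" for i
      by (rule C_k_cong[OF _ _ Suc.IH[OF smooth_partial[OF Suc.prems], of "Suc m" i]])
        (use partial_eq[OF d'] int in auto)
    moreover have "?F differentiable (at x)" if "x \<in> ?B" for x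
      using d'[OF that] by (rule differentiableI)
    ultimately show ?case by simp
  qed
  from this[OF assms, of _ 0] show ?thesis by (simp add: smooth_def)
qed

text \<open>The fundamental theorem of calculus along the segment from \<open>a\<close> to
  \<open>x\<close>; \<open>h i\<close> is the mean of \<open>partial i f\<close> over that
  segment.\<close>

lemma hadamard:
  fixes f :: "real^'n \<Rightarrow> real"
  assumes f: "smooth (ball a r) f" and "r > 0"
  obtains h where "\<And>i. smooth (ball a r) (h i)" "\<And>i. h i a = partial i f a"
    "\<And>x. x \<in> ball a r \<Longrightarrow> f x = f a + (\<Sum>i\<in>UNIV. (x $ i - a $ i) * h i x)"
proof -
  define h where "h i x = integral {0..1} (\<lambda>s. partial i f (a + s *\<^sub>R (x - a)))" for i x
  have "f x = f a + (\<Sum>i\<in>UNIV. (x $ i - a $ i) * h i x)" if x: "x \<in> ball a r" for x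
  proof -
    let ?h = "\<lambda>s. a + s *\<^sub>R (x - a)"
    let ?g = "\<lambda>s. \<Sum>i\<in>UNIV. (x $ i - a $ i) * partial i f (?h s)"
    have seg: "?h s \<in> ball a r" if "s \<in> {0..1}" for s
    proof -
      have "dist a (?h s) = s * dist a x"
        using that by (simp add: dist_norm norm_minus_commute)
      also have "\<dots> \<le> dist a x" using that by (simp add: mult_left_le_one_le)
      finally show ?thesis using x by simp
    qed
    have vd: "((\<lambda>s. f (?h s)) has_vector_derivative ?g s) (at s within {0..1})" if "s \<in> {0..1}" for s
    proof -
      have "(?h has_derivative (\<lambda>t. t *\<^sub>R (x - a))) (at s)"
        by (auto intro!: derivative_eq_intros)
      from has_derivative_compose[OF this has_derivative_partial[OF smooth_differentiable[OF f seg[OF that]]]]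
      have "((\<lambda>s. f (?h s)) has_derivative (\<lambda>t. \<Sum>i\<in>UNIV. partial i f (?h s) * (t *\<^sub>R (x - a)) $ i)) (at s)" .
      moreover have "(\<lambda>t. \<Sum>i\<in>UNIV. partial i f (?h s) * (t *\<^sub>R (x - a)) $ i) = (\<lambda>t. t *\<^sub>R ?g s)"
        by (auto simp: sum_distrib_left mult_ac)
      ultimately show ?thesis
        by (simp add: has_vector_derivative_def has_derivative_at_withinI)
    qed
    have "(?g has_integral f (?h 1) - f (?h 0)) {0..1}"
      by (rule fundamental_theorem_of_calculus[where f = "\<lambda>s. f (?h s)" and f' = ?g, OF _ vd])
        (simp, assumption)
    moreover have "(?g has_integral (\<Sum>i\<in>UNIV. (x $ i - a $ i) * h i x)) {0..1}"
    proof (rule has_integral_sum)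
      fix i :: 'n
      have "continuous_on {0..1} (\<lambda>s. partial i f (?h s))"
        by (rule continuous_on_compose2[OF smooth_continuous_on[OF smooth_partial[OF f]]])
          (use seg in \<open>auto intro!: continuous_intros\<close>)
      then have "((\<lambda>s. partial i f (?h s)) has_integral h i x) {0..1}"
        unfolding h_def by (intro integrable_integral integrable_continuous_real)
      then show "((\<lambda>s. (x $ i - a $ i) * partial i f (?h s)) has_integral (x $ i - a $ i) * h i x) {0..1}"
        by (rule has_integral_mult_right)
    qed simp
    ultimately have "f (?h 1) - f (?h 0) = (\<Sum>i\<in>UNIV. (x $ i - a $ i) * h i x)"
      by (rule has_integral_unique)
    then show ?thesis by simp
  qed
  moreover have "smooth (ball a r) (h i)" for i
    unfolding h_def by (rule smooth_integral_segment[OF smooth_partial[OF f]])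
  moreover have "h i a = partial i f a" for i
    by (simp add: h_def)
  ultimately show ?thesis using that by blast
qed

text \<open>In Hadamard's expansion each nonconstant summand is a product whose first factor
  vanishes at \<open>a\<close>, so the Leibniz rule leaves only the values \<open>h i a\<close>,
  which are the partial derivatives. \<open>L\<close> acts on total functions, and
  \<open>cong\<close> makes it see them only on the ball.\<close>

lemma point_derivation:
  fixes L :: "(real^'n \<Rightarrow> real) \<Rightarrow> real" and a :: "real^'n" and r :: real
  defines "B \<equiv> ball a r"
  assumes "r > 0" and f: "smooth B f"
    and cong: "\<And>f h. smooth B f \<Longrightarrow> smooth B h \<Longrightarrow> (\<And>x. x \<in> B \<Longrightarrow> f x = h x) \<Longrightarrow> L f = L h"
    and add: "\<And>f h. smooth B f \<Longrightarrow> smooth B h \<Longrightarrow> L (\<lambda>x. f x + h x) = L f + L h"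
    and scale: "\<And>c f. smooth B f \<Longrightarrow> L (\<lambda>x. c * f x) = c * L f"
    and leibniz: "\<And>f h. smooth B f \<Longrightarrow> smooth B h \<Longrightarrow> L (\<lambda>x. f x * h x) = L f * h a + f a * L h"
  shows "L f = (\<Sum>i\<in>UNIV. L (\<lambda>x. x $ i) * partial i f a)"
proof -
  have B: "open B" by (simp add: B_def)
  obtain h where h: "\<And>i. smooth B (h i)" "\<And>i. h i a = partial i f a"
    "\<And>x. x \<in> B \<Longrightarrow> f x = f a + (\<Sum>i\<in>UNIV. (x $ i - a $ i) * h i x)"
    using hadamard f \<open>r > 0\<close> unfolding B_def by blast
  note s = smooth_const smooth_component smooth_add[OF B] smooth_mult[OF B] smooth_diff[OF B] smooth_sum[OF B] h(1)
  have "L (\<lambda>x. 1) = 2 * L (\<lambda>x. 1)"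
    using leibniz[of "\<lambda>x. 1" "\<lambda>x. 1"] by (simp add: s)
  then have const: "L (\<lambda>x. c) = 0" for c
    using scale[of "\<lambda>x. 1" c] by (simp add: s)
  have sum: "L (\<lambda>x. \<Sum>i\<in>I. F i x) = (\<Sum>i\<in>I. L (F i))" if "\<And>i. smooth B (F i)" "finite I" for F and I :: "'n set"
    using that(2) by induction (simp_all add: const add s that(1))
  have coord: "L (\<lambda>x. x $ i - a $ i) = L (\<lambda>x. x $ i)" for i
    using add[of "\<lambda>x. x $ i" "\<lambda>x. - a $ i"] by (simp add: s const)
  have "L f = L (\<lambda>x. f a + (\<Sum>i\<in>UNIV. (x $ i - a $ i) * h i x))"
    by (rule cong) (use f h(3) in \<open>auto intro!: s\<close>)
  also have "\<dots> = (\<Sum>i\<in>UNIV. L (\<lambda>x. (x $ i - a $ i) * h i x))"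
    by (simp add: add sum const s)
  also have "\<dots> = (\<Sum>i\<in>UNIV. L (\<lambda>x. x $ i) * partial i f a)"
    by (simp add: leibniz s coord h(2))
  finally show ?thesis .
qed

declare One_nat_def [simp del]

section \<open>Superalgebras\<close>

lemma koszul_simps [simp]: "koszul 0 r = 1" "koszul p 0 = 1" "koszul 1 1 = -1"
  by (simp_all add: koszul_def)

locale super_alg =
  fixes A :: "'s superalgebra" (structure)
  assumes superalgebra: "superalgebra A"
begin

sublocale ring A
  using superalgebra by (simp add: superalgebra_def)

sublocale real: module real_ring A
  using superalgebra by (simp add: superalgebra_def)

lemma real_carrier [simp]: "c \<in> carrier real_ring"
  by (simp add: real_ring_def)

lemma part_submodule: "submodule (part A p) real_ring A"
  using superalgebra by (simp add: superalgebra_def)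

lemma part_carrier: "a \<in> part A p \<Longrightarrow> a \<in> carrier A"
  using real.submoduleE(1)[OF part_submodule] by blast

lemma part_add: "a \<in> part A p \<Longrightarrow> b \<in> part A p \<Longrightarrow> a \<oplus> b \<in> part A p"
  using part_submodule[of p] unfolding submodule_def subgroup_def by auto

lemma part_smult: "a \<in> part A p \<Longrightarrow> c \<odot> a \<in> part A p"
  using part_submodule[of p] unfolding submodule_def submodule_axioms_def by simp

lemma part_zero: "\<zero> \<in> part A p"
  using part_submodule[of p] unfolding submodule_def subgroup_def by auto

lemma part_one: "\<one> \<in> part A 0"
  using superalgebra unfolding superalgebra_def by blast

lemma part_mult: "a \<in> part A p \<Longrightarrow> b \<in> part A r \<Longrightarrow> a \<otimes> b \<in> part A (p + r)"
  using superalgebra unfolding superalgebra_def by blast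

lemma part_decomp: "a \<in> carrier A \<Longrightarrow> \<exists>b\<in>part A 0. \<exists>c\<in>part A 1. a = b \<oplus> c"
  using superalgebra unfolding superalgebra_def by blast

lemma part_Int: "part A 0 \<inter> part A 1 = {\<zero>}"
  using superalgebra unfolding superalgebra_def by blast

text \<open>As the difference of \<open>f\<close> and \<open>a\<close> the odd element
  \<open>b\<close> is also even, and the two parts meet only in zero.\<close>

lemma part_unique:
  assumes "f \<in> part A 0" "a \<in> part A 0" "b \<in> part A 1" "f = a \<oplus> b"
  shows "b = \<zero>"
proof -
  have c: "f \<in> carrier A" "a \<in> carrier A" "b \<in> carrier A" using assms part_carrier by blast+
  then have "b = f \<oplus> \<ominus> a" using assms(4) by (simp add: a_comm a_assoc r_neg2 r_neg1)
  moreover have "\<ominus> a \<in> part A 0" using real.submoduleE(3)[OF part_submodule] assms(2) by blast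
  ultimately have "b \<in> part A 0" using part_add assms(1) by simp
  then show ?thesis using assms(3) part_Int by blast
qed

lemma part_unique':
  assumes "f \<in> part A 1" "a \<in> part A 0" "b \<in> part A 1" "f = a \<oplus> b"
  shows "a = \<zero>"
proof -
  have c: "f \<in> carrier A" "a \<in> carrier A" "b \<in> carrier A" using assms part_carrier by blast+
  then have "a = f \<oplus> \<ominus> b" using assms(4) by (simp add: a_assoc r_neg)
  moreover have "\<ominus> b \<in> part A 1" using real.submoduleE(3)[OF part_submodule] assms(3) by blast
  ultimately have "a \<in> part A 1" using part_add assms(1) by simp
  then show ?thesis using assms(2) part_Int by blast
qed

text \<open>Turns additive inverses into scalar multiples, on which linear component maps can be
  evaluated.\<close>

lemma minus_smult: "a \<in> carrier A \<Longrightarrow> \<ominus> a = (-1) \<odot> a"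
proof -
  assume a: "a \<in> carrier A"
  have "(-1) \<odot> a \<oplus> a = (-1) \<odot> a \<oplus> 1 \<odot> a"
    using a real.smult_one by (simp add: real_ring_def)
  also have "\<dots> = ((-1) \<oplus>\<^bsub>real_ring\<^esub> 1) \<odot> a"
    using a real.smult_l_distr[of "-1" 1 a] by simp
  also have "\<dots> = \<zero>"
    using a real.smult_l_null by (simp add: real_ring_def)
  finally show ?thesis using a by (simp add: minus_equality)
qed

end

section \<open>Superfunctions of one odd variable\<close>

abbreviation SF :: "(real^'n::finite) set \<Rightarrow> 'n grassmann superalgebra" where
  "SF \<equiv> superfunctions 1"

lemma SF_carrier: "f \<in> carrier (SF W) \<longleftrightarrow>
    (\<forall>I x. I \<subseteq> {0} \<and> x \<in> W \<or> f I x = 0) \<and> (\<forall>I. smooth W (f I))"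
proof -
  have "{..<1} = {0::nat}" by auto
  then show ?thesis by (simp add: superfunctions_def Let_def)
qed

lemma SF_part: "f \<in> part (SF W) p \<longleftrightarrow> f \<in> carrier (SF W) \<and> (\<forall>I x. of_nat (card I) = p \<or> f I x = 0)"
  by (simp add: superfunctions_def Let_def)

lemma SF_even: "f \<in> part (SF W) 0 \<longleftrightarrow> f \<in> carrier (SF W) \<and> (\<forall>x. f {0} x = 0)"
proof
  assume f: "f \<in> carrier (SF W) \<and> (\<forall>x. f {0} x = 0)"
  have "of_nat (card I) = (0::bit) \<or> f I x = 0" for I x
  proof (cases "I = {} \<or> I = {0}")
    case False
    then show ?thesis using f unfolding SF_carrier by (metis subset_singletonD)
  qed (use f in auto)
  with f show "f \<in> part (SF W) 0" by (simp add: SF_part)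
qed (auto simp: SF_part dest!: spec[of _ "{0}"])

lemma SF_odd: "f \<in> part (SF W) 1 \<longleftrightarrow> f \<in> carrier (SF W) \<and> (\<forall>x. f {} x = 0)"
proof
  assume f: "f \<in> carrier (SF W) \<and> (\<forall>x. f {} x = 0)"
  have "of_nat (card I) = (1::bit) \<or> f I x = 0" for I x
  proof (cases "I = {} \<or> I = {0}")
    case False
    then show ?thesis using f unfolding SF_carrier by (metis subset_singletonD)
  qed (use f in auto)
  with f show "f \<in> part (SF W) 1" by (simp add: SF_part)
qed (auto simp: SF_part dest!: spec[of _ "{}"])

lemma SF_eqI:
  assumes "f \<in> carrier (SF W)" "h \<in> carrier (SF W)"
    and "\<And>x. x \<in> W \<Longrightarrow> f {} x = h {} x" "\<And>x. x \<in> W \<Longrightarrow> f {0} x = h {0} x"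
  shows "f = h"
proof (intro ext)
  fix I x
  show "f I x = h I x"
  proof (cases "x \<in> W \<and> I \<subseteq> {0}")
    case True
    then have "I = {} \<or> I = {0}" by blast
    then show ?thesis using assms(3,4)[of x] True by (elim disjE) simp_all
  next
    case False
    then have "f I x = 0" "h I x = 0" using assms(1,2) unfolding SF_carrier by blast+
    then show ?thesis by simp
  qed
qed

text \<open>The superfunction \<open>a + b \<xi>\<^sub>0\<close>, cut off outside \<open>W\<close>
  because the carrier demands coefficients extended by zero; \<open>a\<close> and \<open>b\<close>
  may be arbitrary there.\<close>

definition SF_make :: "(real^'n::finite) set \<Rightarrow> (real^'n \<Rightarrow> real) \<Rightarrow> (real^'n \<Rightarrow> real) \<Rightarrow> 'n grassmann" where
  "SF_make W a b = (\<lambda>I x. if x \<in> W then (if I = {} then a x else if I = {0} then b x else 0) else 0)"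

lemma SF_make_carrier:
  assumes "open W" "smooth W a" "smooth W b"
  shows "SF_make W a b \<in> carrier (SF W)"
proof -
  have "smooth W (SF_make W a b I)" for I
  proof -
    consider "I = {}" | "I = {0}" | "I \<noteq> {}" "I \<noteq> {0}" by blast
    then show ?thesis
    proof cases
      case 1
      then show ?thesis using assms(1,2) by (elim smooth_cong) (simp_all add: SF_make_def)
    next
      case 2
      then show ?thesis using assms(1,3) by (elim smooth_cong) (simp_all add: SF_make_def)
    next
      case 3
      then show ?thesis using smooth_const[of W 0] assms(1) by (elim smooth_cong[rotated]) (simp_all add: SF_make_def)
    qed
  qed
  then show ?thesis by (auto simp: SF_carrier SF_make_def)
qed

lemma SF_make_simps [simp]:
  "SF_make W a b {} x = (if x \<in> W then a x else 0)"
  "SF_make W a b {0} x = (if x \<in> W then b x else 0)"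
  by (auto simp: SF_make_def)

lemma grassmann_sign_empty [simp]: "grassmann_sign {} K = 1" "grassmann_sign J {} = 1"
  by (simp_all add: grassmann_sign_def)

text \<open>With one odd generator each sign that occurs has an empty index set and equals
  \<open>1\<close>, so the two coefficients multiply like dual numbers, without signs.\<close>

lemma SF_simps [simp]:
  "(f \<oplus>\<^bsub>SF W\<^esub> h) I x = f I x + h I x"
  "(c \<odot>\<^bsub>SF W\<^esub> f) I x = c * f I x"
  "\<zero>\<^bsub>SF W\<^esub> I x = 0"
  "\<one>\<^bsub>SF W\<^esub> I x = (if I = {} \<and> x \<in> W then 1 else 0)"
  "(f \<otimes>\<^bsub>SF W\<^esub> h) {} x = f {} x * h {} x"
  "(f \<otimes>\<^bsub>SF W\<^esub> h) {0} x = f {} x * h {0} x + f {0} x * h {} x"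
proof -
  have "Pow {0::nat} = {{}, {0}}" by auto
  then show "(f \<otimes>\<^bsub>SF W\<^esub> h) {0} x = f {} x * h {0} x + f {0} x * h {} x"
    by (simp add: superfunctions_def Let_def)
qed (simp_all add: superfunctions_def Let_def)

lemma SF_mult_outside:
  assumes "f \<in> carrier (SF W)" "h \<in> carrier (SF W)" "\<not> (I \<subseteq> {0} \<and> x \<in> W)"
  shows "(f \<otimes>\<^bsub>SF W\<^esub> h) I x = 0"
proof -
  have "f J x * h (I - J) x = 0" if "J \<subseteq> I" for J
  proof -
    have "\<not> (J \<subseteq> {0} \<and> x \<in> W) \<or> \<not> (I - J \<subseteq> {0} \<and> x \<in> W)" using assms(3) by blast
    then show ?thesis using assms(1,2) unfolding SF_carrier by (metis mult_eq_0_iff)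
  qed
  then show ?thesis
    by (auto simp: superfunctions_def Let_def mult.assoc intro!: sum.neutral)
qed

lemma SF_closed:
  assumes W: "open W" and f: "f \<in> carrier (SF W)" and h: "h \<in> carrier (SF W)"
  shows "f \<oplus>\<^bsub>SF W\<^esub> h \<in> carrier (SF W)" "c \<odot>\<^bsub>SF W\<^esub> f \<in> carrier (SF W)"
    "f \<otimes>\<^bsub>SF W\<^esub> h \<in> carrier (SF W)" "\<one>\<^bsub>SF W\<^esub> \<in> carrier (SF W)" "\<zero>\<^bsub>SF W\<^esub> \<in> carrier (SF W)"
proof -
  have s: "smooth W (f I)" "smooth W (h I)" for I using f h by (simp_all add: SF_carrier)
  \<comment> \<open>Every closure statement follows by recognizing the result as
    \<open>SF_make\<close> of two smooth functions: values are compared on \<open>W\<close>, and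
    elsewhere only vanishing is checked.\<close>
  have make: "u \<in> carrier (SF W)"
    if "\<And>I x. \<not> (I \<subseteq> {0} \<and> x \<in> W) \<Longrightarrow> u I x = 0" "smooth W a" "smooth W b"
      "\<And>x. x \<in> W \<Longrightarrow> u {} x = a x" "\<And>x. x \<in> W \<Longrightarrow> u {0} x = b x" for u a b
  proof -
    have "u I x = SF_make W a b I x" for I x
    proof (cases "I \<subseteq> {0} \<and> x \<in> W")
      case True
      then have "I = {} \<or> I = {0}" by blast
      then show ?thesis using True that(4,5) by (elim disjE) simp_all
    next
      case False
      then show ?thesis using that(1)[OF False] by (auto simp: SF_make_def)
    qed
    then have "u = SF_make W a b" by blast
    then show ?thesis using SF_make_carrier[OF W that(2,3)] by simp
  qed
  have out: "f I x = 0" "h I x = 0" if "\<not> (I \<subseteq> {0} \<and> x \<in> W)" for I x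
    using f h that unfolding SF_carrier by blast+
  show "f \<oplus>\<^bsub>SF W\<^esub> h \<in> carrier (SF W)"
    by (rule make[OF _ smooth_add[OF W s] smooth_add[OF W s]]) (simp_all add: out)
  show "c \<odot>\<^bsub>SF W\<^esub> f \<in> carrier (SF W)"
    by (rule make[OF _ smooth_cmult[OF W s(1)] smooth_cmult[OF W s(1)]]) (simp_all add: out)
  show "f \<otimes>\<^bsub>SF W\<^esub> h \<in> carrier (SF W)"
    by (rule make[OF _ smooth_mult[OF W s] smooth_add[OF W smooth_mult[OF W s] smooth_mult[OF W s]]])
      (simp_all add: SF_mult_outside[OF f h])
  show "\<zero>\<^bsub>SF W\<^esub> \<in> carrier (SF W)"
    by (rule make[OF _ smooth_const smooth_const]) simp_all
  show "\<one>\<^bsub>SF W\<^esub> \<in> carrier (SF W)"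
    by (rule make[OF _ smooth_const smooth_const]) auto
qed

lemma SF_res_carrier:
  assumes "f \<in> carrier (SF W)" "open W'" "W' \<subseteq> W"
  shows "(\<lambda>I x. if x \<in> W' then f I x else 0) \<in> carrier (SF W')"
proof -
  have f: "I \<subseteq> {0} \<or> f I x = 0" for I x
    using assms(1) unfolding SF_carrier by blast
  have "smooth W' (f I)" for I
    using assms(1,3) smooth_subset[of W "f I" W'] by (simp add: SF_carrier)
  then have "smooth W' (\<lambda>x. if x \<in> W' then f I x else 0)" for I
    by (rule smooth_cong[OF assms(2)]) simp
  then show ?thesis using f unfolding SF_carrier by simp
qed

section \<open>Sheaves of superalgebras\<close>

locale sheaf_space =
  fixes M :: "('a, 's) superspace"
  assumes presheaf: "presheaf M" and gluing: "gluing M"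
begin

abbreviation opn :: "'a set \<Rightarrow> bool" where "opn W \<equiv> openin (base M) W"
abbreviation Sec :: "'a set \<Rightarrow> 's set" where "Sec W \<equiv> carrier (sheaf M W)"

lemma alg: "opn W \<Longrightarrow> super_alg (sheaf M W)"
  unfolding super_alg_def using presheaf[unfolded presheaf_def, THEN conjunct1, rule_format] .

lemma res_hom:
  assumes "opn U" "opn W" "W \<subseteq> U"
  shows "superalgebra_hom (sheaf M U) (sheaf M W) (res M U W)"
proof -
  have "W \<in> opens M U" using assms by (simp add: opens_def)
  then show ?thesis
    using presheaf[unfolded presheaf_def, THEN conjunct2, THEN conjunct1, rule_format, OF assms(1)] by blast
qed

lemma res_closed: "opn U \<Longrightarrow> opn W \<Longrightarrow> W \<subseteq> U \<Longrightarrow> f \<in> Sec U \<Longrightarrow> res M U W f \<in> Sec W"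
  using res_hom[of U W] unfolding superalgebra_hom_def by (blast dest: ring_hom_closed)

lemma res_add:
  "opn U \<Longrightarrow> opn W \<Longrightarrow> W \<subseteq> U \<Longrightarrow> f \<in> Sec U \<Longrightarrow> h \<in> Sec U \<Longrightarrow>
    res M U W (f \<oplus>\<^bsub>sheaf M U\<^esub> h) = res M U W f \<oplus>\<^bsub>sheaf M W\<^esub> res M U W h"
  using res_hom[of U W] unfolding superalgebra_hom_def by (blast dest: ring_hom_add)

lemma res_mult:
  "opn U \<Longrightarrow> opn W \<Longrightarrow> W \<subseteq> U \<Longrightarrow> f \<in> Sec U \<Longrightarrow> h \<in> Sec U \<Longrightarrow>
    res M U W (f \<otimes>\<^bsub>sheaf M U\<^esub> h) = res M U W f \<otimes>\<^bsub>sheaf M W\<^esub> res M U W h"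
  using res_hom[of U W] unfolding superalgebra_hom_def by (blast dest: ring_hom_mult)

lemma res_smult:
  "opn U \<Longrightarrow> opn W \<Longrightarrow> W \<subseteq> U \<Longrightarrow> f \<in> Sec U \<Longrightarrow>
    res M U W (c \<odot>\<^bsub>sheaf M U\<^esub> f) = c \<odot>\<^bsub>sheaf M W\<^esub> res M U W f"
  using res_hom[of U W] unfolding superalgebra_hom_def by blast

lemma res_one: "opn U \<Longrightarrow> opn W \<Longrightarrow> W \<subseteq> U \<Longrightarrow> res M U W \<one>\<^bsub>sheaf M U\<^esub> = \<one>\<^bsub>sheaf M W\<^esub>"
  using res_hom[of U W] unfolding superalgebra_hom_def by (blast dest: ring_hom_one)

lemma res_part:
  "opn U \<Longrightarrow> opn W \<Longrightarrow> W \<subseteq> U \<Longrightarrow> f \<in> part (sheaf M U) p \<Longrightarrow> res M U W f \<in> part (sheaf M W) p"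
  using res_hom[of U W] unfolding superalgebra_hom_def by blast

lemma res_id: "opn U \<Longrightarrow> f \<in> Sec U \<Longrightarrow> res M U U f = f"
  using presheaf[unfolded presheaf_def, THEN conjunct2, THEN conjunct2, THEN conjunct1, rule_format] .

lemma res_trans:
  assumes "opn U" "opn W" "W \<subseteq> U" "opn W'" "W' \<subseteq> W" "f \<in> Sec U"
  shows "res M W W' (res M U W f) = res M U W' f"
proof -
  have "W \<in> opens M U" "W' \<in> opens M W" using assms by (simp_all add: opens_def)
  then show ?thesis
    using presheaf[unfolded presheaf_def, THEN conjunct2, THEN conjunct2, THEN conjunct2, rule_format,
        OF assms(1) _ _ assms(6)] by blast
qed

lemma glue:
  assumes "\<And>W. W \<in> \<C> \<Longrightarrow> opn W \<and> s W \<in> Sec W"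
    and "\<And>W W'. W \<in> \<C> \<Longrightarrow> W' \<in> \<C> \<Longrightarrow> res M W (W \<inter> W') (s W) = res M W' (W \<inter> W') (s W')"
  shows "\<exists>!f. f \<in> Sec (\<Union>\<C>) \<and> (\<forall>W\<in>\<C>. res M (\<Union>\<C>) W f = s W)"
  by (rule gluing[unfolded gluing_def, rule_format]) (use assms in simp_all)

text \<open>The restrictions of \<open>f\<close> form a compatible family, and both \<open>f\<close>
  and \<open>h\<close> are gluings of it.\<close>

lemma glue_unique:
  assumes "\<And>W. W \<in> \<C> \<Longrightarrow> opn W" "f \<in> Sec (\<Union>\<C>)" "h \<in> Sec (\<Union>\<C>)"
    and "\<And>W. W \<in> \<C> \<Longrightarrow> res M (\<Union>\<C>) W f = res M (\<Union>\<C>) W h"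
  shows "f = h"
proof -
  let ?s = "\<lambda>W. res M (\<Union>\<C>) W f"
  have U: "opn (\<Union>\<C>)" using assms(1) by (blast intro: openin_Union)
  have "\<exists>!f. f \<in> Sec (\<Union>\<C>) \<and> (\<forall>W\<in>\<C>. res M (\<Union>\<C>) W f = ?s W)"
  proof (rule glue)
    fix W assume W: "W \<in> \<C>"
    then show "opn W \<and> ?s W \<in> Sec W" using assms(1,2) U res_closed by blast
    fix W' assume W': "W' \<in> \<C>"
    have "opn (W \<inter> W')" using assms(1) W W' by blast
    then have "res M W (W \<inter> W') (?s W) = res M (\<Union>\<C>) (W \<inter> W') f" "res M W' (W \<inter> W') (?s W') = res M (\<Union>\<C>) (W \<inter> W') f"
      using res_trans[OF U assms(1)[OF W]] res_trans[OF U assms(1)[OF W']] W W' assms(2) by blast+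
    then show "res M W (W \<inter> W') (?s W) = res M W' (W \<inter> W') (?s W')" by simp
  qed
  then show ?thesis using assms(2-4) by metis
qed

end

section \<open>Charts\<close>

locale schart = sheaf_space M for M :: "('a, 's) superspace" +
  fixes U :: "'a set" and V :: "(real^'n::finite) set" and \<phi> :: "'a \<Rightarrow> real^'n"
    and \<Phi> :: "(real^'n) set \<Rightarrow> 'n grassmann \<Rightarrow> 's"
  assumes superchart: "superchart 1 M U V \<phi> \<Phi>"
begin

lemma U_open: "opn U" and V_open: "open V"
  and space_iso: "superspace_iso (open_sub M U) (superdomain 1 V) \<phi> \<Phi>"
  using superchart by (simp_all add: superchart_def)

lemma U_points: "U \<subseteq> points M"
  using U_open openin_subset by blast

lemma homeo: "homeomorphic_map (subtopology (base M) U) (top_of_set V) \<phi>"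
  using space_iso by (simp add: superspace_iso_def open_sub_def superdomain_def)

lemma topspace_U: "topspace (subtopology (base M) U) = U"
  using U_points by auto

lemma inj: "inj_on \<phi> U"
  using homeomorphic_imp_injective_map[OF homeo] unfolding topspace_U .

lemma image_U: "\<phi> ` U = V"
  using homeomorphic_imp_surjective_map[OF homeo] unfolding topspace_U by simp

lemma open_image:
  assumes "opn W" "W \<subseteq> U"
  shows "open (\<phi> ` W)"
proof -
  have "openin (subtopology (base M) U) W"
    using assms by (auto simp: openin_subtopology)
  then have "openin (top_of_set V) (\<phi> ` W)"
    using homeomorphic_map_openness_eq[OF homeo] by blast
  then show ?thesis using V_open openin_open_trans openin_open_eq by blast
qed

lemma opn_preimage:
  assumes "open W'"
  shows "opn {x \<in> U. \<phi> x \<in> W'}"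
proof -
  have "openin (subtopology (base M) U) {x \<in> topspace (subtopology (base M) U). \<phi> x \<in> V \<inter> W'}"
    using homeomorphic_imp_continuous_map[OF homeo] assms
    by (intro openin_continuous_map_preimage[of _ "top_of_set V"]) (auto simp: openin_open)
  then have "opn {x \<in> topspace (subtopology (base M) U). \<phi> x \<in> V \<inter> W'}"
    using openin_trans_full[OF _ U_open] by blast
  moreover have "{x \<in> topspace (subtopology (base M) U). \<phi> x \<in> V \<inter> W'} = {x \<in> U. \<phi> x \<in> W'}"
    using image_U unfolding topspace_U by blast
  ultimately show ?thesis by simp
qed

lemma preim_image:
  assumes "W \<subseteq> U"
  shows "preim (open_sub M U) \<phi> (\<phi> ` W) = W"
proof -
  have "points (open_sub M U) = U" using topspace_U by (simp add: open_sub_def)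
  then show ?thesis using assms inj unfolding preim_def inj_on_def by blast
qed

lemma image_openin:
  assumes "opn W" "W \<subseteq> U"
  shows "openin (base (superdomain 1 V)) (\<phi> ` W)"
  using open_image[OF assms] image_mono[OF assms(2), of \<phi>] image_U
  by (simp add: superdomain_def openin_open_eq[OF V_open])

lemma \<Phi>_iso:
  assumes "opn W" "W \<subseteq> U"
  shows "superalgebra_iso (SF (\<phi> ` W)) (sheaf M W) (\<Phi> (\<phi> ` W))"
proof -
  have "superalgebra_iso (sheaf (superdomain 1 V) (\<phi> ` W))
      (sheaf (open_sub M U) (preim (open_sub M U) \<phi> (\<phi> ` W))) (\<Phi> (\<phi> ` W))"
    using space_iso image_openin[OF assms] unfolding superspace_iso_def by blast
  then show ?thesis unfolding preim_image[OF assms(2)] by (simp add: superdomain_def open_sub_def)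
qed

lemma \<Phi>_bij: "opn W \<Longrightarrow> W \<subseteq> U \<Longrightarrow> bij_betw (\<Phi> (\<phi> ` W)) (carrier (SF (\<phi> ` W))) (Sec W)"
  and \<Phi>_hom: "opn W \<Longrightarrow> W \<subseteq> U \<Longrightarrow> superalgebra_hom (SF (\<phi> ` W)) (sheaf M W) (\<Phi> (\<phi> ` W))"
  using \<Phi>_iso unfolding superalgebra_iso_def by blast+

lemma \<Phi>_res:
  assumes "opn W" "W \<subseteq> U" "opn W'" "W' \<subseteq> W" "f \<in> carrier (SF (\<phi> ` W))"
  shows "\<Phi> (\<phi> ` W') (\<lambda>I x. if x \<in> \<phi> ` W' then f I x else 0) = res M W W' (\<Phi> (\<phi> ` W) f)"
proof -
  have W': "W' \<subseteq> U" using assms by blast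
  have "\<phi> ` W' \<in> opens (superdomain 1 V) (\<phi> ` W)"
    using image_openin[OF assms(3) W'] assms(4) by (auto simp: opens_def)
  then have "\<Phi> (\<phi> ` W') (res (superdomain 1 V) (\<phi> ` W) (\<phi> ` W') f) =
      res (open_sub M U) (preim (open_sub M U) \<phi> (\<phi> ` W)) (preim (open_sub M U) \<phi> (\<phi> ` W')) (\<Phi> (\<phi> ` W) f)"
    using space_iso image_openin[OF assms(1,2)] assms(5) unfolding superspace_iso_def superdomain_def
    by simp
  then show ?thesis
    unfolding preim_image[OF assms(2)] preim_image[OF W'] by (simp add: superdomain_def open_sub_def)
qed

text \<open>The coordinate expression of a section, formed with the same inverse of
  \<open>\<Phi>\<close> that occurs in \<open>chart_vf\<close>.\<close>

definition rep :: "'a set \<Rightarrow> 's \<Rightarrow> 'n grassmann" where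
  "rep W f = inv_into (carrier (SF (\<phi> ` W))) (\<Phi> (\<phi> ` W)) f"

lemma \<Phi>_closed: "opn W \<Longrightarrow> W \<subseteq> U \<Longrightarrow> u \<in> carrier (SF (\<phi> ` W)) \<Longrightarrow> \<Phi> (\<phi> ` W) u \<in> Sec W"
  using \<Phi>_bij bij_betwE by blast

lemma rep_closed: "opn W \<Longrightarrow> W \<subseteq> U \<Longrightarrow> f \<in> Sec W \<Longrightarrow> rep W f \<in> carrier (SF (\<phi> ` W))"
  unfolding rep_def using \<Phi>_bij bij_betw_imp_surj_on inv_into_into by metis

lemma \<Phi>_rep: "opn W \<Longrightarrow> W \<subseteq> U \<Longrightarrow> f \<in> Sec W \<Longrightarrow> \<Phi> (\<phi> ` W) (rep W f) = f"
  unfolding rep_def using \<Phi>_bij bij_betw_inv_into_right by metis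

lemma rep_\<Phi>: "opn W \<Longrightarrow> W \<subseteq> U \<Longrightarrow> u \<in> carrier (SF (\<phi> ` W)) \<Longrightarrow> rep W (\<Phi> (\<phi> ` W) u) = u"
  unfolding rep_def using \<Phi>_bij bij_betw_inv_into_left by metis

lemma rep_eqI: "opn W \<Longrightarrow> W \<subseteq> U \<Longrightarrow> u \<in> carrier (SF (\<phi> ` W)) \<Longrightarrow> \<Phi> (\<phi> ` W) u = f \<Longrightarrow> rep W f = u"
  using rep_\<Phi> by blast

lemma rep_ops:
  assumes W: "opn W" "W \<subseteq> U" and f: "f \<in> Sec W" and h: "h \<in> Sec W"
  shows "rep W (f \<oplus>\<^bsub>sheaf M W\<^esub> h) = rep W f \<oplus>\<^bsub>SF (\<phi> ` W)\<^esub> rep W h"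
    "rep W (f \<otimes>\<^bsub>sheaf M W\<^esub> h) = rep W f \<otimes>\<^bsub>SF (\<phi> ` W)\<^esub> rep W h"
    "rep W (c \<odot>\<^bsub>sheaf M W\<^esub> f) = c \<odot>\<^bsub>SF (\<phi> ` W)\<^esub> rep W f"
    "rep W (\<one>\<^bsub>sheaf M W\<^esub>) = \<one>\<^bsub>SF (\<phi> ` W)\<^esub>"
proof -
  note cl = SF_closed[OF open_image[OF W] rep_closed[OF W f] rep_closed[OF W h]]
  note rc = rep_closed[OF W f] rep_closed[OF W h]
  have hom: "\<Phi> (\<phi> ` W) \<in> ring_hom (SF (\<phi> ` W)) (sheaf M W)"
    "\<And>c u. u \<in> carrier (SF (\<phi> ` W)) \<Longrightarrow> \<Phi> (\<phi> ` W) (c \<odot>\<^bsub>SF (\<phi> ` W)\<^esub> u) = c \<odot>\<^bsub>sheaf M W\<^esub> \<Phi> (\<phi> ` W) u"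
    using \<Phi>_hom[OF W] unfolding superalgebra_hom_def by blast+
  show "rep W (f \<oplus>\<^bsub>sheaf M W\<^esub> h) = rep W f \<oplus>\<^bsub>SF (\<phi> ` W)\<^esub> rep W h"
    by (rule rep_eqI[OF W cl(1)]) (simp add: ring_hom_add[OF hom(1) rc] \<Phi>_rep[OF W] f h)
  show "rep W (f \<otimes>\<^bsub>sheaf M W\<^esub> h) = rep W f \<otimes>\<^bsub>SF (\<phi> ` W)\<^esub> rep W h"
    by (rule rep_eqI[OF W cl(3)]) (simp add: ring_hom_mult[OF hom(1) rc] \<Phi>_rep[OF W] f h)
  show "rep W (c \<odot>\<^bsub>sheaf M W\<^esub> f) = c \<odot>\<^bsub>SF (\<phi> ` W)\<^esub> rep W f"
    by (rule rep_eqI[OF W cl(2)]) (simp add: hom(2)[OF rc(1)] \<Phi>_rep[OF W] f)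
  show "rep W (\<one>\<^bsub>sheaf M W\<^esub>) = \<one>\<^bsub>SF (\<phi> ` W)\<^esub>"
    by (rule rep_eqI[OF W cl(4)]) (simp add: ring_hom_one[OF hom(1)])
qed

lemma rep_smult:
  "opn W \<Longrightarrow> W \<subseteq> U \<Longrightarrow> f \<in> Sec W \<Longrightarrow> rep W (c \<odot>\<^bsub>sheaf M W\<^esub> f) = c \<odot>\<^bsub>SF (\<phi> ` W)\<^esub> rep W f"
  using rep_ops(3)[of W f f] by simp

lemma rep_res:
  assumes "opn W" "W \<subseteq> U" "opn W'" "W' \<subseteq> W" "f \<in> Sec W"
  shows "rep W' (res M W W' f) = (\<lambda>I x. if x \<in> \<phi> ` W' then rep W f I x else 0)"
proof (rule rep_eqI)
  show "W' \<subseteq> U" using assms by blast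
  then show "(\<lambda>I x. if x \<in> \<phi> ` W' then rep W f I x else 0) \<in> carrier (SF (\<phi> ` W'))"
    using assms by (intro SF_res_carrier[OF rep_closed] open_image) auto
  show "\<Phi> (\<phi> ` W') (\<lambda>I x. if x \<in> \<phi> ` W' then rep W f I x else 0) = res M W W' f"
    using \<Phi>_res[OF assms(1-4) rep_closed] \<Phi>_rep assms by simp
qed fact

text \<open>\<open>superalgebra_iso\<close> asks only that \<open>\<Phi>\<close> map parts into
  parts. To get this for the inverse, the coordinate expression is split into its even and odd
  pieces; their images are the homogeneous pieces of \<open>f\<close>, and the one of the wrong
  parity is zero by uniqueness.\<close>

lemma rep_part:
  assumes W: "opn W" "W \<subseteq> U" and "f \<in> part (sheaf M W) p"
  shows "rep W f \<in> part (SF (\<phi> ` W)) p"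
proof -
  interpret A: super_alg "sheaf M W" using W alg by blast
  have f: "f \<in> Sec W" using assms(3) A.part_carrier by blast
  let ?u = "rep W f"
  have u: "?u \<in> carrier (SF (\<phi> ` W))" by (rule rep_closed[OF W f])
  have op: "open (\<phi> ` W)" by (rule open_image[OF W])
  define u0 where "u0 = SF_make (\<phi> ` W) (?u {}) (\<lambda>_. 0)"
  define u1 where "u1 = SF_make (\<phi> ` W) (\<lambda>_. 0) (?u {0})"
  have s: "smooth (\<phi> ` W) (?u I)" for I using u by (simp add: SF_carrier)
  have c: "u0 \<in> carrier (SF (\<phi> ` W))" "u1 \<in> carrier (SF (\<phi> ` W))"
    unfolding u0_def u1_def by (intro SF_make_carrier op s smooth_const)+
  have p: "u0 \<in> part (SF (\<phi> ` W)) 0" "u1 \<in> part (SF (\<phi> ` W)) 1"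
    unfolding SF_even SF_odd using c by (simp_all add: u0_def u1_def)
  let ?f0 = "\<Phi> (\<phi> ` W) u0" and ?f1 = "\<Phi> (\<phi> ` W) u1"
  have fp: "?f0 \<in> part (sheaf M W) 0" "?f1 \<in> part (sheaf M W) 1"
    using \<Phi>_hom[OF W] p unfolding superalgebra_hom_def by blast+
  have "u0 \<oplus>\<^bsub>SF (\<phi> ` W)\<^esub> u1 = ?u"
    by (rule SF_eqI[OF SF_closed(1)[OF op c] u]) (simp_all add: u0_def u1_def)
  moreover have "\<Phi> (\<phi> ` W) (u0 \<oplus>\<^bsub>SF (\<phi> ` W)\<^esub> u1) = ?f0 \<oplus>\<^bsub>sheaf M W\<^esub> ?f1"
    using \<Phi>_hom[OF W] ring_hom_add[OF _ c] unfolding superalgebra_hom_def by blast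
  ultimately have fe: "f = ?f0 \<oplus>\<^bsub>sheaf M W\<^esub> ?f1" using \<Phi>_rep[OF W f] by simp
  consider "p = 0" | "p = 1" by (cases p) auto
  then show ?thesis
  proof cases
    case 1
    then have "?f1 = \<zero>\<^bsub>sheaf M W\<^esub>"
      using A.part_unique[of f ?f0 ?f1] fp assms(3) fe by simp
    then have "f = ?f0" using fe fp A.part_carrier by simp
    then have "?u = u0" using rep_\<Phi>[OF W c(1)] by simp
    then show ?thesis using p 1 by simp
  next
    case 2
    then have "?f0 = \<zero>\<^bsub>sheaf M W\<^esub>"
      using A.part_unique'[of f ?f0 ?f1] fp assms(3) fe by simp
    then have "f = ?f1" using fe fp A.part_carrier by simp
    then have "?u = u1" using rep_\<Phi>[OF W c(2)] by simp
    then show ?thesis using p 2 by simp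
  qed
qed

end

section \<open>Components and values of sections at the points of a chart\<close>

context schart
begin

text \<open>The restriction to \<open>W \<inter> U\<close> comes first so that a section over a set
  not contained in the chart still has components at the points of the chart.\<close>

definition cc :: "nat set \<Rightarrow> 'a set \<Rightarrow> 's \<Rightarrow> 'a \<Rightarrow> real" where
  "cc I W f m = rep (W \<inter> U) (res M W (W \<inter> U) f) I (\<phi> m)"

lemma WU: "opn W \<Longrightarrow> opn (W \<inter> U)" "W \<inter> U \<subseteq> U" "W \<inter> U \<subseteq> W"
  using U_open by auto

lemma cc_ops:
  assumes "opn W" "m \<in> W" "m \<in> U" "f \<in> Sec W" "h \<in> Sec W"
  shows "cc I W (f \<oplus>\<^bsub>sheaf M W\<^esub> h) m = cc I W f m + cc I W h m"
    "cc {} W (f \<otimes>\<^bsub>sheaf M W\<^esub> h) m = cc {} W f m * cc {} W h m"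
    "cc {0} W (f \<otimes>\<^bsub>sheaf M W\<^esub> h) m = cc {} W f m * cc {0} W h m + cc {0} W f m * cc {} W h m"
  using res_closed[OF assms(1) WU(1)[OF assms(1)] WU(3)] assms
  by (simp_all add: cc_def res_add res_mult WU rep_ops)

lemma cc_smult:
  assumes "opn W" "m \<in> W" "m \<in> U" "f \<in> Sec W"
  shows "cc I W (c \<odot>\<^bsub>sheaf M W\<^esub> f) m = c * cc I W f m"
  using res_closed[OF assms(1) WU(1)[OF assms(1)] WU(3)] assms
  by (simp add: cc_def res_smult WU rep_smult)

lemma cc_one:
  assumes "opn W" "m \<in> W" "m \<in> U"
  shows "cc I W (\<one>\<^bsub>sheaf M W\<^esub>) m = (if I = {} then 1 else 0)"
proof -
  interpret A: super_alg "sheaf M (W \<inter> U)" using alg WU assms(1) by blast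
  show ?thesis
    using assms by (simp add: cc_def res_one WU rep_ops(4)[OF WU(1) WU(2) A.one_closed A.one_closed])
qed

lemma cc_res:
  assumes "opn W" "opn W'" "W' \<subseteq> W" "m \<in> W'" "m \<in> U" "f \<in> Sec W"
  shows "cc I W' (res M W W' f) m = cc I W f m"
proof -
  have s: "W' \<inter> U \<subseteq> W \<inter> U" "W' \<inter> U \<subseteq> W" using assms(3) by auto
  have "res M W' (W' \<inter> U) (res M W W' f) = res M (W \<inter> U) (W' \<inter> U) (res M W (W \<inter> U) f)"
    using res_trans[OF assms(1,2,3) WU(1)[OF assms(2)] WU(3) assms(6)]
      res_trans[OF assms(1) WU(1)[OF assms(1)] WU(3) WU(1)[OF assms(2)] s(1) assms(6)] by simp
  then show ?thesis
    using assms rep_res[OF WU(1)[OF assms(1)] WU(2) WU(1)[OF assms(2)] s(1)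
        res_closed[OF assms(1) WU(1)[OF assms(1)] WU(3) assms(6)]]
    by (simp add: cc_def)
qed

lemma cc_even:
  assumes "opn W" "m \<in> W" "m \<in> U" "f \<in> part (sheaf M W) 0"
  shows "cc {0} W f m = 0"
  using rep_part[OF WU(1) WU(2) res_part[OF assms(1) WU(1) WU(3) assms(4)]] assms(1)
  by (simp add: cc_def SF_even)

lemma cc_odd:
  assumes "opn W" "m \<in> W" "m \<in> U" "f \<in> part (sheaf M W) 1"
  shows "cc {} W f m = 0"
  using rep_part[OF WU(1) WU(2) res_part[OF assms(1) WU(1) WU(3) assms(4)]] assms(1)
  by (simp add: cc_def SF_odd)

lemma cc_rep: "opn W \<Longrightarrow> W \<subseteq> U \<Longrightarrow> f \<in> Sec W \<Longrightarrow> cc I W f m = rep W f I (\<phi> m)"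
  by (simp add: cc_def Int_absorb2 res_id)

lemma smooth_rep: "opn W \<Longrightarrow> W \<subseteq> U \<Longrightarrow> f \<in> Sec W \<Longrightarrow> smooth (\<phi> ` W) (rep W f I)"
  using rep_closed[of W f] by (simp add: SF_carrier)

lemma cc_eqI:
  assumes W: "opn W" "W \<subseteq> U" and f: "f \<in> Sec W" and h: "h \<in> Sec W"
    and "\<And>m. m \<in> W \<Longrightarrow> cc {} W f m = cc {} W h m" "\<And>m. m \<in> W \<Longrightarrow> cc {0} W f m = cc {0} W h m"
  shows "f = h"
proof -
  have "rep W f = rep W h"
    by (rule SF_eqI[OF rep_closed[OF W f] rep_closed[OF W h]]) (use assms cc_rep in auto)
  then show ?thesis using \<Phi>_rep[OF W] f h by metis
qed

definition sec :: "'a set \<Rightarrow> (real^'n \<Rightarrow> real) \<Rightarrow> (real^'n \<Rightarrow> real) \<Rightarrow> 's" where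
  "sec W a b = \<Phi> (\<phi> ` W) (SF_make (\<phi> ` W) a b)"

lemma sec_props:
  assumes W: "opn W" "W \<subseteq> U" and s: "smooth (\<phi> ` W) a" "smooth (\<phi> ` W) b"
  shows sec_closed: "sec W a b \<in> Sec W"
    and rep_sec: "rep W (sec W a b) = SF_make (\<phi> ` W) a b"
    and cc_sec: "m \<in> W \<Longrightarrow> cc {} W (sec W a b) m = a (\<phi> m)" "m \<in> W \<Longrightarrow> cc {0} W (sec W a b) m = b (\<phi> m)"
    and sec_even: "(\<And>x. x \<in> \<phi> ` W \<Longrightarrow> b x = 0) \<Longrightarrow> sec W a b \<in> part (sheaf M W) 0"
    and sec_odd: "(\<And>x. x \<in> \<phi> ` W \<Longrightarrow> a x = 0) \<Longrightarrow> sec W a b \<in> part (sheaf M W) 1"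
proof -
  have c: "SF_make (\<phi> ` W) a b \<in> carrier (SF (\<phi> ` W))"
    by (rule SF_make_carrier[OF open_image[OF W] s])
  show cl: "sec W a b \<in> Sec W" unfolding sec_def by (rule \<Phi>_closed[OF W c])
  show r: "rep W (sec W a b) = SF_make (\<phi> ` W) a b" unfolding sec_def by (rule rep_\<Phi>[OF W c])
  show "m \<in> W \<Longrightarrow> cc {} W (sec W a b) m = a (\<phi> m)" "m \<in> W \<Longrightarrow> cc {0} W (sec W a b) m = b (\<phi> m)"
    by (simp_all add: cc_rep[OF W cl] r)
  have hom: "\<Phi> (\<phi> ` W) ` part (SF (\<phi> ` W)) p \<subseteq> part (sheaf M W) p" for p
    using \<Phi>_hom[OF W] unfolding superalgebra_hom_def by blast
  show "sec W a b \<in> part (sheaf M W) 0" if "\<And>x. x \<in> \<phi> ` W \<Longrightarrow> b x = 0"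
  proof -
    have "SF_make (\<phi> ` W) a b \<in> part (SF (\<phi> ` W)) 0" using c that by (simp add: SF_even)
    then show ?thesis unfolding sec_def using hom by blast
  qed
  show "sec W a b \<in> part (sheaf M W) 1" if "\<And>x. x \<in> \<phi> ` W \<Longrightarrow> a x = 0"
  proof -
    have "SF_make (\<phi> ` W) a b \<in> part (SF (\<phi> ` W)) 1" using c that by (simp add: SF_odd)
    then show ?thesis unfolding sec_def using hom by blast
  qed
qed

lemma open_cc_ne:
  assumes W: "opn W" "W \<subseteq> U" and f: "f \<in> Sec W"
  shows "opn {m \<in> W. cc {} W f m \<noteq> c}"
proof -
  let ?O = "\<phi> ` W \<inter> rep W f {} -` (- {c})"
  have "open ?O"
    using smooth_continuous_on[OF smooth_rep[OF W f, of "{}"]] open_image[OF W]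
    by (intro continuous_open_preimage) auto
  from opn_preimage[OF this] have "opn (W \<inter> {m \<in> U. \<phi> m \<in> ?O})" using W(1) by blast
  moreover have "W \<inter> {m \<in> U. \<phi> m \<in> ?O} = {m \<in> W. cc {} W f m \<noteq> c}"
    using W(2) by (auto simp: cc_rep[OF W f])
  ultimately show ?thesis by simp
qed

lemma cc_Units:
  assumes W: "opn W" "W \<subseteq> U" and g: "g \<in> Sec W" and nz: "\<And>m. m \<in> W \<Longrightarrow> cc {} W g m \<noteq> 0"
  shows "g \<in> Units (sheaf M W)"
proof -
  let ?r0 = "rep W g {}" and ?r1 = "rep W g {0}"
  note op = open_image[OF W]
  have nz': "?r0 x \<noteq> 0" if "x \<in> \<phi> ` W" for x using that nz cc_rep[OF W g] by auto
  \<comment> \<open>The inverse of the dual number \<open>r0 + r1 \<tau>\<close> is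
    \<open>1 / r0 - (r1 / r0^2) \<tau>\<close>.\<close>
  have "smooth (\<phi> ` W) (\<lambda>x. 1 / ?r0 x)" "smooth (\<phi> ` W) (\<lambda>x. (-1) * (?r1 x / (?r0 x * ?r0 x)))"
    using nz' by (intro smooth_divide smooth_cmult smooth_mult smooth_const op smooth_rep[OF W g]; simp)+
  from sec_closed[OF W this] cc_sec[OF W this]
  obtain u where u: "u \<in> Sec W" "\<And>m. m \<in> W \<Longrightarrow> cc {} W u m = 1 / cc {} W g m"
    "\<And>m. m \<in> W \<Longrightarrow> cc {0} W u m = - (cc {0} W g m / (cc {} W g m * cc {} W g m))"
    unfolding cc_rep[OF W g] by auto
  interpret A: super_alg "sheaf M W" using alg W by blast
  have "u \<otimes>\<^bsub>sheaf M W\<^esub> g = \<one>\<^bsub>sheaf M W\<^esub>"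
    by (rule cc_eqI[OF W A.m_closed[OF u(1) g] A.one_closed])
      (use W(2) nz in \<open>auto simp: cc_ops[OF W(1) _ _ u(1) g] cc_one[OF W(1)] u field_simps\<close>)
  moreover have "g \<otimes>\<^bsub>sheaf M W\<^esub> u = \<one>\<^bsub>sheaf M W\<^esub>"
    by (rule cc_eqI[OF W A.m_closed[OF g u(1)] A.one_closed])
      (use W(2) nz in \<open>auto simp: cc_ops[OF W(1) _ _ g u(1)] cc_one[OF W(1)] u field_simps\<close>)
  ultimately show ?thesis using u(1) g unfolding Units_def by blast
qed

text \<open>If \<open>c\<close> is the first component of \<open>f\<close> at \<open>m\<close>, then
  \<open>f - c\<close> has first component zero there, as has every multiple of it, so no multiple
  is \<open>1\<close>. For any other \<open>c\<close> the first component of \<open>f - c\<close> is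
  nonzero near \<open>m\<close>, which makes it a unit on a neighbourhood. In particular the first
  component does not depend on the chart.\<close>

lemma val_cc:
  assumes W: "opn W" and m: "m \<in> W" "m \<in> U" and f: "f \<in> Sec W"
  shows "val M W f m = cc {} W f m"
proof -
  define P where "P c \<longleftrightarrow> (\<forall>W'\<in>opens M W. m \<in> W' \<longrightarrow>
    res M W W' f \<ominus>\<^bsub>sheaf M W'\<^esub> c \<odot>\<^bsub>sheaf M W'\<^esub> \<one>\<^bsub>sheaf M W'\<^esub> \<notin> Units (sheaf M W'))" for c
  have diff: "g = res M W W' f \<ominus>\<^bsub>sheaf M W'\<^esub> c \<odot>\<^bsub>sheaf M W'\<^esub> \<one>\<^bsub>sheaf M W'\<^esub> \<Longrightarrow>
      g \<in> Sec W' \<and> (\<forall>x\<in>W' \<inter> U. cc {} W' g x = cc {} W f x - c)"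
    if W': "opn W'" "W' \<subseteq> W" for W' c g
  proof -
    interpret A: super_alg "sheaf M W'" using alg W' by blast
    have r: "res M W W' f \<in> Sec W'" by (rule res_closed[OF W W' f])
    assume "g = res M W W' f \<ominus>\<^bsub>sheaf M W'\<^esub> c \<odot>\<^bsub>sheaf M W'\<^esub> \<one>\<^bsub>sheaf M W'\<^esub>"
    then have "g = res M W W' f \<oplus>\<^bsub>sheaf M W'\<^esub> (-1) \<odot>\<^bsub>sheaf M W'\<^esub> (c \<odot>\<^bsub>sheaf M W'\<^esub> \<one>\<^bsub>sheaf M W'\<^esub>)"
      by (simp add: a_minus_def A.minus_smult)
    then show ?thesis
      using r W' f W by (auto simp: cc_ops cc_smult cc_one cc_res)
  qed
  have "P c \<longleftrightarrow> c = cc {} W f m" for c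
  proof
    assume c: "c = cc {} W f m"
    show "P c" unfolding P_def
    proof (intro ballI impI notI)
      fix W' assume W': "W' \<in> opens M W" and mW': "m \<in> W'"
      have W'o: "opn W'" "W' \<subseteq> W" using W' by (auto simp: opens_def)
      let ?g = "res M W W' f \<ominus>\<^bsub>sheaf M W'\<^esub> c \<odot>\<^bsub>sheaf M W'\<^esub> \<one>\<^bsub>sheaf M W'\<^esub>"
      assume "?g \<in> Units (sheaf M W')"
      then obtain u where u: "u \<in> Sec W'" "u \<otimes>\<^bsub>sheaf M W'\<^esub> ?g = \<one>\<^bsub>sheaf M W'\<^esub>"
        unfolding Units_def by blast
      have g: "?g \<in> Sec W'" "cc {} W' ?g m = 0"
        using diff[OF W'o refl, of c] c m mW' by auto
      have "cc {} W' (u \<otimes>\<^bsub>sheaf M W'\<^esub> ?g) m = 0"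
        using cc_ops(2)[OF W'o(1) mW' m(2) u(1) g(1)] g(2) by simp
      moreover have "cc {} W' (u \<otimes>\<^bsub>sheaf M W'\<^esub> ?g) m = 1"
        unfolding u(2) using cc_one[OF W'o(1) mW' m(2)] by simp
      ultimately show False by simp
    qed
  next
    assume "P c"
    show "c = cc {} W f m"
    proof (rule ccontr)
      assume c: "c \<noteq> cc {} W f m"
      define W' where "W' = {x \<in> W \<inter> U. cc {} (W \<inter> U) (res M W (W \<inter> U) f) x \<noteq> c}"
      have W'o: "opn W'" unfolding W'_def
        by (rule open_cc_ne) (use WU W f res_closed in auto)
      have W's: "W' \<subseteq> W" "W' \<subseteq> U" by (auto simp: W'_def)
      have ne: "cc {} W f x \<noteq> c" if "x \<in> W'" for x
        using that cc_res[OF W WU(1)[OF W] WU(3) _ _ f] by (auto simp: W'_def)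
      have mW': "m \<in> W'"
        using m c cc_res[OF W WU(1)[OF W] WU(3) _ _ f] by (auto simp: W'_def)
      let ?g = "res M W W' f \<ominus>\<^bsub>sheaf M W'\<^esub> c \<odot>\<^bsub>sheaf M W'\<^esub> \<one>\<^bsub>sheaf M W'\<^esub>"
      have g: "?g \<in> Sec W'" "\<And>x. x \<in> W' \<Longrightarrow> cc {} W' ?g x \<noteq> 0"
        using diff[OF W'o W's(1) refl, of c] ne W's(2) by auto
      have "?g \<in> Units (sheaf M W')" by (rule cc_Units[OF W'o W's(2) g])
      then show False using \<open>P c\<close> W'o W's(1) mW' unfolding P_def opens_def by blast
    qed
  qed
  then have "(THE c. P c) = cc {} W f m" by simp
  then show ?thesis unfolding val_def P_def .
qed

end

text \<open>A section with vanishing values is \<open>t b\<close>, where \<open>t\<close> is the odd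
  coordinate of the first chart and \<open>b\<close> is the even section whose value is the second
  component of \<open>d\<close>. In the other chart \<open>t\<close> is still odd and has value
  zero, so the second component of \<open>t b\<close> is that of \<open>t\<close> times the value of
  \<open>b\<close>. A change of chart thus rescales second components and preserves their
  vanishing.\<close>

lemma cc_change:
  assumes A: "schart M U V \<phi> \<Phi>" and B: "schart M U' V' \<phi>' \<Phi>'"
    and W: "openin (base M) W" and m: "m \<in> W" "m \<in> U" "m \<in> U'" and d: "d \<in> carrier (sheaf M W)"
    and v: "\<And>x. x \<in> W \<Longrightarrow> val M W d x = 0"
    and z: "schart.cc M U \<phi> \<Phi> {0} W d m = 0"
  shows "schart.cc M U' \<phi>' \<Phi>' {0} W d m = 0"
proof -
  interpret A: schart M U V \<phi> \<Phi> by (rule A)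
  interpret B: schart M U' V' \<phi>' \<Phi>' by (rule B)
  let ?W = "W \<inter> U"
  let ?d = "res M W ?W d"
  have Wo: "A.opn ?W" "?W \<subseteq> U" "?W \<subseteq> W" using A.WU W by auto
  have dW: "?d \<in> A.Sec ?W" by (rule A.res_closed[OF W Wo(1,3) d])
  have mW: "m \<in> ?W" using m by blast
  let ?b = "A.sec ?W (A.rep ?W ?d {0}) (\<lambda>_. 0)" and ?t = "A.sec ?W (\<lambda>_. 0) (\<lambda>_. 1)"
  note sb = A.smooth_rep[OF Wo(1,2) dW, of "{0}"] smooth_const
  note b = A.sec_closed[OF Wo(1,2) sb] A.cc_sec[OF Wo(1,2) sb]
  note st = smooth_const[where c = 0] smooth_const[where c = 1]
  note t = A.sec_closed[OF Wo(1,2) st] A.cc_sec[OF Wo(1,2) st]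
  interpret R: super_alg "sheaf M ?W" using A.alg Wo by blast
  have dt: "?d = ?t \<otimes>\<^bsub>sheaf M ?W\<^esub> ?b"
  proof (rule A.cc_eqI[OF Wo(1,2) dW R.m_closed[OF t(1) b(1)]])
    fix x assume x: "x \<in> ?W"
    then have "A.cc {} ?W ?d x = val M W d x"
      using A.val_cc[OF W _ _ d] A.cc_res[OF W Wo(1,3) _ _ d] by auto
    then show "A.cc {} ?W ?d x = A.cc {} ?W (?t \<otimes>\<^bsub>sheaf M ?W\<^esub> ?b) x"
      using v x by (simp add: A.cc_ops[OF Wo(1) _ _ t(1) b(1)] t b)
    show "A.cc {0} ?W ?d x = A.cc {0} ?W (?t \<otimes>\<^bsub>sheaf M ?W\<^esub> ?b) x"
      using x by (simp add: A.cc_ops[OF Wo(1) _ _ t(1) b(1)] t b A.cc_rep[OF Wo(1,2) dW])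
  qed
  have "B.cc {} ?W ?b m = val M ?W ?b m" "A.cc {} ?W ?b m = val M ?W ?b m"
    using B.val_cc[OF Wo(1) mW m(3) b(1)] A.val_cc[OF Wo(1) mW m(2) b(1)] by auto
  moreover have "A.cc {} ?W ?b m = A.cc {0} W d m"
    using b(2)[OF mW] A.cc_rep[OF Wo(1,2) dW] A.cc_res[OF W Wo(1,3) mW m(2) d] by simp
  ultimately have bm: "B.cc {} ?W ?b m = 0" using z by simp
  have "?t \<in> part (sheaf M ?W) 1" by (rule A.sec_odd[OF Wo(1,2) st]) simp
  then have tm: "B.cc {} ?W ?t m = 0" by (rule B.cc_odd[OF Wo(1) mW m(3)])
  have "B.cc {0} W d m = B.cc {0} ?W ?d m"
    using B.cc_res[OF W Wo(1,3) mW m(3) d] by simp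
  also have "\<dots> = B.cc {0} ?W (?t \<otimes>\<^bsub>sheaf M ?W\<^esub> ?b) m" using dt by (rule arg_cong)
  also have "\<dots> = 0" unfolding B.cc_ops(3)[OF Wo(1) mW m(3) t(1) b(1)] bm tm by simp
  finally show ?thesis .
qed

section \<open>Sections as functions with values in the dual numbers\<close>

text \<open>As there is only one odd dimension, a section is determined by its two components at every point,
  and these are multiplied like dual numbers. The second component depends on the choice of a chart at
  every point.\<close>

context sheaf_space
begin

lemma Sec_closed [simp]:
  assumes "opn W"
  shows "f \<in> Sec W \<Longrightarrow> h \<in> Sec W \<Longrightarrow> f \<oplus>\<^bsub>sheaf M W\<^esub> h \<in> Sec W"
    "f \<in> Sec W \<Longrightarrow> h \<in> Sec W \<Longrightarrow> f \<otimes>\<^bsub>sheaf M W\<^esub> h \<in> Sec W"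
    "f \<in> Sec W \<Longrightarrow> c \<odot>\<^bsub>sheaf M W\<^esub> f \<in> Sec W"
    "\<one>\<^bsub>sheaf M W\<^esub> \<in> Sec W" "\<zero>\<^bsub>sheaf M W\<^esub> \<in> Sec W"
    "f \<in> part (sheaf M W) p \<Longrightarrow> f \<in> Sec W"
proof -
  interpret super_alg "sheaf M W" by (rule alg[OF assms])
  show "f \<in> Sec W \<Longrightarrow> h \<in> Sec W \<Longrightarrow> f \<oplus>\<^bsub>sheaf M W\<^esub> h \<in> Sec W"
    "f \<in> Sec W \<Longrightarrow> h \<in> Sec W \<Longrightarrow> f \<otimes>\<^bsub>sheaf M W\<^esub> h \<in> Sec W"
    "f \<in> Sec W \<Longrightarrow> c \<odot>\<^bsub>sheaf M W\<^esub> f \<in> Sec W"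
    "\<one>\<^bsub>sheaf M W\<^esub> \<in> Sec W" "\<zero>\<^bsub>sheaf M W\<^esub> \<in> Sec W"
    "f \<in> part (sheaf M W) p \<Longrightarrow> f \<in> Sec W"
    by (simp_all add: part_carrier)
qed

lemma part_decompE:
  assumes "opn W" "f \<in> Sec W"
  obtains a b where "a \<in> part (sheaf M W) 0" "b \<in> part (sheaf M W) 1" "f = a \<oplus>\<^bsub>sheaf M W\<^esub> b"
  using super_alg.part_decomp[OF alg[OF assms(1)] assms(2)] by blast

lemmas part_ops = super_alg.part_add[OF alg] super_alg.part_smult[OF alg] super_alg.part_zero[OF alg]
  super_alg.part_one[OF alg] super_alg.part_mult[OF alg]

end

locale smfd = sheaf_space M for M :: "('a, 's) superspace" +
  fixes N :: "'n::finite itself"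
  assumes Hausdorff: "Hausdorff_space (base M)" and second_countable: "Defs.second_countable (base M)"
    and charts: "m \<in> points M \<Longrightarrow> \<exists>U (V :: (real^'n) set) \<phi> \<Phi>. m \<in> U \<and> superchart 1 M U V \<phi> \<Phi>"
begin

definition chart_at :: "'a \<Rightarrow> 'a set \<times> (real^'n) set \<times> ('a \<Rightarrow> real^'n) \<times> ((real^'n) set \<Rightarrow> 'n grassmann \<Rightarrow> 's)" where
  "chart_at m = (SOME (U, V, \<phi>, \<Phi>). m \<in> U \<and> schart M U V \<phi> \<Phi>)"

definition ev :: "nat set \<Rightarrow> 'a set \<Rightarrow> 's \<Rightarrow> 'a \<Rightarrow> real" where
  "ev I W f m = (case chart_at m of (U, V, \<phi>, \<Phi>) \<Rightarrow> schart.cc M U \<phi> \<Phi> I W f m)"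

lemma ev_chart:
  assumes "m \<in> points M"
  obtains U and V :: "(real^'n) set" and \<phi> \<Phi> where "schart M U V \<phi> \<Phi>" "m \<in> U"
    "\<And>I W f. ev I W f m = schart.cc M U \<phi> \<Phi> I W f m"
proof -
  obtain U V \<phi> \<Phi> where c: "chart_at m = (U, V, \<phi>, \<Phi>)" by (cases "chart_at m")
  have "\<exists>x. case x of (U, V :: (real^'n) set, \<phi>, \<Phi>) \<Rightarrow> m \<in> U \<and> schart M U V \<phi> \<Phi>"
    using charts[OF assms] sheaf_space_axioms by (auto simp: schart_def schart_axioms_def)
  from someI_ex[OF this] c have "m \<in> U \<and> schart M U V \<phi> \<Phi>"
    unfolding chart_at_def[symmetric] by simp
  then show ?thesis using that[of U V \<phi> \<Phi>] c by (simp add: ev_def)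
qed

lemma opn_points: "opn W \<Longrightarrow> m \<in> W \<Longrightarrow> m \<in> points M"
  using openin_subset by blast

lemma ev_ops:
  assumes W: "opn W" "m \<in> W" and f: "f \<in> Sec W" and h: "h \<in> Sec W"
  shows ev_add: "ev I W (f \<oplus>\<^bsub>sheaf M W\<^esub> h) m = ev I W f m + ev I W h m"
    and ev_mult0: "ev {} W (f \<otimes>\<^bsub>sheaf M W\<^esub> h) m = ev {} W f m * ev {} W h m"
    and ev_mult1: "ev {0} W (f \<otimes>\<^bsub>sheaf M W\<^esub> h) m = ev {} W f m * ev {0} W h m + ev {0} W f m * ev {} W h m"
proof -
  obtain U and V :: "(real^'n) set" and \<phi> \<Phi> where c: "schart M U V \<phi> \<Phi>" "m \<in> U"
    "\<And>I W f. ev I W f m = schart.cc M U \<phi> \<Phi> I W f m" by (rule ev_chart[OF opn_points[OF W]]) (rule that)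
  interpret schart M U V \<phi> \<Phi> by (rule c(1))
  show "ev I W (f \<oplus>\<^bsub>sheaf M W\<^esub> h) m = ev I W f m + ev I W h m"
    "ev {} W (f \<otimes>\<^bsub>sheaf M W\<^esub> h) m = ev {} W f m * ev {} W h m"
    "ev {0} W (f \<otimes>\<^bsub>sheaf M W\<^esub> h) m = ev {} W f m * ev {0} W h m + ev {0} W f m * ev {} W h m"
    unfolding c(3) by (rule cc_ops[OF W c(2) f h])+
qed

lemma ev_val: "opn W \<Longrightarrow> m \<in> W \<Longrightarrow> f \<in> Sec W \<Longrightarrow> val M W f m = ev {} W f m"
  and ev_smult: "opn W \<Longrightarrow> m \<in> W \<Longrightarrow> f \<in> Sec W \<Longrightarrow> ev I W (c \<odot>\<^bsub>sheaf M W\<^esub> f) m = c * ev I W f m"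
  and ev_one: "opn W \<Longrightarrow> m \<in> W \<Longrightarrow> ev I W \<one>\<^bsub>sheaf M W\<^esub> m = (if I = {} then 1 else 0)"
  and ev_res: "opn W \<Longrightarrow> opn W' \<Longrightarrow> W' \<subseteq> W \<Longrightarrow> m \<in> W' \<Longrightarrow> f \<in> Sec W \<Longrightarrow> ev I W' (res M W W' f) m = ev I W f m"
  and ev_even: "opn W \<Longrightarrow> m \<in> W \<Longrightarrow> f \<in> part (sheaf M W) 0 \<Longrightarrow> ev {0} W f m = 0"
  and ev_odd: "opn W \<Longrightarrow> m \<in> W \<Longrightarrow> f \<in> part (sheaf M W) 1 \<Longrightarrow> ev {} W f m = 0"
  by (metis ev_chart opn_points schart.val_cc, metis ev_chart opn_points schart.cc_smult,
    metis ev_chart opn_points schart.cc_one, metis ev_chart opn_points schart.cc_res,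
    metis ev_chart opn_points schart.cc_even, metis ev_chart opn_points schart.cc_odd)

lemma ev_zero:
  assumes "opn W" "m \<in> W"
  shows "ev {} W \<zero>\<^bsub>sheaf M W\<^esub> m = 0" "ev {0} W \<zero>\<^bsub>sheaf M W\<^esub> m = 0"
  using assms by (simp_all add: ev_even ev_odd part_ops)

lemmas ev_simps = ev_add ev_mult0 ev_mult1 ev_smult ev_one ev_res ev_zero

text \<open>At different points \<open>ev {0}\<close> refers to different charts. Since the values
  vanish on all of \<open>W\<close>, \<open>cc_change\<close> transports the vanishing of second
  components to one chart around a given point, where it yields zero; the sheaf property does the
  rest.\<close>

lemma ev_eq_zeroI:
  assumes W: "opn W" and d: "d \<in> Sec W"
    and z: "\<And>m. m \<in> W \<Longrightarrow> ev {} W d m = 0" "\<And>m. m \<in> W \<Longrightarrow> ev {0} W d m = 0"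
  shows "d = \<zero>\<^bsub>sheaf M W\<^esub>"
proof -
  have v: "val M W d m = 0" if "m \<in> W" for m
    using ev_val[OF W that d] z(1)[OF that] by simp
  have loc: "\<exists>U. opn U \<and> m \<in> U \<and> U \<subseteq> W \<and> res M W U d = res M W U \<zero>\<^bsub>sheaf M W\<^esub>" if m: "m \<in> W" for m
  proof -
    obtain U and V :: "(real^'n) set" and \<phi> \<Phi> where c: "schart M U V \<phi> \<Phi>" "m \<in> U"
      by (rule ev_chart[OF opn_points[OF W m]]) (rule that)
    interpret schart M U V \<phi> \<Phi> by (rule c(1))
    let ?O = "W \<inter> U"
    have O: "opn ?O" "?O \<subseteq> U" "?O \<subseteq> W" using WU W by auto
    have zero: "\<zero>\<^bsub>sheaf M W\<^esub> \<in> part (sheaf M W) p" for p by (rule part_ops(3)[OF W])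
    have "res M W ?O d = res M W ?O \<zero>\<^bsub>sheaf M W\<^esub>"
    proof (rule cc_eqI[OF O(1,2)])
      fix x assume x: "x \<in> ?O"
      then have xW: "x \<in> W" "x \<in> U" by auto
      obtain U' and V' :: "(real^'n) set" and \<phi>' \<Phi>' where c': "schart M U' V' \<phi>' \<Phi>'" "x \<in> U'"
        "\<And>I W f. ev I W f x = schart.cc M U' \<phi>' \<Phi>' I W f x" by (rule ev_chart[OF opn_points[OF W xW(1)]]) (rule that)
      show "cc {} ?O (res M W ?O d) x = cc {} ?O (res M W ?O \<zero>\<^bsub>sheaf M W\<^esub>) x"
        using cc_res[OF W O(1,3) x xW(2)] d v[OF xW(1)] val_cc[OF W xW d] cc_odd[OF W xW zero] W by simp
      have "cc {0} W d x = 0"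
        by (rule cc_change[OF c'(1) c(1) W xW(1) c'(2) xW(2) d v])
          (use z(2)[OF xW(1)] c'(3) in auto)
      then show "cc {0} ?O (res M W ?O d) x = cc {0} ?O (res M W ?O \<zero>\<^bsub>sheaf M W\<^esub>) x"
        using cc_res[OF W O(1,3) x xW(2)] d cc_even[OF W xW zero] W by simp
    qed (use res_closed[OF W O(1,3)] d W in auto)
    then show ?thesis using O c(2) m by blast
  qed
  let ?C = "{U. opn U \<and> U \<subseteq> W \<and> res M W U d = res M W U \<zero>\<^bsub>sheaf M W\<^esub>}"
  have un: "\<Union>?C = W" using loc by blast
  show ?thesis
    by (rule glue_unique[of ?C, unfolded un]) (use d W in auto)
qed

text \<open>Reduced to the difference, because between charts only the vanishing of second
  components can be compared.\<close>

lemma ev_eqI: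
  assumes W: "opn W" and f: "f \<in> Sec W" and h: "h \<in> Sec W"
    and e: "\<And>m. m \<in> W \<Longrightarrow> ev {} W f m = ev {} W h m" "\<And>m. m \<in> W \<Longrightarrow> ev {0} W f m = ev {0} W h m"
  shows "f = h"
proof -
  interpret super_alg "sheaf M W" by (rule alg[OF W])
  have d: "f \<oplus>\<^bsub>sheaf M W\<^esub> (-1) \<odot>\<^bsub>sheaf M W\<^esub> h = \<zero>\<^bsub>sheaf M W\<^esub>"
    using W f h e by (intro ev_eq_zeroI) (simp_all add: ev_simps)
  then have "f \<oplus>\<^bsub>sheaf M W\<^esub> \<ominus>\<^bsub>sheaf M W\<^esub> h = \<zero>\<^bsub>sheaf M W\<^esub>" using minus_smult[OF h] by simp
  from minus_equality[OF this] show ?thesis using f h by simp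
qed

text \<open>Makes parity a pointwise condition, which is how glued or extended sections get a
  parity.\<close>

lemma even_iff:
  assumes W: "opn W" and f: "f \<in> Sec W"
  shows "f \<in> part (sheaf M W) 0 \<longleftrightarrow> (\<forall>m\<in>W. ev {0} W f m = 0)"
proof
  assume z: "\<forall>m\<in>W. ev {0} W f m = 0"
  obtain a b where ab: "a \<in> part (sheaf M W) 0" "b \<in> part (sheaf M W) 1" "f = a \<oplus>\<^bsub>sheaf M W\<^esub> b"
    using part_decompE[OF W f] .
  have "f = a"
    by (rule ev_eqI[OF W f]) (use W ab z in \<open>auto simp: ev_simps ev_even ev_odd\<close>)
  then show "f \<in> part (sheaf M W) 0" using ab by simp
qed (use ev_even[OF W] in blast)

lemma odd_iff:
  assumes W: "opn W" and f: "f \<in> Sec W"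
  shows "f \<in> part (sheaf M W) 1 \<longleftrightarrow> (\<forall>m\<in>W. ev {} W f m = 0)"
proof
  assume z: "\<forall>m\<in>W. ev {} W f m = 0"
  obtain a b where ab: "a \<in> part (sheaf M W) 0" "b \<in> part (sheaf M W) 1" "f = a \<oplus>\<^bsub>sheaf M W\<^esub> b"
    using part_decompE[OF W f] .
  have "f = b"
    by (rule ev_eqI[OF W f]) (use W ab z in \<open>auto simp: ev_simps ev_even ev_odd\<close>)
  then show "f \<in> part (sheaf M W) 1" using ab by simp
qed (use ev_odd[OF W] in blast)

end

section \<open>Vector fields\<close>

declare add_bit_eq_xor [simp del]

context sheaf_space
begin

lemma opens_iff: "W \<in> opens M U \<longleftrightarrow> opn W \<and> W \<subseteq> U"
  by (simp add: opens_def)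

lemma on_opens_eq [simp]: "opn W \<Longrightarrow> W \<subseteq> U \<Longrightarrow> f \<in> Sec W \<Longrightarrow> on_opens M U F W f = F W f"
  by (simp add: on_opens_def opens_iff)

lemma on_opens_idem [simp]: "on_opens M U (on_opens M U F) = on_opens M U F"
  unfolding on_opens_def by (intro ext) simp

lemma vf_partD:
  assumes "X \<in> vf_part M U p"
  shows vf_part_on: "on_opens M U X = X"
    and vf_part_closed: "\<And>W f. opn W \<Longrightarrow> W \<subseteq> U \<Longrightarrow> f \<in> Sec W \<Longrightarrow> X W f \<in> Sec W"
    and vf_part_add: "\<And>W f h. opn W \<Longrightarrow> W \<subseteq> U \<Longrightarrow> f \<in> Sec W \<Longrightarrow> h \<in> Sec W \<Longrightarrow>
      X W (f \<oplus>\<^bsub>sheaf M W\<^esub> h) = X W f \<oplus>\<^bsub>sheaf M W\<^esub> X W h"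
    and vf_part_smult: "\<And>W f c. opn W \<Longrightarrow> W \<subseteq> U \<Longrightarrow> f \<in> Sec W \<Longrightarrow>
      X W (c \<odot>\<^bsub>sheaf M W\<^esub> f) = c \<odot>\<^bsub>sheaf M W\<^esub> X W f"
    and vf_part_part: "\<And>W f r. opn W \<Longrightarrow> W \<subseteq> U \<Longrightarrow> f \<in> part (sheaf M W) r \<Longrightarrow> X W f \<in> part (sheaf M W) (p + r)"
    and vf_part_leibniz: "\<And>W f h r. opn W \<Longrightarrow> W \<subseteq> U \<Longrightarrow> f \<in> part (sheaf M W) r \<Longrightarrow> h \<in> Sec W \<Longrightarrow>
      X W (f \<otimes>\<^bsub>sheaf M W\<^esub> h) = X W f \<otimes>\<^bsub>sheaf M W\<^esub> h \<oplus>\<^bsub>sheaf M W\<^esub>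
        koszul p r \<odot>\<^bsub>sheaf M W\<^esub> (f \<otimes>\<^bsub>sheaf M W\<^esub> X W h)"
    and vf_part_res: "\<And>W W' f. opn W \<Longrightarrow> W \<subseteq> U \<Longrightarrow> opn W' \<Longrightarrow> W' \<subseteq> W \<Longrightarrow> f \<in> Sec W \<Longrightarrow>
      X W' (res M W W' f) = res M W W' (X W f)"
proof -
  have X: "on_opens M U X = X" and XW: "\<And>W. W \<in> opens M U \<Longrightarrow>
     X W \<in> Sec W \<rightarrow> Sec W \<and>
     (\<forall>f\<in>Sec W. \<forall>h\<in>Sec W. X W (f \<oplus>\<^bsub>sheaf M W\<^esub> h) = X W f \<oplus>\<^bsub>sheaf M W\<^esub> X W h) \<and>
     (\<forall>c. \<forall>f\<in>Sec W. X W (c \<odot>\<^bsub>sheaf M W\<^esub> f) = c \<odot>\<^bsub>sheaf M W\<^esub> X W f) \<and>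
     (\<forall>r. X W ` part (sheaf M W) r \<subseteq> part (sheaf M W) (p + r)) \<and>
     (\<forall>r. \<forall>f\<in>part (sheaf M W) r. \<forall>h\<in>Sec W. X W (f \<otimes>\<^bsub>sheaf M W\<^esub> h) =
       X W f \<otimes>\<^bsub>sheaf M W\<^esub> h \<oplus>\<^bsub>sheaf M W\<^esub> koszul p r \<odot>\<^bsub>sheaf M W\<^esub> (f \<otimes>\<^bsub>sheaf M W\<^esub> X W h)) \<and>
     (\<forall>W'\<in>opens M W. \<forall>f\<in>Sec W. X W' (res M W W' f) = res M W W' (X W f))"
    using assms unfolding vf_part_def by simp_all
  show "on_opens M U X = X" by (rule X)
  fix W assume "opn W" "W \<subseteq> U"
  then have "W \<in> opens M U" by (simp add: opens_iff)
  note XW = XW[OF this]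
  show "\<And>f. f \<in> Sec W \<Longrightarrow> X W f \<in> Sec W" using XW[THEN conjunct1] by blast
  show "\<And>f h. f \<in> Sec W \<Longrightarrow> h \<in> Sec W \<Longrightarrow> X W (f \<oplus>\<^bsub>sheaf M W\<^esub> h) = X W f \<oplus>\<^bsub>sheaf M W\<^esub> X W h"
    using XW[THEN conjunct2, THEN conjunct1] by blast
  show "\<And>f c. f \<in> Sec W \<Longrightarrow> X W (c \<odot>\<^bsub>sheaf M W\<^esub> f) = c \<odot>\<^bsub>sheaf M W\<^esub> X W f"
    using XW[THEN conjunct2, THEN conjunct2, THEN conjunct1] by blast
  show "\<And>f r. f \<in> part (sheaf M W) r \<Longrightarrow> X W f \<in> part (sheaf M W) (p + r)"
    using XW[THEN conjunct2, THEN conjunct2, THEN conjunct2, THEN conjunct1] by blast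
  show "\<And>f h r. f \<in> part (sheaf M W) r \<Longrightarrow> h \<in> Sec W \<Longrightarrow>
      X W (f \<otimes>\<^bsub>sheaf M W\<^esub> h) = X W f \<otimes>\<^bsub>sheaf M W\<^esub> h \<oplus>\<^bsub>sheaf M W\<^esub>
        koszul p r \<odot>\<^bsub>sheaf M W\<^esub> (f \<otimes>\<^bsub>sheaf M W\<^esub> X W h)"
    using XW[THEN conjunct2, THEN conjunct2, THEN conjunct2, THEN conjunct2, THEN conjunct1] by blast
  show "\<And>W' f. opn W' \<Longrightarrow> W' \<subseteq> W \<Longrightarrow> f \<in> Sec W \<Longrightarrow> X W' (res M W W' f) = res M W W' (X W f)"
    using XW[THEN conjunct2, THEN conjunct2, THEN conjunct2, THEN conjunct2, THEN conjunct2]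
    unfolding opens_iff Ball_def by blast
qed

lemma vf_partI:
  assumes "on_opens M U X = X"
    and "\<And>W f. opn W \<Longrightarrow> W \<subseteq> U \<Longrightarrow> f \<in> Sec W \<Longrightarrow> X W f \<in> Sec W"
    and "\<And>W f h. opn W \<Longrightarrow> W \<subseteq> U \<Longrightarrow> f \<in> Sec W \<Longrightarrow> h \<in> Sec W \<Longrightarrow>
      X W (f \<oplus>\<^bsub>sheaf M W\<^esub> h) = X W f \<oplus>\<^bsub>sheaf M W\<^esub> X W h"
    and "\<And>W f c. opn W \<Longrightarrow> W \<subseteq> U \<Longrightarrow> f \<in> Sec W \<Longrightarrow>
      X W (c \<odot>\<^bsub>sheaf M W\<^esub> f) = c \<odot>\<^bsub>sheaf M W\<^esub> X W f"
    and "\<And>W f r. opn W \<Longrightarrow> W \<subseteq> U \<Longrightarrow> f \<in> part (sheaf M W) r \<Longrightarrow> X W f \<in> part (sheaf M W) (p + r)"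
    and "\<And>W f h r. opn W \<Longrightarrow> W \<subseteq> U \<Longrightarrow> f \<in> part (sheaf M W) r \<Longrightarrow> h \<in> Sec W \<Longrightarrow>
      X W (f \<otimes>\<^bsub>sheaf M W\<^esub> h) = X W f \<otimes>\<^bsub>sheaf M W\<^esub> h \<oplus>\<^bsub>sheaf M W\<^esub>
        koszul p r \<odot>\<^bsub>sheaf M W\<^esub> (f \<otimes>\<^bsub>sheaf M W\<^esub> X W h)"
    and "\<And>W W' f. opn W \<Longrightarrow> W \<subseteq> U \<Longrightarrow> opn W' \<Longrightarrow> W' \<subseteq> W \<Longrightarrow> f \<in> Sec W \<Longrightarrow>
      X W' (res M W W' f) = res M W W' (X W f)"
  shows "X \<in> vf_part M U p"
  unfolding vf_part_def
proof (intro CollectI conjI ballI)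
  fix W assume "W \<in> opens M U"
  then have W: "opn W" "W \<subseteq> U" by (simp_all add: opens_iff)
  show "X W \<in> Sec W \<rightarrow> Sec W" using assms(2)[OF W] by blast
  show "\<forall>c. \<forall>f\<in>Sec W. X W (c \<odot>\<^bsub>sheaf M W\<^esub> f) = c \<odot>\<^bsub>sheaf M W\<^esub> X W f" using assms(4)[OF W] by blast
  show "\<forall>r. X W ` part (sheaf M W) r \<subseteq> part (sheaf M W) (p + r)" using assms(5)[OF W] by blast
  show "\<forall>r. \<forall>f\<in>part (sheaf M W) r. \<forall>h\<in>Sec W. X W (f \<otimes>\<^bsub>sheaf M W\<^esub> h) =
       X W f \<otimes>\<^bsub>sheaf M W\<^esub> h \<oplus>\<^bsub>sheaf M W\<^esub> koszul p r \<odot>\<^bsub>sheaf M W\<^esub> (f \<otimes>\<^bsub>sheaf M W\<^esub> X W h)"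
    using assms(6)[OF W] by blast
qed (use assms(1,3,7) opens_iff in auto)

lemma vf_ops_eq:
  assumes "opn W" "W \<subseteq> U" "f \<in> Sec W"
  shows vf_add_eq: "vf_add M U X Y W f = X W f \<oplus>\<^bsub>sheaf M W\<^esub> Y W f"
    and vf_smult_eq: "vf_smult M U h X W f = res M U W h \<otimes>\<^bsub>sheaf M W\<^esub> X W f"
    and vf_zero_eq: "vf_zero M U W f = \<zero>\<^bsub>sheaf M W\<^esub>"
    and vf_res_eq: "vf_res M U X W f = X W f"
  using assms by (simp_all add: vf_add_def vf_smult_def vf_zero_def vf_res_def)

lemma vf_ops_on:
  "on_opens M U (vf_add M U X Y) = vf_add M U X Y"
  "on_opens M U (vf_smult M U h X) = vf_smult M U h X"
  "on_opens M U (vf_zero M U) = vf_zero M U"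
  "on_opens M U (vf_res M U X) = vf_res M U X"
  by (simp_all add: vf_add_def vf_smult_def vf_zero_def vf_res_def)

lemma on_opens_eqI:
  assumes "on_opens M U X = X" "on_opens M U Y = Y"
    and "\<And>W f. opn W \<Longrightarrow> W \<subseteq> U \<Longrightarrow> f \<in> Sec W \<Longrightarrow> X W f = Y W f"
  shows "X = Y"
proof -
  have "on_opens M U X = on_opens M U Y"
    using assms(3) unfolding on_opens_def opens_iff by (intro ext) simp
  then show ?thesis using assms(1,2) by simp
qed

lemma vfE:
  assumes "X \<in> vf M U"
  obtains A B where "A \<in> vf_part M U 0" "B \<in> vf_part M U 1" "X = vf_add M U A B"
  using assms unfolding vf_def by blast

end

context smfd
begin

lemma res_zero: "opn W \<Longrightarrow> opn W' \<Longrightarrow> W' \<subseteq> W \<Longrightarrow> res M W W' \<zero>\<^bsub>sheaf M W\<^esub> = \<zero>\<^bsub>sheaf M W'\<^esub>"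
  by (rule ev_eqI[of W']) (simp_all add: res_closed ev_simps subset_iff)

text \<open>As throughout below, identities between sections are verified in both components at
  every point, where they are identities of real numbers.\<close>

lemma vf_add_part:
  assumes U: "opn U" and X: "X \<in> vf_part M U p" and Y: "Y \<in> vf_part M U p"
  shows "vf_add M U X Y \<in> vf_part M U p"
proof (rule vf_partI[OF vf_ops_on(1)])
  note XY = vf_partD[OF X] vf_partD[OF Y]
  fix W assume W: "opn W" "W \<subseteq> U"
  show "\<And>f h. f \<in> Sec W \<Longrightarrow> h \<in> Sec W \<Longrightarrow> vf_add M U X Y W (f \<oplus>\<^bsub>sheaf M W\<^esub> h) =
      vf_add M U X Y W f \<oplus>\<^bsub>sheaf M W\<^esub> vf_add M U X Y W h"
    using W XY by (intro ev_eqI[OF W(1)]) (simp_all add: vf_ops_eq ev_simps)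
  show "\<And>f c. f \<in> Sec W \<Longrightarrow> vf_add M U X Y W (c \<odot>\<^bsub>sheaf M W\<^esub> f) = c \<odot>\<^bsub>sheaf M W\<^esub> vf_add M U X Y W f"
    using W XY by (intro ev_eqI[OF W(1)]) (simp_all add: vf_ops_eq ev_simps algebra_simps)
  show "\<And>f r. f \<in> part (sheaf M W) r \<Longrightarrow> vf_add M U X Y W f \<in> part (sheaf M W) (p + r)"
    using W XY by (simp add: vf_ops_eq part_ops)
  show "\<And>f h r. f \<in> part (sheaf M W) r \<Longrightarrow> h \<in> Sec W \<Longrightarrow> vf_add M U X Y W (f \<otimes>\<^bsub>sheaf M W\<^esub> h) =
      vf_add M U X Y W f \<otimes>\<^bsub>sheaf M W\<^esub> h \<oplus>\<^bsub>sheaf M W\<^esub>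
        koszul p r \<odot>\<^bsub>sheaf M W\<^esub> (f \<otimes>\<^bsub>sheaf M W\<^esub> vf_add M U X Y W h)"
  proof (rule ev_eqI[OF W(1)])
    fix f h r assume f: "f \<in> part (sheaf M W) r" and h: "h \<in> Sec W"
    note l = vf_part_leibniz[OF X W f h] vf_part_leibniz[OF Y W f h]
    show "\<And>m. m \<in> W \<Longrightarrow> ev {} W (vf_add M U X Y W (f \<otimes>\<^bsub>sheaf M W\<^esub> h)) m =
      ev {} W (vf_add M U X Y W f \<otimes>\<^bsub>sheaf M W\<^esub> h \<oplus>\<^bsub>sheaf M W\<^esub>
        koszul p r \<odot>\<^bsub>sheaf M W\<^esub> (f \<otimes>\<^bsub>sheaf M W\<^esub> vf_add M U X Y W h)) m"
     "\<And>m. m \<in> W \<Longrightarrow> ev {0} W (vf_add M U X Y W (f \<otimes>\<^bsub>sheaf M W\<^esub> h)) m =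
      ev {0} W (vf_add M U X Y W f \<otimes>\<^bsub>sheaf M W\<^esub> h \<oplus>\<^bsub>sheaf M W\<^esub>
        koszul p r \<odot>\<^bsub>sheaf M W\<^esub> (f \<otimes>\<^bsub>sheaf M W\<^esub> vf_add M U X Y W h)) m"
      using W XY(2,9) f h by (simp_all add: vf_ops_eq l ev_simps algebra_simps)
  qed (use W XY(2,9) in \<open>simp_all add: vf_ops_eq\<close>)
  show "\<And>W' f. opn W' \<Longrightarrow> W' \<subseteq> W \<Longrightarrow> f \<in> Sec W \<Longrightarrow> vf_add M U X Y W' (res M W W' f) = res M W W' (vf_add M U X Y W f)"
    using W XY by (simp add: vf_ops_eq res_closed res_add)
qed (use vf_part_closed[OF X] vf_part_closed[OF Y] in \<open>simp add: vf_ops_eq\<close>)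

lemma vf_smult_part:
  assumes U: "opn U" and k: "k \<in> part (sheaf M U) q" and X: "X \<in> vf_part M U p"
  shows "vf_smult M U k X \<in> vf_part M U (q + p)"
proof (rule vf_partI[OF vf_ops_on(2)])
  note XD = vf_partD[OF X]
  have kS: "k \<in> Sec U" using U k by simp
  fix W assume W: "opn W" "W \<subseteq> U"
  let ?k = "res M U W k"
  have k': "?k \<in> part (sheaf M W) q" using res_part[OF U W k] .
  then have kW: "?k \<in> Sec W" using W by simp
  show "\<And>f. f \<in> Sec W \<Longrightarrow> vf_smult M U k X W f \<in> Sec W"
    using W XD kW by (simp add: vf_ops_eq)
  show "\<And>f h. f \<in> Sec W \<Longrightarrow> h \<in> Sec W \<Longrightarrow> vf_smult M U k X W (f \<oplus>\<^bsub>sheaf M W\<^esub> h) =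
      vf_smult M U k X W f \<oplus>\<^bsub>sheaf M W\<^esub> vf_smult M U k X W h"
    using W XD kW by (intro ev_eqI[OF W(1)]) (simp_all add: vf_ops_eq ev_add ev_mult0 ev_mult1 algebra_simps)
  show "\<And>f c. f \<in> Sec W \<Longrightarrow> vf_smult M U k X W (c \<odot>\<^bsub>sheaf M W\<^esub> f) = c \<odot>\<^bsub>sheaf M W\<^esub> vf_smult M U k X W f"
    using W XD kW by (intro ev_eqI[OF W(1)]) (simp_all add: vf_ops_eq ev_smult ev_mult0 ev_mult1 algebra_simps)
  show "vf_smult M U k X W f \<in> part (sheaf M W) (q + p + r)" if f: "f \<in> part (sheaf M W) r" for f r
    unfolding vf_smult_eq[OF W Sec_closed(6)[OF W(1) f]] add.assoc
    by (rule part_ops(5)[OF W(1) k' vf_part_part[OF X W f]])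
  show "\<And>f h r. f \<in> part (sheaf M W) r \<Longrightarrow> h \<in> Sec W \<Longrightarrow> vf_smult M U k X W (f \<otimes>\<^bsub>sheaf M W\<^esub> h) =
      vf_smult M U k X W f \<otimes>\<^bsub>sheaf M W\<^esub> h \<oplus>\<^bsub>sheaf M W\<^esub>
        koszul (q + p) r \<odot>\<^bsub>sheaf M W\<^esub> (f \<otimes>\<^bsub>sheaf M W\<^esub> vf_smult M U k X W h)"
  proof (rule ev_eqI[OF W(1)])
    fix f h r assume f: "f \<in> part (sheaf M W) r" and h: "h \<in> Sec W"
    have fS: "f \<in> Sec W" using f W by simp
    \<comment> \<open>The signs of the two sides differ only if \<open>k\<close> and
      \<open>f\<close> are both odd. Then both have value zero, and their product vanishes because
      there is a single odd dimension.\<close>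
    have e: "q = 0 \<or> r = 0 \<or> (ev {} W ?k m = 0 \<and> ev {} W f m = 0)" if "m \<in> W" for m
      using ev_odd[OF W(1) that, of ?k] ev_odd[OF W(1) that, of f] f k' by (cases q; cases r) auto
    note s = XD(2)[OF W] vf_ops_eq[OF W] vf_part_leibniz[OF X W f h] kW fS h W(1)
    fix m assume m: "m \<in> W"
    show "ev {} W (vf_smult M U k X W (f \<otimes>\<^bsub>sheaf M W\<^esub> h)) m =
      ev {} W (vf_smult M U k X W f \<otimes>\<^bsub>sheaf M W\<^esub> h \<oplus>\<^bsub>sheaf M W\<^esub>
        koszul (q + p) r \<odot>\<^bsub>sheaf M W\<^esub> (f \<otimes>\<^bsub>sheaf M W\<^esub> vf_smult M U k X W h)) m"
      "ev {0} W (vf_smult M U k X W (f \<otimes>\<^bsub>sheaf M W\<^esub> h)) m =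
      ev {0} W (vf_smult M U k X W f \<otimes>\<^bsub>sheaf M W\<^esub> h \<oplus>\<^bsub>sheaf M W\<^esub>
        koszul (q + p) r \<odot>\<^bsub>sheaf M W\<^esub> (f \<otimes>\<^bsub>sheaf M W\<^esub> vf_smult M U k X W h)) m"
      using e[OF m] m by (auto simp: s ev_add ev_smult ev_mult0 ev_mult1 algebra_simps)
  qed (use W XD(2) kW in \<open>simp_all add: vf_ops_eq\<close>)
  show "\<And>W' f. opn W' \<Longrightarrow> W' \<subseteq> W \<Longrightarrow> f \<in> Sec W \<Longrightarrow> vf_smult M U k X W' (res M W W' f) = res M W W' (vf_smult M U k X W f)"
    using W XD kW kS U by (simp add: vf_ops_eq res_closed res_mult res_trans)
qed

lemma vf_zero_part:
  assumes U: "opn U"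
  shows "vf_zero M U \<in> vf_part M U p"
proof (rule vf_partI[OF vf_ops_on(3)])
  fix W assume W: "opn W" "W \<subseteq> U"
  show "\<And>f h. f \<in> Sec W \<Longrightarrow> h \<in> Sec W \<Longrightarrow> vf_zero M U W (f \<oplus>\<^bsub>sheaf M W\<^esub> h) =
      vf_zero M U W f \<oplus>\<^bsub>sheaf M W\<^esub> vf_zero M U W h"
    using W by (intro ev_eqI[OF W(1)]) (simp_all add: vf_ops_eq ev_simps)
  show "\<And>f c. f \<in> Sec W \<Longrightarrow> vf_zero M U W (c \<odot>\<^bsub>sheaf M W\<^esub> f) = c \<odot>\<^bsub>sheaf M W\<^esub> vf_zero M U W f"
    using W by (intro ev_eqI[OF W(1)]) (simp_all add: vf_ops_eq ev_simps)
  show "\<And>f r. f \<in> part (sheaf M W) r \<Longrightarrow> vf_zero M U W f \<in> part (sheaf M W) (p + r)"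
    using W by (simp add: vf_ops_eq part_ops)
  show "\<And>f h r. f \<in> part (sheaf M W) r \<Longrightarrow> h \<in> Sec W \<Longrightarrow> vf_zero M U W (f \<otimes>\<^bsub>sheaf M W\<^esub> h) =
      vf_zero M U W f \<otimes>\<^bsub>sheaf M W\<^esub> h \<oplus>\<^bsub>sheaf M W\<^esub>
        koszul p r \<odot>\<^bsub>sheaf M W\<^esub> (f \<otimes>\<^bsub>sheaf M W\<^esub> vf_zero M U W h)"
    using W by (intro ev_eqI[OF W(1)]) (simp_all add: vf_ops_eq ev_simps)
  show "\<And>W' f. opn W' \<Longrightarrow> W' \<subseteq> W \<Longrightarrow> f \<in> Sec W \<Longrightarrow> vf_zero M U W' (res M W W' f) = res M W W' (vf_zero M U W f)"
    using W by (simp add: vf_zero_eq res_closed res_zero subset_trans[of _ W U])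
qed (simp add: vf_ops_eq)

lemma vf_res_part:
  assumes U: "opn U" and W: "opn W" "W \<subseteq> U" and X: "X \<in> vf_part M U p"
  shows "vf_res M W X \<in> vf_part M W p"
proof -
  note XD = vf_partD[OF X]
  show ?thesis
proof (rule vf_partI[OF vf_ops_on(4)])
  fix W' assume W': "opn W'" "W' \<subseteq> W"
  then have W'U: "W' \<subseteq> U" using W by blast
  show "\<And>W'' f. opn W'' \<Longrightarrow> W'' \<subseteq> W' \<Longrightarrow> f \<in> Sec W' \<Longrightarrow> vf_res M W X W'' (res M W' W'' f) = res M W' W'' (vf_res M W X W' f)"
    using W' W'U XD(7) by (simp add: vf_ops_eq res_closed)
qed (use XD W in \<open>simp_all add: vf_ops_eq subset_trans[OF _ W(2)]\<close>)
qed

lemma vf_part_vf: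
  assumes U: "opn U" and X: "X \<in> vf_part M U p"
  shows "X \<in> vf M U"
proof -
  have e: "vf_add M U X (vf_zero M U) = X" "vf_add M U (vf_zero M U) X = X"
    by (rule on_opens_eqI[OF vf_ops_on(1) vf_part_on[OF X]], rule ev_eqI, assumption,
        use vf_part_closed[OF X] in \<open>simp_all add: vf_ops_eq ev_simps\<close>)+
  show ?thesis using e X vf_zero_part[OF U] unfolding vf_def by (cases p) force+
qed

lemma vfD:
  assumes "X \<in> vf M U"
  shows vf_on: "on_opens M U X = X"
    and vf_closed: "\<And>W f. opn W \<Longrightarrow> W \<subseteq> U \<Longrightarrow> f \<in> Sec W \<Longrightarrow> X W f \<in> Sec W"
    and vf_ev_add: "\<And>W f h. opn W \<Longrightarrow> W \<subseteq> U \<Longrightarrow> f \<in> Sec W \<Longrightarrow> h \<in> Sec W \<Longrightarrow>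
      X W (f \<oplus>\<^bsub>sheaf M W\<^esub> h) = X W f \<oplus>\<^bsub>sheaf M W\<^esub> X W h"
    and vf_ev_smult: "\<And>W f c. opn W \<Longrightarrow> W \<subseteq> U \<Longrightarrow> f \<in> Sec W \<Longrightarrow>
      X W (c \<odot>\<^bsub>sheaf M W\<^esub> f) = c \<odot>\<^bsub>sheaf M W\<^esub> X W f"
    and vf_ev_res: "\<And>W W' f. opn W \<Longrightarrow> W \<subseteq> U \<Longrightarrow> opn W' \<Longrightarrow> W' \<subseteq> W \<Longrightarrow> f \<in> Sec W \<Longrightarrow>
      X W' (res M W W' f) = res M W W' (X W f)"
proof -
  obtain A B where A: "A \<in> vf_part M U 0" and B: "B \<in> vf_part M U 1" and X: "X = vf_add M U A B"
    using assms by (rule vfE)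
  note D = vf_partD[OF A] vf_partD[OF B]
  show "on_opens M U X = X" unfolding X by (rule vf_ops_on)
  fix W assume W: "opn W" "W \<subseteq> U"
  show "\<And>f. f \<in> Sec W \<Longrightarrow> X W f \<in> Sec W" using W D unfolding X by (simp add: vf_ops_eq)
  show "\<And>f h. f \<in> Sec W \<Longrightarrow> h \<in> Sec W \<Longrightarrow> X W (f \<oplus>\<^bsub>sheaf M W\<^esub> h) = X W f \<oplus>\<^bsub>sheaf M W\<^esub> X W h"
    using W D unfolding X by (intro ev_eqI[OF W(1)]) (simp_all add: vf_ops_eq ev_simps)
  show "\<And>f c. f \<in> Sec W \<Longrightarrow> X W (c \<odot>\<^bsub>sheaf M W\<^esub> f) = c \<odot>\<^bsub>sheaf M W\<^esub> X W f"
    using W D unfolding X by (intro ev_eqI[OF W(1)]) (simp_all add: vf_ops_eq ev_simps algebra_simps)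
  show "\<And>W' f. opn W' \<Longrightarrow> W' \<subseteq> W \<Longrightarrow> f \<in> Sec W \<Longrightarrow> X W' (res M W W' f) = res M W W' (X W f)"
    using W D unfolding X by (simp add: vf_ops_eq res_closed res_add)
qed

lemma vf_eqI:
  assumes "X \<in> vf M U" "Y \<in> vf M U"
    and "\<And>W f m. opn W \<Longrightarrow> W \<subseteq> U \<Longrightarrow> f \<in> Sec W \<Longrightarrow> m \<in> W \<Longrightarrow> ev {} W (X W f) m = ev {} W (Y W f) m"
    and "\<And>W f m. opn W \<Longrightarrow> W \<subseteq> U \<Longrightarrow> f \<in> Sec W \<Longrightarrow> m \<in> W \<Longrightarrow> ev {0} W (X W f) m = ev {0} W (Y W f) m"
  shows "X = Y"
  by (rule on_opens_eqI[OF vf_on[OF assms(1)] vf_on[OF assms(2)]], rule ev_eqI, assumption)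
    (use assms vf_closed in auto)

lemma vf_add_vf:
  assumes U: "opn U" and X: "X \<in> vf M U" and Y: "Y \<in> vf M U"
  shows "vf_add M U X Y \<in> vf M U"
proof -
  obtain A B where A: "A \<in> vf_part M U 0" "B \<in> vf_part M U 1" "X = vf_add M U A B"
    using X by (rule vfE)
  obtain C D where C: "C \<in> vf_part M U 0" "D \<in> vf_part M U 1" "Y = vf_add M U C D"
    using Y by (rule vfE)
  note cl = vf_part_closed[OF A(1)] vf_part_closed[OF A(2)] vf_part_closed[OF C(1)] vf_part_closed[OF C(2)]
  have "vf_add M U X Y = vf_add M U (vf_add M U A C) (vf_add M U B D)"
    by (rule on_opens_eqI[OF vf_ops_on(1) vf_ops_on(1)], rule ev_eqI, assumption)
      (use cl in \<open>simp_all add: A(3) C(3) vf_ops_eq ev_simps\<close>)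
  then show ?thesis unfolding vf_def using vf_add_part[OF U] A C by blast
qed

lemma vf_smult_vf:
  assumes U: "opn U" and k: "k \<in> Sec U" and X: "X \<in> vf M U"
  shows "vf_smult M U k X \<in> vf M U"
proof -
  obtain A B where A: "A \<in> vf_part M U 0" "B \<in> vf_part M U 1" "X = vf_add M U A B"
    using X by (rule vfE)
  obtain a b where ab: "a \<in> part (sheaf M U) 0" "b \<in> part (sheaf M U) 1" "k = a \<oplus>\<^bsub>sheaf M U\<^esub> b"
    using part_decompE[OF U k] .
  have S: "a \<in> Sec U" "b \<in> Sec U" using ab U by auto
  note cl = vf_part_closed[OF A(1)] vf_part_closed[OF A(2)]
  have s: "vf_smult M U a A \<in> vf M U" "vf_smult M U b B \<in> vf M U" "vf_smult M U a B \<in> vf M U" "vf_smult M U b A \<in> vf M U"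
    using vf_part_vf[OF U vf_smult_part[OF U]] ab A by blast+
  have "vf_smult M U k X = vf_add M U (vf_add M U (vf_smult M U a A) (vf_smult M U b B))
      (vf_add M U (vf_smult M U a B) (vf_smult M U b A))"
    by (rule on_opens_eqI[OF vf_ops_on(2) vf_ops_on(1)], rule ev_eqI, assumption)
      (use cl S U k in \<open>simp_all add: A(3) ab(3) vf_ops_eq ev_simps res_add res_closed algebra_simps\<close>)
  then show ?thesis using vf_add_vf[OF U] s by simp
qed

lemma vf_zero_vf: "opn U \<Longrightarrow> vf_zero M U \<in> vf M U"
  using vf_part_vf vf_zero_part by blast

lemma vf_res_vf:
  assumes U: "opn U" and W: "opn W" "W \<subseteq> U" and X: "X \<in> vf M U"
  shows "vf_res M W X \<in> vf M W"
proof -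
  obtain A B where A: "A \<in> vf_part M U 0" "B \<in> vf_part M U 1" "X = vf_add M U A B"
    using X by (rule vfE)
  have "vf_res M W X = vf_add M W (vf_res M W A) (vf_res M W B)"
    by (rule on_opens_eqI[OF vf_ops_on(4) vf_ops_on(1)]) (use W in \<open>simp add: A(3) vf_ops_eq subset_trans[OF _ W(2)]\<close>)
  then show ?thesis unfolding vf_def using vf_res_part[OF U W] A by blast
qed

lemma vf_smult_even:
  "opn U \<Longrightarrow> k \<in> part (sheaf M U) 0 \<Longrightarrow> X \<in> vf_part M U p \<Longrightarrow> vf_smult M U k X \<in> vf_part M U p"
  using vf_smult_part[of U k 0 X p] unfolding add_0_left .

end

section \<open>Gluing of vector fields and bump functions\<close>

context smfd
begin

lemma opn_subset_points: "opn W \<Longrightarrow> W \<subseteq> points M"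
  by (rule openin_subset)

lemma ev_eqI_local:
  assumes W: "opn W" and f: "f \<in> Sec W" "h \<in> Sec W"
    and loc: "\<And>m. m \<in> W \<Longrightarrow> \<exists>W'. opn W' \<and> m \<in> W' \<and> W' \<subseteq> W \<and> res M W W' f = res M W W' h"
  shows "f = h"
proof (rule ev_eqI[OF W f])
  fix m assume "m \<in> W"
  then obtain W' where W': "opn W'" "m \<in> W'" "W' \<subseteq> W" "res M W W' f = res M W W' h"
    using loc by blast
  show "ev {} W f m = ev {} W h m" "ev {0} W f m = ev {0} W h m"
    using ev_res[OF W W'(1,3,2) f(1)] ev_res[OF W W'(1,3,2) f(2)] W'(4) by simp_all
qed

lemma part_local:
  assumes W: "opn W" and f: "f \<in> Sec W"
    and loc: "\<And>m. m \<in> W \<Longrightarrow> \<exists>W'. opn W' \<and> m \<in> W' \<and> W' \<subseteq> W \<and> res M W W' f \<in> part (sheaf M W') q"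
  shows "f \<in> part (sheaf M W) q"
proof (cases q)
  case zero
  have "ev {0} W f m = 0" if m: "m \<in> W" for m
  proof -
    obtain W' where "opn W'" "m \<in> W'" "W' \<subseteq> W" "res M W W' f \<in> part (sheaf M W') q" using loc[OF m] by blast
    then show ?thesis using ev_res[OF W _ _ _ f, of W' m "{0}"] ev_even[of W' m "res M W W' f"] zero by simp
  qed
  then show ?thesis using even_iff[OF W f] zero by simp
next
  case one
  have "ev {} W f m = 0" if m: "m \<in> W" for m
  proof -
    obtain W' where "opn W'" "m \<in> W'" "W' \<subseteq> W" "res M W W' f \<in> part (sheaf M W') q" using loc[OF m] by blast
    then show ?thesis using ev_res[OF W _ _ _ f, of W' m "{}"] ev_odd[of W' m "res M W W' f"] one by simp
  qed
  then show ?thesis using odd_iff[OF W f] one by simp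
qed

text \<open>Prescribing one map \<open>F\<close> on all small open sets, rather than a family of
  fields, makes the local fields compatible automatically: each of them computes \<open>F\<close> on
  every smaller set. On a large set the value at \<open>f\<close> is glued from the values of
  \<open>F\<close> at the restrictions of \<open>f\<close>.\<close>

lemma vf_glue:
  assumes opn: "\<And>W. W \<in> \<S> \<Longrightarrow> opn W" and down: "\<And>W W'. W \<in> \<S> \<Longrightarrow> opn W' \<Longrightarrow> W' \<subseteq> W \<Longrightarrow> W' \<in> \<S>"
    and cover: "\<Union>\<S> = points M"
    and loc: "\<And>W. W \<in> \<S> \<Longrightarrow> \<exists>X\<in>vf_part M W p. \<forall>W' f. opn W' \<longrightarrow> W' \<subseteq> W \<longrightarrow> f \<in> Sec W' \<longrightarrow> F W' f = X W' f"
  shows "\<exists>X\<in>Vect_part M p. \<forall>W\<in>\<S>. \<forall>f\<in>Sec W. X W f = F W f"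
proof -
  have small: "\<exists>W'\<in>\<S>. opn W' \<and> m \<in> W' \<and> W' \<subseteq> W" if W: "opn W" "m \<in> W" for W m
  proof -
    obtain S where "S \<in> \<S>" "m \<in> S" using opn_points[OF W] cover by blast
    then show ?thesis using down[of S "S \<inter> W"] opn W by blast
  qed
  have F: "F W f \<in> Sec W" "\<And>W'. opn W' \<Longrightarrow> W' \<subseteq> W \<Longrightarrow> F W' (res M W W' f) = res M W W' (F W f)"
    if W: "W \<in> \<S>" and f: "f \<in> Sec W" for W f
  proof -
    obtain X where X: "X \<in> vf_part M W p"
      "\<And>W' f. opn W' \<Longrightarrow> W' \<subseteq> W \<Longrightarrow> f \<in> Sec W' \<Longrightarrow> F W' f = X W' f"
      using loc[OF W] by blast
    show "F W f \<in> Sec W" using X(2)[of W f] vf_part_closed[OF X(1), of W f] opn[OF W] f by simp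
    show "F W' (res M W W' f) = res M W W' (F W f)" if "opn W'" "W' \<subseteq> W" for W'
      using X(2)[of W f] X(2)[of W' "res M W W' f"] vf_part_res[OF X(1), of W W' f] opn[OF W] f that
      by (simp add: res_closed)
  qed
  \<comment> \<open>\<open>h\<close> is the value of the glued field at \<open>f\<close>; it exists
    and is unique because the small sets contained in \<open>W\<close> cover it.\<close>
  define P where "P W f h \<longleftrightarrow> h \<in> Sec W \<and> (\<forall>W'\<in>\<S>. W' \<subseteq> W \<longrightarrow> res M W W' h = F W' (res M W W' f))" for W f h
  have unique: "h = h'" if "opn W" "P W f h" "P W f h'" for W f h h'
  proof (rule ev_eqI_local[OF that(1)])
    fix m assume "m \<in> W"
    from small[OF that(1) this] show "\<exists>W'. opn W' \<and> m \<in> W' \<and> W' \<subseteq> W \<and> res M W W' h = res M W W' h'"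
      using that(2,3) unfolding P_def by metis
  qed (use that in \<open>auto simp: P_def\<close>)
  have ex: "\<exists>h. P W f h" if W: "opn W" and f: "f \<in> Sec W" for W f
  proof -
    let ?C = "{W'\<in>\<S>. W' \<subseteq> W}"
    have un: "\<Union>?C = W" using small[OF W] by blast
    have "\<exists>!h. h \<in> Sec (\<Union>?C) \<and> (\<forall>W'\<in>?C. res M (\<Union>?C) W' h = F W' (res M W W' f))"
    proof (rule glue)
      fix A assume A: "A \<in> ?C"
      have fA: "res M W A f \<in> Sec A" using A opn res_closed[OF W _ _ f] by blast
      show "opn A \<and> F A (res M W A f) \<in> Sec A" using A opn F(1)[OF _ fA] by blast
      fix B assume B: "B \<in> ?C"
      have fB: "res M W B f \<in> Sec B" using B opn res_closed[OF W _ _ f] by blast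
      have AB: "opn (A \<inter> B)" "A \<inter> B \<subseteq> A" "A \<inter> B \<subseteq> B" using A B opn by auto
      have "res M A (A \<inter> B) (F A (res M W A f)) = F (A \<inter> B) (res M A (A \<inter> B) (res M W A f))"
        using F(2)[OF _ fA AB(1,2)] A by simp
      also have "\<dots> = F (A \<inter> B) (res M B (A \<inter> B) (res M W B f))"
        using res_trans[OF W _ _ AB(1,2) f] res_trans[OF W _ _ AB(1,3) f] A B opn by simp
      also have "\<dots> = res M B (A \<inter> B) (F B (res M W B f))"
        using F(2)[OF _ fB AB(1,3)] B by simp
      finally show "res M A (A \<inter> B) (F A (res M W A f)) = res M B (A \<inter> B) (F B (res M W B f))" .
    qed
    then show ?thesis unfolding un P_def by blast
  qed
  define X where "X = on_opens M (points M) (\<lambda>W f. THE h. P W f h)"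
  have XP: "P W f (X W f)" if W: "opn W" and f: "f \<in> Sec W" for W f
  proof -
    have "P W f (THE h. P W f h)"
      using ex[OF W f] unique[OF W] by (metis theI)
    then show ?thesis using W f opn_subset_points by (simp add: X_def)
  qed
  have Xcl: "X W f \<in> Sec W" if "opn W" "f \<in> Sec W" for W f
    using XP[OF that] by (simp add: P_def)
  have Xres: "res M W W' (X W f) = F W' (res M W W' f)" if "opn W" "f \<in> Sec W" "W' \<in> \<S>" "W' \<subseteq> W" for W W' f
    using XP[OF that(1,2)] that(3,4) by (simp add: P_def)
  have XF: "X W f = F W f" if W: "W \<in> \<S>" and f: "f \<in> Sec W" for W f
    using Xres[OF opn[OF W] f W] Xcl[OF opn[OF W] f] f opn[OF W] by (simp add: res_id)
  \<comment> \<open>Near every point the glued field is one of the local fields. The algebraic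
    axioms are checked there; they become global because equality and parity of sections are
    local.\<close>
  have XW: "\<exists>W'. opn W' \<and> m \<in> W' \<and> W' \<subseteq> W \<and> (\<exists>Y\<in>vf_part M W' p. \<forall>f\<in>Sec W. res M W W' (X W f) = Y W' (res M W W' f))"
    if W: "opn W" and m: "m \<in> W" for W m
  proof -
    obtain W' where W': "W' \<in> \<S>" "opn W'" "m \<in> W'" "W' \<subseteq> W" using small[OF W m] by blast
    obtain Y where Y: "Y \<in> vf_part M W' p" "\<And>f. f \<in> Sec W' \<Longrightarrow> F W' f = Y W' f"
      using loc[OF W'(1)] W'(2) by blast
    show ?thesis
      using W' Y Xres[OF W _ W'(1,4)] res_closed[OF W W'(2,4)] by (intro exI[of _ W'] conjI bexI[of _ Y]) auto
  qed
  have "X \<in> Vect_part M p"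
  proof (rule vf_partI)
    show "on_opens M (points M) X = X" by (simp add: X_def)
    fix W assume W: "opn W"
    show "\<And>f. f \<in> Sec W \<Longrightarrow> X W f \<in> Sec W" by (rule Xcl[OF W])
    show "X W (f \<oplus>\<^bsub>sheaf M W\<^esub> h) = X W f \<oplus>\<^bsub>sheaf M W\<^esub> X W h" if "f \<in> Sec W" "h \<in> Sec W" for f h
    proof (rule ev_eqI_local[OF W])
      fix m assume "m \<in> W"
      from XW[OF W this] obtain W' Y where W': "opn W'" "m \<in> W'" "W' \<subseteq> W" and Y: "Y \<in> vf_part M W' p"
        "\<And>f. f \<in> Sec W \<Longrightarrow> res M W W' (X W f) = Y W' (res M W W' f)" by blast
      have "res M W W' (X W (f \<oplus>\<^bsub>sheaf M W\<^esub> h)) = res M W W' (X W f \<oplus>\<^bsub>sheaf M W\<^esub> X W h)"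
        using W W' that Xcl[OF W] by (simp add: Y(2) res_add vf_part_add[OF Y(1)] res_closed)
      then show "\<exists>W'. opn W' \<and> m \<in> W' \<and> W' \<subseteq> W \<and>
          res M W W' (X W (f \<oplus>\<^bsub>sheaf M W\<^esub> h)) = res M W W' (X W f \<oplus>\<^bsub>sheaf M W\<^esub> X W h)"
        using W' by blast
    qed (use W that Xcl in simp_all)
    show "X W (c \<odot>\<^bsub>sheaf M W\<^esub> f) = c \<odot>\<^bsub>sheaf M W\<^esub> X W f" if "f \<in> Sec W" for f c
    proof (rule ev_eqI_local[OF W])
      fix m assume "m \<in> W"
      from XW[OF W this] obtain W' Y where W': "opn W'" "m \<in> W'" "W' \<subseteq> W" and Y: "Y \<in> vf_part M W' p"
        "\<And>f. f \<in> Sec W \<Longrightarrow> res M W W' (X W f) = Y W' (res M W W' f)" by blast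
      have "res M W W' (X W (c \<odot>\<^bsub>sheaf M W\<^esub> f)) = res M W W' (c \<odot>\<^bsub>sheaf M W\<^esub> X W f)"
        using W W' that Xcl[OF W] by (simp add: Y(2) res_smult vf_part_smult[OF Y(1)] res_closed)
      then show "\<exists>W'. opn W' \<and> m \<in> W' \<and> W' \<subseteq> W \<and>
          res M W W' (X W (c \<odot>\<^bsub>sheaf M W\<^esub> f)) = res M W W' (c \<odot>\<^bsub>sheaf M W\<^esub> X W f)"
        using W' by blast
    qed (use W that Xcl in simp_all)
    show "X W f \<in> part (sheaf M W) (p + r)" if f: "f \<in> part (sheaf M W) r" for f r
    proof -
      have fS: "f \<in> Sec W" using W f by simp
      have "\<exists>W'. opn W' \<and> m \<in> W' \<and> W' \<subseteq> W \<and> res M W W' (X W f) \<in> part (sheaf M W') (p + r)" if m: "m \<in> W" for m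
      proof -
        from XW[OF W m] obtain W' Y where W': "opn W'" "m \<in> W'" "W' \<subseteq> W" and Y: "Y \<in> vf_part M W' p"
          "\<And>f. f \<in> Sec W \<Longrightarrow> res M W W' (X W f) = Y W' (res M W W' f)" by blast
        show ?thesis
          using W' vf_part_part[OF Y(1) W'(1) _ res_part[OF W W'(1,3) f]] Y(2)[OF fS] by auto
      qed
      then show ?thesis by (rule part_local[OF W Xcl[OF W fS]])
    qed
    show "X W (f \<otimes>\<^bsub>sheaf M W\<^esub> h) = X W f \<otimes>\<^bsub>sheaf M W\<^esub> h \<oplus>\<^bsub>sheaf M W\<^esub>
        koszul p r \<odot>\<^bsub>sheaf M W\<^esub> (f \<otimes>\<^bsub>sheaf M W\<^esub> X W h)"
      if f: "f \<in> part (sheaf M W) r" and h: "h \<in> Sec W" for f h r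
    proof (rule ev_eqI_local[OF W])
      have fS: "f \<in> Sec W" using W f by simp
      fix m assume "m \<in> W"
      from XW[OF W this] obtain W' Y where W': "opn W'" "m \<in> W'" "W' \<subseteq> W" and Y: "Y \<in> vf_part M W' p"
        "\<And>f. f \<in> Sec W \<Longrightarrow> res M W W' (X W f) = Y W' (res M W W' f)" by blast
      have "res M W W' (X W (f \<otimes>\<^bsub>sheaf M W\<^esub> h)) = res M W W' (X W f \<otimes>\<^bsub>sheaf M W\<^esub> h \<oplus>\<^bsub>sheaf M W\<^esub>
          koszul p r \<odot>\<^bsub>sheaf M W\<^esub> (f \<otimes>\<^bsub>sheaf M W\<^esub> X W h))"
        using W W' fS h Xcl[OF W] vf_part_leibniz[OF Y(1) W'(1) _ res_part[OF W W'(1,3) f] res_closed[OF W W'(1,3) h]]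
        by (simp add: Y(2) res_add res_mult res_smult)
      then show "\<exists>W'. opn W' \<and> m \<in> W' \<and> W' \<subseteq> W \<and>
          res M W W' (X W (f \<otimes>\<^bsub>sheaf M W\<^esub> h)) = res M W W' (X W f \<otimes>\<^bsub>sheaf M W\<^esub> h \<oplus>\<^bsub>sheaf M W\<^esub>
          koszul p r \<odot>\<^bsub>sheaf M W\<^esub> (f \<otimes>\<^bsub>sheaf M W\<^esub> X W h))"
        using W' by blast
    qed (use W f h Xcl in simp_all)
    show "X W' (res M W W' f) = res M W W' (X W f)" if W': "opn W'" "W' \<subseteq> W" and f: "f \<in> Sec W" for W' f
    proof (rule unique[OF W'(1) XP])
      show "res M W W' f \<in> Sec W'" by (rule res_closed[OF W W' f])
      show "P W' (res M W W' f) (res M W W' (X W f))"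
        unfolding P_def
      proof (intro conjI ballI impI)
        show "res M W W' (X W f) \<in> Sec W'" by (rule res_closed[OF W W' Xcl[OF W f]])
        fix S assume S: "S \<in> \<S>" "S \<subseteq> W'"
        then show "res M W' S (res M W W' (X W f)) = F S (res M W' S (res M W W' f))"
          using res_trans[OF W W' opn[OF S(1)] S(2)] f Xcl[OF W f] Xres[OF W f S(1)] W' by auto
      qed
    qed (rule W')
  qed
  then show ?thesis using XF by blast
qed

text \<open>Extension by zero: \<open>f\<close> on \<open>U\<close> and zero off the closed set
  \<open>K\<close> agree on the overlap and glue.\<close>

lemma ext_fun:
  assumes U: "opn U" and K: "closedin (base M) K" "K \<subseteq> U" and f: "f \<in> Sec U"
    and z: "\<And>m. m \<in> U - K \<Longrightarrow> ev {} U f m = 0" "\<And>m. m \<in> U - K \<Longrightarrow> ev {0} U f m = 0"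
  obtains f' where "f' \<in> C_inf M" "res M (points M) U f' = f"
    "\<And>I m. I \<in> {{}, {0}} \<Longrightarrow> m \<in> points M - K \<Longrightarrow> ev I (points M) f' m = 0"
proof (cases "K = {}")
  \<comment> \<open>The family to be glued is indexed by its open sets, so \<open>U\<close> must
    differ from the complement of \<open>K\<close>. It does once \<open>K\<close> is nonempty; for
    empty \<open>K\<close> the section \<open>f\<close> is zero.\<close>
  case True
  have "f = \<zero>\<^bsub>sheaf M U\<^esub>" by (rule ev_eq_zeroI[OF U f]) (use z True in auto)
  then show ?thesis
    using that[of "\<zero>\<^bsub>sheaf M (points M)\<^esub>"] res_zero[of "points M" U] U opn_subset_points ev_zero[of "points M"] by auto
next
  case False
  let ?V = "points M - K"
  have V: "opn ?V" using K(1) by blast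
  have ne: "U \<noteq> ?V" using K False by blast
  have un: "\<Union>{U, ?V} = points M" using opn_subset_points[OF U] K by blast
  have P: "opn (points M)" by simp
  define s where "s W = (if W = U then f else \<zero>\<^bsub>sheaf M W\<^esub>)" for W
  have UV: "opn (U \<inter> ?V)" using U V by blast
  have fUV: "res M U (U \<inter> ?V) f = \<zero>\<^bsub>sheaf M (U \<inter> ?V)\<^esub>"
    by (rule ev_eq_zeroI[OF UV]) (use res_closed[OF U UV _ f] ev_res[OF U UV _ _ f] z in auto)
  have "\<exists>!h. h \<in> Sec (\<Union>{U, ?V}) \<and> (\<forall>W\<in>{U, ?V}. res M (\<Union>{U, ?V}) W h = s W)"
  proof (rule glue)
    fix A assume A: "A \<in> {U, ?V}"
    then show "opn A \<and> s A \<in> Sec A" using U V f by (auto simp: s_def)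
    fix B assume B: "B \<in> {U, ?V}"
    show "res M A (A \<inter> B) (s A) = res M B (A \<inter> B) (s B)"
    proof -
      have s: "s U = f" "s ?V = \<zero>\<^bsub>sheaf M ?V\<^esub>" using ne by (simp_all add: s_def)
      have UV': "res M ?V (U \<inter> ?V) \<zero>\<^bsub>sheaf M ?V\<^esub> = \<zero>\<^bsub>sheaf M (U \<inter> ?V)\<^esub>"
        by (rule res_zero[OF V UV]) blast
      have "A = B \<or> A = U \<and> B = ?V \<or> A = ?V \<and> B = U" using A B by blast
      then show ?thesis
      proof (elim disjE conjE)
        assume "A = U" "B = ?V"
        then show ?thesis using fUV UV' s by (simp only:)
      next
        assume AB: "A = ?V" "B = U"
        show ?thesis unfolding AB Int_commute[of ?V U] using fUV UV' s by (simp only:)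
      qed simp
    qed
  qed
  then obtain h where h: "h \<in> C_inf M" "res M (points M) U h = s U" "res M (points M) ?V h = s ?V"
    unfolding un by auto
  have "ev I (points M) h m = 0" if "I \<in> {{}, {0}}" "m \<in> ?V" for I m
    using ev_res[OF P V _ that(2) h(1), of I] that ev_zero[OF V that(2)] h(3) ne by (auto simp: s_def)
  then show ?thesis using that h by (simp add: s_def)
qed

text \<open>\<open>K\<close> is closed so that products with \<open>\<rho>\<close> extend by zero,
  and \<open>\<rho>\<close> has value \<open>1\<close> on the open \<open>O'\<close> so that the
  extension agrees there with the original. Being even, \<open>\<rho>\<close> has no second
  component and acts at each point as a real factor.\<close>

definition cutoff :: "'s \<Rightarrow> 'a set \<Rightarrow> 'a set \<Rightarrow> bool" where
  "cutoff \<rho> O' K \<longleftrightarrow> \<rho> \<in> part (sheaf M (points M)) 0 \<and> opn O' \<and> closedin (base M) K \<and> O' \<subseteq> K \<and>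
    (\<forall>m\<in>O'. ev {} (points M) \<rho> m = 1) \<and> (\<forall>m\<in>points M - K. ev {} (points M) \<rho> m = 0)"

lemma ex_cutoff:
  assumes W: "opn W" "m \<in> W"
  obtains \<rho> O' K where "cutoff \<rho> O' K" "m \<in> O'" "K \<subseteq> W"
proof -
  obtain U and V :: "(real^'n) set" and \<phi> \<Phi> where c: "schart M U V \<phi> \<Phi>" "m \<in> U"
    "\<And>I W f. ev I W f m = schart.cc M U \<phi> \<Phi> I W f m" by (rule ev_chart[OF opn_points[OF W]]) (rule that)
  interpret schart M U V \<phi> \<Phi> by (rule c(1))
  let ?W = "W \<inter> U"
  have Wo: "opn ?W" "?W \<subseteq> U" using W U_open by auto
  obtain r where r: "r > 0" "cball (\<phi> m) r \<subseteq> \<phi> ` ?W"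
    using open_image[OF Wo] W c(2) unfolding open_contains_cball by blast
  obtain b :: "real^'n \<Rightarrow> real" and s where b: "smooth UNIV b" "0 < s" "s < r"
    "\<And>x. x \<in> ball (\<phi> m) s \<Longrightarrow> b x = 1" "\<And>x. x \<notin> ball (\<phi> m) r \<Longrightarrow> b x = 0"
    using smooth_bump[OF r(1)] by metis
  define O' where "O' = {x \<in> U. \<phi> x \<in> ball (\<phi> m) s} \<inter> ?W"
  define K where "K = {x \<in> ?W. \<phi> x \<in> cball (\<phi> m) r}"
  have O': "opn O'" unfolding O'_def using opn_preimage Wo by blast
  \<comment> \<open>The preimage of a closed ball is compact, hence closed in the whole space, which
    is Hausdorff; being closed in the chart would not allow extension by zero.\<close>
  have "compactin (base M) K"
  proof -
    have im: "\<phi> ` K = cball (\<phi> m) r" using r(2) unfolding K_def by blast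
    have "K \<subseteq> U" by (auto simp: K_def)
    have "compactin (top_of_set V) (\<phi> ` K)"
      using r(2) image_U Wo(2) unfolding im by (auto simp: compactin_subtopology)
    then have "compactin (subtopology (base M) U) K"
      using homeomorphic_map_compactness_eq[OF homeo] \<open>K \<subseteq> U\<close> topspace_U by auto
    then show ?thesis by (simp add: compactin_subtopology)
  qed
  then have K: "closedin (base M) K" using Hausdorff compactin_imp_closedin by blast
  have sm: "smooth (\<phi> ` ?W) b" "smooth (\<phi> ` ?W) (\<lambda>_. 0)"
    using smooth_subset[OF b(1)] smooth_const by auto
  let ?f = "sec ?W b (\<lambda>_. 0)"
  have f: "?f \<in> Sec ?W" "?f \<in> part (sheaf M ?W) 0" by (rule sec_closed[OF Wo sm], rule sec_even[OF Wo sm]) simp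
  have fv: "ev {} ?W ?f x = b (\<phi> x)" if "x \<in> ?W" for x
    using ev_val[OF Wo(1) that f(1)] val_cc[OF Wo(1) that _ f(1)] cc_sec[OF Wo sm that] that by simp
  obtain \<rho> where \<rho>: "\<rho> \<in> C_inf M" "res M (points M) ?W \<rho> = ?f"
    "\<And>I m. I \<in> {{}, {0}} \<Longrightarrow> m \<in> points M - K \<Longrightarrow> ev I (points M) \<rho> m = 0"
  proof (rule ext_fun[OF Wo(1) K _ f(1)])
    show "K \<subseteq> ?W" by (auto simp: K_def)
    show "ev {} ?W ?f x = 0" if "x \<in> ?W - K" for x
      using that b(5)[of "\<phi> x"] fv[of x] by (auto simp: K_def)
    show "ev {0} ?W ?f x = 0" if "x \<in> ?W - K" for x
      using that ev_even[OF Wo(1) _ f(2)] by blast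
  qed (rule that)
  have P: "opn (points M)" by simp
  have ev\<rho>: "ev I (points M) \<rho> x = ev I ?W ?f x" if "x \<in> ?W" for x I
    using ev_res[OF P Wo(1) opn_subset_points[OF Wo(1)] that \<rho>(1), of I] \<rho>(2) by simp
  have "ev {0} (points M) \<rho> x = 0" if "x \<in> points M" for x
  proof (cases "x \<in> ?W")
    case True
    then show ?thesis using ev\<rho>[OF True] ev_even[OF Wo(1) True f(2)] by simp
  next
    case False
    then show ?thesis using \<rho>(3) that by (auto simp: K_def)
  qed
  then have "\<rho> \<in> part (sheaf M (points M)) 0" using even_iff[OF P \<rho>(1)] by blast
  moreover have "ev {} (points M) \<rho> x = 1" if "x \<in> O'" for x
    using that ev\<rho>[of x "{}"] fv[of x] b(4)[of "\<phi> x"] by (auto simp: O'_def)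
  moreover have "O' \<subseteq> K" using b(3) by (auto simp: O'_def K_def)
  ultimately have "cutoff \<rho> O' K" using O' K \<rho>(3) by (simp add: cutoff_def)
  moreover have "m \<in> O'" using W c(2) b(2) by (simp add: O'_def)
  moreover have "K \<subseteq> W" by (auto simp: K_def)
  ultimately show ?thesis by (rule that)
qed

lemma extend_fun:
  assumes \<rho>: "cutoff \<rho> O' K" and U: "opn U" "K \<subseteq> U" and f: "f \<in> part (sheaf M U) p"
  obtains f' where "f' \<in> part (sheaf M (points M)) p" "res M (points M) O' f' = res M U O' f"
proof -
  have P: "opn (points M)" by simp
  note \<rho>D = \<rho>[unfolded cutoff_def]
  have \<rho>S: "\<rho> \<in> C_inf M" by (rule Sec_closed(6)[OF P conjunct1[OF \<rho>D]])
  have UP: "U \<subseteq> points M" by (rule opn_subset_points[OF U(1)])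
  have O': "opn O'" "O' \<subseteq> U" "O' \<subseteq> points M" using \<rho>D U UP by auto
  have fS: "f \<in> Sec U" using f U by simp
  let ?\<rho> = "res M (points M) U \<rho>"
  have \<rho>U: "?\<rho> \<in> Sec U" by (rule res_closed[OF P U(1) UP \<rho>S])
  let ?h = "?\<rho> \<otimes>\<^bsub>sheaf M U\<^esub> f"
  have h: "?h \<in> Sec U" using U fS \<rho>U by simp
  have \<rho>e: "ev I U ?\<rho> m = ev I (points M) \<rho> m" if "m \<in> U" for m I
    by (rule ev_res[OF P U(1) UP that \<rho>S])
  have \<rho>0: "ev {0} (points M) \<rho> m = 0" if "m \<in> U" for m
    using ev_even[OF P] \<rho>D UP that by blast
  obtain f' where f': "f' \<in> C_inf M" "res M (points M) U f' = ?h"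
    "\<And>I m. I \<in> {{}, {0}} \<Longrightarrow> m \<in> points M - K \<Longrightarrow> ev I (points M) f' m = 0"
  proof (rule ext_fun[OF U(1) _ U(2) h])
    show "closedin (base M) K" using \<rho>D by blast
    show "ev {} U ?h m = 0" "ev {0} U ?h m = 0" if "m \<in> U - K" for m
      using that \<rho>D UP \<rho>0 by (auto simp: ev_mult0[OF U(1) _ \<rho>U fS] ev_mult1[OF U(1) _ \<rho>U fS] \<rho>e)
  qed (rule that)
  have f'e: "ev I (points M) f' m = ev I U ?h m" if "m \<in> U" for m I
    using ev_res[OF P U(1) UP that f'(1), of I] f'(2) by simp
  have hp: "?h \<in> part (sheaf M U) p"
    using part_ops(5)[OF U(1) res_part[OF P U(1) UP] f, of \<rho> 0] \<rho>D by simp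
  have "f' \<in> part (sheaf M (points M)) p"
  proof -
    have out: "ev {} (points M) f' m = 0" "ev {0} (points M) f' m = 0" if "m \<in> points M" "m \<notin> U" for m
      using f'(3)[of _ m] that U by auto
    show ?thesis
    proof (cases p)
      case zero
      have "ev {0} (points M) f' m = 0" if "m \<in> points M" for m
        using out[OF that] f'e[of m "{0}"] ev_even[OF U(1), of m ?h] hp zero by (cases "m \<in> U") auto
      then show ?thesis using even_iff[OF P f'(1)] zero by simp
    next
      case one
      have "ev {} (points M) f' m = 0" if "m \<in> points M" for m
        using out[OF that] f'e[of m "{}"] ev_odd[OF U(1), of m ?h] hp one by (cases "m \<in> U") auto
      then show ?thesis using odd_iff[OF P f'(1)] one by simp
    qed
  qed
  moreover have "res M (points M) O' f' = res M U O' f"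
  proof (rule ev_eqI[OF O'(1)])
    fix m assume m: "m \<in> O'"
    then have mU: "m \<in> U" using O' by blast
    have \<rho>1: "ev {} (points M) \<rho> m = 1" using \<rho>D m by blast
    show "ev {} O' (res M (points M) O' f') m = ev {} O' (res M U O' f) m"
      using ev_res[OF P O'(1,3) m f'(1)] ev_res[OF U(1) O'(1,2) m fS] f'e[OF mU] \<rho>1 mU
      by (simp add: ev_mult0[OF U(1) _ \<rho>U fS] \<rho>e)
    show "ev {0} O' (res M (points M) O' f') m = ev {0} O' (res M U O' f) m"
      using ev_res[OF P O'(1,3) m f'(1)] ev_res[OF U(1) O'(1,2) m fS] f'e[OF mU] \<rho>1 \<rho>0[OF mU] mU
      by (simp add: ev_mult1[OF U(1) _ \<rho>U fS] \<rho>e)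
  qed (use res_closed[OF P O'(1,3) f'(1)] res_closed[OF U(1) O'(1,2) fS] in auto)
  ultimately show ?thesis by (rule that)
qed

text \<open>Glues \<open>\<rho> X\<close> on \<open>U\<close> with zero off \<open>K\<close>. Sets
  inside \<open>U\<close> that miss \<open>K\<close> fall under both descriptions, which agree
  because \<open>\<rho>\<close> vanishes there.\<close>

lemma extend_vf:
  assumes \<rho>: "cutoff \<rho> O' K" and U: "opn U" "K \<subseteq> U" and X: "X \<in> vf_part M U p"
  obtains X' where "X' \<in> Vect_part M p" "vf_res M O' X' = vf_res M O' X"
proof -
  have P: "opn (points M)" by simp
  note \<rho>D = \<rho>[unfolded cutoff_def]
  have \<rho>S: "\<rho> \<in> C_inf M" by (rule Sec_closed(6)[OF P conjunct1[OF \<rho>D]])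
  have UP: "U \<subseteq> points M" by (rule opn_subset_points[OF U(1)])
  have O': "opn O'" "O' \<subseteq> U" "O' \<subseteq> points M" using \<rho>D U UP by auto
  let ?\<S> = "{W. opn W \<and> (W \<subseteq> U \<or> W \<inter> K = {})}"
  define F where "F W f = (if W \<subseteq> U then res M (points M) W \<rho> \<otimes>\<^bsub>sheaf M W\<^esub> X W f else \<zero>\<^bsub>sheaf M W\<^esub>)" for W f
  let ?Y = "vf_smult M U (res M (points M) U \<rho>) X"
  have Y: "?Y \<in> vf_part M U p"
    using vf_smult_even[OF U(1) res_part[OF P U(1) UP] X] \<rho>D by blast
  have Yeq: "?Y W f = F W f" if "opn W" "W \<subseteq> U" "f \<in> Sec W" for W f
    using that res_trans[OF P U(1) UP that(1,2) \<rho>S] by (simp add: F_def vf_smult_eq)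
  have "\<exists>X'\<in>Vect_part M p. \<forall>W\<in>?\<S>. \<forall>f\<in>Sec W. X' W f = F W f"
  proof (rule vf_glue)
    have "points M - K \<in> ?\<S>" using \<rho>D by blast
    moreover have "U \<in> ?\<S>" using U by blast
    ultimately show "\<Union>?\<S> = points M" using U(2) opn_subset_points by blast
    fix W assume W: "W \<in> ?\<S>"
    show "\<exists>X'\<in>vf_part M W p. \<forall>W' f. opn W' \<longrightarrow> W' \<subseteq> W \<longrightarrow> f \<in> Sec W' \<longrightarrow> F W' f = X' W' f"
    proof (cases "W \<subseteq> U")
      case True
      show ?thesis
      proof (intro bexI allI impI)
        show "vf_res M W ?Y \<in> vf_part M W p" using vf_res_part[OF U(1) _ True Y] W by blast
        fix W' f assume "opn W'" "W' \<subseteq> W" "f \<in> Sec W'"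
        then show "F W' f = vf_res M W ?Y W' f" using Yeq[of W' f] True by (simp add: vf_res_eq)
      qed
    next
      case False
      then have WK: "W \<inter> K = {}" "opn W" using W by auto
      show ?thesis
      proof (intro bexI allI impI)
        show "vf_zero M W \<in> vf_part M W p" by (rule vf_zero_part[OF WK(2)])
        fix W' f assume W': "opn W'" "W' \<subseteq> W" and f: "f \<in> Sec W'"
        have W'P: "W' \<subseteq> points M" by (rule opn_subset_points[OF W'(1)])
        have c: "res M (points M) W' \<rho> \<in> Sec W'" by (rule res_closed[OF P W'(1) W'P \<rho>S])
        have z: "ev {} W' (res M (points M) W' \<rho>) m = 0" "ev {0} W' (res M (points M) W' \<rho>) m = 0" if "m \<in> W'" for m
        proof -
          have "m \<in> points M - K" using WK(1) W' W'P that by blast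
          then show "ev {} W' (res M (points M) W' \<rho>) m = 0" "ev {0} W' (res M (points M) W' \<rho>) m = 0"
            using ev_res[OF P W'(1) W'P that \<rho>S] \<rho>D ev_even[OF P _ conjunct1[OF \<rho>D], of m] by auto
        qed
        have "F W' f = \<zero>\<^bsub>sheaf M W'\<^esub>"
        proof (cases "W' \<subseteq> U")
          case True
          have Xf: "X W' f \<in> Sec W'" by (rule vf_part_closed[OF X W'(1) True f])
          show ?thesis
            by (rule ev_eq_zeroI[OF W'(1)])
              (use True W' c Xf z in \<open>auto simp: F_def ev_mult0[OF W'(1) _ c Xf] ev_mult1[OF W'(1) _ c Xf]\<close>)
        qed (simp add: F_def)
        then show "F W' f = vf_zero M W W' f" using W' f by (simp add: vf_zero_eq)
      qed
    qed
  qed auto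
  then obtain X' where X': "X' \<in> Vect_part M p" "\<And>W f. opn W \<Longrightarrow> W \<subseteq> U \<Longrightarrow> f \<in> Sec W \<Longrightarrow> X' W f = F W f"
    by blast
  have "vf_res M O' X' = vf_res M O' X"
  proof (rule on_opens_eqI[OF vf_ops_on(4) vf_ops_on(4)])
    fix W f assume W: "opn W" "W \<subseteq> O'" and f: "f \<in> Sec W"
    have WU: "W \<subseteq> U" "W \<subseteq> points M" using W O' by auto
    have c: "res M (points M) W \<rho> \<in> Sec W" by (rule res_closed[OF P W(1) WU(2) \<rho>S])
    have z: "ev {} W (res M (points M) W \<rho>) m = 1" "ev {0} W (res M (points M) W \<rho>) m = 0" if "m \<in> W" for m
      using ev_res[OF P W(1) WU(2) that \<rho>S] \<rho>D W WU that ev_even[OF P _ conjunct1[OF \<rho>D]] by auto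
    have Xf: "X W f \<in> Sec W" by (rule vf_part_closed[OF X W(1) WU(1) f])
    have "X' W f = X W f"
      by (rule ev_eqI[OF W(1)])
        (use W WU f c Xf z in \<open>auto simp: X'(2) F_def ev_mult0[OF W(1) _ c Xf] ev_mult1[OF W(1) _ c Xf]\<close>)
    then show "vf_res M O' X' W f = vf_res M O' X W f" using W f by (simp add: vf_res_eq)
  qed
  with X'(1) show ?thesis by (rule that)
qed

end

section \<open>Vector fields in a chart\<close>

lemma partial_add:
  assumes "f differentiable (at x)" "h differentiable (at x)"
  shows "partial i (\<lambda>x. f x + h x) x = partial i f x + partial i h x"
  using partial_eq[OF has_derivative_add[OF frechet_derivative_works[THEN iffD1, OF assms(1)] frechet_derivative_works[THEN iffD1, OF assms(2)]], of i]
  by (simp add: partial_def)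

lemma partial_mult:
  assumes "f differentiable (at x)" "h differentiable (at x)"
  shows "partial i (\<lambda>x. f x * h x) x = f x * partial i h x + partial i f x * h x"
  using partial_eq[OF has_derivative_mult[OF frechet_derivative_works[THEN iffD1, OF assms(1)] frechet_derivative_works[THEN iffD1, OF assms(2)]], of i]
  by (simp add: partial_def)

lemma partial_const: "partial i (\<lambda>x. c) x = 0"
proof -
  have "((\<lambda>x. c) has_derivative (\<lambda>v. 0)) (at x)" by simp
  from partial_eq[OF this, of i] show ?thesis by simp
qed

lemma partial_cmult:
  assumes "f differentiable (at x)"
  shows "partial i (\<lambda>x. c * f x) x = c * partial i f x"
proof -
  have "(\<lambda>x. c) differentiable (at x)" by simp
  from partial_mult[OF this assms, of i] show ?thesis by (simp add: partial_const)
qed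

lemma partial_component: "partial i (\<lambda>x. x $ j) a = (if i = j then 1 else 0)"
  using partial_eq[OF bounded_linear_imp_has_derivative[OF bounded_linear_vec_nth, of j], of i]
  by (simp add: axis_def)

context sheaf_space
begin

text \<open>A fold over a list, because the addition belongs to an algebra that varies with
  \<open>W\<close>.\<close>

definition rsum :: "'a set \<Rightarrow> ('b \<Rightarrow> 's) \<Rightarrow> 'b list \<Rightarrow> 's" where
  "rsum W h xs = foldr (\<lambda>i a. h i \<oplus>\<^bsub>sheaf M W\<^esub> a) xs \<zero>\<^bsub>sheaf M W\<^esub>"

definition lsum :: "'a set \<Rightarrow> ('b \<Rightarrow> ('a, 's) vf) \<Rightarrow> 'b list \<Rightarrow> ('a, 's) vf" where
  "lsum U F xs = foldr (\<lambda>i. vf_add M U (F i)) xs (vf_zero M U)"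

lemma rsum_closed [simp]: "opn W \<Longrightarrow> (\<And>i. i \<in> set xs \<Longrightarrow> h i \<in> Sec W) \<Longrightarrow> rsum W h xs \<in> Sec W"
  by (induction xs) (simp_all add: rsum_def)

lemma lsum_eq: "opn W \<Longrightarrow> W \<subseteq> U \<Longrightarrow> f \<in> Sec W \<Longrightarrow> lsum U F xs W f = rsum W (\<lambda>i. F i W f) xs"
  by (induction xs) (simp_all add: lsum_def rsum_def vf_ops_eq)

end

context smfd
begin

lemma lsum_part: "opn U \<Longrightarrow> (\<And>i. i \<in> set xs \<Longrightarrow> F i \<in> vf_part M U p) \<Longrightarrow> lsum U F xs \<in> vf_part M U p"
  by (induction xs) (simp_all add: lsum_def vf_zero_part vf_add_part)

lemma lsum_vf: "opn U \<Longrightarrow> (\<And>i. i \<in> set xs \<Longrightarrow> F i \<in> vf M U) \<Longrightarrow> lsum U F xs \<in> vf M U"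
  by (induction xs) (simp_all add: lsum_def vf_zero_vf vf_add_vf)

end

locale smfd_chart = smfd M N + schart M U V \<phi> \<Phi>
  for M :: "('a, 's) superspace" and N :: "'n::finite itself" and U and V :: "(real^'n) set" and \<phi> \<Phi>
begin

lemma cc_zero:
  assumes "opn W" "m \<in> W" "m \<in> U"
  shows "cc {} W \<zero>\<^bsub>sheaf M W\<^esub> m = 0" "cc {0} W \<zero>\<^bsub>sheaf M W\<^esub> m = 0"
  using assms by (simp_all add: cc_even cc_odd part_ops)

lemmas cc_simps = cc_ops cc_smult cc_one cc_res cc_zero

lemma cc_rsum:
  assumes "opn W" "m \<in> W" "m \<in> U" "\<And>i. i \<in> set xs \<Longrightarrow> h i \<in> Sec W" "J \<in> {{}, {0}}"
  shows "cc J W (rsum W h xs) m = (\<Sum>i\<leftarrow>xs. cc J W (h i) m)"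
  using assms(4)
proof (induction xs)
  case Nil
  then show ?case using cc_zero[OF assms(1-3)] assms(5) by (auto simp: rsum_def)
next
  case (Cons x xs)
  have "rsum W h xs \<in> Sec W" using Cons.prems by (intro rsum_closed assms(1)) auto
  then show ?case using Cons cc_ops(1)[OF assms(1-3), of "h x" "rsum W h xs" J] by (simp add: rsum_def)
qed

lemma cc_vf_eqI:
  assumes W: "opn W" "W \<subseteq> U" and X: "X \<in> vf M W" and Y: "Y \<in> vf M W"
    and e: "\<And>W' f m J. opn W' \<Longrightarrow> W' \<subseteq> W \<Longrightarrow> f \<in> Sec W' \<Longrightarrow> m \<in> W' \<Longrightarrow> J \<in> {{}, {0}} \<Longrightarrow>
      cc J W' (X W' f) m = cc J W' (Y W' f) m"
  shows "X = Y"
proof (rule on_opens_eqI[OF vf_on[OF X] vf_on[OF Y]])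
  fix W' f assume W': "opn W'" "W' \<subseteq> W" and f: "f \<in> Sec W'"
  show "X W' f = Y W' f"
    by (rule cc_eqI[OF W'(1) _ vf_closed[OF X W' f] vf_closed[OF Y W' f]]) (use W' W f e in auto)
qed

abbreviation bd :: "'a set \<Rightarrow> (real^'n \<Rightarrow> real) \<Rightarrow> 's" where
  "bd W a \<equiv> sec W a (\<lambda>_. 0)"

definition co :: "'n \<Rightarrow> 'a set \<Rightarrow> 's" where "co i W = bd W (\<lambda>x. x $ i)"

definition tau :: "'a set \<Rightarrow> 's" where "tau W = sec W (\<lambda>_. 0) (\<lambda>_. 1)"

lemma bd_props:
  assumes W: "opn W" "W \<subseteq> U" and a: "smooth (\<phi> ` W) a"
  shows bd_closed: "bd W a \<in> Sec W" and bd_even: "bd W a \<in> part (sheaf M W) 0"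
    and cc_bd: "\<And>m. m \<in> W \<Longrightarrow> cc {} W (bd W a) m = a (\<phi> m)" "\<And>m. m \<in> W \<Longrightarrow> cc {0} W (bd W a) m = 0"
  using sec_closed[OF W a smooth_const] sec_even[OF W a smooth_const] cc_sec[OF W a smooth_const] by simp_all

lemma tau_props:
  assumes W: "opn W" "W \<subseteq> U"
  shows tau_closed: "tau W \<in> Sec W" and tau_odd: "tau W \<in> part (sheaf M W) 1"
    and cc_tau: "\<And>m. m \<in> W \<Longrightarrow> cc {} W (tau W) m = 0" "\<And>m. m \<in> W \<Longrightarrow> cc {0} W (tau W) m = 1"
  using sec_closed[OF W smooth_const smooth_const] sec_odd[OF W smooth_const smooth_const]
    cc_sec[OF W smooth_const smooth_const] by (simp_all add: tau_def)

lemma co_props: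
  assumes W: "opn W" "W \<subseteq> U"
  shows co_closed: "co i W \<in> Sec W" and co_even: "co i W \<in> part (sheaf M W) 0"
    and cc_co: "\<And>m. m \<in> W \<Longrightarrow> cc {} W (co i W) m = \<phi> m $ i" "\<And>m. m \<in> W \<Longrightarrow> cc {0} W (co i W) m = 0"
  using bd_closed[OF W smooth_component] bd_even[OF W smooth_component] cc_bd[OF W smooth_component]
  by (simp_all add: co_def)

lemma res_bd:
  assumes W: "opn W" "W \<subseteq> U" "opn W'" "W' \<subseteq> W" and a: "smooth (\<phi> ` W) a"
  shows "res M W W' (bd W a) = bd W' a"
proof -
  have W'U: "W' \<subseteq> U" using W by blast
  have a': "smooth (\<phi> ` W') a" using smooth_subset[OF a] W by blast
  show ?thesis
    by (rule cc_eqI[OF W(3) W'U res_closed[OF W(1,3,4) bd_closed[OF W(1,2) a]] bd_closed[OF W(3) W'U a']])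
      (use W W'U in \<open>auto simp: cc_res[OF W(1,3,4) _ _ bd_closed[OF W(1,2) a]] cc_bd[OF W(1,2) a]
          cc_bd[OF W(3) W'U a'] subset_iff\<close>)
qed

lemma res_tau:
  assumes W: "opn W" "W \<subseteq> U" "opn W'" "W' \<subseteq> W"
  shows "res M W W' (tau W) = tau W'"
proof -
  have W'U: "W' \<subseteq> U" using W by blast
  show ?thesis
    by (rule cc_eqI[OF W(3) W'U res_closed[OF W(1,3,4) tau_closed[OF W(1,2)]] tau_closed[OF W(3) W'U]])
      (use W W'U in \<open>auto simp: cc_res[OF W(1,3,4) _ _ tau_closed[OF W(1,2)]] cc_tau[OF W(1,2)]
          cc_tau[OF W(3) W'U] subset_iff\<close>)
qed

lemma res_co: "opn W \<Longrightarrow> W \<subseteq> U \<Longrightarrow> opn W' \<Longrightarrow> W' \<subseteq> W \<Longrightarrow> res M W W' (co i W) = co i W'"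
  unfolding co_def by (rule res_bd[OF _ _ _ _ smooth_component])

lemma bd_cong: "(\<And>x. x \<in> \<phi> ` W \<Longrightarrow> a x = b x) \<Longrightarrow> bd W a = bd W b"
proof -
  assume "\<And>x. x \<in> \<phi> ` W \<Longrightarrow> a x = b x"
  then have "SF_make (\<phi> ` W) a (\<lambda>_. 0) = SF_make (\<phi> ` W) b (\<lambda>_. 0)"
    by (intro ext) (simp add: SF_make_def)
  then show ?thesis by (simp add: sec_def)
qed

lemma ball_nbhd:
  assumes W: "opn W" "W \<subseteq> U" "m \<in> W"
  obtains r W' where "r > 0" "opn W'" "m \<in> W'" "W' \<subseteq> W" "\<phi> ` W' = ball (\<phi> m) r"
proof -
  obtain r where r: "r > 0" "ball (\<phi> m) r \<subseteq> \<phi> ` W"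
    using open_image[OF W(1,2)] W(3) unfolding open_contains_ball by blast
  let ?W' = "W \<inter> {x \<in> U. \<phi> x \<in> ball (\<phi> m) r}"
  have "\<phi> ` ?W' = ball (\<phi> m) r" using r(2) W(2) by blast
  moreover have "opn ?W'" using W(1) opn_preimage[of "ball (\<phi> m) r"] by blast
  moreover have "m \<in> ?W'" using W r(1) by auto
  ultimately show ?thesis using that[OF r(1), of ?W'] by blast
qed

text \<open>A functional that is a derivation at \<open>m\<close> on even functions is a combination of partial derivatives;
  it is applied to the components of vector fields and to tangent vectors.\<close>

lemma derivation_formula:
  assumes W: "opn W" "W \<subseteq> U" "m \<in> W" and a: "smooth (\<phi> ` W) a"
    and res: "\<And>W' f. opn W' \<Longrightarrow> W' \<subseteq> W \<Longrightarrow> m \<in> W' \<Longrightarrow> f \<in> Sec W \<Longrightarrow> L W' (res M W W' f) = (L W f :: real)"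
    and add: "\<And>W' f h. opn W' \<Longrightarrow> W' \<subseteq> W \<Longrightarrow> m \<in> W' \<Longrightarrow> f \<in> Sec W' \<Longrightarrow> h \<in> Sec W' \<Longrightarrow>
      L W' (f \<oplus>\<^bsub>sheaf M W'\<^esub> h) = L W' f + L W' h"
    and smult: "\<And>W' f c. opn W' \<Longrightarrow> W' \<subseteq> W \<Longrightarrow> m \<in> W' \<Longrightarrow> f \<in> Sec W' \<Longrightarrow>
      L W' (c \<odot>\<^bsub>sheaf M W'\<^esub> f) = c * L W' f"
    and leibniz: "\<And>W' f h. opn W' \<Longrightarrow> W' \<subseteq> W \<Longrightarrow> m \<in> W' \<Longrightarrow> f \<in> part (sheaf M W') 0 \<Longrightarrow> h \<in> part (sheaf M W') 0 \<Longrightarrow>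
      L W' (f \<otimes>\<^bsub>sheaf M W'\<^esub> h) = L W' f * cc {} W' h m + cc {} W' f m * L W' h"
  shows "L W (bd W a) = (\<Sum>i\<in>UNIV. L W (co i W) * partial i a (\<phi> m))"
proof -
  \<comment> \<open>\<open>point_derivation\<close> rests on Hadamard's lemma and needs a ball
    around the point; the assumption \<open>res\<close> carries the result back to
    \<open>W\<close>.\<close>
  obtain r W' where r: "r > 0" and W': "opn W'" "m \<in> W'" "W' \<subseteq> W" "\<phi> ` W' = ball (\<phi> m) r"
    using ball_nbhd[OF W] by blast
  have W'U: "W' \<subseteq> U" using W W' by blast
  let ?B = "ball (\<phi> m) r"
  have b: "bd W' f \<in> Sec W'" "bd W' f \<in> part (sheaf M W') 0" "\<And>x. x \<in> W' \<Longrightarrow> cc {} W' (bd W' f) x = f (\<phi> x)"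
    "\<And>x. x \<in> W' \<Longrightarrow> cc {0} W' (bd W' f) x = 0"
    if "smooth ?B f" for f
    using bd_props[OF W'(1) W'U, of f] that by (simp_all add: W'(4))
  have sB: "smooth ?B f \<Longrightarrow> smooth ?B h \<Longrightarrow> smooth ?B (\<lambda>x. f x + h x)" "smooth ?B f \<Longrightarrow> smooth ?B (\<lambda>x. c * f x)"
    "smooth ?B f \<Longrightarrow> smooth ?B h \<Longrightarrow> smooth ?B (\<lambda>x. f x * h x)" for f h c
    by (auto intro: smooth_add smooth_cmult smooth_mult)
  have a': "smooth ?B a" using smooth_subset[OF a] W'(3,4) by (metis image_mono)
  have "L W' (bd W' a) = (\<Sum>i\<in>UNIV. L W' (bd W' (\<lambda>x. x $ i)) * partial i a (\<phi> m))"
  proof (rule point_derivation[OF r a', where L = "\<lambda>f. L W' (bd W' f)"])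
    show "L W' (bd W' f) = L W' (bd W' h)" if "\<And>x. x \<in> ?B \<Longrightarrow> f x = h x" for f h
      using bd_cong[of W' f h] that W'(4) by simp
    show "L W' (bd W' (\<lambda>x. f x + h x)) = L W' (bd W' f) + L W' (bd W' h)" if f: "smooth ?B f" and h: "smooth ?B h" for f h
    proof -
      have "bd W' (\<lambda>x. f x + h x) = bd W' f \<oplus>\<^bsub>sheaf M W'\<^esub> bd W' h"
        by (rule cc_eqI[OF W'(1) W'U]) (use W'(1) W'U b[OF f] b[OF h] b[OF sB(1)[OF f h]] in \<open>auto simp: cc_ops(1) subset_iff\<close>)
      then show ?thesis using add[OF W'(1,3,2) b(1)[OF f] b(1)[OF h]] by simp
    qed
    show "L W' (bd W' (\<lambda>x. c * f x)) = c * L W' (bd W' f)" if f: "smooth ?B f" for c f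
    proof -
      have "bd W' (\<lambda>x. c * f x) = c \<odot>\<^bsub>sheaf M W'\<^esub> bd W' f"
        by (rule cc_eqI[OF W'(1) W'U]) (use W'(1) W'U b[OF f] b[OF sB(2)[OF f]] in \<open>auto simp: cc_smult subset_iff\<close>)
      then show ?thesis using smult[OF W'(1,3,2) b(1)[OF f]] by simp
    qed
    show "L W' (bd W' (\<lambda>x. f x * h x)) = L W' (bd W' f) * h (\<phi> m) + f (\<phi> m) * L W' (bd W' h)"
      if f: "smooth ?B f" and h: "smooth ?B h" for f h
    proof -
      have "bd W' (\<lambda>x. f x * h x) = bd W' f \<otimes>\<^bsub>sheaf M W'\<^esub> bd W' h"
        by (rule cc_eqI[OF W'(1) W'U]) (use W'(1) W'U b[OF f] b[OF h] b[OF sB(3)[OF f h]] in \<open>auto simp: cc_ops subset_iff\<close>)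
      then show ?thesis using leibniz[OF W'(1,3,2) b(2)[OF f] b(2)[OF h]] b(3)[OF f W'(2)] b(3)[OF h W'(2)] by simp
    qed
  qed
  then show ?thesis
    using res[OF W'(1,3,2) bd_closed[OF W(1,2) a]] res[OF W'(1,3,2) co_closed[OF W(1,2)]]
      res_bd[OF W(1,2) W'(1,3) a] res_co[OF W(1,2) W'(1,3)] by (simp add: co_def)
qed

text \<open>The expansion in the odd coordinate, with \<open>tau\<close> on the left so that the
  Leibniz rule differentiates it first.\<close>

lemma section_decomp:
  assumes W: "opn W" "W \<subseteq> U" and f: "f \<in> Sec W"
  shows "f = bd W (rep W f {}) \<oplus>\<^bsub>sheaf M W\<^esub> tau W \<otimes>\<^bsub>sheaf M W\<^esub> bd W (rep W f {0})"
proof -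
  note s = bd_props[OF W smooth_rep[OF W f]] tau_props[OF W]
  show ?thesis
    by (rule cc_eqI[OF W f]) (use W s in \<open>auto simp: cc_ops cc_rep[OF W f] subset_iff\<close>)
qed

text \<open>A vector field is determined by its values on the coordinates: expand \<open>f\<close>
  in \<open>tau\<close>, apply the Leibniz rule to the product, and treat the remaining even
  functions with \<open>derivation_formula\<close>, once for each component of the result.\<close>

lemma vf_part_formula:
  assumes W: "opn W" "W \<subseteq> U" "m \<in> W" and Y: "Y \<in> vf_part M W p" and f: "f \<in> Sec W"
  shows "cc {} W (Y W f) m = (\<Sum>i\<in>UNIV. cc {} W (Y W (co i W)) m * partial i (rep W f {}) (\<phi> m)) +
      cc {} W (Y W (tau W)) m * cc {0} W f m"
    "cc {0} W (Y W f) m = (\<Sum>i\<in>UNIV. cc {0} W (Y W (co i W)) m * partial i (rep W f {}) (\<phi> m)) +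
      (\<Sum>i\<in>UNIV. cc {} W (Y W (co i W)) m * partial i (rep W f {0}) (\<phi> m)) + cc {0} W (Y W (tau W)) m * cc {0} W f m"
proof -
  have mU: "m \<in> U" using W by blast
  note D = vf_partD[OF Y]
  have body: "cc J W (Y W (bd W a)) m = (\<Sum>i\<in>UNIV. cc J W (Y W (co i W)) m * partial i a (\<phi> m))"
    if a: "smooth (\<phi> ` W) a" and J: "J \<in> {{}, {0}}" for a J
  proof (rule derivation_formula[OF W a, where L = "\<lambda>W f. cc J W (Y W f) m"])
    fix W' assume W': "opn W'" "W' \<subseteq> W" "m \<in> W'"
    show "\<And>f. f \<in> Sec W \<Longrightarrow> cc J W' (Y W' (res M W W' f)) m = cc J W (Y W f) m"
      using W W' D(2,7) mU by (simp add: cc_res)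
    show "\<And>f h. f \<in> Sec W' \<Longrightarrow> h \<in> Sec W' \<Longrightarrow> cc J W' (Y W' (f \<oplus>\<^bsub>sheaf M W'\<^esub> h)) m = cc J W' (Y W' f) m + cc J W' (Y W' h) m"
      using W' D(2,3) mU by (simp add: cc_ops)
    show "\<And>f c. f \<in> Sec W' \<Longrightarrow> cc J W' (Y W' (c \<odot>\<^bsub>sheaf M W'\<^esub> f)) m = c * cc J W' (Y W' f) m"
      using W' D(2,4) mU by (simp add: cc_smult)
    fix f h assume fh: "f \<in> part (sheaf M W') 0" "h \<in> part (sheaf M W') 0"
    have S: "f \<in> Sec W'" "h \<in> Sec W'" using fh W' by auto
    show "cc J W' (Y W' (f \<otimes>\<^bsub>sheaf M W'\<^esub> h)) m = cc J W' (Y W' f) m * cc {} W' h m + cc {} W' f m * cc J W' (Y W' h) m"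
      using J W' S D(2)[OF W'(1,2)] mU D(6)[OF W'(1,2) fh(1) S(2)] cc_even[OF W'(1,3) mU] fh
      by (auto simp: cc_ops cc_smult)
  qed
  let ?a = "rep W f {}" and ?b = "rep W f {0}"
  note sa = smooth_rep[OF W(1,2) f, of "{}"] and sb = smooth_rep[OF W(1,2) f, of "{0}"]
  note a = bd_props[OF W(1,2) sa] and b = bd_props[OF W(1,2) sb] and t = tau_props[OF W(1,2)]
  have Wr: "W \<subseteq> W" by simp
  note cl = D(2)[OF W(1) Wr]
  have "Y W f = Y W (bd W ?a \<oplus>\<^bsub>sheaf M W\<^esub> tau W \<otimes>\<^bsub>sheaf M W\<^esub> bd W ?b)"
    using section_decomp[OF W(1,2) f] by (rule arg_cong)
  also have "\<dots> = Y W (bd W ?a) \<oplus>\<^bsub>sheaf M W\<^esub> (Y W (tau W) \<otimes>\<^bsub>sheaf M W\<^esub> bd W ?b \<oplus>\<^bsub>sheaf M W\<^esub>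
      koszul p 1 \<odot>\<^bsub>sheaf M W\<^esub> (tau W \<otimes>\<^bsub>sheaf M W\<^esub> Y W (bd W ?b)))"
    using a(1) b(1) t(1) W(1) by (simp add: D(3)[OF W(1) Wr] D(6)[OF W(1) Wr t(2) b(1)])
  finally have Yf: "Y W f = Y W (bd W ?a) \<oplus>\<^bsub>sheaf M W\<^esub> (Y W (tau W) \<otimes>\<^bsub>sheaf M W\<^esub> bd W ?b \<oplus>\<^bsub>sheaf M W\<^esub>
      koszul p 1 \<odot>\<^bsub>sheaf M W\<^esub> (tau W \<otimes>\<^bsub>sheaf M W\<^esub> Y W (bd W ?b)))" .
  have J: "cc J W (Y W f) m = cc J W (Y W (bd W ?a)) m + (cc J W (Y W (tau W) \<otimes>\<^bsub>sheaf M W\<^esub> bd W ?b) m +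
      koszul p 1 * cc J W (tau W \<otimes>\<^bsub>sheaf M W\<^esub> Y W (bd W ?b)) m)" for J
    unfolding Yf using W mU cl a(1) b(1) t(1) by (simp add: cc_ops(1) cc_smult)
  have fm: "cc {0} W f m = ?b (\<phi> m)" by (rule cc_rep[OF W(1,2) f])
  show "cc {} W (Y W f) m = (\<Sum>i\<in>UNIV. cc {} W (Y W (co i W)) m * partial i ?a (\<phi> m)) +
      cc {} W (Y W (tau W)) m * cc {0} W f m"
    using J[of "{}"] body[OF sa, of "{}"] W mU cl a(1) b(1) t b(3)[OF W(3)] fm by (simp add: cc_ops)
  \<comment> \<open>The sign is \<open>-1\<close> only for odd \<open>Y\<close>. Then
    \<open>Y\<close> maps even functions to odd ones, whose first components vanish, so the sign has
    no effect.\<close>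
  have k: "koszul p 1 * cc {} W (Y W (bd W ?b)) m = (\<Sum>i\<in>UNIV. cc {} W (Y W (co i W)) m * partial i ?b (\<phi> m))"
  proof (cases p)
    case zero
    then show ?thesis using body[OF sb, of "{}"] by simp
  next
    case one
    have "cc {} W (Y W (co i W)) m = 0" for i
      using cc_odd[OF W(1,3) mU] D(5)[OF W(1) Wr co_even[OF W(1,2)], of i] one by simp
    then show ?thesis using body[OF sb, of "{}"] by simp
  qed
  show "cc {0} W (Y W f) m = (\<Sum>i\<in>UNIV. cc {0} W (Y W (co i W)) m * partial i ?a (\<phi> m)) +
      (\<Sum>i\<in>UNIV. cc {} W (Y W (co i W)) m * partial i ?b (\<phi> m)) + cc {0} W (Y W (tau W)) m * cc {0} W f m"
    using J[of "{0}"] body[OF sa, of "{0}"] k W mU cl a(1) b t fm by (simp add: cc_ops)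
qed

text \<open>The formula for homogeneous fields is free of signs, so it adds up over the even and the
  odd part.\<close>

lemma vf_formula:
  assumes W: "opn W" "W \<subseteq> U" "m \<in> W" and Y: "Y \<in> vf M W" and f: "f \<in> Sec W"
  shows "cc {} W (Y W f) m = (\<Sum>i\<in>UNIV. cc {} W (Y W (co i W)) m * partial i (rep W f {}) (\<phi> m)) +
      cc {} W (Y W (tau W)) m * cc {0} W f m"
    "cc {0} W (Y W f) m = (\<Sum>i\<in>UNIV. cc {0} W (Y W (co i W)) m * partial i (rep W f {}) (\<phi> m)) +
      (\<Sum>i\<in>UNIV. cc {} W (Y W (co i W)) m * partial i (rep W f {0}) (\<phi> m)) + cc {0} W (Y W (tau W)) m * cc {0} W f m"
proof -
  obtain A B where A: "A \<in> vf_part M W 0" and B: "B \<in> vf_part M W 1" and Ye: "Y = vf_add M W A B"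
    using Y by (rule vfE)
  have mU: "m \<in> U" using W by blast
  have s: "cc J W (Y W h) m = cc J W (A W h) m + cc J W (B W h) m" if "h \<in> Sec W" for J h
    using that W mU vf_part_closed[OF A] vf_part_closed[OF B] by (simp add: Ye vf_add_eq cc_ops(1))
  note s' = s[OF f] s[OF co_closed[OF W(1,2)]] s[OF tau_closed[OF W(1,2)]]
  show "cc {} W (Y W f) m = (\<Sum>i\<in>UNIV. cc {} W (Y W (co i W)) m * partial i (rep W f {}) (\<phi> m)) +
      cc {} W (Y W (tau W)) m * cc {0} W f m"
    using vf_part_formula(1)[OF W A f] vf_part_formula(1)[OF W B f]
    by (simp add: s' sum.distrib algebra_simps)
  show "cc {0} W (Y W f) m = (\<Sum>i\<in>UNIV. cc {0} W (Y W (co i W)) m * partial i (rep W f {}) (\<phi> m)) +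
      (\<Sum>i\<in>UNIV. cc {} W (Y W (co i W)) m * partial i (rep W f {0}) (\<phi> m)) + cc {0} W (Y W (tau W)) m * cc {0} W f m"
    using vf_part_formula(2)[OF W A f] vf_part_formula(2)[OF W B f]
    by (simp add: s' sum.distrib algebra_simps)
qed

end

section \<open>Metrics\<close>

lemma (in super_alg) one_smult: "a \<in> carrier A \<Longrightarrow> 1 \<odot> a = a"
  using real.smult_one by (simp add: real_ring_def)

locale metric_mfd = smfd M N for M :: "('a, 's) superspace" and N :: "'n::finite itself" +
  fixes g :: "('a, 's) pairing"
  assumes metric: "metric M g"
begin

lemma metricD:
  assumes U: "opn U"
  shows g_closed: "X \<in> vf M U \<Longrightarrow> Y \<in> vf M U \<Longrightarrow> g U X Y \<in> Sec U"
    and g_linear: "X \<in> vf M U \<Longrightarrow> Y \<in> vf M U \<Longrightarrow> Z \<in> vf M U \<Longrightarrow> f \<in> Sec U \<Longrightarrow>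
      g U (vf_add M U (vf_smult M U f X) Y) Z = f \<otimes>\<^bsub>sheaf M U\<^esub> g U X Z \<oplus>\<^bsub>sheaf M U\<^esub> g U Y Z"
    and g_add2: "X \<in> vf M U \<Longrightarrow> Y \<in> vf M U \<Longrightarrow> Z \<in> vf M U \<Longrightarrow>
      g U X (vf_add M U Y Z) = g U X Y \<oplus>\<^bsub>sheaf M U\<^esub> g U X Z"
    and g_part: "X \<in> vf_part M U p \<Longrightarrow> Y \<in> vf_part M U r \<Longrightarrow> g U X Y \<in> part (sheaf M U) (p + r)"
    and g_sym: "X \<in> vf_part M U p \<Longrightarrow> Y \<in> vf_part M U r \<Longrightarrow> g U X Y = koszul p r \<odot>\<^bsub>sheaf M U\<^esub> g U Y X"
    and g_res: "opn W \<Longrightarrow> W \<subseteq> U \<Longrightarrow> X \<in> vf M U \<Longrightarrow> Y \<in> vf M U \<Longrightarrow>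
      g W (vf_res M W X) (vf_res M W Y) = res M U W (g U X Y)"
proof -
  note m = metric[unfolded metric_def, rule_format, OF U]
  show "X \<in> vf M U \<Longrightarrow> Y \<in> vf M U \<Longrightarrow> g U X Y \<in> Sec U"
    using m[THEN conjunct1] by blast
  show "X \<in> vf M U \<Longrightarrow> Y \<in> vf M U \<Longrightarrow> Z \<in> vf M U \<Longrightarrow> f \<in> Sec U \<Longrightarrow>
      g U (vf_add M U (vf_smult M U f X) Y) Z = f \<otimes>\<^bsub>sheaf M U\<^esub> g U X Z \<oplus>\<^bsub>sheaf M U\<^esub> g U Y Z"
    using m[THEN conjunct2, THEN conjunct1] by blast
  show "X \<in> vf M U \<Longrightarrow> Y \<in> vf M U \<Longrightarrow> Z \<in> vf M U \<Longrightarrow>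
      g U X (vf_add M U Y Z) = g U X Y \<oplus>\<^bsub>sheaf M U\<^esub> g U X Z"
    using m[THEN conjunct2, THEN conjunct2, THEN conjunct1] by blast
  show "X \<in> vf_part M U p \<Longrightarrow> Y \<in> vf_part M U r \<Longrightarrow> g U X Y \<in> part (sheaf M U) (p + r)"
    "X \<in> vf_part M U p \<Longrightarrow> Y \<in> vf_part M U r \<Longrightarrow> g U X Y = koszul p r \<odot>\<^bsub>sheaf M U\<^esub> g U Y X"
    using m[THEN conjunct2, THEN conjunct2, THEN conjunct2, THEN conjunct1] by blast+
  show "opn W \<Longrightarrow> W \<subseteq> U \<Longrightarrow> X \<in> vf M U \<Longrightarrow> Y \<in> vf M U \<Longrightarrow>
      g W (vf_res M W X) (vf_res M W Y) = res M U W (g U X Y)"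
    using m[THEN conjunct2, THEN conjunct2, THEN conjunct2, THEN conjunct2] unfolding opens_iff Ball_def by blast
qed

lemma vf_smult_one:
  assumes U: "opn U" and X: "X \<in> vf M U"
  shows "vf_smult M U \<one>\<^bsub>sheaf M U\<^esub> X = X"
  by (rule vf_eqI[OF vf_smult_vf[OF U _ X] X])
    (use U vf_closed[OF X] in \<open>simp_all add: vf_smult_eq res_one ev_simps\<close>)

lemma vf_add_zero:
  assumes U: "opn U" and X: "X \<in> vf M U"
  shows "vf_add M U X (vf_zero M U) = X"
  by (rule vf_eqI[OF vf_add_vf[OF U X vf_zero_vf[OF U]] X])
    (use U vf_closed[OF X] in \<open>simp_all add: vf_ops_eq ev_simps\<close>)

lemma g_add1:
  assumes U: "opn U" and X: "X \<in> vf M U" "Y \<in> vf M U" "Z \<in> vf M U"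
  shows "g U (vf_add M U X Y) Z = g U X Z \<oplus>\<^bsub>sheaf M U\<^esub> g U Y Z"
proof -
  interpret A: super_alg "sheaf M U" by (rule alg[OF U])
  show ?thesis
    using g_linear[OF U X, of "\<one>\<^bsub>sheaf M U\<^esub>"] vf_smult_one[OF U X(1)] g_closed[OF U X(1,3)] by simp
qed

lemma g_zero1:
  assumes U: "opn U" and Z: "Z \<in> vf M U"
  shows "g U (vf_zero M U) Z = \<zero>\<^bsub>sheaf M U\<^esub>"
proof -
  have z: "vf_zero M U \<in> vf M U" by (rule vf_zero_vf[OF U])
  note e = g_add1[OF U z z Z] vf_add_zero[OF U z]
  have c: "g U (vf_zero M U) Z \<in> Sec U" by (rule g_closed[OF U z Z])
  have "ev J U (g U (vf_zero M U) Z) m = 0" if "m \<in> U" for J m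
    using ev_add[OF U that c c, of J] e by simp
  then show ?thesis by (intro ev_eq_zeroI[OF U c])
qed

lemma g_smult1:
  assumes U: "opn U" and X: "X \<in> vf M U" "Z \<in> vf M U" and f: "f \<in> Sec U"
  shows "g U (vf_smult M U f X) Z = f \<otimes>\<^bsub>sheaf M U\<^esub> g U X Z"
proof -
  interpret A: super_alg "sheaf M U" by (rule alg[OF U])
  show ?thesis
    using g_linear[OF U X(1) vf_zero_vf[OF U] X(2) f] vf_add_zero[OF U vf_smult_vf[OF U f X(1)]]
      g_zero1[OF U X(2)] g_closed[OF U X] f by simp
qed

lemma g_lsum1:
  assumes U: "opn U" and Z: "Z \<in> vf M U"
  shows "(\<And>i. i \<in> set xs \<Longrightarrow> F i \<in> vf M U) \<Longrightarrow> g U (lsum U F xs) Z = rsum U (\<lambda>i. g U (F i) Z) xs"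
proof (induction xs)
  case (Cons x xs)
  have l: "lsum U F xs \<in> vf M U" using Cons.prems by (intro lsum_vf[OF U]) simp
  have "g U (lsum U F (x # xs)) Z = g U (F x) Z \<oplus>\<^bsub>sheaf M U\<^esub> g U (lsum U F xs) Z"
    using g_add1[OF U _ l Z, of "F x"] Cons.prems by (simp add: lsum_def)
  then show ?case using Cons by (simp add: rsum_def)
qed (simp add: lsum_def rsum_def g_zero1[OF U Z])

text \<open>Against an even argument the Koszul sign is \<open>1\<close> for both homogeneous parts
  of \<open>Y\<close>.\<close>

lemma g_even_sym:
  assumes U: "opn U" and v: "v \<in> vf_part M U 0" and Y: "Y \<in> vf M U"
  shows "g U v Y = g U Y v"
proof -
  obtain A B where AB: "A \<in> vf_part M U 0" "B \<in> vf_part M U 1" "Y = vf_add M U A B"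
    using Y by (rule vfE)
  note vf = vf_part_vf[OF U v] vf_part_vf[OF U AB(1)] vf_part_vf[OF U AB(2)]
  have "g U v A = g U A v" "g U v B = g U B v"
    using g_sym[OF U v AB(1)] g_sym[OF U v AB(2)] g_closed[OF U] vf
      super_alg.one_smult[OF alg[OF U]] by simp_all
  then show ?thesis unfolding AB(3) using g_add1[OF U vf(2,3,1)] g_add2[OF U vf(1,2,3)] by simp
qed

lemma vf_res_vf_res: "W' \<subseteq> W \<Longrightarrow> vf_res M W' (vf_res M W X) = vf_res M W' X"
  unfolding vf_res_def on_opens_def opens_iff by (intro ext) auto

text \<open>By assumption \<open>Q\<close> is orthogonal to global fields. Near each point a
  homogeneous local field coincides with a global one, obtained by cutting it off.\<close>

lemma g_ker_local:
  assumes Q: "Q \<in> Vect M" and ker: "\<And>Y. Y \<in> Vect M \<Longrightarrow> g (points M) Q Y = \<zero>\<^bsub>sheaf M (points M)\<^esub>"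
    and W: "opn W" and Z: "Z \<in> vf M W"
  shows "g W (vf_res M W Q) Z = \<zero>\<^bsub>sheaf M W\<^esub>"
proof -
  have P: "opn (points M)" by simp
  have QW: "vf_res M W Q \<in> vf M W" by (rule vf_res_vf[OF P W opn_subset_points[OF W] Q])
  have part: "g W (vf_res M W Q) Z = \<zero>\<^bsub>sheaf M W\<^esub>" if Z: "Z \<in> vf_part M W p" for Z p
  proof (rule ev_eqI_local[OF W])
    note ZW = vf_part_vf[OF W Z]
    show "g W (vf_res M W Q) Z \<in> Sec W" by (rule g_closed[OF W QW ZW])
    fix m assume "m \<in> W"
    then obtain \<rho> O' K where c: "cutoff \<rho> O' K" "m \<in> O'" "K \<subseteq> W" using ex_cutoff[OF W] by blast
    then have O': "opn O'" "O' \<subseteq> W" "O' \<subseteq> points M" using opn_subset_points[OF W] by (auto simp: cutoff_def)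
    obtain Z' where Z': "Z' \<in> Vect_part M p" "vf_res M O' Z' = vf_res M O' Z"
      using extend_vf[OF c(1) W c(3) Z] by blast
    note Z'V = vf_part_vf[OF P Z'(1)]
    have "res M W O' (g W (vf_res M W Q) Z) = g O' (vf_res M O' Q) (vf_res M O' Z')"
      using g_res[OF W O'(1,2) QW ZW] Z'(2) vf_res_vf_res[OF O'(2)] by simp
    also have "\<dots> = res M (points M) O' \<zero>\<^bsub>sheaf M (points M)\<^esub>"
      using g_res[OF P O'(1,3) Q Z'V] ker[OF Z'V] by simp
    finally show "\<exists>W'. opn W' \<and> m \<in> W' \<and> W' \<subseteq> W \<and> res M W W' (g W (vf_res M W Q) Z) = res M W W' \<zero>\<^bsub>sheaf M W\<^esub>"
      using O' c(2) res_zero[OF P O'(1,3)] res_zero[OF W O'(1,2)] by (intro exI[of _ O']) simp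
  qed (simp add: W)
  obtain A B where AB: "A \<in> vf_part M W 0" "B \<in> vf_part M W 1" "Z = vf_add M W A B"
    using Z by (rule vfE)
  interpret A: super_alg "sheaf M W" by (rule alg[OF W])
  show ?thesis
    unfolding AB(3) g_add2[OF W QW vf_part_vf[OF W AB(1)] vf_part_vf[OF W AB(2)]] part[OF AB(1)] part[OF AB(2)] by simp
qed

end

section \<open>Coordinate vector fields\<close>

lemma d_even_carrier:
  assumes W: "open W" and u: "u \<in> carrier (SF W)"
  shows "d_even i W u \<in> carrier (SF W)"
    and "u \<in> part (SF W) p \<Longrightarrow> d_even i W u \<in> part (SF W) p"
proof -
  have z: "d_even i W u I x = 0" if "\<And>x. u I x = 0" for I x
  proof -
    have "u I = (\<lambda>x. 0)" using that by blast
    then show ?thesis by (simp add: d_even_def partial_const)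
  qed
  have "smooth W (d_even i W u I)" for I
    using smooth_cong[OF W smooth_partial[of W "u I" i], of "d_even i W u I"] u by (simp add: SF_carrier d_even_def)
  moreover have "(I \<subseteq> {0} \<and> x \<in> W) \<or> d_even i W u I x = 0" for I x
  proof (cases "I \<subseteq> {0}")
    case True
    then show ?thesis by (cases "x \<in> W") (simp_all add: d_even_def)
  next
    case False
    then have "u I y = 0" for y using u unfolding SF_carrier by blast
    then show ?thesis using z by blast
  qed
  ultimately show c: "d_even i W u \<in> carrier (SF W)" unfolding SF_carrier by blast
  show "u \<in> part (SF W) p \<Longrightarrow> d_even i W u \<in> part (SF W) p"
    using c z unfolding SF_part by blast
qed

lemma d_odd_carrier:
  assumes W: "open W" and u: "u \<in> carrier (SF W)"
  shows "d_odd 0 W u \<in> carrier (SF W)"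
proof -
  have "d_odd 0 W u I x = SF_make W (u {0}) (\<lambda>_. 0) I x" for I x
  proof (cases "I = {}")
    case False
    have "\<not> insert 0 I \<subseteq> {0}" if "0 \<notin> I" using False that by blast
    then have "u (insert 0 I) x = 0" if "0 \<notin> I" using that u unfolding SF_carrier by blast
    then show ?thesis using False by (auto simp: d_odd_def SF_make_def)
  qed (use u in \<open>auto simp: d_odd_def SF_make_def SF_carrier\<close>)
  then have "d_odd 0 W u = SF_make W (u {0}) (\<lambda>_. 0)" by blast
  then show ?thesis using SF_make_carrier[OF W _ smooth_const, of "u {0}" 0] u by (simp add: SF_carrier)
qed

context smfd_chart
begin

text \<open>Only the even coordinate fields are named: \<open>Q\<close> takes the place of the odd
  one, which makes the kernel direction a member of the frame.\<close>

definition E :: "'n \<Rightarrow> ('a, 's) vf" where "E i = chart_vf 1 M U \<phi> \<Phi> (d_even i)"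

lemma chart_vf_eq:
  "opn W \<Longrightarrow> W \<subseteq> U \<Longrightarrow> f \<in> Sec W \<Longrightarrow> chart_vf 1 M U \<phi> \<Phi> D W f = \<Phi> (\<phi> ` W) (D (\<phi> ` W) (rep W f))"
  by (simp add: chart_vf_def rep_def)

lemma E_props:
  assumes W: "opn W" "W \<subseteq> U" and f: "f \<in> Sec W"
  shows E_closed: "E i W f \<in> Sec W" and rep_E: "rep W (E i W f) = d_even i (\<phi> ` W) (rep W f)"
    and cc_E: "m \<in> W \<Longrightarrow> cc J W (E i W f) m = partial i (rep W f J) (\<phi> m)"
    and E_parity: "f \<in> part (sheaf M W) p \<Longrightarrow> E i W f \<in> part (sheaf M W) p"
proof -
  have e: "E i W f = \<Phi> (\<phi> ` W) (d_even i (\<phi> ` W) (rep W f))" unfolding E_def by (rule chart_vf_eq[OF W f])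
  note d = d_even_carrier[OF open_image[OF W] rep_closed[OF W f]]
  show c: "E i W f \<in> Sec W" unfolding e by (rule \<Phi>_closed[OF W d(1)])
  show r: "rep W (E i W f) = d_even i (\<phi> ` W) (rep W f)" unfolding e by (rule rep_\<Phi>[OF W d(1)])
  show "m \<in> W \<Longrightarrow> cc J W (E i W f) m = partial i (rep W f J) (\<phi> m)"
    by (simp add: cc_rep[OF W c] r d_even_def)
  show "f \<in> part (sheaf M W) p \<Longrightarrow> E i W f \<in> part (sheaf M W) p"
    unfolding e using d(2)[OF rep_part[OF W]] \<Phi>_hom[OF W] unfolding superalgebra_hom_def by blast
qed

lemma differentiable_rep: "opn W \<Longrightarrow> W \<subseteq> U \<Longrightarrow> f \<in> Sec W \<Longrightarrow> m \<in> W \<Longrightarrow> rep W f J differentiable (at (\<phi> m))"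
  using smooth_differentiable[OF smooth_rep] by blast

lemma rep_fun:
  assumes W: "opn W" "W \<subseteq> U" and f: "f \<in> Sec W" "h \<in> Sec W"
  shows "rep W (f \<oplus>\<^bsub>sheaf M W\<^esub> h) J = (\<lambda>x. rep W f J x + rep W h J x)"
    "rep W (c \<odot>\<^bsub>sheaf M W\<^esub> f) J = (\<lambda>x. c * rep W f J x)"
    "rep W (f \<otimes>\<^bsub>sheaf M W\<^esub> h) {} = (\<lambda>x. rep W f {} x * rep W h {} x)"
    "rep W (f \<otimes>\<^bsub>sheaf M W\<^esub> h) {0} = (\<lambda>x. rep W f {} x * rep W h {0} x + rep W f {0} x * rep W h {} x)"
  by (simp_all add: rep_ops[OF W f] fun_eq_iff)

lemma E_part: "E i \<in> vf_part M U 0"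
proof (rule vf_partI)
  show "on_opens M U (E i) = E i" by (simp add: E_def chart_vf_def)
  fix W assume W: "opn W" "W \<subseteq> U"
  show "\<And>f. f \<in> Sec W \<Longrightarrow> E i W f \<in> Sec W" by (rule E_closed[OF W])
  show "E i W (f \<oplus>\<^bsub>sheaf M W\<^esub> h) = E i W f \<oplus>\<^bsub>sheaf M W\<^esub> E i W h" if fh: "f \<in> Sec W" "h \<in> Sec W" for f h
    by (rule cc_eqI[OF W]) (use W fh differentiable_rep[OF W] in
        \<open>auto simp: E_closed cc_E cc_ops rep_fun[OF W fh] partial_add subset_iff\<close>)
  show "E i W (c \<odot>\<^bsub>sheaf M W\<^esub> f) = c \<odot>\<^bsub>sheaf M W\<^esub> E i W f" if f: "f \<in> Sec W" for f c
    by (rule cc_eqI[OF W]) (use W f differentiable_rep[OF W] in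
        \<open>auto simp: E_closed cc_E cc_smult rep_fun(2)[OF W f f] partial_cmult subset_iff\<close>)
  show "\<And>f r. f \<in> part (sheaf M W) r \<Longrightarrow> E i W f \<in> part (sheaf M W) (0 + r)"
    using E_parity[OF W] W by simp
  show "E i W (f \<otimes>\<^bsub>sheaf M W\<^esub> h) = E i W f \<otimes>\<^bsub>sheaf M W\<^esub> h \<oplus>\<^bsub>sheaf M W\<^esub>
      koszul 0 r \<odot>\<^bsub>sheaf M W\<^esub> (f \<otimes>\<^bsub>sheaf M W\<^esub> E i W h)"
    if f: "f \<in> part (sheaf M W) r" and h: "h \<in> Sec W" for f h r
  proof -
    have fS: "f \<in> Sec W" using f W by simp
    note d = differentiable_rep[OF W fS] differentiable_rep[OF W h]
    show ?thesis
    proof (rule cc_eqI[OF W])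
      fix m assume m: "m \<in> W"
      then have mU: "m \<in> U" using W by blast
      note dm = d(1)[OF m] d(2)[OF m]
      show "cc {} W (E i W (f \<otimes>\<^bsub>sheaf M W\<^esub> h)) m = cc {} W (E i W f \<otimes>\<^bsub>sheaf M W\<^esub> h \<oplus>\<^bsub>sheaf M W\<^esub>
          koszul 0 r \<odot>\<^bsub>sheaf M W\<^esub> (f \<otimes>\<^bsub>sheaf M W\<^esub> E i W h)) m"
        using W m mU fS h by (simp add: E_closed cc_E cc_ops cc_smult rep_fun[OF W fS h] partial_mult[OF dm] cc_rep[OF W fS] cc_rep[OF W h])
      show "cc {0} W (E i W (f \<otimes>\<^bsub>sheaf M W\<^esub> h)) m = cc {0} W (E i W f \<otimes>\<^bsub>sheaf M W\<^esub> h \<oplus>\<^bsub>sheaf M W\<^esub>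
          koszul 0 r \<odot>\<^bsub>sheaf M W\<^esub> (f \<otimes>\<^bsub>sheaf M W\<^esub> E i W h)) m"
        using W m mU fS h by (simp add: E_closed cc_E cc_ops cc_smult rep_fun[OF W fS h] partial_mult[OF dm]
            partial_add[OF differentiable_mult[OF dm] differentiable_mult[OF dm]] cc_rep[OF W fS] cc_rep[OF W h])
    qed (use W fS h E_closed[OF W] in simp_all)
  qed
  show "E i W' (res M W W' f) = res M W W' (E i W f)" if W': "opn W'" "W' \<subseteq> W" and f: "f \<in> Sec W" for W' f
  proof -
    have W'U: "W' \<subseteq> U" using W W' by blast
    have r: "res M W W' f \<in> Sec W'" by (rule res_closed[OF W(1) W' f])
    have p: "partial i (rep W' (res M W W' f) J) (\<phi> m) = partial i (rep W f J) (\<phi> m)" if "m \<in> W'" for m J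
      by (rule partial_cong[OF open_image[OF W'(1) W'U]]) (use that in \<open>auto simp: rep_res[OF W W' f]\<close>)
    show ?thesis
      by (rule cc_eqI[OF W'(1) W'U E_closed[OF W'(1) W'U r] res_closed[OF W(1) W' E_closed[OF W f]]])
        (use W W' W'U f r p E_closed[OF W f] in \<open>auto simp: cc_E cc_res subset_iff\<close>)
  qed
qed

text \<open>The coefficients are taken on \<open>W\<close> while the field is applied on a smaller
  \<open>W'\<close>; in this form it can be compared with combinations of \<open>E i\<close> and
  \<open>Q\<close> whose coefficients live on \<open>W\<close>.\<close>

lemma vf_formula_res:
  assumes W: "opn W" "W \<subseteq> U" and W': "opn W'" "W' \<subseteq> W" "m \<in> W'" and Y: "Y \<in> vf M W" and f: "f \<in> Sec W'"
  shows "cc {} W' (Y W' f) m = (\<Sum>i\<in>UNIV. cc {} W (Y W (co i W)) m * cc {} W' (E i W' f) m) +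
      cc {} W (Y W (tau W)) m * cc {0} W' f m"
    "cc {0} W' (Y W' f) m = (\<Sum>i\<in>UNIV. cc {0} W (Y W (co i W)) m * cc {} W' (E i W' f) m) +
      (\<Sum>i\<in>UNIV. cc {} W (Y W (co i W)) m * cc {0} W' (E i W' f) m) + cc {0} W (Y W (tau W)) m * cc {0} W' f m"
proof -
  have W'U: "W' \<subseteq> U" "m \<in> U" using W W' by auto
  have YW': "vf_res M W' Y \<in> vf M W'" by (rule vf_res_vf[OF W(1) W'(1,2) Y])
  have eq: "vf_res M W' Y W' h = Y W' h" if "h \<in> Sec W'" for h using that W' by (simp add: vf_res_eq)
  have r: "cc J W' (Y W' (co i W')) m = cc J W (Y W (co i W)) m" "cc J W' (Y W' (tau W')) m = cc J W (Y W (tau W)) m" for J i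
    using vf_ev_res[OF Y W(1) _ W'(1,2) co_closed[OF W]] vf_ev_res[OF Y W(1) _ W'(1,2) tau_closed[OF W]]
      res_co[OF W W'(1,2)] res_tau[OF W W'(1,2)] cc_res[OF W(1) W' W'U(2)] vf_closed[OF Y W(1)] co_closed[OF W] tau_closed[OF W]
    by (metis order_refl)+
  note cl = co_closed[OF W'(1) W'U(1)] tau_closed[OF W'(1) W'U(1)]
  show "cc {} W' (Y W' f) m = (\<Sum>i\<in>UNIV. cc {} W (Y W (co i W)) m * cc {} W' (E i W' f) m) +
      cc {} W (Y W (tau W)) m * cc {0} W' f m"
    "cc {0} W' (Y W' f) m = (\<Sum>i\<in>UNIV. cc {0} W (Y W (co i W)) m * cc {} W' (E i W' f) m) +
      (\<Sum>i\<in>UNIV. cc {} W (Y W (co i W)) m * cc {0} W' (E i W' f) m) + cc {0} W (Y W (tau W)) m * cc {0} W' f m"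
    using vf_formula[OF W'(1) W'U(1) W'(3) YW' f] cl f W' W'U by (simp_all add: eq r cc_E)
qed

definition ns :: "'n list" where "ns = (SOME xs. set xs = UNIV \<and> distinct xs)"

lemma ns: "set ns = UNIV" "distinct ns"
  using someI_ex[OF finite_distinct_list[OF finite_class.finite_UNIV]] unfolding ns_def by blast+

lemma sum_ns: "(\<Sum>i\<leftarrow>ns. F i) = (\<Sum>i\<in>UNIV. F i)"
  by (simp add: sum_list_distinct_conv_sum_set ns)

end

section \<open>Shander charts\<close>

locale null_chart = smfd_chart M N U V \<phi> \<Phi> + metric_mfd M N g
  for M :: "('a, 's) superspace" and N :: "'n::finite itself" and U and V :: "(real^'n) set" and \<phi> \<Phi> and g +
  fixes Q P :: "('a, 's) vf" and t :: 'n
  assumes Q_odd: "Q \<in> Vect_part M 1"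
    and Q_ker: "\<And>Y. Y \<in> Vect M \<Longrightarrow> g (points M) Q Y = \<zero>\<^bsub>sheaf M (points M)\<^esub>"
    and ker_dim: "\<And>m. m \<in> points M \<Longrightarrow> form_ker_dim_0_1 M g m"
    and shander: "shander_chart M Q P U V \<phi> \<Phi> t"
begin

abbreviation QW :: "'a set \<Rightarrow> ('a, 's) vf" where "QW W \<equiv> vf_res M W Q"
abbreviation EW :: "'a set \<Rightarrow> 'n \<Rightarrow> ('a, 's) vf" where "EW W i \<equiv> vf_res M W (E i)"

lemma Q_vf: "Q \<in> Vect M"
  by (rule vf_part_vf[OF _ Q_odd]) simp

lemma QW_vf: "opn W \<Longrightarrow> QW W \<in> vf M W"
  using vf_res_vf[OF _ _ opn_subset_points Q_vf] by simp

lemma EW_part: "opn W \<Longrightarrow> W \<subseteq> U \<Longrightarrow> EW W i \<in> vf_part M W 0"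
  by (rule vf_res_part[OF U_open _ _ E_part])

lemma EW_vf: "opn W \<Longrightarrow> W \<subseteq> U \<Longrightarrow> EW W i \<in> vf M W"
  using vf_part_vf EW_part by blast

lemma EW_U: "EW U i = E i"
  using vf_part_on[OF E_part] by (simp add: vf_res_def)

text \<open>The field \<open>\<partial>\<^sub>\<tau> + \<tau> \<partial>\<^sub>t\<close> maps
  \<open>a + \<tau> b\<close> to \<open>b + \<tau> \<partial>\<^sub>t a\<close>.\<close>

lemma cc_Q:
  assumes W: "opn W" "W \<subseteq> U" "m \<in> W" and f: "f \<in> Sec W"
  shows "cc {} W (Q W f) m = cc {0} W f m" "cc {0} W (Q W f) m = cc {} W (E t W f) m"
proof -
  have mU: "m \<in> U" using W by blast
  have tU: "\<Phi> V (odd_coord 0 V) = tau U"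
  proof -
    have "odd_coord 0 V = SF_make V (\<lambda>_. 0) (\<lambda>_. 1)"
      by (intro ext) (auto simp: odd_coord_def SF_make_def)
    then show ?thesis by (simp add: tau_def sec_def image_U)
  qed
  have "vf_res M U Q = vf_add M U (chart_vf 1 M U \<phi> \<Phi> (d_odd 0)) (vf_smult M U (tau U) (E t))"
    using shander tU by (simp add: shander_chart_def Let_def E_def)
  then have "vf_res M U Q W f = vf_add M U (chart_vf 1 M U \<phi> \<Phi> (d_odd 0)) (vf_smult M U (tau U) (E t)) W f" by simp
  then have Qf: "Q W f = chart_vf 1 M U \<phi> \<Phi> (d_odd 0) W f \<oplus>\<^bsub>sheaf M W\<^esub> tau W \<otimes>\<^bsub>sheaf M W\<^esub> E t W f"
    using res_tau[OF U_open _ W(1,2)] W f by (simp add: vf_ops_eq)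
  let ?D = "chart_vf 1 M U \<phi> \<Phi> (d_odd 0) W f"
  note d = d_odd_carrier[OF open_image[OF W(1,2)] rep_closed[OF W(1,2) f]]
  have De: "?D = \<Phi> (\<phi> ` W) (d_odd 0 (\<phi> ` W) (rep W f))" by (rule chart_vf_eq[OF W(1,2) f])
  have D: "?D \<in> Sec W" unfolding De by (rule \<Phi>_closed[OF W(1,2) d])
  have r: "rep W ?D = d_odd 0 (\<phi> ` W) (rep W f)" unfolding De by (rule rep_\<Phi>[OF W(1,2) d])
  have "cc {} W ?D m = cc {0} W f m" "cc {0} W ?D m = 0"
    by (simp_all add: cc_rep[OF W(1,2) D] cc_rep[OF W(1,2) f] r d_odd_def)
  then show "cc {} W (Q W f) m = cc {0} W f m" "cc {0} W (Q W f) m = cc {} W (E t W f) m"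
    using W mU D tau_closed[OF W(1,2)] cc_tau[OF W(1,2)] E_closed[OF W(1,2) f]
    by (simp_all add: Qf cc_ops)
qed

text \<open>The coefficients of \<open>Y\<close> with respect to \<open>E\<close> and
  \<open>Q\<close>. Substituting
  \<open>\<partial>\<^sub>\<tau> = Q - \<tau> \<partial>\<^sub>t\<close> into the coordinate
  expression of \<open>Y\<close> changes only the coefficient of \<open>\<partial>\<^sub>t\<close>,
  by \<open>- Y(\<tau>) \<tau>\<close>.\<close>

definition yc :: "'a set \<Rightarrow> ('a, 's) vf \<Rightarrow> 'n \<Rightarrow> 's" where
  "yc W Y i = Y W (co i W) \<oplus>\<^bsub>sheaf M W\<^esub>
    (if i = t then (-1) \<odot>\<^bsub>sheaf M W\<^esub> (Y W (tau W) \<otimes>\<^bsub>sheaf M W\<^esub> tau W) else \<zero>\<^bsub>sheaf M W\<^esub>)"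

lemma yc_props:
  assumes W: "opn W" "W \<subseteq> U" and Y: "Y \<in> vf M W"
  shows yc_closed: "yc W Y i \<in> Sec W"
    and cc_yc: "m \<in> W \<Longrightarrow> cc {} W (yc W Y i) m = cc {} W (Y W (co i W)) m"
      "m \<in> W \<Longrightarrow> cc {0} W (yc W Y i) m = cc {0} W (Y W (co i W)) m - (if i = t then cc {} W (Y W (tau W)) m else 0)"
proof -
  have c: "Y W (co i W) \<in> Sec W" "Y W (tau W) \<in> Sec W"
    using vf_closed[OF Y W(1)] co_closed[OF W] tau_closed[OF W] by simp_all
  note t = tau_props[OF W]
  show "yc W Y i \<in> Sec W" using W c t by (simp add: yc_def)
  show "m \<in> W \<Longrightarrow> cc {} W (yc W Y i) m = cc {} W (Y W (co i W)) m"
      "m \<in> W \<Longrightarrow> cc {0} W (yc W Y i) m = cc {0} W (Y W (co i W)) m - (if i = t then cc {} W (Y W (tau W)) m else 0)"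
    using W c t subsetD[OF W(2), of m] by (auto simp: yc_def cc_simps)
qed

lemma decomposition:
  assumes W: "opn W" "W \<subseteq> U" and Y: "Y \<in> vf M W"
  shows "Y = vf_add M W (lsum W (\<lambda>i. vf_smult M W (yc W Y i) (EW W i)) ns) (vf_smult M W (Y W (tau W)) (QW W))"
proof (rule cc_vf_eqI[OF W Y])
  have YW: "Y W (tau W) \<in> Sec W" using vf_closed[OF Y W(1)] tau_closed[OF W] by simp
  note yc = yc_props[OF W Y]
  have v: "vf_smult M W (yc W Y i) (EW W i) \<in> vf M W" for i
    by (rule vf_smult_vf[OF W(1) yc(1) EW_vf[OF W]])
  show "vf_add M W (lsum W (\<lambda>i. vf_smult M W (yc W Y i) (EW W i)) ns) (vf_smult M W (Y W (tau W)) (QW W)) \<in> vf M W"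
    by (intro vf_add_vf lsum_vf vf_smult_vf W(1) v YW QW_vf)
  fix W' f m and J :: "nat set"
  assume W': "opn W'" "W' \<subseteq> W" and f: "f \<in> Sec W'" and m: "m \<in> W'" and J: "J \<in> {{}, {0}}"
  have W'U: "W' \<subseteq> U" "m \<in> U" "m \<in> W" using W' W m by auto
  have EE: "E i W' f \<in> Sec W'" for i by (rule E_closed[OF W'(1) W'U(1) f])
  have rs: "res M W W' (yc W Y i) \<in> Sec W'" "res M W W' (Y W (tau W)) \<in> Sec W'" for i
    using res_closed[OF W(1) W'] yc(1) YW by blast+
  have rc: "cc K W' (res M W W' (yc W Y i)) m = cc K W (yc W Y i) m"
    "cc K W' (res M W W' (Y W (tau W))) m = cc K W (Y W (tau W)) m" for K i
    using cc_res[OF W(1) W' m W'U(2)] yc(1) YW by blast+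
  have Qc: "Q W' f \<in> Sec W'"
    by (rule vf_closed[OF Q_vf W'(1) opn_subset_points[OF W'(1)] f])
  let ?R = "vf_add M W (lsum W (\<lambda>i. vf_smult M W (yc W Y i) (EW W i)) ns) (vf_smult M W (Y W (tau W)) (QW W))"
  have R: "?R W' f = rsum W' (\<lambda>i. res M W W' (yc W Y i) \<otimes>\<^bsub>sheaf M W'\<^esub> E i W' f) ns \<oplus>\<^bsub>sheaf M W'\<^esub>
      res M W W' (Y W (tau W)) \<otimes>\<^bsub>sheaf M W'\<^esub> Q W' f"
    using W' f by (simp add: vf_ops_eq lsum_eq)
  have prd: "res M W W' (yc W Y i) \<otimes>\<^bsub>sheaf M W'\<^esub> E i W' f \<in> Sec W'" for i using W' rs EE by simp
  have cR: "cc J W' (?R W' f) m = (\<Sum>i\<in>UNIV. cc J W' (res M W W' (yc W Y i) \<otimes>\<^bsub>sheaf M W'\<^esub> E i W' f) m) +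
      cc J W' (res M W W' (Y W (tau W)) \<otimes>\<^bsub>sheaf M W'\<^esub> Q W' f) m"
  proof -
    have "cc J W' (rsum W' (\<lambda>i. res M W W' (yc W Y i) \<otimes>\<^bsub>sheaf M W'\<^esub> E i W' f) ns) m =
        (\<Sum>i\<leftarrow>ns. cc J W' (res M W W' (yc W Y i) \<otimes>\<^bsub>sheaf M W'\<^esub> E i W' f) m)"
      by (rule cc_rsum[OF W'(1) m W'U(2) _ J]) (rule prd)
    then show ?thesis
      unfolding R using W' m W'U rs Qc prd by (simp add: cc_ops(1) sum_ns)
  qed
  consider "J = {}" | "J = {0}" using J by blast
  then show "cc J W' (Y W' f) m = cc J W' (?R W' f) m"
  proof cases
    case 1
    show ?thesis
      using vf_formula_res(1)[OF W W' m Y f] cc_Q(1)[OF W'(1) W'U(1) m f] cR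
      by (simp add: 1 cc_ops[OF W'(1) m W'U(2)] rs EE Qc rc yc(2)[OF W'U(3)])
  next
    case 2
    \<comment> \<open>The correction in \<open>yc\<close> at the index \<open>t\<close> cancels the
      contribution of the summand \<open>\<tau> \<partial>\<^sub>t\<close> of
      \<open>Q\<close>.\<close>
    have "(\<Sum>i\<in>UNIV. (cc {0} W (Y W (co i W)) m - (if i = t then cc {} W (Y W (tau W)) m else 0)) * cc {} W' (E i W' f) m) =
      (\<Sum>i\<in>UNIV. cc {0} W (Y W (co i W)) m * cc {} W' (E i W' f) m) - cc {} W (Y W (tau W)) m * cc {} W' (E t W' f) m"
      by (simp add: left_diff_distrib sum_subtractf if_distrib[of "\<lambda>x. x * _"] cong: if_cong)
    then show ?thesis
      using vf_formula_res(2)[OF W W' m Y f] cc_Q[OF W'(1) W'U(1) m f] cR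
      by (simp add: 2 cc_ops[OF W'(1) m W'U(2)] rs EE Qc rc yc(2,3)[OF W'U(3)] sum.distrib)
  qed
qed

section \<open>The Gram matrix of the even coordinate fields\<close>

definition Gr :: "'n \<Rightarrow> 'n \<Rightarrow> 's" where "Gr i j = g U (E i) (E j)"

lemma Gr_even: "Gr i j \<in> part (sheaf M U) 0"
  using g_part[OF U_open E_part E_part, of i j] by (simp add: Gr_def)

lemma Gr_closed: "Gr i j \<in> Sec U"
  by (rule Sec_closed(6)[OF U_open Gr_even])

lemma Gr_sym: "Gr i j = Gr j i"
  unfolding Gr_def by (rule g_even_sym[OF U_open E_part vf_part_vf[OF U_open E_part]])

definition GM :: "'a \<Rightarrow> real^'n^'n" where "GM m = (\<chi> i j. cc {} U (Gr i j) m)"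

lemma GM_sym: "GM m $ i $ j = GM m $ j $ i"
  using Gr_sym by (simp add: GM_def)

lemma g_EW:
  assumes W: "opn W" "W \<subseteq> U" "m \<in> W"
  shows "cc {} W (g W (EW W i) (EW W j)) m = GM m $ i $ j" "cc {0} W (g W (EW W i) (EW W j)) m = 0"
proof -
  have mU: "m \<in> U" using W by blast
  have "g W (EW W i) (EW W j) = res M U W (Gr i j)"
    unfolding Gr_def by (rule g_res[OF U_open W(1,2) vf_part_vf[OF U_open E_part] vf_part_vf[OF U_open E_part]])
  then show "cc {} W (g W (EW W i) (EW W j)) m = GM m $ i $ j" "cc {0} W (g W (EW W i) (EW W j)) m = 0"
    using cc_res[OF U_open W mU Gr_closed] cc_even[OF U_open mU mU Gr_even] by (simp_all add: GM_def)
qed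

text \<open>The \<open>Q\<close>-summand of the decomposition drops out, as \<open>Q\<close> is
  orthogonal to every local field.\<close>

lemma g_formula:
  assumes W: "opn W" "W \<subseteq> U" and Y: "Y \<in> vf M W" and Z: "Z \<in> vf M W"
  shows "g W Y Z = rsum W (\<lambda>i. yc W Y i \<otimes>\<^bsub>sheaf M W\<^esub> g W (EW W i) Z) ns"
proof -
  interpret A: super_alg "sheaf M W" by (rule alg[OF W(1)])
  have YW: "Y W (tau W) \<in> Sec W" using vf_closed[OF Y W(1)] tau_closed[OF W] by simp
  note yc = yc_props[OF W Y]
  note EV = EW_vf[OF W]
  have v: "vf_smult M W (yc W Y i) (EW W i) \<in> vf M W" for i
    by (rule vf_smult_vf[OF W(1) yc(1) EV])
  have q: "vf_smult M W (Y W (tau W)) (QW W) \<in> vf M W" by (rule vf_smult_vf[OF W(1) YW QW_vf[OF W(1)]])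
  have l: "lsum W (\<lambda>i. vf_smult M W (yc W Y i) (EW W i)) ns \<in> vf M W" by (rule lsum_vf[OF W(1) v])
  have gk: "g W (QW W) Z = \<zero>\<^bsub>sheaf M W\<^esub>" by (rule g_ker_local[OF Q_vf _ W(1) Z]) (rule Q_ker)
  have "g W Y Z = g W (vf_add M W (lsum W (\<lambda>i. vf_smult M W (yc W Y i) (EW W i)) ns) (vf_smult M W (Y W (tau W)) (QW W))) Z"
    using decomposition[OF W Y] by (rule arg_cong)
  also have "\<dots> = g W (lsum W (\<lambda>i. vf_smult M W (yc W Y i) (EW W i)) ns) Z \<oplus>\<^bsub>sheaf M W\<^esub> \<zero>\<^bsub>sheaf M W\<^esub>"
    unfolding g_add1[OF W(1) l q Z] g_smult1[OF W(1) QW_vf[OF W(1)] Z YW] gk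
    using YW by simp
  also have "\<dots> = g W (lsum W (\<lambda>i. vf_smult M W (yc W Y i) (EW W i)) ns) Z"
    using g_closed[OF W(1) l Z] by simp
  also have "\<dots> = rsum W (\<lambda>i. g W (vf_smult M W (yc W Y i) (EW W i)) Z) ns"
    by (rule g_lsum1[OF W(1) Z v])
  finally show ?thesis unfolding g_smult1[OF W(1) EV Z yc(1)] .
qed

text \<open>The entries of the Gram matrix are even and so have no second component. Hence both
  components of the pairings arise from those of the coefficients through the same real matrix
  \<open>GM m\<close>.\<close>

lemma cc_g_E:
  assumes W: "opn W" "W \<subseteq> U" "m \<in> W" and Y: "Y \<in> vf M W" and J: "J \<in> {{}, {0}}"
  shows "cc J W (g W Y (EW W j)) m = (\<Sum>i\<in>UNIV. cc J W (yc W Y i) m * GM m $ i $ j)"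
proof -
  have mU: "m \<in> U" using W by blast
  note EV = EW_vf[OF W(1,2)]
  note yc = yc_closed[OF W(1,2) Y]
  have gc: "g W (EW W i) (EW W j) \<in> Sec W" for i by (rule g_closed[OF W(1) EV EV])
  have "cc J W (g W Y (EW W j)) m = (\<Sum>i\<in>UNIV. cc J W (yc W Y i \<otimes>\<^bsub>sheaf M W\<^esub> g W (EW W i) (EW W j)) m)"
    unfolding g_formula[OF W(1,2) Y EV] cc_rsum[OF W(1,3) mU Sec_closed(2)[OF W(1) yc gc] J] sum_ns ..
  also have "\<dots> = (\<Sum>i\<in>UNIV. cc J W (yc W Y i) m * GM m $ i $ j)"
    using J by (auto simp: cc_ops[OF W(1,3) mU yc gc] g_EW[OF W])
  finally show ?thesis .
qed

section \<open>Tangent vectors at the points of a Shander chart\<close>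

lemma vf_at_cc:
  assumes U': "opn U'" "m \<in> U'" and m: "m \<in> U" and X: "X \<in> vf M U'" and W: "opn W" "m \<in> W" and f: "f \<in> Sec W"
  shows "vf_at M U' X m W f = cc {} (U' \<inter> W) (X (U' \<inter> W) (res M W (U' \<inter> W) f)) m"
proof -
  have o: "opn (U' \<inter> W)" "U' \<inter> W \<subseteq> W" "U' \<inter> W \<subseteq> U'" using U' W by auto
  have "X (U' \<inter> W) (res M W (U' \<inter> W) f) \<in> Sec (U' \<inter> W)"
    by (rule vf_closed[OF X o(1,3) res_closed[OF W(1) o(1,2) f]])
  then show ?thesis using val_cc[OF o(1) _ m] U' W f by (simp add: vf_at_def)
qed

text \<open>The argument of \<open>vf_part_formula\<close> at a single point. It serves both
  parities, because the signed term of the Leibniz rule carries the value of \<open>tau\<close>,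
  which is zero.\<close>

lemma tangent_formula:
  assumes m: "m \<in> U" and w: "w \<in> tangent_part M m p" and W: "opn W" "m \<in> W" and f: "f \<in> Sec W"
  shows "w W f = (\<Sum>i\<in>UNIV. w U (co i U) * cc {} (U \<inter> W) (E i (U \<inter> W) (res M W (U \<inter> W) f)) m) +
    w U (tau U) * cc {0} W f m"
proof -
  have wD: "\<And>O' W f. opn O' \<Longrightarrow> m \<in> O' \<Longrightarrow> opn W \<Longrightarrow> W \<subseteq> O' \<Longrightarrow> m \<in> W \<Longrightarrow> f \<in> Sec O' \<Longrightarrow> w W (res M O' W f) = w O' f"
    "\<And>O' f h. opn O' \<Longrightarrow> m \<in> O' \<Longrightarrow> f \<in> Sec O' \<Longrightarrow> h \<in> Sec O' \<Longrightarrow> w O' (f \<oplus>\<^bsub>sheaf M O'\<^esub> h) = w O' f + w O' h"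
    "\<And>O' c f. opn O' \<Longrightarrow> m \<in> O' \<Longrightarrow> f \<in> Sec O' \<Longrightarrow> w O' (c \<odot>\<^bsub>sheaf M O'\<^esub> f) = c * w O' f"
    "\<And>O' r f h. opn O' \<Longrightarrow> m \<in> O' \<Longrightarrow> f \<in> part (sheaf M O') r \<Longrightarrow> h \<in> Sec O' \<Longrightarrow>
       w O' (f \<otimes>\<^bsub>sheaf M O'\<^esub> h) = w O' f * val M O' h m + koszul p r * val M O' f m * w O' h"
  proof -
    note w' = w[unfolded tangent_part_def mem_Collect_eq, THEN conjunct2, rule_format, OF conjI]
    fix O' assume O': "opn O'" "m \<in> O'"
    show "\<And>W f. opn W \<Longrightarrow> W \<subseteq> O' \<Longrightarrow> m \<in> W \<Longrightarrow> f \<in> Sec O' \<Longrightarrow> w W (res M O' W f) = w O' f"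
      using w'[OF O', THEN conjunct1] unfolding opens_iff Ball_def by blast
    show "\<And>f h. f \<in> Sec O' \<Longrightarrow> h \<in> Sec O' \<Longrightarrow> w O' (f \<oplus>\<^bsub>sheaf M O'\<^esub> h) = w O' f + w O' h"
      using w'[OF O', THEN conjunct2, THEN conjunct1] by blast
    show "\<And>c f. f \<in> Sec O' \<Longrightarrow> w O' (c \<odot>\<^bsub>sheaf M O'\<^esub> f) = c * w O' f"
      using w'[OF O', THEN conjunct2, THEN conjunct2, THEN conjunct1] by blast
    show "\<And>r f h. f \<in> part (sheaf M O') r \<Longrightarrow> h \<in> Sec O' \<Longrightarrow>
       w O' (f \<otimes>\<^bsub>sheaf M O'\<^esub> h) = w O' f * val M O' h m + koszul p r * val M O' f m * w O' h"
      using w'[OF O', THEN conjunct2, THEN conjunct2, THEN conjunct2, THEN conjunct2] by blast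
  qed
  let ?W = "U \<inter> W"
  have o: "opn ?W" "?W \<subseteq> U" "m \<in> ?W" "?W \<subseteq> W" using W m U_open by auto
  let ?f = "res M W ?W f"
  have fS: "?f \<in> Sec ?W" by (rule res_closed[OF W(1) o(1,4) f])
  let ?a = "rep ?W ?f {}" and ?b = "rep ?W ?f {0}"
  note sa = smooth_rep[OF o(1,2) fS, of "{}"] and sb = smooth_rep[OF o(1,2) fS, of "{0}"]
  note a = bd_props[OF o(1,2) sa] and b = bd_props[OF o(1,2) sb] and t = tau_props[OF o(1,2)]
  have body: "w ?W (bd ?W ?a) = (\<Sum>i\<in>UNIV. w ?W (co i ?W) * partial i ?a (\<phi> m))"
  proof (rule derivation_formula[OF o(1,2,3) sa])
    fix W' assume W': "opn W'" "W' \<subseteq> ?W" "m \<in> W'"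
    show "\<And>f. f \<in> Sec ?W \<Longrightarrow> w W' (res M ?W W' f) = w ?W f" by (rule wD(1)[OF o(1,3) W'])
    show "\<And>f h. f \<in> Sec W' \<Longrightarrow> h \<in> Sec W' \<Longrightarrow> w W' (f \<oplus>\<^bsub>sheaf M W'\<^esub> h) = w W' f + w W' h"
      by (rule wD(2)[OF W'(1,3)])
    show "\<And>f c. f \<in> Sec W' \<Longrightarrow> w W' (c \<odot>\<^bsub>sheaf M W'\<^esub> f) = c * w W' f" by (rule wD(3)[OF W'(1,3)])
    fix f h assume fh: "f \<in> part (sheaf M W') 0" "h \<in> part (sheaf M W') 0"
    have S: "f \<in> Sec W'" "h \<in> Sec W'" using fh W' by auto
    show "w W' (f \<otimes>\<^bsub>sheaf M W'\<^esub> h) = w W' f * cc {} W' h m + cc {} W' f m * w W' h"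
      using wD(4)[OF W'(1,3) fh(1) S(2)] val_cc[OF W'(1,3) m] S by simp
  qed
  have "w W f = w ?W ?f" using wD(1)[OF W o(1,4,3) f] by simp
  also have "\<dots> = w ?W (bd ?W ?a \<oplus>\<^bsub>sheaf M ?W\<^esub> tau ?W \<otimes>\<^bsub>sheaf M ?W\<^esub> bd ?W ?b)"
    using section_decomp[OF o(1,2) fS] by (rule arg_cong)
  also have "\<dots> = w ?W (bd ?W ?a) + w ?W (tau ?W) * ?b (\<phi> m)"
    using wD(2)[OF o(1,3) a(1)] wD(4)[OF o(1,3) t(2) b(1)] o(1) t b val_cc[OF o(1,3) m t(1)] val_cc[OF o(1,3) m b(1)]
      t(3)[OF o(3)] b(3)[OF o(3)] by simp
  also have "w ?W (tau ?W) = w U (tau U)"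
    using wD(1)[OF U_open m o(1,2,3) tau_closed[OF U_open]] res_tau[OF U_open _ o(1,2)] by simp
  also have "?b (\<phi> m) = cc {0} W f m"
    using cc_rep[OF o(1,2) fS, of "{0}" m] cc_res[OF W(1) o(1,4,3) m f] by simp
  finally show ?thesis
    using body wD(1)[OF U_open m o(1,2,3) co_closed[OF U_open]] res_co[OF U_open _ o(1,2)]
    by (simp add: cc_E[OF o(1,2) fS o(3)])
qed

lemma vf_at_tangent:
  assumes m: "m \<in> U" and X: "X \<in> vf_part M U 0"
  shows "vf_at M U X m \<in> tangent_part M m 0"
proof -
  note D = vf_partD[OF X] and at = vf_at_cc[OF U_open m m vf_part_vf[OF U_open X]]
  have o: "opn (U \<inter> W)" "U \<inter> W \<subseteq> U" "m \<in> U \<inter> W" "U \<inter> W \<subseteq> W" if "opn W" "m \<in> W" for W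
    using that m U_open by auto
  show ?thesis
    unfolding tangent_part_def
  proof (intro CollectI conjI allI impI ballI)
    fix W f show "opn W \<and> m \<in> W \<and> f \<in> Sec W \<or> vf_at M U X m W f = 0" by (simp add: vf_at_def)
  next
    fix O' W f assume O': "opn O' \<and> m \<in> O'" and W: "W \<in> opens M O'" and f: "f \<in> Sec O'" and mW: "m \<in> W"
    have W': "opn W" "W \<subseteq> O'" using W by (auto simp: opens_iff)
    note oO = o[of O'] and oW = o[OF W'(1) mW]
    have s: "U \<inter> W \<subseteq> U \<inter> O'" "U \<inter> W \<subseteq> O'" using W' by auto
    have rf: "res M W (U \<inter> W) (res M O' W f) = res M (U \<inter> O') (U \<inter> W) (res M O' (U \<inter> O') f)"
      using O' W' oO oW s f by (simp add: res_trans)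
    have "res M O' (U \<inter> O') f \<in> Sec (U \<inter> O')" using O' oO f res_closed by blast
    then show "vf_at M U X m W (res M O' W f) = vf_at M U X m O' f"
      using at[OF W'(1) mW res_closed[OF _ W' f]] at[of O' f] O' f rf D(2,7) oO oW s m by (simp add: cc_res)
  next
    fix O' f h assume O': "opn O' \<and> m \<in> O'" and f: "f \<in> Sec O'" and h: "h \<in> Sec O'"
    note oO = o[of O']
    show "vf_at M U X m O' (f \<oplus>\<^bsub>sheaf M O'\<^esub> h) = vf_at M U X m O' f + vf_at M U X m O' h"
      using O' f h oO D(2,3) m by (simp add: at res_add res_closed cc_ops)
  next
    fix O' c f assume O': "opn O' \<and> m \<in> O'" and f: "f \<in> Sec O'"
    note oO = o[of O']
    show "vf_at M U X m O' (c \<odot>\<^bsub>sheaf M O'\<^esub> f) = c * vf_at M U X m O' f"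
      using O' f oO D(2,4) m by (simp add: at res_smult res_closed cc_smult)
  next
    fix O' r f assume O': "opn O' \<and> m \<in> O'" and f: "f \<in> part (sheaf M O') r"
    have O'': "opn O'" "m \<in> O'" using O' by auto
    note oO = o[OF O'']
    show "r = 0 \<or> vf_at M U X m O' f = 0"
    proof (cases r)
      case one
      have "res M O' (U \<inter> O') f \<in> part (sheaf M (U \<inter> O')) 1" using res_part[OF O''(1) oO(1,4) f] one by simp
      then have "X (U \<inter> O') (res M O' (U \<inter> O') f) \<in> part (sheaf M (U \<inter> O')) 1"
        using D(5)[OF oO(1,2), of _ 1] by simp
      then show ?thesis using at[OF O'' Sec_closed(6)[OF O''(1) f]] cc_odd[OF oO(1,3) m] by simp
    qed simp
  next
    fix O' r f h assume O': "opn O' \<and> m \<in> O'" and f: "f \<in> part (sheaf M O') r" and h: "h \<in> Sec O'"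
    have O'': "opn O'" "m \<in> O'" using O' by auto
    note oO = o[OF O'']
    have fS: "f \<in> Sec O'" by (rule Sec_closed(6)[OF O''(1) f])
    let ?f = "res M O' (U \<inter> O') f" and ?h = "res M O' (U \<inter> O') h"
    have r: "?f \<in> Sec (U \<inter> O')" "?h \<in> Sec (U \<inter> O')" using res_closed[OF O''(1) oO(1,4)] fS h by blast+
    have "vf_at M U X m O' (f \<otimes>\<^bsub>sheaf M O'\<^esub> h) = cc {} (U \<inter> O') (X (U \<inter> O') ?f) m * cc {} (U \<inter> O') ?h m +
        cc {} (U \<inter> O') ?f m * cc {} (U \<inter> O') (X (U \<inter> O') ?h) m"
      using at[OF O'', of "f \<otimes>\<^bsub>sheaf M O'\<^esub> h"] O'' fS h oO m r D(2)[OF oO(1,2)]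
        D(6)[OF oO(1,2) res_part[OF O''(1) oO(1,4) f] r(2)] by (simp add: res_mult cc_ops cc_smult)
    then show "vf_at M U X m O' (f \<otimes>\<^bsub>sheaf M O'\<^esub> h) =
        vf_at M U X m O' f * val M O' h m + koszul 0 r * val M O' f m * vf_at M U X m O' h"
      using at[OF O''] fS h val_cc[OF O'' m] cc_res[OF O''(1) oO(1,4,3) m] by simp
  qed
qed

end

section \<open>Nondegeneracy of the Gram matrix\<close>

context null_chart
begin

lemma cc_lincomb:
  assumes W: "opn W" "W \<subseteq> U" "m \<in> W" and f: "f \<in> Sec W" and k: "\<And>i. k i \<in> Sec U"
    and J: "J \<in> {{}, {0}}"
  shows "cc J W (lsum U (\<lambda>i. vf_smult M U (k i) (E i)) ns W f) m =
    (\<Sum>i\<in>UNIV. cc J W (res M U W (k i) \<otimes>\<^bsub>sheaf M W\<^esub> E i W f) m)"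
proof -
  have mU: "m \<in> U" using W by blast
  have c: "res M U W (k i) \<otimes>\<^bsub>sheaf M W\<^esub> E i W f \<in> Sec W" for i
    using W res_closed[OF U_open W(1,2) k] E_closed[OF W(1,2) f] by simp
  have "cc J W (rsum W (\<lambda>i. res M U W (k i) \<otimes>\<^bsub>sheaf M W\<^esub> E i W f) ns) m =
      (\<Sum>i\<leftarrow>ns. cc J W (res M U W (k i) \<otimes>\<^bsub>sheaf M W\<^esub> E i W f) m)"
    by (rule cc_rsum[OF W(1,3) mU _ J]) (rule c)
  then show ?thesis using W f by (simp add: lsum_eq vf_smult_eq sum_ns)
qed

lemma const_Sec: "opn W \<Longrightarrow> c \<odot>\<^bsub>sheaf M W\<^esub> \<one>\<^bsub>sheaf M W\<^esub> \<in> Sec W"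
  by simp

lemma cc_const_mult:
  assumes W: "opn W" "W \<subseteq> U" "m \<in> W" and f: "f \<in> Sec W"
  shows "cc {} W (res M U W (c \<odot>\<^bsub>sheaf M U\<^esub> \<one>\<^bsub>sheaf M U\<^esub>) \<otimes>\<^bsub>sheaf M W\<^esub> f) m = c * cc {} W f m"
proof -
  have mU: "m \<in> U" using W by blast
  have r: "res M U W (c \<odot>\<^bsub>sheaf M U\<^esub> \<one>\<^bsub>sheaf M U\<^esub>) \<in> Sec W"
    by (rule res_closed[OF U_open W(1,2) const_Sec[OF U_open]])
  have "cc {} W (res M U W (c \<odot>\<^bsub>sheaf M U\<^esub> \<one>\<^bsub>sheaf M U\<^esub>)) m = c"
    using cc_res[OF U_open W mU const_Sec[OF U_open]] U_open mU by (simp add: cc_smult cc_one)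
  then show ?thesis using cc_ops(2)[OF W(1,3) mU r f] by simp
qed

text \<open>The value of the pairing at \<open>m\<close> depends on \<open>X\<close> only through
  \<open>GM m\<close> applied to its coordinate values. The domain \<open>U'\<close> is arbitrary
  because \<open>form_at\<close> admits representatives on every neighbourhood of
  \<open>m\<close>.\<close>

lemma pairing_zero:
  assumes m: "m \<in> U" and U': "opn U'" "m \<in> U'" and X: "X \<in> vf M U'" and Y: "Y \<in> vf M U'"
    and ker: "\<And>j. (\<Sum>i\<in>UNIV. GM m $ j $ i * vf_at M U' X m U (co i U)) = 0"
  shows "val M U' (g U' X Y) m = 0"
proof -
  let ?W = "U' \<inter> U"
  have o: "opn ?W" "?W \<subseteq> U'" "?W \<subseteq> U" "m \<in> ?W" using m U' U_open by auto
  let ?X = "vf_res M ?W X" and ?Y = "vf_res M ?W Y"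
  have XW: "?X \<in> vf M ?W" and YW: "?Y \<in> vf M ?W" using vf_res_vf[OF U'(1) o(1,2)] X Y by blast+
  have gS: "g U' X Y \<in> Sec U'" by (rule g_closed[OF U'(1) X Y])
  note EV = EW_vf[OF o(1,3)]
  have gc: "g ?W (EW ?W i) ?Y \<in> Sec ?W" for i by (rule g_closed[OF o(1) EV YW])
  note yc = yc_props[OF o(1,3) XW]
  have x: "cc {} ?W (yc ?W ?X i) m = vf_at M U' X m U (co i U)" for i
    using yc(2)[OF o(4)] vf_at_cc[OF U' m X U_open m co_closed[OF U_open order_refl]] res_co[OF U_open _ o(1,3)]
      co_closed[OF o(1,3)] by (simp add: vf_res_eq o)
  have e: "cc {} ?W (g ?W (EW ?W i) ?Y) m = (\<Sum>j\<in>UNIV. cc {} ?W (yc ?W ?Y j) m * GM m $ j $ i)" for i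
    using cc_g_E[OF o(1,3,4) YW, of "{}"] g_even_sym[OF o(1) EW_part[OF o(1,3)] YW] by simp
  have prd: "yc ?W ?X i \<otimes>\<^bsub>sheaf M ?W\<^esub> g ?W (EW ?W i) ?Y \<in> Sec ?W" for i using o(1) yc(1) gc by simp
  have rs: "cc {} ?W (rsum ?W (\<lambda>i. yc ?W ?X i \<otimes>\<^bsub>sheaf M ?W\<^esub> g ?W (EW ?W i) ?Y) ns) m =
      (\<Sum>i\<leftarrow>ns. cc {} ?W (yc ?W ?X i \<otimes>\<^bsub>sheaf M ?W\<^esub> g ?W (EW ?W i) ?Y) m)"
    by (rule cc_rsum[OF o(1,4) m]) (simp_all add: prd)
  have "val M U' (g U' X Y) m = cc {} ?W (g ?W ?X ?Y) m"
    using val_cc[OF U' m gS] cc_res[OF U'(1) o(1,2,4) m gS] g_res[OF U'(1) o(1,2) X Y] by simp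
  also have "\<dots> = (\<Sum>i\<in>UNIV. cc {} ?W (yc ?W ?X i) m * cc {} ?W (g ?W (EW ?W i) ?Y) m)"
    unfolding g_formula[OF o(1,3) XW YW] rs sum_ns by (simp add: cc_ops(2)[OF o(1,4) m yc(1) gc])
  also have "\<dots> = (\<Sum>i\<in>UNIV. \<Sum>j\<in>UNIV. cc {} ?W (yc ?W ?Y j) m * (GM m $ j $ i * vf_at M U' X m U (co i U)))"
    by (simp add: x e sum_distrib_left mult_ac)
  also have "\<dots> = (\<Sum>j\<in>UNIV. cc {} ?W (yc ?W ?Y j) m * (\<Sum>i\<in>UNIV. GM m $ j $ i * vf_at M U' X m U (co i U)))"
    by (subst sum.swap) (simp add: sum_distrib_left)
  finally show ?thesis by (simp add: ker)
qed

text \<open>Supplies the representatives that the description in \<open>form_at\<close> asks for.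
  Constant coefficients suffice: at \<open>m\<close> the field \<open>Q\<close> has the value of
  \<open>\<partial>\<^sub>\<tau>\<close>, because \<open>\<tau>\<close> has value zero, and together
  with the \<open>E i\<close> it spans the tangent space.\<close>

lemma tangent_vf_at:
  assumes m: "m \<in> U" and w: "w \<in> tangent M m"
  shows "\<exists>Y\<in>vf M U. vf_at M U Y m = w"
proof -
  obtain w0 w1 where w01: "w0 \<in> tangent_part M m 0" "w1 \<in> tangent_part M m 1" and we: "w = (\<lambda>W f. w0 W f + w1 W f)"
    using w unfolding tangent_def by blast
  let ?c = "\<lambda>c. c \<odot>\<^bsub>sheaf M U\<^esub> \<one>\<^bsub>sheaf M U\<^esub>"
  have UP: "U \<subseteq> points M" by (rule opn_subset_points[OF U_open])
  let ?L = "lsum U (\<lambda>i. vf_smult M U (?c (w U (co i U))) (E i)) ns"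
  let ?Y = "vf_add M U ?L (vf_smult M U (?c (w U (tau U))) (QW U))"
  note cS = const_Sec[OF U_open]
  have LV: "?L \<in> vf M U" by (intro lsum_vf vf_smult_vf U_open cS vf_part_vf[OF _ E_part])
  have Y: "?Y \<in> vf M U"
    by (intro vf_add_vf vf_smult_vf U_open cS QW_vf LV)
  have zero: "w W f = 0" if "\<not> (opn W \<and> m \<in> W \<and> f \<in> Sec W)" for W f
  proof -
    have "w0 W f = 0" "w1 W f = 0"
      using w01[unfolded tangent_part_def mem_Collect_eq, THEN conjunct1] that by blast+
    then show ?thesis by (simp add: we)
  qed
  have "vf_at M U ?Y m W f = w W f" for W f
  proof (cases "opn W \<and> m \<in> W \<and> f \<in> Sec W")
    case True
    then have W: "opn W" "m \<in> W" and f: "f \<in> Sec W" by auto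
    let ?W = "U \<inter> W"
    have o: "opn ?W" "?W \<subseteq> U" "m \<in> ?W" "?W \<subseteq> W" using W m U_open by auto
    let ?f = "res M W ?W f"
    have fS: "?f \<in> Sec ?W" by (rule res_closed[OF W(1) o(1,4) f])
    have Qc: "Q ?W ?f \<in> Sec ?W" by (rule vf_closed[OF Q_vf o(1) opn_subset_points[OF o(1)] fS])
    have rc: "res M U ?W (?c c) \<in> Sec ?W" for c by (rule res_closed[OF U_open o(1,2) cS])
    have "vf_at M U ?Y m W f = cc {} ?W (?Y ?W ?f) m"
      by (rule vf_at_cc[OF U_open m m Y W f])
    also have "?Y ?W ?f = ?L ?W ?f \<oplus>\<^bsub>sheaf M ?W\<^esub> (res M U ?W (?c (w U (tau U))) \<otimes>\<^bsub>sheaf M ?W\<^esub> Q ?W ?f)"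
      using o fS by (simp only: vf_ops_eq)
    also have "cc {} ?W \<dots> m = cc {} ?W (?L ?W ?f) m + w U (tau U) * cc {} ?W (Q ?W ?f) m"
      using cc_ops(1)[OF o(1,3) m vf_closed[OF LV o(1,2) fS] Sec_closed(2)[OF o(1) rc Qc]]
        cc_const_mult[OF o(1,2,3) Qc] by simp
    also have "cc {} ?W (Q ?W ?f) m = cc {0} W f m"
      using cc_Q(1)[OF o(1,2,3) fS] cc_res[OF W(1) o(1,4,3) m f] by simp
    also have "cc {} ?W (?L ?W ?f) m = (\<Sum>i\<in>UNIV. w U (co i U) * cc {} ?W (E i ?W ?f) m)"
      using cc_lincomb[OF o(1,2,3) fS cS, of "{}"] cc_const_mult[OF o(1,2,3) E_closed[OF o(1,2) fS]] by simp
    also have "\<dots> + w U (tau U) * cc {0} W f m = w W f"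
      using tangent_formula[OF m w01(1) W f] tangent_formula[OF m w01(2) W f]
      by (simp add: we algebra_simps sum.distrib)
    finally show ?thesis .
  next
    case False
    then show ?thesis using zero[OF False] by (auto simp: vf_at_def)
  qed
  then have "vf_at M U ?Y m = w" by blast
  then show ?thesis using Y by blast
qed

text \<open>A null vector \<open>c\<close> of \<open>GM m\<close> gives an even field with constant
  coefficients whose value at \<open>m\<close> lies in the kernel of the form. The even part of that
  kernel is zero by \<open>ker_dim\<close>; evaluating on the coordinates shows
  \<open>c = 0\<close>.\<close>

lemma GM_invertible:
  assumes m: "m \<in> U"
  shows "det (GM m) \<noteq> 0"
proof
  assume "det (GM m) = 0"
  then have "\<not> (\<exists>B. B ** GM m = mat 1)"
    using invertible_det_nz[of "GM m"] invertible_left_inverse[of "GM m"] by blast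
  then obtain c where c: "GM m *v c = 0" "c \<noteq> 0" using matrix_left_invertible_ker by blast
  have mP: "m \<in> points M" using opn_points[OF U_open m] .
  let ?c = "\<lambda>c. c \<odot>\<^bsub>sheaf M U\<^esub> \<one>\<^bsub>sheaf M U\<^esub>"
  note cS = const_Sec[OF U_open]
  define X where "X = lsum U (\<lambda>i. vf_smult M U (?c (c $ i)) (E i)) ns"
  have X: "X \<in> vf_part M U 0"
    unfolding X_def using part_ops(2,4)[OF U_open] by (intro lsum_part U_open vf_smult_even E_part) auto
  note XV = vf_part_vf[OF U_open X]
  let ?v = "vf_at M U X m"
  have UU: "U \<subseteq> U" by simp
  have vc: "?v U (co j U) = c $ j" for j
  proof -
    have p: "cc {} U (E i U (co j U)) m = (if i = j then 1 else 0)" for i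
    proof -
      have "partial i (rep U (co j U) {}) (\<phi> m) = partial i (\<lambda>x. x $ j) (\<phi> m)"
        by (rule partial_cong[OF open_image[OF U_open UU]])
          (use m rep_sec[OF U_open UU smooth_component smooth_const] in \<open>auto simp: co_def\<close>)
      then show ?thesis by (simp add: cc_E[OF U_open UU co_closed[OF U_open UU] m] partial_component)
    qed
    have "?v U (co j U) = cc {} U (X U (co j U)) m"
      using vf_at_cc[OF U_open m m XV U_open m co_closed[OF U_open UU]] U_open UU co_closed by (simp add: res_id)
    also have "\<dots> = (\<Sum>i\<in>UNIV. c $ i * cc {} U (E i U (co j U)) m)"
      unfolding X_def using cc_lincomb[OF U_open UU m co_closed[OF U_open UU] cS, of "{}"]
        cc_const_mult[OF U_open UU m E_closed[OF U_open UU co_closed[OF U_open UU]]] by simp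
    also have "\<dots> = c $ j" by (simp add: p if_distrib cong: if_cong)
    finally show ?thesis .
  qed
  have ker: "(\<Sum>i\<in>UNIV. GM m $ j $ i * c $ i) = 0" for j
  proof -
    have "(GM m *v c) $ j = 0" using c(1) by simp
    then show ?thesis by (simp add: matrix_vector_mult_def)
  qed
  have form: "form_at M g m ?v w = 0" if w: "w \<in> tangent M m" for w
  proof -
    \<comment> \<open>The property described by \<open>form_at\<close>. Every \<open>r\<close> that
      has it is zero, and the fields \<open>X\<close> and \<open>Y\<close> below provide one, so the
      definite description equals zero.\<close>
    let ?P = "\<lambda>r. \<exists>U' X' Y'. opn U' \<and> m \<in> U' \<and> X' \<in> vf M U' \<and> Y' \<in> vf M U' \<and>
      vf_at M U' X' m = ?v \<and> vf_at M U' Y' m = w \<and> r = val M U' (g U' X' Y') m"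
    have unique: "r = 0" if r: "?P r" for r
    proof -
      obtain U' X' Y' where *: "opn U'" "m \<in> U'" "X' \<in> vf M U'" "Y' \<in> vf M U'" "vf_at M U' X' m = ?v"
        "r = val M U' (g U' X' Y') m"
        using r by (elim exE conjE) (rule that; assumption)
      show ?thesis unfolding *(6)
        by (rule pairing_zero[OF m *(1-4)]) (simp add: *(5) vc ker)
    qed
    obtain Y where Y: "Y \<in> vf M U" "vf_at M U Y m = w" using tangent_vf_at[OF m w] by blast
    have P: "?P (val M U (g U X Y) m)"
      by (intro exI[of _ U] exI[of _ X] exI[of _ Y]) (simp add: U_open m XV Y)
    have "?P 0" using P unfolding unique[OF P] .
    then have "(THE r. ?P r) = 0" by (rule the_equality) (rule unique)
    then show ?thesis unfolding form_at_def .
  qed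
  have vt: "?v \<in> tangent_part M m 0" by (rule vf_at_tangent[OF m X])
  have "?v \<in> tangent M m"
  proof -
    have "(\<lambda>W f. 0) \<in> tangent_part M m 1" by (simp add: tangent_part_def)
    then show ?thesis using vt unfolding tangent_def by force
  qed
  then have "?v \<in> form_ker M g m \<inter> tangent_part M m 0" using form vt by (simp add: form_ker_def)
  then have "?v = (\<lambda>W f. 0)" using ker_dim[OF mP] unfolding form_ker_dim_0_1_def by blast
  then have "c $ j = 0" for j using vc[of j] by simp
  then show False using c(2) by (simp add: vec_eq_iff)
qed

end

section \<open>Polarized frames\<close>

text \<open>Here \<open>a\<close> and \<open>b\<close> are the pairings of a field with the
  \<open>E i\<close> and with their dual fields, \<open>e\<close> and \<open>h\<close> the values of
  these fields on a function. Polarization reduces the left side to the mean of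
  \<open>a \<bullet> h\<close> and \<open>b \<bullet> e\<close>. Both equal
  \<open>y \<bullet> e\<close>, since \<open>b = H G y = y\<close> and
  \<open>a \<bullet> h = (y G) \<bullet> (H e)\<close>.\<close>

lemma polarized_sum:
  fixes G H :: "real^'n^'n" and y e :: "real^'n"
  assumes sym: "\<And>i j. G $ i $ j = G $ j $ i" and inv: "G ** H = mat 1" "H ** G = mat 1"
    and a: "\<And>i. a i = (\<Sum>j\<in>UNIV. y $ j * G $ j $ i)"
    and b: "\<And>i. b i = (\<Sum>k\<in>UNIV. H $ i $ k * a k)"
    and h: "\<And>i. h i = (\<Sum>k\<in>UNIV. H $ i $ k * e $ k)"
  shows "(\<Sum>i\<in>UNIV. 1/4 * ((a i + b i) * (e $ i + h i))) + (\<Sum>i\<in>UNIV. - 1/4 * ((a i - b i) * (e $ i - h i))) =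
    (\<Sum>i\<in>UNIV. y $ i * e $ i)"
proof -
  have av: "(\<chi> i. a i) = y v* G" "(\<chi> i. a i) = G *v y"
    by (simp_all add: vec_eq_iff a vector_matrix_mult_def matrix_vector_mult_def sym mult.commute)
  have bv: "(\<chi> i. b i) = H *v (\<chi> i. a i)" and hv: "(\<chi> i. h i) = H *v e"
    by (simp_all add: vec_eq_iff b h matrix_vector_mult_def)
  have "(\<chi> i. b i) = y" unfolding bv av(2) by (simp add: matrix_vector_mul_assoc inv)
  then have by': "b i = y $ i" for i by (metis vec_lambda_beta)
  have "(\<chi> i. a i) \<bullet> (\<chi> i. h i) = y \<bullet> e"
    unfolding av(1) hv dot_lmul_matrix by (simp add: matrix_vector_mul_assoc inv)
  then have ah: "(\<Sum>i\<in>UNIV. a i * h i) = (\<Sum>i\<in>UNIV. y $ i * e $ i)"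
    by (simp add: inner_vec_def)
  have "(\<Sum>i\<in>UNIV. 1/4 * ((a i + b i) * (e $ i + h i))) + (\<Sum>i\<in>UNIV. - 1/4 * ((a i - b i) * (e $ i - h i))) =
      (\<Sum>i\<in>UNIV. 1/2 * (a i * h i) + 1/2 * (b i * e $ i))"
    unfolding sum.distrib[symmetric] by (rule sum.cong) (simp_all add: algebra_simps)
  also have "\<dots> = 1/2 * (\<Sum>i\<in>UNIV. a i * h i) + 1/2 * (\<Sum>i\<in>UNIV. b i * e $ i)"
    unfolding sum.distrib sum_distrib_left ..
  finally show ?thesis by (simp add: ah by')
qed

context null_chart
begin

text \<open>The inverse Gram matrix. The entries of \<open>Gr\<close> are even, so only first
  components have to be inverted, and Cramer's rule keeps them smooth.\<close>

definition Hs :: "'n \<Rightarrow> 'n \<Rightarrow> 's" where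
  "Hs i k = bd U (\<lambda>x. matrix_inv (\<chi> i j. rep U (Gr i j) {} x) $ i $ k)"

lemma Hs_props:
  shows Hs_even: "Hs i k \<in> part (sheaf M U) 0"
    and cc_Hs: "m \<in> U \<Longrightarrow> cc {} U (Hs i k) m = matrix_inv (GM m) $ i $ k" "m \<in> U \<Longrightarrow> cc {0} U (Hs i k) m = 0"
proof -
  have UU: "U \<subseteq> U" by simp
  have GM: "(\<chi> i j. rep U (Gr i j) {} (\<phi> m)) = GM m" for m
    by (simp add: GM_def cc_rep[OF U_open UU Gr_closed])
  have "smooth (\<phi> ` U) (\<lambda>x. matrix_inv (\<chi> i j. rep U (Gr i j) {} x) $ i $ k)"
    by (rule smooth_matrix_inv[OF open_image[OF U_open UU]])
      (use smooth_rep[OF U_open UU Gr_closed] GM_invertible in \<open>auto simp: GM\<close>)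
  note p = bd_props[OF U_open UU this]
  show "Hs i k \<in> part (sheaf M U) 0" unfolding Hs_def by (rule p(2))
  show "m \<in> U \<Longrightarrow> cc {} U (Hs i k) m = matrix_inv (GM m) $ i $ k" "m \<in> U \<Longrightarrow> cc {0} U (Hs i k) m = 0"
    unfolding Hs_def using p(3,4) by (simp_all add: GM)
qed

lemma Hs_closed: "Hs i k \<in> Sec U"
  by (rule Sec_closed(6)[OF U_open Hs_even])

text \<open>The fields dual to \<open>E\<close> under the metric:
  \<open>\<langle>hv i|E j\<rangle>\<close> is \<open>1\<close> for \<open>i = j\<close> and
  \<open>0\<close> otherwise.\<close>

definition hv :: "'n \<Rightarrow> ('a, 's) vf" where "hv i = lsum U (\<lambda>k. vf_smult M U (Hs i k) (E k)) ns"

lemma hv_part: "hv i \<in> vf_part M U 0"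
  unfolding hv_def by (intro lsum_part U_open vf_smult_even Hs_even E_part)

lemma cc_hv:
  assumes W: "opn W" "W \<subseteq> U" "m \<in> W" and f: "f \<in> Sec W" and J: "J \<in> {{}, {0}}"
  shows "cc J W (hv i W f) m = (\<Sum>k\<in>UNIV. matrix_inv (GM m) $ i $ k * cc J W (E k W f) m)"
proof -
  have mU: "m \<in> U" using W by blast
  have r: "res M U W (Hs i k) \<in> Sec W" for k by (rule res_closed[OF U_open W(1,2) Hs_closed])
  have rc: "cc K W (res M U W (Hs i k)) m = cc K U (Hs i k) m" for k K
    by (rule cc_res[OF U_open W mU Hs_closed])
  show ?thesis
    unfolding hv_def cc_lincomb[OF W f Hs_closed J]
    using J by (auto simp: cc_ops(2,3)[OF W(1,3) mU r E_closed[OF W(1,2) f]] rc cc_Hs[OF mU])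
qed

lemma cc_g_hv:
  assumes m: "m \<in> U" and Y: "Y \<in> vf M U" and J: "J \<in> {{}, {0}}"
  shows "cc J U (g U (hv i) Y) m = (\<Sum>k\<in>UNIV. matrix_inv (GM m) $ i $ k * cc J U (g U (E k) Y) m)"
proof -
  have EV: "E k \<in> vf M U" for k by (rule vf_part_vf[OF U_open E_part])
  have sV: "vf_smult M U (Hs i k) (E k) \<in> vf M U" for k by (rule vf_smult_vf[OF U_open Hs_closed EV])
  have gc: "g U (E k) Y \<in> Sec U" for k by (rule g_closed[OF U_open EV Y])
  have e: "g U (hv i) Y = rsum U (\<lambda>k. Hs i k \<otimes>\<^bsub>sheaf M U\<^esub> g U (E k) Y) ns"
    unfolding hv_def g_lsum1[OF U_open Y sV] g_smult1[OF U_open EV Y Hs_closed] ..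
  have "cc J U (g U (hv i) Y) m = (\<Sum>k\<leftarrow>ns. cc J U (Hs i k \<otimes>\<^bsub>sheaf M U\<^esub> g U (E k) Y) m)"
    unfolding e by (rule cc_rsum[OF U_open m m _ J]) (rule Sec_closed(2)[OF U_open Hs_closed gc])
  then show ?thesis
    unfolding sum_ns using J by (auto simp: cc_ops(2,3)[OF U_open m m Hs_closed gc] cc_Hs[OF m])
qed

text \<open>\<open>fp i\<close> and \<open>fm i\<close> polarize \<open>E i\<close> against its
  dual: \<open>e h + h e = ((e + h)^2 - (e - h)^2) / 2\<close> leaves only squares, the shape that
  \<open>pconn_term\<close> handles.\<close>

definition fp :: "'n \<Rightarrow> ('a, 's) vf" where "fp i = vf_add M U (E i) (hv i)"
definition fm :: "'n \<Rightarrow> ('a, 's) vf" where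
  "fm i = vf_add M U (E i) (vf_smult M U ((-1) \<odot>\<^bsub>sheaf M U\<^esub> \<one>\<^bsub>sheaf M U\<^esub>) (hv i))"

lemma mone_even: "(-1) \<odot>\<^bsub>sheaf M U\<^esub> \<one>\<^bsub>sheaf M U\<^esub> \<in> part (sheaf M U) 0"
  by (rule part_ops(2)[OF U_open part_ops(4)[OF U_open]])

lemma fp_part: "fp i \<in> vf_part M U 0" and fm_part: "fm i \<in> vf_part M U 0"
  unfolding fp_def fm_def by (intro vf_add_part vf_smult_even U_open E_part hv_part mone_even)+

lemma mone_mult:
  assumes W: "opn W" "W \<subseteq> U" "m \<in> W" and f: "f \<in> Sec W" and J: "J \<in> {{}, {0}}"
  shows "cc J W (res M U W ((-1) \<odot>\<^bsub>sheaf M U\<^esub> \<one>\<^bsub>sheaf M U\<^esub>) \<otimes>\<^bsub>sheaf M W\<^esub> f) m = - cc J W f m"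
proof -
  have mU: "m \<in> U" using W by blast
  let ?c = "(-1) \<odot>\<^bsub>sheaf M U\<^esub> \<one>\<^bsub>sheaf M U\<^esub>"
  have r: "res M U W ?c \<in> Sec W" by (rule res_closed[OF U_open W(1,2) const_Sec[OF U_open]])
  have rc: "cc K W (res M U W ?c) m = (if K = {} then -1 else 0)" for K
    using cc_res[OF U_open W mU const_Sec[OF U_open], of K "-1"] U_open mU by (simp add: cc_smult cc_one)
  show ?thesis using J by (auto simp: cc_ops(2,3)[OF W(1,3) mU r f] rc)
qed

lemma cc_fpm:
  assumes W: "opn W" "W \<subseteq> U" "m \<in> W" and f: "f \<in> Sec W" and J: "J \<in> {{}, {0}}"
  shows "cc J W (fp i W f) m = cc J W (E i W f) m + cc J W (hv i W f) m"
    "cc J W (fm i W f) m = cc J W (E i W f) m - cc J W (hv i W f) m"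
proof -
  have mU: "m \<in> U" using W by blast
  note cl = vf_part_closed[OF E_part W(1,2) f] vf_part_closed[OF hv_part W(1,2) f]
  show "cc J W (fp i W f) m = cc J W (E i W f) m + cc J W (hv i W f) m"
    using cl W f by (simp add: fp_def vf_add_eq cc_ops(1)[OF W(1,3) mU])
  have r: "res M U W ((-1) \<odot>\<^bsub>sheaf M U\<^esub> \<one>\<^bsub>sheaf M U\<^esub>) \<otimes>\<^bsub>sheaf M W\<^esub> hv i W f \<in> Sec W"
    by (rule Sec_closed(2)[OF W(1) res_closed[OF U_open W(1,2) const_Sec[OF U_open]] cl(2)])
  show "cc J W (fm i W f) m = cc J W (E i W f) m - cc J W (hv i W f) m"
    unfolding fm_def vf_add_eq[OF W(1,2) f] vf_smult_eq[OF W(1,2) f] cc_ops(1)[OF W(1,3) mU cl(1) r]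
      mone_mult[OF W cl(2) J] by simp
qed

lemma cc_g_fpm:
  assumes m: "m \<in> U" and Y: "Y \<in> vf M U" and J: "J \<in> {{}, {0}}"
  shows "cc J U (g U Y (fp i)) m = cc J U (g U (E i) Y) m + cc J U (g U (hv i) Y) m"
    "cc J U (g U Y (fm i)) m = cc J U (g U (E i) Y) m - cc J U (g U (hv i) Y) m"
proof -
  have V: "E i \<in> vf M U" "hv i \<in> vf M U" using vf_part_vf[OF U_open] E_part hv_part by blast+
  note c = const_Sec[OF U_open, of "-1"]
  have gc: "g U (E i) Y \<in> Sec U" "g U (hv i) Y \<in> Sec U" using g_closed[OF U_open _ Y] V by blast+
  have "g U Y (fp i) = g U (E i) Y \<oplus>\<^bsub>sheaf M U\<^esub> g U (hv i) Y"
    using g_even_sym[OF U_open fp_part Y] g_add1[OF U_open V Y] by (simp add: fp_def)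
  then show "cc J U (g U Y (fp i)) m = cc J U (g U (E i) Y) m + cc J U (g U (hv i) Y) m"
    using cc_ops(1)[OF U_open m m gc] by simp
  have "g U Y (fm i) = g U (E i) Y \<oplus>\<^bsub>sheaf M U\<^esub> ((-1) \<odot>\<^bsub>sheaf M U\<^esub> \<one>\<^bsub>sheaf M U\<^esub>) \<otimes>\<^bsub>sheaf M U\<^esub> g U (hv i) Y"
    using g_even_sym[OF U_open fm_part Y] g_add1[OF U_open V(1) vf_smult_vf[OF U_open c V(2)] Y]
      g_smult1[OF U_open V(2) Y c] by (simp add: fm_def)
  then show "cc J U (g U Y (fm i)) m = cc J U (g U (E i) Y) m - cc J U (g U (hv i) Y) m"
    using cc_ops(1)[OF U_open m m gc(1) Sec_closed(2)[OF U_open c gc(2)]]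
      mone_mult[OF U_open order_refl m gc(2) J] res_id[OF U_open c] by simp
qed

text \<open>The inverse metric is the sum over \<open>i\<close> of the mean of
  \<open>E i \<otimes> hv i\<close> and \<open>hv i \<otimes> E i\<close>. The mean contributes a
  factor \<open>1/2\<close> and the polarization another one, hence the weights \<open>1/4\<close>
  and \<open>-1/4\<close>.\<close>

definition frame :: "(real \<times> ('a, 's) vf) list" where
  "frame = map (\<lambda>i. (1/4, fp i)) ns @ map (\<lambda>i. (-1/4, fm i)) ns"

lemma frame_part: "(c, v) \<in> set frame \<Longrightarrow> v \<in> vf_part M U 0"
  using fp_part fm_part by (auto simp: frame_def)

lemma frame_sum:
  assumes Y: "Y \<in> vf M U"
  shows "Y = vf_add M U (lsum U (\<lambda>(c, v). vf_smult M U (c \<odot>\<^bsub>sheaf M U\<^esub> g U Y v) v) frame)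
    (vf_smult M U (Y U (tau U)) (QW U))"
proof -
  have UU: "U \<subseteq> U" by simp
  let ?F = "\<lambda>(c, v). vf_smult M U (c \<odot>\<^bsub>sheaf M U\<^esub> g U Y v) v"
  have gS: "c \<odot>\<^bsub>sheaf M U\<^esub> g U Y v \<in> Sec U" "g U Y v \<in> Sec U" if "(c, v) \<in> set frame" for c v
    using g_closed[OF U_open Y vf_part_vf[OF U_open frame_part[OF that]]] U_open by simp_all
  have FV: "?F s \<in> vf M U" if s: "s \<in> set frame" for s
  proof (cases s)
    case (Pair c v)
    then have cv: "(c, v) \<in> set frame" using s by simp
    show ?thesis
      using vf_smult_vf[OF U_open gS(1)[OF cv] vf_part_vf[OF U_open frame_part[OF cv]]] Pair by simp
  qed
  have EV: "E i \<in> vf M U" for i by (rule vf_part_vf[OF U_open E_part])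
  note yc = yc_props[OF U_open UU Y]
  have LV: "lsum U (\<lambda>i. vf_smult M U (yc U Y i) (E i)) ns \<in> vf M U"
    by (intro lsum_vf vf_smult_vf U_open yc(1) EV)
  have "lsum U ?F frame = lsum U (\<lambda>i. vf_smult M U (yc U Y i) (E i)) ns"
  proof (rule cc_vf_eqI[OF U_open UU lsum_vf[OF U_open FV] LV])
    fix W f m and J :: "nat set"
    assume W: "opn W" "W \<subseteq> U" and f: "f \<in> Sec W" and m: "m \<in> W" and J: "J \<in> {{}, {0}}"
    have mU: "m \<in> U" using W m by blast
    have vc: "v W f \<in> Sec W" if "(c, v) \<in> set frame" for c v
      using vf_part_closed[OF frame_part[OF that] W f] .
    have rS: "res M U W (c \<odot>\<^bsub>sheaf M U\<^esub> g U Y v) \<in> Sec W" if "(c, v) \<in> set frame" for c v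
      by (rule res_closed[OF U_open W gS(1)[OF that]])
    have tS: "?F s W f \<in> Sec W" if "s \<in> set frame" for s
      using vf_closed[OF FV[OF that] W f] .
    have rc: "cc K W (res M U W (c \<odot>\<^bsub>sheaf M U\<^esub> g U Y v)) m = c * cc K U (g U Y v) m" if "(c, v) \<in> set frame" for c v K
      using cc_res[OF U_open W m mU gS(1)[OF that]] cc_smult[OF U_open mU mU gS(2)[OF that]] by simp
    have t: "cc {} W (?F (c, v) W f) m = c * (cc {} U (g U Y v) m * cc {} W (v W f) m)"
      "cc {0} W (?F (c, v) W f) m = c * (cc {} U (g U Y v) m * cc {0} W (v W f) m) + c * (cc {0} U (g U Y v) m * cc {} W (v W f) m)"
      if s: "(c, v) \<in> set frame" for c v
      using rc[OF s] cc_ops(2,3)[OF W(1) m mU rS[OF s] vc[OF s]] W f by (simp_all add: vf_smult_eq)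
    let ?G = "GM m" and ?H = "matrix_inv (GM m)"
    define a where "a K i = cc K U (g U (E i) Y) m" for K i
    define b where "b K i = cc K U (g U (hv i) Y) m" for K i
    define e where "e K = (\<chi> i. cc K W (E i W f) m)" for K
    define h where "h K i = cc K W (hv i W f) m" for K i
    define y where "y K = (\<chi> i. cc K U (yc U Y i) m)" for K
    have aK: "a K i = (\<Sum>j\<in>UNIV. y K $ j * ?G $ j $ i)" if "K \<in> {{}, {0}}" for K i
      using cc_g_E[OF U_open UU mU Y that, of i] g_even_sym[OF U_open E_part Y] by (simp add: a_def y_def EW_U)
    have bK: "b K i = (\<Sum>k\<in>UNIV. ?H $ i $ k * a K k)" if "K \<in> {{}, {0}}" for K i
      unfolding a_def b_def by (rule cc_g_hv[OF mU Y that])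
    have hK: "h K i = (\<Sum>k\<in>UNIV. ?H $ i $ k * e K $ k)" if "K \<in> {{}, {0}}" for K i
      unfolding h_def e_def vec_lambda_beta by (rule cc_hv[OF W m f that])
    \<comment> \<open>The coefficient and the direction may be taken in different components:
      \<open>GM m\<close> and its inverse act alike on both, so one identity serves all
      combinations.\<close>
    have polar: "(\<Sum>i\<in>UNIV. 1/4 * ((a K i + b K i) * (e K' $ i + h K' i))) +
        (\<Sum>i\<in>UNIV. - 1/4 * ((a K i - b K i) * (e K' $ i - h K' i))) = (\<Sum>i\<in>UNIV. y K $ i * e K' $ i)"
      if "K \<in> {{}, {0}}" "K' \<in> {{}, {0}}" for K K'
      using polarized_sum[OF GM_sym matrix_inv_inverse[OF GM_invertible[OF mU]] aK[OF that(1)] bK[OF that(1)] hK[OF that(2)]] .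
    have mem: "(1/4, fp i) \<in> set frame" "(-1/4, fm i) \<in> set frame" for i
      by (auto simp: frame_def ns)
    have L: "cc J W (lsum U ?F frame W f) m = (\<Sum>i\<in>UNIV. cc J W (?F (1/4, fp i) W f) m) + (\<Sum>i\<in>UNIV. cc J W (?F (-1/4, fm i) W f) m)"
    proof -
      have "cc J W (rsum W (\<lambda>s. ?F s W f) frame) m = (\<Sum>s\<leftarrow>frame. cc J W (?F s W f) m)"
        by (rule cc_rsum[OF W(1) m mU tS J])
      also have "\<dots> = (\<Sum>i\<leftarrow>ns. cc J W (?F (1/4, fp i) W f) m) + (\<Sum>i\<leftarrow>ns. cc J W (?F (-1/4, fm i) W f) m)"
        by (simp add: frame_def o_def)
      finally show ?thesis unfolding lsum_eq[OF W f] sum_ns .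
    qed
    note fpm = cc_g_fpm[OF mU Y] cc_fpm[OF W m f]
    have R: "cc J W (lsum U (\<lambda>i. vf_smult M U (yc U Y i) (E i)) ns W f) m =
        (\<Sum>i\<in>UNIV. cc J W (res M U W (yc U Y i) \<otimes>\<^bsub>sheaf M W\<^esub> E i W f) m)"
      by (rule cc_lincomb[OF W m f yc(1) J])
    note ry = res_closed[OF U_open W yc(1)] and ryc = cc_res[OF U_open W m mU yc(1)]
    have prd: "cc {} W (res M U W (yc U Y i) \<otimes>\<^bsub>sheaf M W\<^esub> E i W f) m = y {} $ i * e {} $ i"
      "cc {0} W (res M U W (yc U Y i) \<otimes>\<^bsub>sheaf M W\<^esub> E i W f) m = y {} $ i * e {0} $ i + y {0} $ i * e {} $ i" for i
      using cc_ops(2,3)[OF W(1) m mU ry E_closed[OF W f]] ryc by (simp_all add: y_def e_def)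
    consider "J = {}" | "J = {0}" using J by blast
    then show "cc J W (lsum U ?F frame W f) m = cc J W (lsum U (\<lambda>i. vf_smult M U (yc U Y i) (E i)) ns W f) m"
    proof cases
      case 1
      have c1: "cc {} W (?F (1/4, fp i) W f) m = 1/4 * ((a {} i + b {} i) * (e {} $ i + h {} i))"
        "cc {} W (?F (-1/4, fm i) W f) m = - 1/4 * ((a {} i - b {} i) * (e {} $ i - h {} i))" for i
        unfolding t[OF mem(1)] t[OF mem(2)] by (simp_all add: fpm a_def b_def e_def h_def)
      show ?thesis unfolding L R unfolding 1 c1 prd by (rule polar) simp_all
    next
      case 2
      \<comment> \<open>The second component of a product has two terms, according to which factor
        is taken in its second component; the polarization identity applies to each of them.\<close>
      have c2: "cc {0} W (?F (1/4, fp i) W f) m = 1/4 * ((a {} i + b {} i) * (e {0} $ i + h {0} i)) + 1/4 * ((a {0} i + b {0} i) * (e {} $ i + h {} i))"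
        "cc {0} W (?F (-1/4, fm i) W f) m = - 1/4 * ((a {} i - b {} i) * (e {0} $ i - h {0} i)) + - 1/4 * ((a {0} i - b {0} i) * (e {} $ i - h {} i))" for i
        unfolding t[OF mem(1)] t[OF mem(2)] by (simp_all add: fpm a_def b_def e_def h_def)
      have p: "(x + y') + (z + w) = r + r'" if "x + z = r" "y' + w = r'" for x y' z w r r' :: real
        using that by simp
      show ?thesis unfolding L R unfolding 2 c2 prd sum.distrib
        by (rule p; rule polar) simp_all
    qed
  qed
  then show ?thesis using decomposition[OF U_open UU Y] by (simp add: EW_U)
qed

lemma Q_tau: "Q U (tau U) = \<one>\<^bsub>sheaf M U\<^esub>"
proof -
  have UU: "U \<subseteq> U" by simp
  note t = tau_closed[OF U_open UU]
  have z: "partial i (rep U (tau U) {}) (\<phi> m) = 0" if "m \<in> U" for m i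
  proof -
    have "partial i (rep U (tau U) {}) (\<phi> m) = partial i (\<lambda>x. 0) (\<phi> m)"
      by (rule partial_cong[OF open_image[OF U_open UU]])
        (use that rep_sec[OF U_open UU smooth_const smooth_const] in \<open>auto simp: tau_def\<close>)
    then show ?thesis by (simp add: partial_const)
  qed
  show ?thesis
    by (rule cc_eqI[OF U_open UU vf_closed[OF Q_vf U_open opn_subset_points[OF U_open] t]])
      (use U_open t z in \<open>auto simp: cc_Q[OF U_open UU _ t] cc_one cc_tau[OF U_open UU] cc_E[OF U_open UU t]\<close>)
qed

end

section \<open>Weighted connections\<close>

context sheaf_space
begin

lemma vf_res_add: "opn W \<Longrightarrow> W \<subseteq> U \<Longrightarrow> vf_res M W (vf_add M U X Y) = vf_add M W (vf_res M W X) (vf_res M W Y)"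
  by (rule on_opens_eqI[OF vf_ops_on(4) vf_ops_on(1)]) (simp add: vf_ops_eq subset_trans[of _ W U])

lemma vf_res_smult:
  assumes "opn U" "opn W" "W \<subseteq> U" "f \<in> Sec U"
  shows "vf_res M W (vf_smult M U f X) = vf_smult M W (res M U W f) (vf_res M W X)"
  by (rule on_opens_eqI[OF vf_ops_on(4) vf_ops_on(2)])
    (use assms in \<open>simp add: vf_ops_eq subset_trans[of _ W U] res_trans\<close>)

end

locale null_mfd = metric_mfd M N g for M :: "('a, 's) superspace" and N :: "'n::finite itself" and g +
  fixes Q :: "('a, 's) vf"
  assumes Q_odd: "Q \<in> Vect_part M 1"
    and Q_ker: "\<And>Y. Y \<in> Vect M \<Longrightarrow> g (points M) Q Y = \<zero>\<^bsub>sheaf M (points M)\<^esub>"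
begin

abbreviation T :: "'a set" where "T \<equiv> points M"
abbreviation R :: "'s superalgebra" where "R \<equiv> sheaf M T"
abbreviation sm :: "'s \<Rightarrow> ('a, 's) vf \<Rightarrow> ('a, 's) vf" where "sm \<equiv> vf_smult M T"
abbreviation ad :: "('a, 's) vf \<Rightarrow> ('a, 's) vf \<Rightarrow> ('a, 's) vf" where "ad \<equiv> vf_add M T"

lemma opT: "opn T" by simp

lemma vfT [simp]:
  "X \<in> Vect_part M p \<Longrightarrow> X \<in> Vect M"
  "X \<in> Vect M \<Longrightarrow> Y \<in> Vect M \<Longrightarrow> ad X Y \<in> Vect M"
  "f \<in> Sec T \<Longrightarrow> X \<in> Vect M \<Longrightarrow> sm f X \<in> Vect M"
  "X \<in> Vect M \<Longrightarrow> f \<in> Sec T \<Longrightarrow> X T f \<in> Sec T"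
  "X \<in> Vect M \<Longrightarrow> Y \<in> Vect M \<Longrightarrow> g T X Y \<in> Sec T"
  "vf_zero M T \<in> Vect M" "Q \<in> Vect M"
  by (rule vf_part_vf[OF opT], assumption, rule vf_add_vf[OF opT], assumption+, rule vf_smult_vf[OF opT], assumption+,
    rule vf_closed[OF _ opT order_refl], assumption+, rule g_closed[OF opT], assumption+, rule vf_zero_vf[OF opT],
    rule vf_part_vf[OF opT Q_odd])

lemma secT [simp]:
  "f \<in> Sec T \<Longrightarrow> h \<in> Sec T \<Longrightarrow> f \<oplus>\<^bsub>R\<^esub> h \<in> Sec T" "f \<in> Sec T \<Longrightarrow> h \<in> Sec T \<Longrightarrow> f \<otimes>\<^bsub>R\<^esub> h \<in> Sec T"
  "f \<in> Sec T \<Longrightarrow> c \<odot>\<^bsub>R\<^esub> f \<in> Sec T" "\<one>\<^bsub>R\<^esub> \<in> Sec T" "\<zero>\<^bsub>R\<^esub> \<in> Sec T" "f \<in> part R p \<Longrightarrow> f \<in> Sec T"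
  by (rule Sec_closed(1)[OF opT], assumption+, rule Sec_closed(2)[OF opT], assumption+, rule Sec_closed(3)[OF opT], assumption,
    rule Sec_closed(4)[OF opT], rule Sec_closed(5)[OF opT], rule Sec_closed(6)[OF opT], assumption)

lemma resT [simp]:
  assumes "opn W"
  shows "f \<in> Sec T \<Longrightarrow> res M T W f \<in> Sec W" "f \<in> Sec T \<Longrightarrow> h \<in> Sec T \<Longrightarrow> res M T W (f \<oplus>\<^bsub>R\<^esub> h) = res M T W f \<oplus>\<^bsub>sheaf M W\<^esub> res M T W h"
    "f \<in> Sec T \<Longrightarrow> h \<in> Sec T \<Longrightarrow> res M T W (f \<otimes>\<^bsub>R\<^esub> h) = res M T W f \<otimes>\<^bsub>sheaf M W\<^esub> res M T W h"
    "f \<in> Sec T \<Longrightarrow> res M T W (c \<odot>\<^bsub>R\<^esub> f) = c \<odot>\<^bsub>sheaf M W\<^esub> res M T W f"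
    "res M T W \<one>\<^bsub>R\<^esub> = \<one>\<^bsub>sheaf M W\<^esub>" "res M T W \<zero>\<^bsub>R\<^esub> = \<zero>\<^bsub>sheaf M W\<^esub>"
proof -
  note W = opT assms opn_subset_points[OF assms]
  show "f \<in> Sec T \<Longrightarrow> res M T W f \<in> Sec W" by (rule res_closed[OF W])
  show "f \<in> Sec T \<Longrightarrow> h \<in> Sec T \<Longrightarrow> res M T W (f \<oplus>\<^bsub>R\<^esub> h) = res M T W f \<oplus>\<^bsub>sheaf M W\<^esub> res M T W h"
    by (rule res_add[OF W])
  show "f \<in> Sec T \<Longrightarrow> h \<in> Sec T \<Longrightarrow> res M T W (f \<otimes>\<^bsub>R\<^esub> h) = res M T W f \<otimes>\<^bsub>sheaf M W\<^esub> res M T W h"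
    by (rule res_mult[OF W])
  show "f \<in> Sec T \<Longrightarrow> res M T W (c \<odot>\<^bsub>R\<^esub> f) = c \<odot>\<^bsub>sheaf M W\<^esub> res M T W f" by (rule res_smult[OF W])
  show "res M T W \<one>\<^bsub>R\<^esub> = \<one>\<^bsub>sheaf M W\<^esub>" by (rule res_one[OF W])
  show "res M T W \<zero>\<^bsub>R\<^esub> = \<zero>\<^bsub>sheaf M W\<^esub>" by (rule res_zero[OF W])
qed

lemma vfT_eq [simp]:
  assumes "opn W" "f \<in> Sec W"
  shows "ad X Y W f = X W f \<oplus>\<^bsub>sheaf M W\<^esub> Y W f" "sm h X W f = res M T W h \<otimes>\<^bsub>sheaf M W\<^esub> X W f"
    "vf_zero M T W f = \<zero>\<^bsub>sheaf M W\<^esub>"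
  by (rule vf_ops_eq[OF assms(1) opn_subset_points[OF assms(1)] assms(2)])+

lemma vfT_closed [simp]: "X \<in> Vect M \<Longrightarrow> opn W \<Longrightarrow> f \<in> Sec W \<Longrightarrow> X W f \<in> Sec W"
  by (rule vf_closed[OF _ _ opn_subset_points])

lemma vfT_add: "X \<in> Vect M \<Longrightarrow> f \<in> Sec T \<Longrightarrow> h \<in> Sec T \<Longrightarrow> X T (f \<oplus>\<^bsub>R\<^esub> h) = X T f \<oplus>\<^bsub>R\<^esub> X T h"
  by (rule vf_ev_add[OF _ opT order_refl])

lemma vfT_smult: "X \<in> Vect M \<Longrightarrow> f \<in> Sec T \<Longrightarrow> X T (c \<odot>\<^bsub>R\<^esub> f) = c \<odot>\<^bsub>R\<^esub> X T f"
  by (rule vf_ev_smult[OF _ opT order_refl])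

lemma vfT_leibniz:
  "X \<in> Vect_part M p \<Longrightarrow> f \<in> part R r \<Longrightarrow> h \<in> Sec T \<Longrightarrow>
    X T (f \<otimes>\<^bsub>R\<^esub> h) = X T f \<otimes>\<^bsub>R\<^esub> h \<oplus>\<^bsub>R\<^esub> koszul p r \<odot>\<^bsub>R\<^esub> (f \<otimes>\<^bsub>R\<^esub> X T h)"
  by (rule vf_part_leibniz[OF _ opT order_refl])

lemma vfT_part: "X \<in> Vect_part M p \<Longrightarrow> f \<in> part R r \<Longrightarrow> X T f \<in> part R (p + r)"
  by (rule vf_part_part[OF _ opT order_refl])

lemma vfT_zero: "X \<in> Vect M \<Longrightarrow> X T \<zero>\<^bsub>R\<^esub> = \<zero>\<^bsub>R\<^esub>"
proof -
  assume X: "X \<in> Vect M"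
  have "\<zero>\<^bsub>R\<^esub> = 0 \<odot>\<^bsub>R\<^esub> \<zero>\<^bsub>R\<^esub>" by (rule ev_eqI[OF opT]) (simp_all add: ev_zero ev_smult)
  then have "X T \<zero>\<^bsub>R\<^esub> = 0 \<odot>\<^bsub>R\<^esub> X T \<zero>\<^bsub>R\<^esub>" using vfT_smult[OF X, of "\<zero>\<^bsub>R\<^esub>" 0] by simp
  then have "ev J T (X T \<zero>\<^bsub>R\<^esub>) m = 0" if "m \<in> T" for J m
    using ev_smult[OF opT that, of "X T \<zero>\<^bsub>R\<^esub>" J 0] X by simp
  then show ?thesis using X by (intro ev_eq_zeroI[OF opT]) simp_all
qed

lemma ev_sm:
  assumes "opn W" "m \<in> W" "f \<in> Sec W" "X \<in> Vect M" "h \<in> Sec T"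
  shows "ev {} W (sm h X W f) m = ev {} T h m * ev {} W (X W f) m"
    "ev {0} W (sm h X W f) m = ev {} T h m * ev {0} W (X W f) m + ev {0} T h m * ev {} W (X W f) m"
  using assms ev_res[OF opT assms(1) opn_subset_points[OF assms(1)] assms(2,5)]
  by (simp_all add: ev_mult0 ev_mult1)

lemma ev_ad:
  assumes "opn W" "m \<in> W" "f \<in> Sec W" "X \<in> Vect M" "Y \<in> Vect M"
  shows "ev I W (ad X Y W f) m = ev I W (X W f) m + ev I W (Y W f) m"
  using assms by (simp add: ev_add)

lemmas evT = ev_add[OF opT] ev_mult0[OF opT] ev_mult1[OF opT] ev_smult[OF opT] ev_one[OF opT] ev_zero[OF opT]

section \<open>Operators additive in both arguments and linear over functions in the first\<close>

definition bilin :: "('a, 's) connection \<Rightarrow> bool" where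
  "bilin D \<longleftrightarrow> (\<forall>X\<in>Vect M. \<forall>Y\<in>Vect M. D X Y \<in> Vect M) \<and>
    (\<forall>p r. \<forall>X\<in>Vect_part M p. \<forall>Y\<in>Vect_part M r. D X Y \<in> Vect_part M (p + r)) \<and>
    (\<forall>X\<in>Vect M. \<forall>Y\<in>Vect M. \<forall>Z\<in>Vect M.
        D (ad X Y) Z = ad (D X Z) (D Y Z) \<and> D X (ad Y Z) = ad (D X Y) (D X Z)) \<and>
    (\<forall>f\<in>C_inf M. \<forall>X\<in>Vect M. \<forall>Y\<in>Vect M. D (sm f X) Y = sm f (D X Y))"

lemma bilinD:
  assumes "bilin D"
  shows "X \<in> Vect M \<Longrightarrow> Y \<in> Vect M \<Longrightarrow> D X Y \<in> Vect M"
    "X \<in> Vect_part M p \<Longrightarrow> Y \<in> Vect_part M r \<Longrightarrow> D X Y \<in> Vect_part M (p + r)"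
    "X \<in> Vect M \<Longrightarrow> Y \<in> Vect M \<Longrightarrow> Z \<in> Vect M \<Longrightarrow> D (ad X Y) Z = ad (D X Z) (D Y Z)"
    "X \<in> Vect M \<Longrightarrow> Y \<in> Vect M \<Longrightarrow> Z \<in> Vect M \<Longrightarrow> D X (ad Y Z) = ad (D X Y) (D X Z)"
    "f \<in> Sec T \<Longrightarrow> X \<in> Vect M \<Longrightarrow> Y \<in> Vect M \<Longrightarrow> D (sm f X) Y = sm f (D X Y)"
  using assms unfolding bilin_def by blast+

lemma bilin_add:
  assumes D: "bilin D" and D': "bilin D'"
  shows "bilin (\<lambda>X Y. ad (D X Y) (D' X Y))"
proof -
  note b = bilinD[OF D] and b' = bilinD[OF D']
  show ?thesis
    unfolding bilin_def
  proof (intro conjI ballI allI)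
    fix X Y assume XY: "X \<in> Vect M" "Y \<in> Vect M"
    show "ad (D X Y) (D' X Y) \<in> Vect M" using b(1) b'(1) XY by simp
    fix Z assume Z: "Z \<in> Vect M"
    show "ad (D (ad X Y) Z) (D' (ad X Y) Z) = ad (ad (D X Z) (D' X Z)) (ad (D Y Z) (D' Y Z))"
      "ad (D X (ad Y Z)) (D' X (ad Y Z)) = ad (ad (D X Y) (D' X Y)) (ad (D X Z) (D' X Z))"
      using b(1,3,4) b'(1,3,4) XY Z by (intro vf_eqI[where U = T]; simp add: ev_add)+
  next
    fix p r X Y assume "X \<in> Vect_part M p" "Y \<in> Vect_part M r"
    then show "ad (D X Y) (D' X Y) \<in> Vect_part M (p + r)" using b(2) b'(2) by (intro vf_add_part) simp_all
  next
    fix f X Y assume "f \<in> Sec T" "X \<in> Vect M" "Y \<in> Vect M"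
    then show "ad (D (sm f X) Y) (D' (sm f X) Y) = sm f (ad (D X Y) (D' X Y))"
      using b(1,5) b'(1,5) by (intro vf_eqI[where U = T]) (simp_all add: ev_add ev_mult0 ev_mult1 algebra_simps)
  qed
qed

lemma bilin_scale:
  assumes D: "bilin D" and h: "h \<in> part R 0"
  shows "bilin (\<lambda>X Y. sm h (D X Y))"
proof -
  note b = bilinD[OF D]
  have hS: "h \<in> Sec T" using h by simp
  show ?thesis
    unfolding bilin_def
  proof (intro conjI ballI allI)
    fix X Y assume XY: "X \<in> Vect M" "Y \<in> Vect M"
    show "sm h (D X Y) \<in> Vect M" using b(1) XY hS by simp
    fix Z assume Z: "Z \<in> Vect M"
    show "sm h (D (ad X Y) Z) = ad (sm h (D X Z)) (sm h (D Y Z))"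
      "sm h (D X (ad Y Z)) = ad (sm h (D X Y)) (sm h (D X Z))"
      using b(1,3,4) XY Z hS by (intro vf_eqI[where U = T]; simp add: ev_add ev_mult0 ev_mult1 algebra_simps)+
  next
    fix p r X Y assume "X \<in> Vect_part M p" "Y \<in> Vect_part M r"
    then show "sm h (D X Y) \<in> Vect_part M (p + r)" using b(2) h by (intro vf_smult_even) simp_all
  next
    fix f X Y assume "f \<in> Sec T" "X \<in> Vect M" "Y \<in> Vect M"
    then show "sm h (D (sm f X) Y) = sm f (sm h (D X Y))"
      using b(1,5) hS by (intro vf_eqI[where U = T]) (simp_all add: ev_mult0 ev_mult1 algebra_simps)
  qed
qed

lemma bilin_zero: "bilin (\<lambda>X Y. vf_zero M T)"
  unfolding bilin_def
proof (intro conjI ballI allI)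
  show "vf_zero M T \<in> Vect_part M (p + r)" for p r by (rule vf_zero_part[OF opT])
  show z: "vf_zero M T = ad (vf_zero M T) (vf_zero M T)" by (rule vf_eqI[where U = T]) (simp_all add: ev_simps)
  then show "vf_zero M T = ad (vf_zero M T) (vf_zero M T)" .
  show "vf_zero M T = sm f (vf_zero M T)" if "f \<in> Sec T" for f
    using that by (intro vf_eqI[where U = T]) (simp_all add: ev_mult0 ev_mult1 ev_zero)
qed simp

text \<open>\<open>D\<close> satisfies the Leibniz rule up to the operator \<open>w\<close> and is metric for the form
  \<open>(Y, Z) \<mapsto> g (w Y) Z\<close>. This is additive in \<open>(D, w)\<close>, and every summand
  \<open>c X\<langle>Y|v\<rangle> v\<close> of the local connection has this property for \<open>w Y = c \<langle>Y|v\<rangle> v\<close>.\<close>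

definition pconn :: "('a, 's) connection \<Rightarrow> (('a, 's) vf \<Rightarrow> ('a, 's) vf) \<Rightarrow> bool" where
  "pconn D w \<longleftrightarrow> bilin D \<and> (\<forall>Y\<in>Vect M. w Y \<in> Vect M) \<and>
    (\<forall>p r. \<forall>X\<in>Vect_part M p. \<forall>f\<in>part R r. \<forall>Y\<in>Vect M.
       D X (sm f Y) = ad (sm (X T f) (w Y)) (sm (koszul p r \<odot>\<^bsub>R\<^esub> f) (D X Y))) \<and>
    (\<forall>p r s. \<forall>X\<in>Vect_part M p. \<forall>Y\<in>Vect_part M r. \<forall>Z\<in>Vect_part M s.
       g T (D X Y) Z \<oplus>\<^bsub>R\<^esub> koszul r s \<odot>\<^bsub>R\<^esub> g T (D X Z) Y = X T (g T (w Y) Z))"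

lemma pconnD:
  assumes "pconn D w"
  shows "bilin D" "Y \<in> Vect M \<Longrightarrow> w Y \<in> Vect M"
    "X \<in> Vect_part M p \<Longrightarrow> f \<in> part R r \<Longrightarrow> Y \<in> Vect M \<Longrightarrow>
       D X (sm f Y) = ad (sm (X T f) (w Y)) (sm (koszul p r \<odot>\<^bsub>R\<^esub> f) (D X Y))"
    "X \<in> Vect_part M p \<Longrightarrow> Y \<in> Vect_part M r \<Longrightarrow> Z \<in> Vect_part M s \<Longrightarrow>
       g T (D X Y) Z \<oplus>\<^bsub>R\<^esub> koszul r s \<odot>\<^bsub>R\<^esub> g T (D X Z) Y = X T (g T (w Y) Z)"
  using assms unfolding pconn_def by blast+

lemma pconn_add:
  assumes D: "pconn D w" and D': "pconn D' w'"
  shows "pconn (\<lambda>X Y. ad (D X Y) (D' X Y)) (\<lambda>Y. ad (w Y) (w' Y))"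
proof -
  note d = pconnD[OF D] and d' = pconnD[OF D']
  note b = bilinD(1)[OF d(1)] and b' = bilinD(1)[OF d'(1)]
  show ?thesis
    unfolding pconn_def
  proof (intro conjI ballI allI)
    show "bilin (\<lambda>X Y. ad (D X Y) (D' X Y))" by (rule bilin_add[OF d(1) d'(1)])
    show "ad (w Y) (w' Y) \<in> Vect M" if "Y \<in> Vect M" for Y using that d(2) d'(2) by simp
  next
    fix p r X f Y assume X: "X \<in> Vect_part M p" and f: "f \<in> part R r" and Y: "Y \<in> Vect M"
    have S: "X \<in> Vect M" "f \<in> Sec T" using X f by simp_all
    show "ad (D X (sm f Y)) (D' X (sm f Y)) = ad (sm (X T f) (ad (w Y) (w' Y))) (sm (koszul p r \<odot>\<^bsub>R\<^esub> f) (ad (D X Y) (D' X Y)))"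
      unfolding d(3)[OF X f Y] d'(3)[OF X f Y] using S Y b b' d(2) d'(2)
      by (intro vf_eqI[where U = T]) (simp_all add: ev_add ev_smult ev_mult0 ev_mult1 algebra_simps)
  next
    fix p r s X Y Z assume X: "X \<in> Vect_part M p" and Y: "Y \<in> Vect_part M r" and Z: "Z \<in> Vect_part M s"
    have S: "X \<in> Vect M" "Y \<in> Vect M" "Z \<in> Vect M" using X Y Z by simp_all
    have "X T (g T (ad (w Y) (w' Y)) Z) = X T (g T (w Y) Z) \<oplus>\<^bsub>R\<^esub> X T (g T (w' Y) Z)"
      using S d(2) d'(2) by (simp add: g_add1[OF opT] vfT_add)
    then show "g T (ad (D X Y) (D' X Y)) Z \<oplus>\<^bsub>R\<^esub> koszul r s \<odot>\<^bsub>R\<^esub> g T (ad (D X Z) (D' X Z)) Y = X T (g T (ad (w Y) (w' Y)) Z)"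
      using S b b' unfolding d(4)[OF X Y Z, symmetric] d'(4)[OF X Y Z, symmetric]
      by (intro ev_eqI[OF opT]) (simp_all add: g_add1[OF opT] evT algebra_simps)
  qed
qed

lemma pconn_zero: "pconn (\<lambda>X Y. vf_zero M T) (\<lambda>Y. vf_zero M T)"
  unfolding pconn_def
proof (intro conjI ballI allI)
  show "vf_zero M T = ad (sm (X T f) (vf_zero M T)) (sm (koszul p r \<odot>\<^bsub>R\<^esub> f) (vf_zero M T))"
    if "X \<in> Vect_part M p" "f \<in> part R r" for p r X f
  proof -
    have S: "X \<in> Vect M" "f \<in> Sec T" using that by simp_all
    show ?thesis using S by (intro vf_eqI[where U = T]) (simp_all add: ev_add ev_smult ev_mult0 ev_mult1 ev_zero)
  qed
  show "g T (vf_zero M T) Z \<oplus>\<^bsub>R\<^esub> koszul r s \<odot>\<^bsub>R\<^esub> g T (vf_zero M T) Y = X T (g T (vf_zero M T) Z)"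
    if "X \<in> Vect_part M p" "Y \<in> Vect_part M r" "Z \<in> Vect_part M s" for p r s X Y Z
  proof -
    have S: "X \<in> Vect M" "Y \<in> Vect M" "Z \<in> Vect M" using that by simp_all
    show ?thesis using S by (intro ev_eqI[OF opT]) (simp_all add: g_zero1[OF opT] vfT_zero evT)
  qed
qed (simp_all add: bilin_zero)

text \<open>The metric identity is the Leibniz rule for
  \<open>c \<langle>Y|v\<rangle> \<langle>v|Z\<rangle>\<close>; as \<open>v\<close> is even,
  \<open>\<langle>v|Z\<rangle>\<close> may be replaced by \<open>\<langle>Z|v\<rangle>\<close>,
  whose derivative is the coefficient of the operator at \<open>Z\<close>.\<close>

lemma pconn_term:
  assumes v: "v \<in> Vect_part M 0"
  shows "pconn (\<lambda>X Y. sm (c \<odot>\<^bsub>R\<^esub> X T (g T Y v)) v) (\<lambda>Y. sm (c \<odot>\<^bsub>R\<^esub> g T Y v) v)"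
proof -
  have vV: "v \<in> Vect M" using v by simp
  note vf = vV vfT_closed[OF vV]
  have gp: "g T Y v \<in> part R r" if "Y \<in> Vect_part M r" for Y r
    using g_part[OF opT that v] by simp
  show ?thesis
    unfolding pconn_def bilin_def
  proof (intro conjI ballI allI)
    fix X Y assume XY: "X \<in> Vect M" "Y \<in> Vect M"
    show "sm (c \<odot>\<^bsub>R\<^esub> X T (g T Y v)) v \<in> Vect M" using XY vV by simp
    fix Z assume Z: "Z \<in> Vect M"
    show "sm (c \<odot>\<^bsub>R\<^esub> ad X Y T (g T Z v)) v = ad (sm (c \<odot>\<^bsub>R\<^esub> X T (g T Z v)) v) (sm (c \<odot>\<^bsub>R\<^esub> Y T (g T Z v)) v)"
      "sm (c \<odot>\<^bsub>R\<^esub> X T (g T (ad Y Z) v)) v = ad (sm (c \<odot>\<^bsub>R\<^esub> X T (g T Y v)) v) (sm (c \<odot>\<^bsub>R\<^esub> X T (g T Z v)) v)"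
      using XY Z vV by (intro vf_eqI[where U = T]; simp add: g_add1[OF opT] vfT_add ev_add ev_smult ev_mult0 ev_mult1 algebra_simps)+
  next
    fix p r X Y assume X: "X \<in> Vect_part M p" and Y: "Y \<in> Vect_part M r"
    show "sm (c \<odot>\<^bsub>R\<^esub> X T (g T Y v)) v \<in> Vect_part M (p + r)"
      using vf_smult_part[OF opT part_ops(2)[OF opT vfT_part[OF X gp[OF Y]], of c] v] by simp
  next
    fix f X Y assume "f \<in> Sec T" "X \<in> Vect M" "Y \<in> Vect M"
    then show "sm (c \<odot>\<^bsub>R\<^esub> sm f X T (g T Y v)) v = sm f (sm (c \<odot>\<^bsub>R\<^esub> X T (g T Y v)) v)"
      using vV by (intro vf_eqI[where U = T]) (simp_all add: res_id ev_add ev_smult ev_mult0 ev_mult1 algebra_simps)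
  next
    show "sm (c \<odot>\<^bsub>R\<^esub> g T Y v) v \<in> Vect M" if "Y \<in> Vect M" for Y using that vV by simp
  next
    fix p r X f Y assume X: "X \<in> Vect_part M p" and f: "f \<in> part R r" and Y: "Y \<in> Vect M"
    have S: "X \<in> Vect M" "f \<in> Sec T" using X f by simp_all
    have gY: "g T Y v \<in> Sec T" using Y vV by simp
    show "sm (c \<odot>\<^bsub>R\<^esub> X T (g T (sm f Y) v)) v = ad (sm (X T f) (sm (c \<odot>\<^bsub>R\<^esub> g T Y v) v))
        (sm (koszul p r \<odot>\<^bsub>R\<^esub> f) (sm (c \<odot>\<^bsub>R\<^esub> X T (g T Y v)) v))"
      unfolding g_smult1[OF opT Y vV S(2)] vfT_leibniz[OF X f gY] using S Y vV
      by (intro vf_eqI[where U = T]) (simp_all add: ev_add ev_smult ev_mult0 ev_mult1 algebra_simps)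
  next
    fix p r s X Y Z assume X: "X \<in> Vect_part M p" and Y: "Y \<in> Vect_part M r" and Z: "Z \<in> Vect_part M s"
    have S: "X \<in> Vect M" "Y \<in> Vect M" "Z \<in> Vect M" using X Y Z by simp_all
    let ?A = "g T Y v" and ?B = "g T Z v"
    have A: "?A \<in> part R r" "?A \<in> Sec T" and B: "?B \<in> part R s" "?B \<in> Sec T" using gp[OF Y] gp[OF Z] by simp_all
    have XS: "X T ?A \<in> Sec T" "X T ?B \<in> Sec T" using S vV by simp_all
    have XB: "X T ?B \<in> part R (p + s)" by (rule vfT_part[OF X B(1)])
    have l: "g T (sm (c \<odot>\<^bsub>R\<^esub> X T ?A) v) Z = (c \<odot>\<^bsub>R\<^esub> X T ?A) \<otimes>\<^bsub>R\<^esub> ?B" "g T (sm (c \<odot>\<^bsub>R\<^esub> X T ?B) v) Y = (c \<odot>\<^bsub>R\<^esub> X T ?B) \<otimes>\<^bsub>R\<^esub> ?A"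
      "g T (sm (c \<odot>\<^bsub>R\<^esub> ?A) v) Z = (c \<odot>\<^bsub>R\<^esub> ?A) \<otimes>\<^bsub>R\<^esub> ?B"
      using XS A B S by (simp_all add: g_smult1[OF opT vV] g_even_sym[OF opT v])
    have r: "X T ((c \<odot>\<^bsub>R\<^esub> ?A) \<otimes>\<^bsub>R\<^esub> ?B) = (c \<odot>\<^bsub>R\<^esub> X T ?A) \<otimes>\<^bsub>R\<^esub> ?B \<oplus>\<^bsub>R\<^esub> koszul p r \<odot>\<^bsub>R\<^esub> ((c \<odot>\<^bsub>R\<^esub> ?A) \<otimes>\<^bsub>R\<^esub> X T ?B)"
      using vfT_leibniz[OF X part_ops(2)[OF opT A(1)] B(2), of c] S A by (simp add: vfT_smult)
    \<comment> \<open>Components multiply commutatively, so the two signs have to agree wherever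
      they matter. They differ only if \<open>r = 1\<close> and \<open>p \<noteq> s\<close>; then
      \<open>\<langle>Y|v\<rangle>\<close> and \<open>X\<langle>Z|v\<rangle>\<close> are both odd
      and their product is zero.\<close>
    have k: "koszul r s = koszul p r \<or> (ev {} T ?A m = 0 \<and> ev {} T (X T ?B) m = 0)" if m: "m \<in> T" for m
    proof (cases "r = 0 \<or> p = s")
      case True
      then show ?thesis by (auto simp: koszul_def mult.commute)
    next
      case False
      then have "r = 1" "p + s = 1" by (cases r; cases p; cases s; simp)+
      then show ?thesis using ev_odd[OF opT m] A(1) XB by simp
    qed
    have c: "c \<odot>\<^bsub>R\<^esub> X T ?A \<in> Sec T" "c \<odot>\<^bsub>R\<^esub> X T ?B \<in> Sec T" "c \<odot>\<^bsub>R\<^esub> ?A \<in> Sec T" using XS A by simp_all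
    show "g T (sm (c \<odot>\<^bsub>R\<^esub> X T ?A) v) Z \<oplus>\<^bsub>R\<^esub> koszul r s \<odot>\<^bsub>R\<^esub> g T (sm (c \<odot>\<^bsub>R\<^esub> X T ?B) v) Y = X T (g T (sm (c \<odot>\<^bsub>R\<^esub> ?A) v) Z)"
      unfolding l r
    proof (rule ev_eqI[OF opT])
      fix m assume m: "m \<in> T"
      show "ev {} T ((c \<odot>\<^bsub>R\<^esub> X T ?A) \<otimes>\<^bsub>R\<^esub> ?B \<oplus>\<^bsub>R\<^esub> koszul r s \<odot>\<^bsub>R\<^esub> ((c \<odot>\<^bsub>R\<^esub> X T ?B) \<otimes>\<^bsub>R\<^esub> ?A)) m =
        ev {} T ((c \<odot>\<^bsub>R\<^esub> X T ?A) \<otimes>\<^bsub>R\<^esub> ?B \<oplus>\<^bsub>R\<^esub> koszul p r \<odot>\<^bsub>R\<^esub> ((c \<odot>\<^bsub>R\<^esub> ?A) \<otimes>\<^bsub>R\<^esub> X T ?B)) m"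
        "ev {0} T ((c \<odot>\<^bsub>R\<^esub> X T ?A) \<otimes>\<^bsub>R\<^esub> ?B \<oplus>\<^bsub>R\<^esub> koszul r s \<odot>\<^bsub>R\<^esub> ((c \<odot>\<^bsub>R\<^esub> X T ?B) \<otimes>\<^bsub>R\<^esub> ?A)) m =
        ev {0} T ((c \<odot>\<^bsub>R\<^esub> X T ?A) \<otimes>\<^bsub>R\<^esub> ?B \<oplus>\<^bsub>R\<^esub> koszul p r \<odot>\<^bsub>R\<^esub> ((c \<odot>\<^bsub>R\<^esub> ?A) \<otimes>\<^bsub>R\<^esub> X T ?B)) m"
        using k[OF m] m A(2) B(2) XS c by (auto simp: evT algebra_simps)
    qed (use A B XS in simp_all)
  qed
qed

text \<open>All values are multiples of \<open>Q\<close>, which is orthogonal to everything, so the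
  metric identity reads \<open>0 = 0\<close>; the Leibniz rule is the one for \<open>X\<close>
  applied to the product of \<open>f\<close> and \<open>Y \<tau>\<close>.\<close>

lemma pconn_Q:
  assumes \<tau>: "\<tau> \<in> part R 1"
  shows "pconn (\<lambda>X Y. sm (X T (Y T \<tau>)) Q) (\<lambda>Y. sm (Y T \<tau>) Q)"
proof -
  have tS: "\<tau> \<in> Sec T" using \<tau> by simp
  have QV: "Q \<in> Vect M" by simp
  have gQ: "g T (sm a Q) Z = \<zero>\<^bsub>R\<^esub>" if "a \<in> Sec T" "Z \<in> Vect M" for a Z
  proof -
    interpret A: super_alg R by (rule alg[OF opT])
    show ?thesis using that by (simp add: g_smult1[OF opT] Q_ker)
  qed
  show ?thesis
    unfolding pconn_def bilin_def
  proof (intro conjI ballI allI)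
    fix X Y assume XY: "X \<in> Vect M" "Y \<in> Vect M"
    show "sm (X T (Y T \<tau>)) Q \<in> Vect M" using XY tS by simp
    fix Z assume Z: "Z \<in> Vect M"
    show "sm (ad X Y T (Z T \<tau>)) Q = ad (sm (X T (Z T \<tau>)) Q) (sm (Y T (Z T \<tau>)) Q)"
      "sm (X T (ad Y Z T \<tau>)) Q = ad (sm (X T (Y T \<tau>)) Q) (sm (X T (Z T \<tau>)) Q)"
      using XY Z tS by (intro vf_eqI[where U = T]; simp add: vfT_add ev_add ev_mult0 ev_mult1 algebra_simps)+
  next
    fix p r X Y assume X: "X \<in> Vect_part M p" and Y: "Y \<in> Vect_part M r"
    \<comment> \<open>\<open>\<tau>\<close> and \<open>Q\<close> are both odd, so their parities
      cancel.\<close>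
    have e: "p + (r + 1) + 1 = p + r" by (cases p; cases r) simp_all
    show "sm (X T (Y T \<tau>)) Q \<in> Vect_part M (p + r)"
      using vf_smult_part[OF opT vfT_part[OF X vfT_part[OF Y \<tau>]] Q_odd] unfolding e .
  next
    fix f X Y assume "f \<in> Sec T" "X \<in> Vect M" "Y \<in> Vect M"
    then show "sm (sm f X T (Y T \<tau>)) Q = sm f (sm (X T (Y T \<tau>)) Q)"
      using tS by (intro vf_eqI[where U = T]) (simp_all add: res_id ev_mult0 ev_mult1 algebra_simps)
  next
    show "sm (Y T \<tau>) Q \<in> Vect M" if "Y \<in> Vect M" for Y using that tS by simp
  next
    fix p r X f Y assume X: "X \<in> Vect_part M p" and f: "f \<in> part R r" and Y: "Y \<in> Vect M"
    have S: "X \<in> Vect M" "f \<in> Sec T" using X f by simp_all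
    have e: "X T (sm f Y T \<tau>) = X T f \<otimes>\<^bsub>R\<^esub> Y T \<tau> \<oplus>\<^bsub>R\<^esub> koszul p r \<odot>\<^bsub>R\<^esub> (f \<otimes>\<^bsub>R\<^esub> X T (Y T \<tau>))"
      using vfT_leibniz[OF X f, of "Y T \<tau>"] S Y tS by (simp add: res_id)
    show "sm (X T (sm f Y T \<tau>)) Q = ad (sm (X T f) (sm (Y T \<tau>) Q)) (sm (koszul p r \<odot>\<^bsub>R\<^esub> f) (sm (X T (Y T \<tau>)) Q))"
      unfolding e using S Y tS
      by (intro vf_eqI[where U = T]) (simp_all add: ev_add ev_smult ev_mult0 ev_mult1 algebra_simps)
  next
    fix p r s X Y Z assume "X \<in> Vect_part M p" "Y \<in> Vect_part M r" "Z \<in> Vect_part M s"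
    then have S: "X \<in> Vect M" "Y \<in> Vect M" "Z \<in> Vect M" by simp_all
    show "g T (sm (X T (Y T \<tau>)) Q) Z \<oplus>\<^bsub>R\<^esub> koszul r s \<odot>\<^bsub>R\<^esub> g T (sm (X T (Z T \<tau>)) Q) Y = X T (g T (sm (Y T \<tau>) Q) Z)"
      using S tS by (intro ev_eqI[OF opT]) (simp_all add: gQ vfT_zero evT)
  qed
qed

lemma pconn_lsum:
  assumes "\<And>c v. (c, v) \<in> set vs \<Longrightarrow> v \<in> Vect_part M 0"
  shows "pconn (\<lambda>X Y. lsum T (\<lambda>(c, v). sm (c \<odot>\<^bsub>R\<^esub> X T (g T Y v)) v) vs)
    (\<lambda>Y. lsum T (\<lambda>(c, v). sm (c \<odot>\<^bsub>R\<^esub> g T Y v) v) vs)"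
  using assms
proof (induction vs)
  case Nil
  then show ?case using pconn_zero by (simp add: lsum_def)
next
  case (Cons s vs)
  obtain c v where s: "s = (c, v)" by (cases s)
  have v: "v \<in> Vect_part M 0" using Cons.prems[of c v] s by simp
  have "pconn (\<lambda>X Y. lsum T (\<lambda>(c, v). sm (c \<odot>\<^bsub>R\<^esub> X T (g T Y v)) v) vs)
    (\<lambda>Y. lsum T (\<lambda>(c, v). sm (c \<odot>\<^bsub>R\<^esub> g T Y v) v) vs)"
    by (rule Cons.IH) (use Cons.prems in auto)
  from pconn_add[OF pconn_term[OF v, of c] this] show ?case by (simp add: s lsum_def)
qed

text \<open>For weight \<open>1\<close> this is a compatible connection. The weight stands in front
  of the derivatives, so no derivative of \<open>\<kappa>\<close> appears when operators are scaled
  or added. In the metric condition the operator is in the first slot both times, where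
  \<open>g\<close> is linear over functions; the sign is the one for exchanging \<open>Y\<close> and
  \<open>Z\<close>.\<close>

definition wconn :: "'s \<Rightarrow> ('a, 's) connection \<Rightarrow> bool" where
  "wconn \<kappa> D \<longleftrightarrow> \<kappa> \<in> part R 0 \<and> bilin D \<and>
    (\<forall>p r. \<forall>X\<in>Vect_part M p. \<forall>f\<in>part R r. \<forall>Y\<in>Vect M.
       D X (sm f Y) = ad (sm (X T f) (sm \<kappa> Y)) (sm (koszul p r \<odot>\<^bsub>R\<^esub> f) (D X Y))) \<and>
    (\<forall>p r s. \<forall>X\<in>Vect_part M p. \<forall>Y\<in>Vect_part M r. \<forall>Z\<in>Vect_part M s.
       g T (D X Y) Z \<oplus>\<^bsub>R\<^esub> koszul r s \<odot>\<^bsub>R\<^esub> g T (D X Z) Y = \<kappa> \<otimes>\<^bsub>R\<^esub> X T (g T Y Z)) \<and>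
    (\<forall>X\<in>Vect M. D X Q = vf_zero M T)"

lemma wconnD:
  assumes "wconn \<kappa> D"
  shows "\<kappa> \<in> part R 0" "bilin D"
    "X \<in> Vect_part M p \<Longrightarrow> f \<in> part R r \<Longrightarrow> Y \<in> Vect M \<Longrightarrow>
       D X (sm f Y) = ad (sm (X T f) (sm \<kappa> Y)) (sm (koszul p r \<odot>\<^bsub>R\<^esub> f) (D X Y))"
    "X \<in> Vect_part M p \<Longrightarrow> Y \<in> Vect_part M r \<Longrightarrow> Z \<in> Vect_part M s \<Longrightarrow>
       g T (D X Y) Z \<oplus>\<^bsub>R\<^esub> koszul r s \<odot>\<^bsub>R\<^esub> g T (D X Z) Y = \<kappa> \<otimes>\<^bsub>R\<^esub> X T (g T Y Z)"
    "X \<in> Vect M \<Longrightarrow> D X Q = vf_zero M T"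
  using assms unfolding wconn_def by blast+

lemma wconn_zero: "wconn \<zero>\<^bsub>R\<^esub> (\<lambda>X Y. vf_zero M T)"
  unfolding wconn_def
proof (intro conjI ballI allI)
  show "\<zero>\<^bsub>R\<^esub> \<in> part R 0" by (rule part_ops(3)[OF opT])
  show "vf_zero M T = ad (sm (X T f) (sm \<zero>\<^bsub>R\<^esub> Y)) (sm (koszul p r \<odot>\<^bsub>R\<^esub> f) (vf_zero M T))"
    if "X \<in> Vect_part M p" "f \<in> part R r" "Y \<in> Vect M" for p r X f Y
  proof -
    have S: "X \<in> Vect M" "f \<in> Sec T" using that by simp_all
    show ?thesis using S that(3) by (intro vf_eqI[where U = T]) (simp_all add: ev_add ev_smult ev_mult0 ev_mult1 ev_zero)
  qed
  show "g T (vf_zero M T) Z \<oplus>\<^bsub>R\<^esub> koszul r s \<odot>\<^bsub>R\<^esub> g T (vf_zero M T) Y = \<zero>\<^bsub>R\<^esub> \<otimes>\<^bsub>R\<^esub> X T (g T Y Z)"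
    if "X \<in> Vect_part M p" "Y \<in> Vect_part M r" "Z \<in> Vect_part M s" for p r s X Y Z
  proof -
    have S: "X \<in> Vect M" "Y \<in> Vect M" "Z \<in> Vect M" using that by simp_all
    show ?thesis using S by (intro ev_eqI[OF opT]) (simp_all add: g_zero1[OF opT] evT)
  qed
qed (simp_all add: bilin_zero)

text \<open>An even factor \<open>h\<close> passes through every condition without a sign. With
  \<open>h = 1 - \<sigma>\<close> this is one step of the recursion for the weights.\<close>

lemma wconn_add:
  assumes D: "wconn \<sigma> D" and D': "wconn \<rho> D'" and h: "h \<in> part R 0"
  shows "wconn (\<sigma> \<oplus>\<^bsub>R\<^esub> h \<otimes>\<^bsub>R\<^esub> \<rho>) (\<lambda>X Y. ad (D X Y) (sm h (D' X Y)))"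
proof -
  note d = wconnD[OF D] and d' = wconnD[OF D']
  note b = bilinD(1)[OF d(2)] and b' = bilinD(1)[OF d'(2)]
  have S0: "\<sigma> \<in> Sec T" "\<rho> \<in> Sec T" "h \<in> Sec T" using d(1) d'(1) h by simp_all
  have e0: "ev {0} T h m = 0" if "m \<in> T" for m using ev_even[OF opT that h] .
  show ?thesis
    unfolding wconn_def
  proof (intro conjI ballI allI)
    show "\<sigma> \<oplus>\<^bsub>R\<^esub> h \<otimes>\<^bsub>R\<^esub> \<rho> \<in> part R 0"
      using part_ops(1)[OF opT d(1)] part_ops(5)[OF opT h d'(1)] by simp
    show "bilin (\<lambda>X Y. ad (D X Y) (sm h (D' X Y)))" by (rule bilin_add[OF d(2) bilin_scale[OF d'(2) h]])
  next
    fix p r X f Y assume X: "X \<in> Vect_part M p" and f: "f \<in> part R r" and Y: "Y \<in> Vect M"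
    have S: "X \<in> Vect M" "f \<in> Sec T" using X f by simp_all
    show "ad (D X (sm f Y)) (sm h (D' X (sm f Y))) = ad (sm (X T f) (sm (\<sigma> \<oplus>\<^bsub>R\<^esub> h \<otimes>\<^bsub>R\<^esub> \<rho>) Y))
        (sm (koszul p r \<odot>\<^bsub>R\<^esub> f) (ad (D X Y) (sm h (D' X Y))))"
      unfolding d(3)[OF X f Y] d'(3)[OF X f Y] using S S0 Y b b'
      by (intro vf_eqI[where U = T]) (simp_all add: ev_add ev_smult ev_mult0 ev_mult1 algebra_simps)
  next
    fix p r s X Y Z assume X: "X \<in> Vect_part M p" and Y: "Y \<in> Vect_part M r" and Z: "Z \<in> Vect_part M s"
    have S: "X \<in> Vect M" "Y \<in> Vect M" "Z \<in> Vect M" using X Y Z by simp_all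
    note DV = b[OF S(1,2)] b[OF S(1,3)] b'[OF S(1,2)] b'[OF S(1,3)]
    have g: "g T (ad (D X Y) (sm h (D' X Y))) Z = g T (D X Y) Z \<oplus>\<^bsub>R\<^esub> h \<otimes>\<^bsub>R\<^esub> g T (D' X Y) Z"
      "g T (ad (D X Z) (sm h (D' X Z))) Y = g T (D X Z) Y \<oplus>\<^bsub>R\<^esub> h \<otimes>\<^bsub>R\<^esub> g T (D' X Z) Y"
      using DV S S0 by (simp_all add: g_add1[OF opT] g_smult1[OF opT])
    have "(\<sigma> \<oplus>\<^bsub>R\<^esub> h \<otimes>\<^bsub>R\<^esub> \<rho>) \<otimes>\<^bsub>R\<^esub> X T (g T Y Z) = \<sigma> \<otimes>\<^bsub>R\<^esub> X T (g T Y Z) \<oplus>\<^bsub>R\<^esub> h \<otimes>\<^bsub>R\<^esub> (\<rho> \<otimes>\<^bsub>R\<^esub> X T (g T Y Z))"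
      using S S0 by (intro ev_eqI[OF opT]) (simp_all add: evT algebra_simps)
    then show "g T (ad (D X Y) (sm h (D' X Y))) Z \<oplus>\<^bsub>R\<^esub> koszul r s \<odot>\<^bsub>R\<^esub> g T (ad (D X Z) (sm h (D' X Z))) Y =
        (\<sigma> \<oplus>\<^bsub>R\<^esub> h \<otimes>\<^bsub>R\<^esub> \<rho>) \<otimes>\<^bsub>R\<^esub> X T (g T Y Z)"
      unfolding g d(4)[OF X Y Z, symmetric] d'(4)[OF X Y Z, symmetric] using DV S S0
      by (intro ev_eqI[OF opT]) (simp_all add: evT algebra_simps)
  next
    fix X assume X: "X \<in> Vect M"
    show "ad (D X Q) (sm h (D' X Q)) = vf_zero M T"
      unfolding d(5)[OF X] d'(5)[OF X] using S0 by (intro vf_eqI[where U = T]) (simp_all add: ev_add ev_mult0 ev_mult1 ev_zero)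
  qed
qed

text \<open>\<open>w\<close> is meant to be the identity on the region where \<open>\<kappa>\<close>
  lives. The assumptions express this after multiplication by \<open>\<kappa>\<close>, which turns
  it into global equations.\<close>

lemma wconn_of_pconn:
  assumes D: "pconn D w" and \<kappa>: "\<kappa> \<in> part R 0"
    and w: "\<And>Y. Y \<in> Vect M \<Longrightarrow> sm \<kappa> (w Y) = sm \<kappa> Y"
    and gw: "\<And>X Y Z. X \<in> Vect M \<Longrightarrow> Y \<in> Vect M \<Longrightarrow> Z \<in> Vect M \<Longrightarrow> \<kappa> \<otimes>\<^bsub>R\<^esub> X T (g T (w Y) Z) = \<kappa> \<otimes>\<^bsub>R\<^esub> X T (g T Y Z)"
    and Q: "\<And>X. X \<in> Vect M \<Longrightarrow> sm \<kappa> (D X Q) = vf_zero M T"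
  shows "wconn \<kappa> (\<lambda>X Y. sm \<kappa> (D X Y))"
proof -
  note d = pconnD[OF D]
  note b = bilinD(1)[OF d(1)]
  have S0: "\<kappa> \<in> Sec T" using \<kappa> by simp
  show ?thesis
    unfolding wconn_def
  proof (intro conjI ballI allI)
    show "bilin (\<lambda>X Y. sm \<kappa> (D X Y))" by (rule bilin_scale[OF d(1) \<kappa>])
  next
    fix p r X f Y assume X: "X \<in> Vect_part M p" and f: "f \<in> part R r" and Y: "Y \<in> Vect M"
    have S: "X \<in> Vect M" "f \<in> Sec T" using X f by simp_all
    show "sm \<kappa> (D X (sm f Y)) = ad (sm (X T f) (sm \<kappa> Y)) (sm (koszul p r \<odot>\<^bsub>R\<^esub> f) (sm \<kappa> (D X Y)))"
      unfolding d(3)[OF X f Y] w[OF Y, symmetric] using S S0 Y b d(2)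
      by (intro vf_eqI[where U = T]) (simp_all add: ev_add ev_smult ev_mult0 ev_mult1 algebra_simps)
  next
    fix p r s X Y Z assume X: "X \<in> Vect_part M p" and Y: "Y \<in> Vect_part M r" and Z: "Z \<in> Vect_part M s"
    have S: "X \<in> Vect M" "Y \<in> Vect M" "Z \<in> Vect M" using X Y Z by simp_all
    note DV = b[OF S(1,2)] b[OF S(1,3)]
    show "g T (sm \<kappa> (D X Y)) Z \<oplus>\<^bsub>R\<^esub> koszul r s \<odot>\<^bsub>R\<^esub> g T (sm \<kappa> (D X Z)) Y = \<kappa> \<otimes>\<^bsub>R\<^esub> X T (g T Y Z)"
      unfolding gw[OF S, symmetric] d(4)[OF X Y Z, symmetric] using DV S S0
      by (intro ev_eqI[OF opT]) (simp_all add: g_smult1[OF opT] evT algebra_simps)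
  qed (use \<kappa> Q in simp_all)
qed

end

section \<open>Local and global existence\<close>

context smfd
begin

lemma rsum_map: "rsum W h (map k xs) = rsum W (\<lambda>i. h (k i)) xs"
  by (simp add: rsum_def foldr_map o_def)

lemma rsum_cong: "(\<And>i. i \<in> set xs \<Longrightarrow> h i = k i) \<Longrightarrow> rsum W h xs = rsum W k xs"
  by (induction xs) (simp_all add: rsum_def)

text \<open>The members of a countable basis that satisfy \<open>Pr\<close> still cover, since
  \<open>Pr\<close> passes to subsets. The empty set is added to make the collection nonempty, as an
  enumeration by natural numbers requires.\<close>

lemma countable_cover:
  assumes loc: "\<And>m. m \<in> points M \<Longrightarrow> \<exists>B. opn B \<and> m \<in> B \<and> Pr B"
    and down: "\<And>B B'. Pr B \<Longrightarrow> B' \<subseteq> B \<Longrightarrow> Pr B'" and empty: "Pr {}"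
  obtains B :: "nat \<Rightarrow> 'a set" where "\<And>j. opn (B j)" "\<And>j. Pr (B j)" "(\<Union>j. B j) = points M"
proof -
  obtain \<B> where \<B>: "countable \<B>" "\<And>B. B \<in> \<B> \<Longrightarrow> opn B" "\<And>U. opn U \<Longrightarrow> \<exists>\<U>\<subseteq>\<B>. U = \<Union>\<U>"
    using second_countable unfolding Defs.second_countable_def by blast
  let ?C = "insert {} {B \<in> \<B>. Pr B}"
  have C: "countable ?C" "?C \<noteq> {}" using \<B>(1) by auto
  note ran = range_from_nat_into[OF C(2,1)]
  have mem: "from_nat_into ?C j \<in> ?C" for j using from_nat_into[OF C(2)] .
  have o: "opn B" if "B \<in> ?C" for B using that \<B>(2) by auto
  have "\<exists>j. m \<in> from_nat_into ?C j" if m: "m \<in> points M" for m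
  proof -
    obtain B0 where B0: "opn B0" "m \<in> B0" "Pr B0" using loc[OF m] by blast
    obtain \<U> where "\<U> \<subseteq> \<B>" "B0 = \<Union>\<U>" using \<B>(3)[OF B0(1)] by blast
    then obtain B where B: "B \<in> \<B>" "m \<in> B" "B \<subseteq> B0" using B0(2) by blast
    then have "B \<in> ?C" using down[OF B0(3)] by blast
    then obtain j where "B = from_nat_into ?C j" using ran by (metis rangeE)
    then show ?thesis using B(2) by blast
  qed
  moreover have "from_nat_into ?C j \<subseteq> points M" for j using o[OF mem] opn_subset_points by blast
  ultimately have "(\<Union>j. from_nat_into ?C j) = points M" by blast
  moreover have "Pr (from_nat_into ?C j)" for j using mem[of j] empty by auto
  ultimately show ?thesis using that[of "from_nat_into ?C"] o[OF mem] by blast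
qed

end

section \<open>Multiplication by cutoffs and local existence\<close>

context null_mfd
begin

text \<open>Derivations are local: over \<open>U\<close> the two derivatives agree, and off
  \<open>K\<close> the factor \<open>\<kappa>\<close> vanishes.\<close>

lemma cutoff_fun:
  assumes \<kappa>: "cutoff \<kappa> O' K" and U: "opn U" "K \<subseteq> U" and F: "F \<in> Sec T" "F' \<in> Sec T"
    and e: "res M T U F = res M T U F'" and X: "X \<in> Vect M"
  shows "\<kappa> \<otimes>\<^bsub>R\<^esub> X T F = \<kappa> \<otimes>\<^bsub>R\<^esub> X T F'"
proof -
  note \<kappa>D = \<kappa>[unfolded cutoff_def]
  have \<kappa>S: "\<kappa> \<in> Sec T" by (rule secT(6)[OF conjunct1[OF \<kappa>D]])
  have XF: "X T F \<in> Sec T" "X T F' \<in> Sec T" using X F by simp_all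
  have UT: "U \<subseteq> T" by (rule opn_subset_points[OF U(1)])
  have r: "res M T U (X T F) = res M T U (X T F')"
    using vf_ev_res[OF X opT order_refl U(1) UT F(1)] vf_ev_res[OF X opT order_refl U(1) UT F(2)] e by simp
  have c: "(ev {} T \<kappa> m = 0 \<and> ev {0} T \<kappa> m = 0) \<or> (\<forall>J. ev J T (X T F) m = ev J T (X T F') m)" if m: "m \<in> T" for m
  proof (cases "m \<in> K")
    case True
    then show ?thesis
      using ev_res[OF opT U(1) UT _ XF(1)] ev_res[OF opT U(1) UT _ XF(2)] r U(2) by (metis subsetD)
  next
    case False
    then show ?thesis using \<kappa>D m ev_even[OF opT m conjunct1[OF \<kappa>D]] by blast
  qed
  show ?thesis
  proof (rule ev_eqI[OF opT])
    fix m assume m: "m \<in> T"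
    show "ev {} T (\<kappa> \<otimes>\<^bsub>R\<^esub> X T F) m = ev {} T (\<kappa> \<otimes>\<^bsub>R\<^esub> X T F') m" "ev {0} T (\<kappa> \<otimes>\<^bsub>R\<^esub> X T F) m = ev {0} T (\<kappa> \<otimes>\<^bsub>R\<^esub> X T F') m"
      using c[OF m] m \<kappa>S XF by (auto simp: evT)
  qed (use \<kappa>S XF in simp_all)
qed

lemma vf_res_at:
  assumes A: "A \<in> Vect M" and U: "opn U" and W: "opn W" and f: "f \<in> Sec W" and m: "m \<in> W" "m \<in> U"
  shows "ev J W (A W f) m = ev J (W \<inter> U) (vf_res M U A (W \<inter> U) (res M W (W \<inter> U) f)) m"
proof -
  have o: "opn (W \<inter> U)" "W \<inter> U \<subseteq> W" "W \<inter> U \<subseteq> U" "m \<in> W \<inter> U" using U W m by auto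
  note r = res_closed[OF W o(1,2) f]
  show ?thesis
    using vf_ev_res[OF A W opn_subset_points[OF W] o(1,2) f] ev_res[OF W o(1,2,4) vfT_closed[OF A W f]] r o
    by (simp add: vf_res_eq)
qed

lemma cutoff_vf:
  assumes \<kappa>: "cutoff \<kappa> O' K" and U: "opn U" "K \<subseteq> U" and A: "A \<in> Vect M" "B \<in> Vect M"
    and e: "vf_res M U A = vf_res M U B"
  shows "sm \<kappa> A = sm \<kappa> B"
proof -
  note \<kappa>D = \<kappa>[unfolded cutoff_def]
  have \<kappa>S: "\<kappa> \<in> Sec T" by (rule secT(6)[OF conjunct1[OF \<kappa>D]])
  have c: "(ev {} T \<kappa> m = 0 \<and> ev {0} T \<kappa> m = 0) \<or> (\<forall>J. ev J W (A W f) m = ev J W (B W f) m)"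
    if W: "opn W" and f: "f \<in> Sec W" and m: "m \<in> W" for W f m
  proof (cases "m \<in> K")
    case True
    then show ?thesis using vf_res_at[OF A(1) U(1) W f m] vf_res_at[OF A(2) U(1) W f m] e U(2) by auto
  next
    case False
    have mT: "m \<in> T" by (rule opn_points[OF W m])
    then show ?thesis using False \<kappa>D ev_even[OF opT mT conjunct1[OF \<kappa>D]] by blast
  qed
  show ?thesis
  proof (rule vf_eqI[where U = T])
    fix W f m assume W: "opn W" and f: "f \<in> Sec W" and m: "m \<in> W"
    show "ev {} W (sm \<kappa> A W f) m = ev {} W (sm \<kappa> B W f) m" "ev {0} W (sm \<kappa> A W f) m = ev {0} W (sm \<kappa> B W f) m"
      using c[OF W f m] by (auto simp only: ev_sm[OF W m f A(1) \<kappa>S] ev_sm[OF W m f A(2) \<kappa>S])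
  qed (use \<kappa>S A in simp_all)
qed

lemma vfT_one: "X \<in> Vect M \<Longrightarrow> X T \<one>\<^bsub>R\<^esub> = \<zero>\<^bsub>R\<^esub>"
proof -
  have part: "ev J T (X T \<one>\<^bsub>R\<^esub>) m = 0" if X: "X \<in> Vect_part M p" and m: "m \<in> T" and J: "J \<in> {{}, {0}}" for X p m J
  proof -
    have one: "\<one>\<^bsub>R\<^esub> \<otimes>\<^bsub>R\<^esub> \<one>\<^bsub>R\<^esub> = \<one>\<^bsub>R\<^esub>" by (rule ev_eqI[OF opT]) (simp_all add: evT)
    have XV: "X \<in> Vect M" using X by simp
    have "X T \<one>\<^bsub>R\<^esub> = X T \<one>\<^bsub>R\<^esub> \<otimes>\<^bsub>R\<^esub> \<one>\<^bsub>R\<^esub> \<oplus>\<^bsub>R\<^esub> koszul p 0 \<odot>\<^bsub>R\<^esub> (\<one>\<^bsub>R\<^esub> \<otimes>\<^bsub>R\<^esub> X T \<one>\<^bsub>R\<^esub>)"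
      using vfT_leibniz[OF X part_ops(4)[OF opT], of "\<one>\<^bsub>R\<^esub>"] unfolding one by simp
    then have "ev J T (X T \<one>\<^bsub>R\<^esub>) m = ev J T (X T \<one>\<^bsub>R\<^esub> \<otimes>\<^bsub>R\<^esub> \<one>\<^bsub>R\<^esub> \<oplus>\<^bsub>R\<^esub> koszul p 0 \<odot>\<^bsub>R\<^esub> (\<one>\<^bsub>R\<^esub> \<otimes>\<^bsub>R\<^esub> X T \<one>\<^bsub>R\<^esub>)) m"
      by (rule arg_cong)
    also have "\<dots> = 2 * ev J T (X T \<one>\<^bsub>R\<^esub>) m" using XV m J by (auto simp: evT)
    finally show ?thesis by simp
  qed
  assume "X \<in> Vect M"
  then obtain A B where AB: "A \<in> Vect_part M 0" "B \<in> Vect_part M 1" "X = ad A B" by (rule vfE)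
  have V: "A \<in> Vect M" "B \<in> Vect M" using AB by simp_all
  show ?thesis
    unfolding AB(3) using V part[OF AB(1)] part[OF AB(2)]
    by (intro ev_eq_zeroI[OF opT]) (simp_all add: evT)
qed

lemma lsum_zero: "(\<And>s. s \<in> set xs \<Longrightarrow> F s = vf_zero M T) \<Longrightarrow> lsum T F xs = vf_zero M T"
  by (induction xs) (simp_all add: lsum_def vf_add_zero[OF opT vfT(6)])

text \<open>Two nested cutoffs. The first extends the frame and the odd coordinate from the chart to
  global data that are correct on \<open>O1\<close>; the operators \<open>D\<close> and
  \<open>w\<close> formed from them satisfy \<open>pconn\<close> everywhere, although
  \<open>w\<close> is known to be the identity only on \<open>O1\<close>. The second cutoff
  \<open>\<kappa>\<close> vanishes off a closed subset of \<open>O1\<close> and removes the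
  discrepancy.\<close>

lemma local_wconn:
  fixes U and V :: "(real^'n) set" and \<phi> \<Phi> P t
  assumes chart: "null_chart M U V \<phi> \<Phi> g Q P t" and m: "m \<in> U"
  shows "\<exists>B. opn B \<and> m \<in> B \<and> (\<exists>\<kappa> D. wconn \<kappa> D \<and> (\<forall>x\<in>B. ev {} T \<kappa> x = 1))"
proof -
  interpret C: null_chart M N U V \<phi> \<Phi> g Q P t by (rule chart)
  have Uo: "opn U" by (rule C.U_open)
  have UT: "U \<subseteq> T" by (rule opn_subset_points[OF Uo])
  obtain \<rho> O1 K1 where \<rho>: "cutoff \<rho> O1 K1" "m \<in> O1" "K1 \<subseteq> U" using ex_cutoff[OF Uo m] by blast
  have O1: "opn O1" "O1 \<subseteq> U" "O1 \<subseteq> T" using \<rho> UT by (auto simp: cutoff_def)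
  obtain \<kappa> O2 K2 where \<kappa>: "cutoff \<kappa> O2 K2" "m \<in> O2" "K2 \<subseteq> O1" using ex_cutoff[OF O1(1) \<rho>(2)] by blast
  have \<kappa>p: "\<kappa> \<in> part R 0" using \<kappa>(1) by (simp add: cutoff_def)
  have \<kappa>S: "\<kappa> \<in> Sec T" using \<kappa>p by simp
  have "\<exists>v'. v' \<in> Vect_part M 0 \<and> vf_res M O1 v' = vf_res M O1 (snd s)" if "s \<in> set C.frame" for s
    using extend_vf[OF \<rho>(1) Uo \<rho>(3) C.frame_part[of "fst s" "snd s"]] that by (metis prod.collapse)
  then obtain e where e: "\<And>s. s \<in> set C.frame \<Longrightarrow> e s \<in> Vect_part M 0"
    "\<And>s. s \<in> set C.frame \<Longrightarrow> vf_res M O1 (e s) = vf_res M O1 (snd s)" by metis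
  have tau: "C.tau U \<in> part (sheaf M U) 1" "C.tau U \<in> Sec U"
    using C.tau_odd[OF Uo order_refl] C.tau_closed[OF Uo order_refl] by simp_all
  obtain \<tau> where \<tau>: "\<tau> \<in> part R 1" "res M T O1 \<tau> = res M U O1 (C.tau U)"
    using extend_fun[OF \<rho>(1) Uo \<rho>(3) tau(1)] by blast
  have \<tau>S: "\<tau> \<in> Sec T" using \<tau>(1) by simp
  let ?vs = "map (\<lambda>s. (fst s, e s)) C.frame"
  have vs: "v \<in> Vect_part M 0" if "(c, v) \<in> set ?vs" for c v using that e(1) by auto
  define D where "D X Y = ad (lsum T (\<lambda>(c, v). sm (c \<odot>\<^bsub>R\<^esub> X T (g T Y v)) v) ?vs) (sm (X T (Y T \<tau>)) Q)" for X Y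
  define w where "w Y = ad (lsum T (\<lambda>(c, v). sm (c \<odot>\<^bsub>R\<^esub> g T Y v) v) ?vs) (sm (Y T \<tau>) Q)" for Y
  have pc: "pconn D w"
    using pconn_add[OF pconn_lsum[OF vs] pconn_Q[OF \<tau>(1)]] unfolding D_def[abs_def] w_def[abs_def] .
  have wV: "w Y \<in> Vect M" if "Y \<in> Vect M" for Y using pconnD(2)[OF pc that] .
  \<comment> \<open>\<open>\<tau>\<close> extends the odd coordinate of the chart from
    \<open>O1\<close> only, so the values of \<open>Y\<close> on the two are compared after
    restriction to subsets of \<open>O1\<close>.\<close>
  have Ytau: "res M T W (Y T \<tau>) = res M U W (vf_res M U Y U (C.tau U))"
    if Y: "Y \<in> Vect M" and W: "opn W" "W \<subseteq> O1" for Y W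
  proof -
    have WU: "W \<subseteq> U" "W \<subseteq> T" using W O1 by auto
    have "res M T W \<tau> = res M O1 W (res M T O1 \<tau>)" by (rule res_trans[OF opT O1(1,3) W \<tau>S, symmetric])
    also have "\<dots> = res M U W (C.tau U)" unfolding \<tau>(2) by (rule res_trans[OF Uo O1(1,2) W tau(2)])
    finally have r: "res M T W \<tau> = res M U W (C.tau U)" .
    have "res M T W (Y T \<tau>) = Y W (res M T W \<tau>)" by (rule vf_ev_res[OF Y opT order_refl W(1) WU(2) \<tau>S, symmetric])
    also have "\<dots> = res M U W (Y U (C.tau U))" unfolding r by (rule vf_ev_res[OF Y Uo UT W(1) WU(1) tau(2)])
    finally show ?thesis using Uo tau(2) by (simp add: vf_res_eq)
  qed
  \<comment> \<open>On \<open>O1\<close> the extended data agree with the frame of the chart, and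
    \<open>frame_sum\<close> says that the operator formed from that frame is the identity.\<close>
  have w_res: "vf_res M O1 (w Y) = vf_res M O1 Y" if Y: "Y \<in> Vect M" for Y
  proof (rule on_opens_eqI[OF vf_ops_on(4) vf_ops_on(4)])
    fix W f assume W: "opn W" "W \<subseteq> O1" and f: "f \<in> Sec W"
    have WU: "W \<subseteq> U" "W \<subseteq> T" using W O1 by auto
    let ?YU = "vf_res M U Y"
    have YU: "?YU \<in> vf M U" by (rule vf_res_vf[OF opT Uo UT Y])
    have trm: "(case (fst s, e s) of (c, v) \<Rightarrow> sm (c \<odot>\<^bsub>R\<^esub> g T Y v) v) W f =
        (case s of (c, v) \<Rightarrow> vf_smult M U (c \<odot>\<^bsub>sheaf M U\<^esub> g U ?YU v) v) W f" if s: "s \<in> set C.frame" for s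
    proof -
      obtain c v where cv: "s = (c, v)" by (cases s)
      have v: "v \<in> vf M U" using vf_part_vf[OF Uo C.frame_part] s cv by blast
      have es: "e s \<in> Vect M" "vf_res M O1 (e s) = vf_res M O1 v" using e[OF s] cv by simp_all
      have r: "vf_res M W (e s) = vf_res M W v" "vf_res M W ?YU = vf_res M W Y"
        using vf_res_vf_res[OF W(2), of "e s"] vf_res_vf_res[OF W(2), of v] vf_res_vf_res[OF WU(1)] es(2) by simp_all
      have "vf_res M W (e s) W f = vf_res M W v W f" using r(1) by simp
      then have ev: "e s W f = v W f" using W f by (simp add: vf_res_eq)
      have "res M T W (g T Y (e s)) = res M U W (g U ?YU v)"
        using g_res[OF opT W(1) WU(2) Y es(1)] g_res[OF Uo W(1) WU(1) YU v] r by simp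
      then show ?thesis
        using Y es(1) W WU f ev res_smult[OF Uo W(1) WU(1) g_closed[OF Uo YU v]] by (simp add: cv[symmetric] vf_smult_eq) (simp add: cv vf_smult_eq)
    qed
    have "w Y W f = rsum W (\<lambda>s. (case (fst s, e s) of (c, v) \<Rightarrow> sm (c \<odot>\<^bsub>R\<^esub> g T Y v) v) W f) C.frame \<oplus>\<^bsub>sheaf M W\<^esub>
        res M T W (Y T \<tau>) \<otimes>\<^bsub>sheaf M W\<^esub> Q W f"
      unfolding w_def using W f WU by (simp add: lsum_eq rsum_map)
    also have "rsum W (\<lambda>s. (case (fst s, e s) of (c, v) \<Rightarrow> sm (c \<odot>\<^bsub>R\<^esub> g T Y v) v) W f) C.frame =
        rsum W (\<lambda>s. (case s of (c, v) \<Rightarrow> vf_smult M U (c \<odot>\<^bsub>sheaf M U\<^esub> g U ?YU v) v) W f) C.frame"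
      by (rule rsum_cong) (rule trm)
    also have "rsum W (\<lambda>s. (case s of (c, v) \<Rightarrow> vf_smult M U (c \<odot>\<^bsub>sheaf M U\<^esub> g U ?YU v) v) W f) C.frame \<oplus>\<^bsub>sheaf M W\<^esub>
        res M T W (Y T \<tau>) \<otimes>\<^bsub>sheaf M W\<^esub> Q W f = rsum W (\<lambda>s. (case s of (c, v) \<Rightarrow> vf_smult M U (c \<odot>\<^bsub>sheaf M U\<^esub> g U ?YU v) v) W f) C.frame \<oplus>\<^bsub>sheaf M W\<^esub>
        res M U W (?YU U (C.tau U)) \<otimes>\<^bsub>sheaf M W\<^esub> Q W f"
      unfolding Ytau[OF Y W] ..
    also have "\<dots> = vf_add M U (lsum U (\<lambda>(c, v). vf_smult M U (c \<odot>\<^bsub>sheaf M U\<^esub> g U ?YU v) v) C.frame)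
        (vf_smult M U (?YU U (C.tau U)) (vf_res M U Q)) W f"
      using W WU f by (simp add: vf_add_eq vf_smult_eq vf_res_eq lsum_eq)
    also have "\<dots> = ?YU W f" using C.frame_sum[OF YU] by (rule arg_cong[of _ _ "\<lambda>Z. Z W f", symmetric])
    also have "\<dots> = Y W f" using W WU f by (simp add: vf_res_eq)
    finally show "vf_res M O1 (w Y) W f = vf_res M O1 Y W f" using W f by (simp add: vf_res_eq)
  qed
  have "wconn \<kappa> (\<lambda>X Y. sm \<kappa> (D X Y))"
  proof (rule wconn_of_pconn[OF pc \<kappa>p])
    fix Y assume Y: "Y \<in> Vect M"
    show "sm \<kappa> (w Y) = sm \<kappa> Y" by (rule cutoff_vf[OF \<kappa>(1) O1(1) \<kappa>(3) wV[OF Y] Y w_res[OF Y]])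
    fix X Z assume X: "X \<in> Vect M" and Z: "Z \<in> Vect M"
    show "\<kappa> \<otimes>\<^bsub>R\<^esub> X T (g T (w Y) Z) = \<kappa> \<otimes>\<^bsub>R\<^esub> X T (g T Y Z)"
    proof (rule cutoff_fun[OF \<kappa>(1) O1(1) \<kappa>(3) _ _ _ X])
      show "res M T O1 (g T (w Y) Z) = res M T O1 (g T Y Z)"
        using g_res[OF opT O1(1,3) wV[OF Y] Z] g_res[OF opT O1(1,3) Y Z] w_res[OF Y] by simp
    qed (use Y Z wV in simp_all)
  next
    fix X assume X: "X \<in> Vect M"
    have QV: "Q \<in> Vect M" by simp
    have "(case s of (c, v) \<Rightarrow> sm (c \<odot>\<^bsub>R\<^esub> X T (g T Q v)) v) = vf_zero M T" if s: "s \<in> set ?vs" for s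
    proof -
      obtain c v where cv: "s = (c, v)" by (cases s)
      have v: "v \<in> Vect M" by (rule vfT(1)[OF vs[OF s[unfolded cv]]])
      show ?thesis
        using X v by (simp add: cv Q_ker vfT_zero) (intro vf_eqI[where U = T]; simp add: ev_mult0 ev_mult1 ev_smult ev_zero)
    qed
    then have l: "lsum T (\<lambda>(c, v). sm (c \<odot>\<^bsub>R\<^esub> X T (g T Q v)) v) ?vs = vf_zero M T" by (rule lsum_zero)
    have F: "Q T \<tau> \<in> Sec T" using \<tau>S by simp
    have "res M T O1 (Q T \<tau>) = res M U O1 (vf_res M U Q U (C.tau U))" by (rule Ytau[OF QV O1(1) order_refl])
    also have "\<dots> = \<one>\<^bsub>sheaf M O1\<^esub>"
      using C.Q_tau res_one[OF Uo O1(1,2)] Uo tau(2) by (simp add: vf_res_eq)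
    finally have rQ: "res M T O1 (Q T \<tau>) = res M T O1 \<one>\<^bsub>R\<^esub>" using O1(1) by simp
    \<comment> \<open>\<open>Q \<tau>\<close> is \<open>1\<close> on \<open>O1\<close>, so its
      derivative vanishes there, and outside \<open>K2\<close> the factor \<open>\<kappa>\<close> is
      zero.\<close>
    have "\<kappa> \<otimes>\<^bsub>R\<^esub> X T (Q T \<tau>) = \<kappa> \<otimes>\<^bsub>R\<^esub> X T \<one>\<^bsub>R\<^esub>"
      by (rule cutoff_fun[OF \<kappa>(1) O1(1) \<kappa>(3) F secT(4) rQ X])
    also have "\<dots> = \<zero>\<^bsub>R\<^esub>" unfolding vfT_one[OF X] using \<kappa>S by (intro ev_eq_zeroI[OF opT]) (simp_all add: evT)
    finally have k: "\<kappa> \<otimes>\<^bsub>R\<^esub> X T (Q T \<tau>) = \<zero>\<^bsub>R\<^esub>" .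
    have XQ: "X T (Q T \<tau>) \<in> Sec T" using X F by simp
    have "sm \<kappa> (D X Q) = sm (\<kappa> \<otimes>\<^bsub>R\<^esub> X T (Q T \<tau>)) Q"
      unfolding D_def l using \<kappa>S XQ
      by (intro vf_eqI[where U = T]) (simp_all add: ev_add ev_mult0 ev_mult1 ev_zero algebra_simps)
    also have "\<dots> = vf_zero M T"
      unfolding k by (intro vf_eqI[where U = T]) (simp_all add: ev_mult0 ev_mult1 ev_zero)
    finally show "sm \<kappa> (D X Q) = vf_zero M T" .
  qed
  moreover have "\<forall>x\<in>O2. ev {} T \<kappa> x = 1" "opn O2" using \<kappa>(1) by (simp_all add: cutoff_def)
  ultimately show ?thesis using \<kappa>(2) by blast
qed

end

section \<open>Limits of stationary sequences and the global connection\<close>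

context null_mfd
begin

lemma vf_eq_cover:
  assumes A: "A \<in> Vect M" "A' \<in> Vect M" and B: "\<And>j. opn (B j)" "(\<Union>j. B j) = T"
    and e: "\<And>j. vf_res M (B j) A = vf_res M (B j) A'"
  shows "A = A'"
proof -
  have "ev J W (A W f) m = ev J W (A' W f) m" if W: "opn W" "f \<in> Sec W" "m \<in> W" for W f m J
  proof -
    obtain j where "m \<in> B j" using opn_points[OF W(1,3)] B(2) by blast
    then show ?thesis
      using vf_res_at[OF A(1) B(1) W, of j J] vf_res_at[OF A(2) B(1) W, of j J] e by simp
  qed
  then show ?thesis by (intro vf_eqI[OF A]) blast+
qed

text \<open>From index \<open>Suc j\<close> on nothing changes on \<open>B j\<close>. The limit
  takes that term on subsets of \<open>B j\<close>, and a set contained in several of the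
  \<open>B j\<close> gets the same value from each.\<close>

lemma vf_limit:
  fixes F :: "nat \<Rightarrow> ('a, 's) vf"
  assumes B: "\<And>j. opn (B j)" "(\<Union>j. B j) = T" and F: "\<And>n. F n \<in> Vect_part M p"
    and stable: "\<And>j n. j < n \<Longrightarrow> vf_res M (B j) (F n) = vf_res M (B j) (F (Suc j))"
  shows "\<exists>Z\<in>Vect_part M p. \<forall>j. vf_res M (B j) Z = vf_res M (B j) (F (Suc j))"
proof -
  have st: "F n W f = F (Suc j) W f" if "j < n" "opn W" "W \<subseteq> B j" "f \<in> Sec W" for j n W f
  proof -
    have "vf_res M (B j) (F n) W f = vf_res M (B j) (F (Suc j)) W f" using stable[OF that(1)] by simp
    then show ?thesis using that by (simp add: vf_res_eq)
  qed
  let ?\<S> = "{W. opn W \<and> (\<exists>j. W \<subseteq> B j)}"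
  \<comment> \<open>A definite index is fixed to obtain one map; the value does not depend on it,
    because the terms for two admissible indices both agree with a later one.\<close>
  define G where "G W f = F (Suc (LEAST j. W \<subseteq> B j)) W f" for W f
  have G: "G W f = F (Suc j) W f" if W: "opn W" "W \<subseteq> B j" and f: "f \<in> Sec W" for W f j
  proof -
    let ?i = "LEAST j. W \<subseteq> B j"
    have i: "W \<subseteq> B ?i" using W(2) by (rule LeastI)
    have "?i < Suc (max ?i j)" "j < Suc (max ?i j)" by auto
    then show ?thesis unfolding G_def using st[of ?i _ W f] st[of j _ W f] i W f by metis
  qed
  have "\<exists>Z\<in>Vect_part M p. \<forall>W\<in>?\<S>. \<forall>f\<in>Sec W. Z W f = G W f"
  proof (rule vf_glue)
    show "\<Union>?\<S> = T"
    proof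
      show "\<Union>?\<S> \<subseteq> T" using opn_subset_points by blast
      have "B j \<in> ?\<S>" for j using B(1) by blast
      then show "T \<subseteq> \<Union>?\<S>" unfolding B(2)[symmetric] by blast
    qed
    fix W assume "W \<in> ?\<S>"
    then obtain j where W: "opn W" "W \<subseteq> B j" by blast
    show "\<exists>X\<in>vf_part M W p. \<forall>W' f. opn W' \<longrightarrow> W' \<subseteq> W \<longrightarrow> f \<in> Sec W' \<longrightarrow> G W' f = X W' f"
    proof (intro bexI allI impI)
      show "vf_res M W (F (Suc j)) \<in> vf_part M W p"
        by (rule vf_res_part[OF opT W(1) opn_subset_points[OF W(1)] F])
      fix W' f assume W': "opn W'" "W' \<subseteq> W" "f \<in> Sec W'"
      then show "G W' f = vf_res M W (F (Suc j)) W' f"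
        using G[of W' j f] W by (simp add: vf_res_eq)
    qed
  qed auto
  then obtain Z where Z: "Z \<in> Vect_part M p" "\<And>W f j. opn W \<Longrightarrow> W \<subseteq> B j \<Longrightarrow> f \<in> Sec W \<Longrightarrow> Z W f = G W f"
    by blast
  have "vf_res M (B j) Z = vf_res M (B j) (F (Suc j))" for j
    by (rule on_opens_eqI[OF vf_ops_on(4) vf_ops_on(4)]) (simp add: vf_res_eq Z(2) G)
  then show ?thesis using Z(1) by blast
qed

lemma global_connection:
  assumes loc: "\<And>m. m \<in> T \<Longrightarrow> \<exists>B. opn B \<and> m \<in> B \<and> (\<exists>\<kappa> D. wconn \<kappa> D \<and> (\<forall>x\<in>B. ev {} T \<kappa> x = 1))"
  shows "\<exists>nabla. affine_connection M nabla \<and> compatible M g Q nabla"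
proof -
  define Pr where "Pr B \<longleftrightarrow> (\<exists>p. wconn (fst p) (snd p) \<and> (\<forall>x\<in>B. ev {} T (fst p) x = 1))" for B
  have down: "Pr B'" if "Pr B" "B' \<subseteq> B" for B B' using that unfolding Pr_def by (elim exE) (rule exI, auto)
  have Pe: "Pr {}" unfolding Pr_def by (rule exI[of _ "(\<zero>\<^bsub>R\<^esub>, \<lambda>X Y. vf_zero M T)"]) (simp add: wconn_zero)
  have Pl: "\<exists>B. opn B \<and> m \<in> B \<and> Pr B" if "m \<in> T" for m using loc[OF that] unfolding Pr_def by force
  obtain B :: "nat \<Rightarrow> 'a set" where B: "\<And>j. opn (B j)" "(\<Union>j. B j) = T" and Bw: "\<And>j. Pr (B j)"
  proof (rule countable_cover[of Pr, OF Pl down Pe])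
    fix B :: "nat \<Rightarrow> 'a set" assume a: "\<And>j. opn (B j)" "\<And>j. Pr (B j)" "(\<Union>j. B j) = T"
    show thesis by (rule that[OF a(1,3,2)])
  qed
  obtain \<kappa>D where \<kappa>D: "\<And>j. wconn (fst (\<kappa>D j)) (snd (\<kappa>D j)) \<and> (\<forall>x\<in>B j. ev {} T (fst (\<kappa>D j)) x = 1)"
  proof -
    have "\<forall>j. \<exists>p. wconn (fst p) (snd p) \<and> (\<forall>x\<in>B j. ev {} T (fst p) x = 1)"
      by (rule allI) (rule Bw[unfolded Pr_def])
    from choice[OF this] show thesis by (elim exE) (rule that, erule spec)
  qed
  define \<kappa> where "\<kappa> j = fst (\<kappa>D j)" for j
  define D where "D j = snd (\<kappa>D j)" for j
  have \<kappa>: "wconn (\<kappa> j) (D j)" "\<And>x. x \<in> B j \<Longrightarrow> ev {} T (\<kappa> j) x = 1" for j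
    using \<kappa>D[of j] by (simp_all add: \<kappa>_def D_def)
  \<comment> \<open>\<open>1 - \<sigma>\<close>, the part of the weight that is still
    missing.\<close>
  define h where "h \<sigma> = \<one>\<^bsub>R\<^esub> \<oplus>\<^bsub>R\<^esub> (-1) \<odot>\<^bsub>R\<^esub> \<sigma>" for \<sigma>
  \<comment> \<open>Weight and operator grow together, so that \<open>wconn_add\<close> applies at
    every step; at the start the zero operator has weight zero.\<close>
  define sq where "sq = rec_nat (\<zero>\<^bsub>R\<^esub>, \<lambda>X Y. vf_zero M T)
    (\<lambda>n (\<sigma>, S). (\<sigma> \<oplus>\<^bsub>R\<^esub> h \<sigma> \<otimes>\<^bsub>R\<^esub> \<kappa> n, \<lambda>X Y. ad (S X Y) (sm (h \<sigma>) (D n X Y))))"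
  define \<sigma> where "\<sigma> n = fst (sq n)" for n
  define S where "S n = snd (sq n)" for n
  have \<sigma>0: "\<sigma> 0 = \<zero>\<^bsub>R\<^esub>" "S 0 = (\<lambda>X Y. vf_zero M T)" by (simp_all add: \<sigma>_def S_def sq_def)
  have \<sigma>S: "\<sigma> (Suc n) = \<sigma> n \<oplus>\<^bsub>R\<^esub> h (\<sigma> n) \<otimes>\<^bsub>R\<^esub> \<kappa> n"
    "S (Suc n) = (\<lambda>X Y. ad (S n X Y) (sm (h (\<sigma> n)) (D n X Y)))" for n
    by (simp_all add: \<sigma>_def S_def sq_def case_prod_beta)
  have hp: "h s \<in> part R 0" if "s \<in> part R 0" for s
    unfolding h_def by (rule part_ops(1)[OF opT part_ops(4)[OF opT] part_ops(2)[OF opT that]])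
  have W: "wconn (\<sigma> n) (S n)" for n
  proof (induction n)
    case (Suc n)
    then show ?case unfolding \<sigma>S by (intro wconn_add \<kappa>(1) hp wconnD(1)[OF Suc])
  qed (simp add: \<sigma>0 wconn_zero)
  note wD = wconnD[OF W] and b = bilinD[OF wconnD(2)[OF W]]
  have \<sigma>T: "\<sigma> n \<in> Sec T" for n using wD(1)[of n] by simp
  have hT: "h (\<sigma> n) \<in> Sec T" for n using hp[OF wD(1)[of n]] by simp
  have \<kappa>T: "\<kappa> n \<in> Sec T" for n using wconnD(1)[OF \<kappa>(1)[of n]] by simp
  have DT: "D n X Y \<in> Vect M" if "X \<in> Vect M" "Y \<in> Vect M" for n X Y
    by (rule bilinD(1)[OF wconnD(2)[OF \<kappa>(1)] that])
  have ev_odd0: "ev {0} T (\<sigma> n) x = 0" "ev {0} T (h (\<sigma> n)) x = 0" if "x \<in> T" for n x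
    by (rule ev_even[OF opT that wD(1)], rule ev_even[OF opT that hp[OF wD(1)]])
  have evh: "ev {} T (h (\<sigma> n)) x = 1 - ev {} T (\<sigma> n) x" if "x \<in> T" for x n
    using that \<sigma>T by (simp add: h_def evT)
  have BT: "B j \<subseteq> T" for j using opn_subset_points[OF B(1)] .
  \<comment> \<open>Step \<open>n\<close> multiplies \<open>1 - \<sigma>\<close> by
    \<open>1 - \<kappa> n\<close>. The factor of step \<open>j\<close> vanishes on
    \<open>B j\<close>, so the weight is \<open>1\<close> there from index \<open>Suc j\<close>
    on.\<close>
  have one: "ev {} T (\<sigma> n) x = 1" if "x \<in> B j" "j < n" for x j n
    using that(2)
  proof (induction n)
    case (Suc n)
    have x: "x \<in> T" using BT that(1) by blast
    have "ev {} T (\<sigma> (Suc n)) x = ev {} T (\<sigma> n) x + (1 - ev {} T (\<sigma> n) x) * ev {} T (\<kappa> n) x"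
      using x \<sigma>T hT \<kappa>T by (simp add: \<sigma>S evT evh)
    then show ?case using Suc \<kappa>(2)[OF that(1)] by (cases "j = n") simp_all
  qed simp
  have sm_one: "vf_res M (B j) (sm (\<sigma> (Suc j)) Y) = vf_res M (B j) Y" if Y: "Y \<in> Vect M" for j Y
  proof (rule on_opens_eqI[OF vf_ops_on(4) vf_ops_on(4)])
    fix W f assume W': "opn W" "W \<subseteq> B j" and f: "f \<in> Sec W"
    have z: "ev {} T (\<sigma> (Suc j)) x = 1" "ev {0} T (\<sigma> (Suc j)) x = 0" if "x \<in> W" for x
    proof -
      have x: "x \<in> B j" "x \<in> T" using that W'(2) BT by auto
      show "ev {} T (\<sigma> (Suc j)) x = 1" by (rule one[OF x(1) lessI])
      show "ev {0} T (\<sigma> (Suc j)) x = 0" by (rule ev_odd0(1)[OF x(2)])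
    qed
    have sY: "sm (\<sigma> (Suc j)) Y \<in> Vect M" by (rule vfT(3)[OF \<sigma>T Y])
    have "sm (\<sigma> (Suc j)) Y W f = Y W f"
    proof (rule ev_eqI[OF W'(1)])
      fix x assume x: "x \<in> W"
      show "ev {} W (sm (\<sigma> (Suc j)) Y W f) x = ev {} W (Y W f) x"
        "ev {0} W (sm (\<sigma> (Suc j)) Y W f) x = ev {0} W (Y W f) x"
        unfolding ev_sm[OF W'(1) x f Y \<sigma>T] z[OF x] by simp_all
    qed (rule vfT_closed[OF sY W'(1) f], rule vfT_closed[OF Y W'(1) f])
    then show "vf_res M (B j) (sm (\<sigma> (Suc j)) Y) W f = vf_res M (B j) Y W f" using W' f by (simp add: vf_res_eq)
  qed
  \<comment> \<open>On \<open>B j\<close> the missing weight \<open>h (\<sigma> n)\<close> is zero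
    for \<open>n > j\<close>, so later steps add nothing there.\<close>
  have stable: "vf_res M (B j) (S n X Y) = vf_res M (B j) (S (Suc j) X Y)"
    if "j < n" and X: "X \<in> Vect M" and Y: "Y \<in> Vect M" for j n X Y
    using that(1)
  proof (induction n)
    case (Suc n)
    show ?case
    proof (cases "j = n")
      case False
      then have jn: "j < n" using Suc.prems by simp
      have "vf_res M (B j) (S (Suc n) X Y) = vf_res M (B j) (S n X Y)"
      proof (rule on_opens_eqI[OF vf_ops_on(4) vf_ops_on(4)])
        fix W f assume W': "opn W" "W \<subseteq> B j" and f: "f \<in> Sec W"
        note D = DT[OF X Y, of n] and SV = b(1)[OF X Y, of n]
        have z: "ev {} T (h (\<sigma> n)) x = 0" "ev {0} T (h (\<sigma> n)) x = 0" if "x \<in> W" for x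
        proof -
          have x: "x \<in> B j" "x \<in> T" using that W'(2) BT by auto
          show "ev {} T (h (\<sigma> n)) x = 0" "ev {0} T (h (\<sigma> n)) x = 0"
            using evh[OF x(2)] one[OF x(1) jn] ev_odd0(2)[OF x(2)] by simp_all
        qed
        have smV: "sm (h (\<sigma> n)) (D n X Y) \<in> Vect M" using D hT by simp
        have "ad (S n X Y) (sm (h (\<sigma> n)) (D n X Y)) W f = S n X Y W f"
        proof (rule ev_eqI[OF W'(1)])
          fix x assume x: "x \<in> W"
          show "ev {} W (ad (S n X Y) (sm (h (\<sigma> n)) (D n X Y)) W f) x = ev {} W (S n X Y W f) x"
            "ev {0} W (ad (S n X Y) (sm (h (\<sigma> n)) (D n X Y)) W f) x = ev {0} W (S n X Y W f) x"
            unfolding ev_ad[OF W'(1) x f SV smV] ev_sm[OF W'(1) x f D hT] z[OF x] by simp_all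
        qed (rule vfT_closed[OF vfT(2)[OF SV smV] W'(1) f], rule vfT_closed[OF SV W'(1) f])
        then show "vf_res M (B j) (S (Suc n) X Y) W f = vf_res M (B j) (S n X Y) W f"
          using W' f by (simp only: \<sigma>S vf_res_eq)
      qed
      then show ?thesis using Suc.IH[OF jn] by simp
    qed simp
  qed simp
  \<comment> \<open>\<open>Z\<close> is the limit of the sequence \<open>S n X Y\<close>. Limits are
    unique, so the linear axioms follow by showing that both sides are limits of the same
    sequence.\<close>
  define L where "L X Y Z \<longleftrightarrow> Z \<in> Vect M \<and> (\<forall>j. vf_res M (B j) Z = vf_res M (B j) (S (Suc j) X Y))" for X Y Z
  have Lpart: "\<exists>Z\<in>Vect_part M (p + r). L X Y Z" if X: "X \<in> Vect_part M p" and Y: "Y \<in> Vect_part M r" for X Y p r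
  proof -
    have "\<exists>Z\<in>Vect_part M (p + r). \<forall>j. vf_res M (B j) Z = vf_res M (B j) (S (Suc j) X Y)"
    proof (rule vf_limit[of B "\<lambda>n. S n X Y" "p + r", OF B])
      show "S n X Y \<in> Vect_part M (p + r)" for n by (rule b(2)[OF X Y])
      show "vf_res M (B j) (S n X Y) = vf_res M (B j) (S (Suc j) X Y)" if "j < n" for j n
        by (rule stable[OF that vfT(1)[OF X] vfT(1)[OF Y]])
    qed
    then show ?thesis unfolding L_def by (elim bexE) (rule bexI, rule conjI, erule vfT(1))
  qed
  have Luniq: "Z = Z'" if "L X Y Z" "L X Y Z'" for X Y Z Z'
  proof (rule vf_eq_cover[OF _ _ B])
    show "Z \<in> Vect M" "Z' \<in> Vect M" using that by (simp_all add: L_def)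
    show "vf_res M (B j) Z = vf_res M (B j) Z'" for j using that by (simp add: L_def)
  qed
  have rad: "vf_res M (B j) (ad A A') = vf_add M (B j) (vf_res M (B j) A) (vf_res M (B j) A')" for j A A'
    by (rule vf_res_add[OF B(1) BT])
  have rsm: "vf_res M (B j) (sm f A) = vf_smult M (B j) (res M T (B j) f) (vf_res M (B j) A)" if "f \<in> Sec T" for j f A
    by (rule vf_res_smult[OF opT B(1) BT that])
  have Ladd1: "L (ad X Y) Z (ad A A')" if "L X Z A" "L Y Z A'" "X \<in> Vect M" "Y \<in> Vect M" "Z \<in> Vect M" for X Y Z A A'
    unfolding L_def using that by (simp add: L_def rad b(3)[OF that(3,4,5)])
  have Ladd2: "L X (ad Y Z) (ad A A')" if "L X Y A" "L X Z A'" "X \<in> Vect M" "Y \<in> Vect M" "Z \<in> Vect M" for X Y Z A A'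
    unfolding L_def using that by (simp add: L_def rad b(4)[OF that(3,4,5)])
  \<comment> \<open>\<open>vf_limit\<close> concerns fields of a fixed parity; in general the limit
    is the sum over the four pairs of homogeneous parts.\<close>
  have Lex: "\<exists>Z. L X Y Z" if X: "X \<in> Vect M" and Y: "Y \<in> Vect M" for X Y
  proof -
    obtain X0 X1 where X': "X0 \<in> Vect_part M 0" "X1 \<in> Vect_part M 1" "X = ad X0 X1" using X by (rule vfE)
    obtain Y0 Y1 where Y': "Y0 \<in> Vect_part M 0" "Y1 \<in> Vect_part M 1" "Y = ad Y0 Y1" using Y by (rule vfE)
    have V: "X0 \<in> Vect M" "X1 \<in> Vect M" "Y0 \<in> Vect M" "Y1 \<in> Vect M" using X' Y' by simp_all
    obtain Z00 where Z00: "L X0 Y0 Z00" using Lpart[OF X'(1) Y'(1)] by (rule bexE)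
    obtain Z01 where Z01: "L X0 Y1 Z01" using Lpart[OF X'(1) Y'(2)] by (rule bexE)
    obtain Z10 where Z10: "L X1 Y0 Z10" using Lpart[OF X'(2) Y'(1)] by (rule bexE)
    obtain Z11 where Z11: "L X1 Y1 Z11" using Lpart[OF X'(2) Y'(2)] by (rule bexE)
    show ?thesis
      unfolding X'(3) Y'(3)
      by (rule exI, rule Ladd1[OF Ladd2[OF Z00 Z01 V(1,3,4)] Ladd2[OF Z10 Z11 V(2,3,4)] V(1,2) vfT(2)[OF V(3,4)]])
  qed
  define nabla where "nabla X Y = (SOME Z. L X Y Z)" for X Y
  have nL: "L X Y (nabla X Y)" if "X \<in> Vect M" "Y \<in> Vect M" for X Y
    unfolding nabla_def by (rule someI_ex[OF Lex[OF that]])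
  have nV: "nabla X Y \<in> Vect M" and nr: "\<And>j. vf_res M (B j) (nabla X Y) = vf_res M (B j) (S (Suc j) X Y)"
    if "X \<in> Vect M" "Y \<in> Vect M" for X Y
    using nL[OF that] by (simp_all add: L_def)
  have npart: "nabla X Y \<in> Vect_part M (p + r)" if XY: "X \<in> Vect_part M p" "Y \<in> Vect_part M r" for X Y p r
  proof -
    obtain Z where Z: "Z \<in> Vect_part M (p + r)" "L X Y Z" using Lpart[OF XY] by (rule bexE)
    have "nabla X Y = Z" by (rule Luniq[OF nL[OF vfT(1)[OF XY(1)] vfT(1)[OF XY(2)]] Z(2)])
    then show ?thesis using Z(1) by simp
  qed
  have nQ: "nabla X Q = vf_zero M T" if X: "X \<in> Vect M" for X
    by (rule Luniq[OF nL[OF X vfT(7)]]) (simp add: L_def wD(5)[OF X] vfT(6))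
  \<comment> \<open>Still in the first-slot form of \<open>wconn\<close>; it is checked on each
    \<open>B j\<close>, where \<open>nabla\<close> agrees with \<open>S (Suc j)\<close> and the
    weight is \<open>1\<close>.\<close>
  have metric: "g T (nabla X Y) Z \<oplus>\<^bsub>R\<^esub> koszul r s \<odot>\<^bsub>R\<^esub> g T (nabla X Z) Y = X T (g T Y Z)"
    if X: "X \<in> Vect_part M p" and Y: "Y \<in> Vect_part M r" and Z: "Z \<in> Vect_part M s" for X Y Z p r s
  proof (rule ev_eqI_local[OF opT])
    have V: "X \<in> Vect M" "Y \<in> Vect M" "Z \<in> Vect M" using X Y Z by simp_all
    note n = nV[OF V(1,2)] nV[OF V(1,3)]
    show "g T (nabla X Y) Z \<oplus>\<^bsub>R\<^esub> koszul r s \<odot>\<^bsub>R\<^esub> g T (nabla X Z) Y \<in> Sec T" "X T (g T Y Z) \<in> Sec T" using V n by simp_all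
    fix m assume "m \<in> T"
    then obtain j where j: "m \<in> B j" using B(2) by blast
    let ?S = "S (Suc j)"
    note SV = b(1)[OF V(1,2), of "Suc j"] b(1)[OF V(1,3), of "Suc j"]
    have gr: "res M T (B j) (g T (nabla X Y) Z) = res M T (B j) (g T (?S X Y) Z)"
      "res M T (B j) (g T (nabla X Z) Y) = res M T (B j) (g T (?S X Z) Y)"
      using g_res[OF opT B(1) BT n(1) V(3), of j] g_res[OF opT B(1) BT n(2) V(2), of j]
        g_res[OF opT B(1) BT SV(1) V(3)] g_res[OF opT B(1) BT SV(2) V(2)] nr[OF V(1,2), of j] nr[OF V(1,3), of j] by simp_all
    have XS: "X T (g T Y Z) \<in> Sec T" using V by simp
    have "res M T (B j) (g T (nabla X Y) Z \<oplus>\<^bsub>R\<^esub> koszul r s \<odot>\<^bsub>R\<^esub> g T (nabla X Z) Y) =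
        res M T (B j) (g T (?S X Y) Z \<oplus>\<^bsub>R\<^esub> koszul r s \<odot>\<^bsub>R\<^esub> g T (?S X Z) Y)"
      using V n SV B(1) by (simp add: gr)
    also have "\<dots> = res M T (B j) (\<sigma> (Suc j)) \<otimes>\<^bsub>sheaf M (B j)\<^esub> res M T (B j) (X T (g T Y Z))"
      unfolding wD(4)[OF X Y Z] using XS \<sigma>T B(1) by simp
    also have "\<dots> = res M T (B j) (X T (g T Y Z))"
    proof (rule ev_eqI[OF B(1)])
      fix x assume x: "x \<in> B j"
      have xT: "x \<in> T" using x BT by blast
      have e: "ev J (B j) (res M T (B j) (\<sigma> (Suc j))) x = ev J T (\<sigma> (Suc j)) x" for J
        by (rule ev_res[OF opT B(1) BT x \<sigma>T])
      have z: "ev {} T (\<sigma> (Suc j)) x = 1" "ev {0} T (\<sigma> (Suc j)) x = 0"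
        using one[OF x lessI] ev_odd0(1)[OF xT] by simp_all
      note r = resT(1)[OF B(1) \<sigma>T] resT(1)[OF B(1) XS]
      show "ev {} (B j) (res M T (B j) (\<sigma> (Suc j)) \<otimes>\<^bsub>sheaf M (B j)\<^esub> res M T (B j) (X T (g T Y Z))) x =
          ev {} (B j) (res M T (B j) (X T (g T Y Z))) x"
        "ev {0} (B j) (res M T (B j) (\<sigma> (Suc j)) \<otimes>\<^bsub>sheaf M (B j)\<^esub> res M T (B j) (X T (g T Y Z))) x =
          ev {0} (B j) (res M T (B j) (X T (g T Y Z))) x"
        unfolding ev_mult0[OF B(1) x r] ev_mult1[OF B(1) x r] e z by simp_all
    qed (use B(1) \<sigma>T XS in simp_all)
    finally show "\<exists>W'. opn W' \<and> m \<in> W' \<and> W' \<subseteq> T \<and>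
        res M T W' (g T (nabla X Y) Z \<oplus>\<^bsub>R\<^esub> koszul r s \<odot>\<^bsub>R\<^esub> g T (nabla X Z) Y) = res M T W' (X T (g T Y Z))"
      using B(1) BT j by blast
  qed
  have "affine_connection M nabla"
    unfolding affine_connection_def
  proof (intro conjI ballI allI)
    fix X Y assume XY: "X \<in> Vect M" "Y \<in> Vect M"
    show "nabla X Y \<in> Vect M" by (rule nV[OF XY])
    fix Z assume Z: "Z \<in> Vect M"
    show "nabla (ad X Y) Z = ad (nabla X Z) (nabla Y Z)"
      by (rule Luniq[OF nL Ladd1[OF nL nL]]) (rule vfT(2)[OF XY] XY Z)+
    show "nabla X (ad Y Z) = ad (nabla X Y) (nabla X Z)"
      by (rule Luniq[OF nL Ladd2[OF nL nL]]) (rule vfT(2)[OF XY(2) Z] XY Z)+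
  next
    fix p r X Y assume "X \<in> Vect_part M p" "Y \<in> Vect_part M r"
    then show "nabla X Y \<in> Vect_part M (p + r)" by (rule npart)
  next
    fix f X Y assume f: "f \<in> Sec T" and X: "X \<in> Vect M" and Y: "Y \<in> Vect M"
    have "L (sm f X) Y (sm f (nabla X Y))"
      unfolding L_def b(5)[OF f X Y] rsm[OF f] nr[OF X Y] using nV[OF X Y] f by simp
    then show "nabla (sm f X) Y = sm f (nabla X Y)"
      by (rule Luniq[OF nL[OF vfT(3)[OF f X] Y]])
  next
    fix p r X f Y assume X: "X \<in> Vect_part M p" and f: "f \<in> part R r" and Y: "Y \<in> Vect M"
    have V: "X \<in> Vect M" "f \<in> Sec T" "X T f \<in> Sec T" "koszul p r \<odot>\<^bsub>R\<^esub> f \<in> Sec T" using X f by simp_all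
    \<comment> \<open>The rule for \<open>S (Suc j)\<close> has \<open>\<sigma> (Suc j)\<close> in
      its first summand; restricted to \<open>B j\<close> this weight disappears by
      \<open>sm_one\<close>.\<close>
    have "L X (sm f Y) (ad (sm (X T f) Y) (sm (koszul p r \<odot>\<^bsub>R\<^esub> f) (nabla X Y)))"
      unfolding L_def wD(3)[OF X f Y] rad rsm[OF V(3)] rsm[OF V(4)] nr[OF V(1) Y] sm_one[OF Y]
      using V Y nV[OF V(1) Y] by simp
    then show "nabla X (sm f Y) = ad (sm (X T f) Y) (sm (koszul p r \<odot>\<^bsub>R\<^esub> f) (nabla X Y))"
      by (rule Luniq[OF nL[OF V(1) vfT(3)[OF V(2) Y]]])
  qed
  moreover have "compatible M g Q nabla"
    unfolding compatible_def
  proof (intro conjI ballI allI)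
    fix p r s X Y Z assume X: "X \<in> Vect_part M p" and Y: "Y \<in> Vect_part M r" and Z: "Z \<in> Vect_part M s"
    have V: "X \<in> Vect M" "Y \<in> Vect M" "Z \<in> Vect M" using X Y Z by simp_all
    note n = nV[OF V(1,2)] nV[OF V(1,3)]
    \<comment> \<open>\<open>nabla X Z\<close> has parity \<open>p + s\<close>, so moving it to the
      second slot past \<open>Y\<close> costs \<open>koszul r (p + s)\<close>; this turns the
      exchange sign \<open>koszul r s\<close> into \<open>koszul p r\<close>.\<close>
    have k: "koszul p r * koszul r (p + s) = koszul r s" by (cases p; cases r; cases s) (simp_all add: koszul_def)
    have gs: "g T Y (nabla X Z) = koszul r (p + s) \<odot>\<^bsub>R\<^esub> g T (nabla X Z) Y"
      by (rule g_sym[OF opT Y npart[OF X Z]])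
    show "X T (g T Y Z) = g T (nabla X Y) Z \<oplus>\<^bsub>R\<^esub> koszul p r \<odot>\<^bsub>R\<^esub> g T Y (nabla X Z)"
      unfolding metric[OF X Y Z, symmetric] gs using V n
      by (intro ev_eqI[OF opT]) (simp_all add: evT flip: k)
  qed (rule nQ)
  ultimately show ?thesis by blast
qed

end

theorem mainTheorem1:
  fixes M :: "('a, 's) superspace"
    and g :: "('a, 's) pairing"
    and Q P :: "('a, 's) vf"
  assumes "super_null_manifold TYPE('n::finite) M g Q P"
  shows "\<exists>nabla. affine_connection M nabla \<and> compatible M g Q nabla"
proof -
  note null = assms[unfolded super_null_manifold_def]
  have sm: "supermanifold TYPE('n) 1 M" and metric: "metric M g" and Q: "Q \<in> Vect_part M 1"
    and ker: "metric_ker M g = {vf_smult M (points M) f Q | f. f \<in> C_inf M}"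
    and dim: "\<forall>m\<in>points M. form_ker_dim_0_1 M g m"
    and shander: "\<forall>m\<in>points M. \<exists>U (V :: (real^'n) set) \<phi> \<Phi> i. m \<in> U \<and> shander_chart M Q P U V \<phi> \<Phi> i"
    using null by simp_all
  interpret metric_mfd M "TYPE('n)" g
  proof
    show "presheaf M" "gluing M" "Hausdorff_space (base M)" "Defs.second_countable (base M)" "metric M g"
      using sm metric by (simp_all add: supermanifold_def)
    show "\<exists>U (V :: (real^'n) set) \<phi> \<Phi>. m \<in> U \<and> superchart 1 M U V \<phi> \<Phi>" if "m \<in> points M" for m
      using sm that unfolding supermanifold_def by blast
  qed
  \<comment> \<open>\<open>Q\<close> is the multiple of itself by the unit, hence an element of the
    span that equals the kernel.\<close>
  have "vf_smult M (points M) \<one>\<^bsub>sheaf M (points M)\<^esub> Q = Q"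
    by (rule vf_smult_one[OF _ vf_part_vf[OF _ Q]]) simp_all
  then have "Q \<in> metric_ker M g" unfolding ker by (intro CollectI exI[of _ "\<one>\<^bsub>sheaf M (points M)\<^esub>"]) simp
  then have Q_ker: "g (points M) Q Y = \<zero>\<^bsub>sheaf M (points M)\<^esub>" if "Y \<in> Vect M" for Y
    using that unfolding metric_ker_def by blast
  interpret null_mfd M "TYPE('n)" g Q
    by unfold_locales (rule Q, rule Q_ker)
  show ?thesis
  proof (rule global_connection)
    fix m assume m: "m \<in> points M"
    obtain U and V :: "(real^'n) set" and \<phi> \<Phi> i where c: "m \<in> U" "shander_chart M Q P U V \<phi> \<Phi> i"
      using shander m by blast
    have "superchart 1 M U V \<phi> \<Phi>" using c(2) by (simp add: shander_chart_def)
    then have "null_chart M U V \<phi> \<Phi> g Q P i"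
      using c(2) dim Q Q_ker by unfold_locales auto
    then show "\<exists>B. opn B \<and> m \<in> B \<and> (\<exists>\<kappa> D. wconn \<kappa> D \<and> (\<forall>x\<in>B. ev {} (points M) \<kappa> x = 1))"
      using c(1) by (rule local_wconn)
  qed
qed

end
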